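(* There is a polynomial-time randomized algorithm for FTFP which always outputs a feasible integral solution and whose expected cost is at most $3\cdot\mathrm{LP}^\ast\le 3\cdot\mathrm{OPT}$, where $\mathrm{LP}^\ast$ is the optimal value of the LP relaxation and $\mathrm{OPT}$ the optimal integral cost.
   Context: FTFP (Fault-Tolerant Facility Placement): given a finite set $\mathbb{F}$ of sites and a finite set $\mathbb{C}$ of clients, an opening cost $f_i\ge 0$ for each site $i$, connection costs $d_{ij}\ge 0$ forming a metric (symmetric, triangle inequality), and a positive integer demand $r_j$ for each client $j$. Any number of facilities may be opened at a site; a feasible integral solution consists of nonnegative integers $y_i$ (facilities opened at site $i$) and $x_{ij}$ (connections of $j$ to facilities at site $i$) with $x_{ij}\le y_i$ and $\sum_{i}x_{ij}\ge r_j$, so that each client is connected to $r_j$ distinct facilities; its cost is $\sum_i f_iy_i+\sum_{i,j}d_{ij}x_{ij}$. The LP relaxation is the same program with real $x_{ij},y_i\ge 0$. *)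

theory Defs
  imports
    "HOL-Probability.Probability_Mass_Function"
    "HOL-Computational_Algebra.Polynomial"
    "HOL-Library.Log_Nat"
begin

section \<open>Fault-tolerant facility placement\<close>

text \<open>
  Sites are numbered \<open>0, \<dots>, nsites I - 1\<close> and clients \<open>0, \<dots>, nclients I - 1\<close>; values of the
  cost and demand functions outside these ranges are irrelevant. Costs are rational so that an
  instance is a finite input.
\<close>

record ftfp =
  nsites :: nat
  nclients :: nat
  open_cost :: "nat \<Rightarrow> rat"
  conn_cost :: "nat \<Rightarrow> nat \<Rightarrow> rat"
  demand :: "nat \<Rightarrow> nat"

text \<open>
  Connection costs are only given between sites (\<open>Inl\<close>) and clients (\<open>Inr\<close>); they form a metric
  if they are the restriction of a (pseudo)metric on the disjoint union of sites and clients.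
  Distinct points may be at distance 0.
\<close>

definition metric_costs :: "ftfp \<Rightarrow> bool" where
  "metric_costs I \<longleftrightarrow> (\<exists>D :: nat + nat \<Rightarrow> nat + nat \<Rightarrow> real.
     let X = {..<nsites I} <+> {..<nclients I} in
       (\<forall>u\<in>X. D u u = 0) \<and>
       (\<forall>u\<in>X. \<forall>v\<in>X. 0 \<le> D u v \<and> D u v = D v u) \<and>
       (\<forall>u\<in>X. \<forall>v\<in>X. \<forall>w\<in>X. D u w \<le> D u v + D v w) \<and>
       (\<forall>i<nsites I. \<forall>j<nclients I. D (Inl i) (Inr j) = of_rat (conn_cost I i j)))"

text \<open>
  The last conjunct excludes only the instances with clients but no site, which have no
  feasible solution.
\<close>

definition ftfp_instance :: "ftfp \<Rightarrow> bool" where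
  "ftfp_instance I \<longleftrightarrow>
     (\<forall>i<nsites I. 0 \<le> open_cost I i) \<and>
     (\<forall>i<nsites I. \<forall>j<nclients I. 0 \<le> conn_cost I i j) \<and>
     metric_costs I \<and>
     (\<forall>j<nclients I. 1 \<le> demand I j) \<and>
     (0 < nclients I \<longrightarrow> 0 < nsites I)"

definition lp_feasible :: "ftfp \<Rightarrow> (nat \<Rightarrow> nat \<Rightarrow> real) \<Rightarrow> (nat \<Rightarrow> real) \<Rightarrow> bool" where
  "lp_feasible I x y \<longleftrightarrow>
     (\<forall>i<nsites I. 0 \<le> y i) \<and>
     (\<forall>i<nsites I. \<forall>j<nclients I. 0 \<le> x i j \<and> x i j \<le> y i) \<and>
     (\<forall>j<nclients I. real (demand I j) \<le> (\<Sum>i<nsites I. x i j))"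

definition int_feasible :: "ftfp \<Rightarrow> (nat \<Rightarrow> nat \<Rightarrow> real) \<Rightarrow> (nat \<Rightarrow> real) \<Rightarrow> bool" where
  "int_feasible I x y \<longleftrightarrow> lp_feasible I x y \<and>
     (\<forall>i<nsites I. y i \<in> \<nat>) \<and> (\<forall>i<nsites I. \<forall>j<nclients I. x i j \<in> \<nat>)"

definition cost :: "ftfp \<Rightarrow> (nat \<Rightarrow> nat \<Rightarrow> real) \<Rightarrow> (nat \<Rightarrow> real) \<Rightarrow> real" where
  "cost I x y = (\<Sum>i<nsites I. of_rat (open_cost I i) * y i) +
     (\<Sum>i<nsites I. \<Sum>j<nclients I. of_rat (conn_cost I i j) * x i j)"

definition lp_opt :: "ftfp \<Rightarrow> real" where
  "lp_opt I = Inf {cost I x y | x y. lp_feasible I x y}"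

definition int_opt :: "ftfp \<Rightarrow> real" where
  "int_opt I = Inf {cost I x y | x y. int_feasible I x y}"


section \<open>Randomized programs with logarithmic cost\<close>

text \<open>
  The machine model is a randomized random-access machine with logarithmic cost, presented as a
  while language. The memory consists of arrays \<open>0, 1, 2, \<dots>\<close> of integers, indexed by integers.
  Every integer that occurs during the evaluation of an expression (constants, addresses,
  operands and results) is charged its bit length, and every instruction one further unit, so
  that polynomial time agrees with polynomial time on (probabilistic) Turing machines. The only
  source of randomness is the fair coin.
\<close>

type_synonym memory = "nat \<Rightarrow> int \<Rightarrow> int"

datatype binop = Add | Sub | Mul | Div | Less

datatype expr = Const int | Read nat expr | Bin binop expr expr

datatype prog =
    Skip
  | Write nat expr expr
  | Flip nat expr
  | Seq prog prog
  | Cond expr prog prog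
  | While expr prog

definition bit_length :: "int \<Rightarrow> nat" where
  "bit_length k = Suc (floorlog 2 (nat \<bar>k\<bar>))"

fun apply_binop :: "binop \<Rightarrow> int \<Rightarrow> int \<Rightarrow> int" where
  "apply_binop Add a b = a + b"
| "apply_binop Sub a b = a - b"
| "apply_binop Mul a b = a * b"
| "apply_binop Div a b = a div b"
| "apply_binop Less a b = of_bool (a < b)"

fun value_of :: "memory \<Rightarrow> expr \<Rightarrow> int" where
  "value_of \<sigma> (Const k) = k"
| "value_of \<sigma> (Read a e) = \<sigma> a (value_of \<sigma> e)"
| "value_of \<sigma> (Bin f e1 e2) = apply_binop f (value_of \<sigma> e1) (value_of \<sigma> e2)"

fun expr_time :: "memory \<Rightarrow> expr \<Rightarrow> nat" where
  "expr_time \<sigma> (Const k) = bit_length k"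
| "expr_time \<sigma> (Read a e) = expr_time \<sigma> e + bit_length (value_of \<sigma> (Read a e))"
| "expr_time \<sigma> (Bin f e1 e2) =
     expr_time \<sigma> e1 + expr_time \<sigma> e2 + bit_length (value_of \<sigma> (Bin f e1 e2))"

definition store :: "memory \<Rightarrow> nat \<Rightarrow> int \<Rightarrow> int \<Rightarrow> memory" where
  "store \<sigma> a k v = \<sigma>(a := (\<sigma> a)(k := v))"

text \<open>
  A configuration consists of the stack of programs still to be executed, the memory, and the
  time used so far. Conditions hold iff their value is nonzero.
\<close>

type_synonym config = "prog list \<times> memory \<times> nat"

fun step :: "config \<Rightarrow> config pmf" where
  "step ([], \<sigma>, t) = return_pmf ([], \<sigma>, t)"
| "step (Skip # ps, \<sigma>, t) = return_pmf (ps, \<sigma>, t + 1)"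
| "step (Write a e1 e2 # ps, \<sigma>, t) =
     return_pmf (ps, store \<sigma> a (value_of \<sigma> e1) (value_of \<sigma> e2),
       t + 1 + expr_time \<sigma> e1 + expr_time \<sigma> e2)"
| "step (Flip a e # ps, \<sigma>, t) =
     map_pmf (\<lambda>b. (ps, store \<sigma> a (value_of \<sigma> e) (of_bool b), t + 1 + expr_time \<sigma> e))
       (bernoulli_pmf (1 / 2))"
| "step (Seq p q # ps, \<sigma>, t) = return_pmf (p # q # ps, \<sigma>, t + 1)"
| "step (Cond e p q # ps, \<sigma>, t) =
     return_pmf ((if value_of \<sigma> e \<noteq> 0 then p else q) # ps, \<sigma>, t + 1 + expr_time \<sigma> e)"
| "step (While e p # ps, \<sigma>, t) =
     return_pmf (if value_of \<sigma> e \<noteq> 0 then p # While e p # ps else ps,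
       \<sigma>, t + 1 + expr_time \<sigma> e)"

fun steps :: "nat \<Rightarrow> config \<Rightarrow> config pmf" where
  "steps 0 c = return_pmf c"
| "steps (Suc k) c = bind_pmf (step c) (steps k)"

text \<open>
  Every instruction takes at least one unit of time, so a run of time at most \<open>T\<close> has stopped
  after \<open>T\<close> steps. The bound is required for all outcomes of the coin flips.
\<close>

definition halts_within :: "prog \<Rightarrow> memory \<Rightarrow> nat \<Rightarrow> bool" where
  "halts_within P \<sigma> T \<longleftrightarrow>
     (\<forall>(ps, \<sigma>', t) \<in> set_pmf (steps T ([P], \<sigma>, 0)). ps = [] \<and> t \<le> T)"

text \<open>The distribution of the final memory of a program that halts within time \<open>T\<close>.\<close>

definition final_memory :: "prog \<Rightarrow> memory \<Rightarrow> nat \<Rightarrow> memory pmf" where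
  "final_memory P \<sigma> T = map_pmf (\<lambda>(ps, \<sigma>', t). \<sigma>') (steps T ([P], \<sigma>, 0))"


section \<open>Input and output\<close>

text \<open>
  Rationals are given by numerator and denominator in lowest terms, matrices row by row, and
  memory not occupied by the input is 0.
\<close>

definition input_tables :: "ftfp \<Rightarrow> int list list" where
  "input_tables I =
     (let m = nsites I; n = nclients I;
          ds = concat (map (\<lambda>i. map (conn_cost I i) [0..<n]) [0..<m])
      in [[int m, int n],
          map (\<lambda>i. fst (quotient_of (open_cost I i))) [0..<m],
          map (\<lambda>i. snd (quotient_of (open_cost I i))) [0..<m],
          map (\<lambda>d. fst (quotient_of d)) ds,
          map (\<lambda>d. snd (quotient_of d)) ds,
          map (\<lambda>j. int (demand I j)) [0..<n]])"

definition input_size :: "ftfp \<Rightarrow> nat" where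
  "input_size I = sum_list (map bit_length (concat (input_tables I)))"

definition input_memory :: "ftfp \<Rightarrow> memory" where
  "input_memory I a k =
     (if a < length (input_tables I) \<and> 0 \<le> k \<and> nat k < length (input_tables I ! a)
      then input_tables I ! a ! nat k else 0)"

text \<open>The output is read from array 6 (facilities) and, row by row, from array 7 (connections).\<close>

definition output_y :: "ftfp \<Rightarrow> memory \<Rightarrow> nat \<Rightarrow> real" where
  "output_y I \<sigma> i = of_int (\<sigma> 6 (int i))"

definition output_x :: "ftfp \<Rightarrow> memory \<Rightarrow> nat \<Rightarrow> nat \<Rightarrow> real" where
  "output_x I \<sigma> i j = of_int (\<sigma> 7 (int (i * nclients I + j)))"

end

theory Submission
  imports Defs
begin

text \<open>
  The program is deterministic. It approximates the LP, rounds the result and then improves the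
  rounded solution greedily; all arithmetic is exact.

  \<^item> The LP is a fractional covering problem whose columns are stars, i.e. a site with a set of
    clients. Multiplicative weights on the clients, with step sizes that cover the smallest
    demand of a star completely, yield a fractional solution within a factor of 1.0112 of the
    optimum after a number of steps that does not depend on the size of the demands. The cost of
    a step is charged to the decrease of the logarithm of the total weight, since the weights,
    scaled by the cost of the cheapest star, form a dual solution.
  \<^item> The integral part of the fractional solution is kept. It remains a solution with facility
    cost \<open>F\<close>, connection cost \<open>C\<close> and demands of at most twice the number of sites.
  \<^item> The residual solution is cut into tokens. Clusters of half a unit of tokens are formed around
    clients in the order of their radii, and every cluster opens its cheapest site. A client joins
    an existing cluster that meets its nearest tokens, and gives up its tokens of this cluster;
    so it joins every cluster at most once, at distance at most three times its radius. This
    costs at most \<open>2 F + 6 C\<close>.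
  \<^item> Greedy augmentation repeatedly opens the facility with the best ratio of the saving, when every
    client replaces its farthest connection, to the opening cost. The farthest distances are a
    dual solution in the end, and the total cost drops to \<open>2.96 (F + C)\<close>.

  For the running time, loop bounds are polynomials in the numbers of sites and clients, and the
  arrays are arranged in levels such that every assignment is linear in the arrays of its own
  level; this bounds the bit lengths of all numbers.
\<close>

section \<open>Structured programs\<close>

text \<open>Only the residual part of the fractional solution is rounded, at the factor 2.96, while
  the integral part is paid once; as 2.96 * 1.0112 < 3, the slack admits an approximate LP solution,
  and no linear program has to be solved exactly. All bounds compare with an arbitrary fractional
  solution, which occurs in the analysis only.

  Half a unit is a suitable size for clusters. A client gives up at most half a unit per unit of
  demand served, so until its last unit it owns enough tokens for another cluster, and every radius
  can be charged to half a unit of tokens at this distance or beyond. Hence a whole facility is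
  bought for half a unit, which gives 2 F, and three radii are paid by half a unit, which gives 6 C.

  The machine model shapes the rest. Quotients are compared by cross-multiplication, the weights
  share a common factor instead of being fractions, and numbers of rounds may depend neither on
  demands nor on costs, which can be exponential in the input size. This is why the potentials that
  bound the numbers of rounds use floors, units of residual demand, and ranks of distances.\<close>

datatype sprog =
    SSkip
  | Asg nat expr expr
  | SSeq sprog sprog
  | SIf expr sprog sprog
  | For nat expr sprog

fun compile :: "sprog \<Rightarrow> prog" where
  "compile SSkip = Skip"
| "compile (Asg a e1 e2) = Write a e1 e2"
| "compile (SSeq p q) = Seq (compile p) (compile q)"
| "compile (SIf e p q) = Cond e (compile p) (compile q)"
| "compile (For v e p) =
     Seq (Write v (Const 0) (Const 0))
       (While (Bin Less (Read v (Const 0)) e)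
         (Seq (compile p) (Write v (Const 0) (Bin Add (Read v (Const 0)) (Const 1)))))"

text \<open>The counter is set, not incremented, after each round, and the number of rounds is fixed
  in advance. This matches the compiled while loop as long as the body does not write
  \<open>v\<close> and the bound keeps its value, which \<open>bounded_loops\<close>
  ensures.\<close>

primrec loop :: "nat \<Rightarrow> nat \<Rightarrow> (memory \<Rightarrow> memory) \<Rightarrow> memory \<Rightarrow> memory" where
  "loop v 0 g \<sigma> = store \<sigma> v 0 0"
| "loop v (Suc k) g \<sigma> = store (g (loop v k g \<sigma>)) v 0 (int (Suc k))"

fun sem :: "sprog \<Rightarrow> memory \<Rightarrow> memory" where
  "sem SSkip \<sigma> = \<sigma>"
| "sem (Asg a e1 e2) \<sigma> = store \<sigma> a (value_of \<sigma> e1) (value_of \<sigma> e2)"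
| "sem (SSeq p q) \<sigma> = sem q (sem p \<sigma>)"
| "sem (SIf e p q) \<sigma> = (if value_of \<sigma> e \<noteq> 0 then sem p \<sigma> else sem q \<sigma>)"
| "sem (For v e p) \<sigma> = loop v (nat (value_of \<sigma> e)) (sem p) \<sigma>"

fun writes :: "sprog \<Rightarrow> nat set" where
  "writes SSkip = {}"
| "writes (Asg a e1 e2) = {a}"
| "writes (SSeq p q) = writes p \<union> writes q"
| "writes (SIf e p q) = writes p \<union> writes q"
| "writes (For v e p) = insert v (writes p)"

fun limit :: "expr \<Rightarrow> bool" where
  "limit (Const k) = True"
| "limit (Read a e) = (a = 0 \<and> limit e)"
| "limit (Bin f e1 e2) = ((f = Add \<or> f = Mul) \<and> limit e1 \<and> limit e2)"

text \<open>
  Array 0 holds the numbers of sites and clients. Since loop bounds only read this array and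
  it is never written, the number of iterations is polynomial in the input size.
\<close>

fun bounded_loops :: "sprog \<Rightarrow> bool" where
  "bounded_loops SSkip = True"
| "bounded_loops (Asg a e1 e2) = (a \<noteq> 0)"
| "bounded_loops (SSeq p q) = (bounded_loops p \<and> bounded_loops q)"
| "bounded_loops (SIf e p q) = (bounded_loops p \<and> bounded_loops q)"
| "bounded_loops (For v e p) = (v \<noteq> 0 \<and> limit e \<and> v \<notin> writes p \<and> bounded_loops p)"

lemma store_other [simp]: "b \<noteq> a \<Longrightarrow> store \<sigma> a k x b = \<sigma> b"
  by (simp add: store_def)

lemma store_same [simp]: "store \<sigma> a k x a = (\<sigma> a)(k := x)"
  by (simp add: store_def)

lemma loop_frame:
  assumes "\<And>\<tau>. g \<tau> b = \<tau> b" "b \<noteq> v"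
  shows "loop v k g \<sigma> b = \<sigma> b"
  using assms by (induction k) auto

lemma loop_counter:
  assumes "\<And>\<tau>. g \<tau> v = \<tau> v"
  shows "loop v k g \<sigma> v = (\<sigma> v)(0 := int k)"
  using assms by (induction k) auto

lemma sem_frame: "b \<notin> writes p \<Longrightarrow> sem p \<sigma> b = \<sigma> b"
proof (induction p arbitrary: \<sigma>)
  case (For v e p)
  then show ?case by (auto intro: loop_frame)
qed auto

lemma bounded_loops_zero: "bounded_loops p \<Longrightarrow> 0 \<notin> writes p"
  by (induction p) auto

lemma limit_cong: "limit e \<Longrightarrow> \<tau> 0 = \<sigma> 0 \<Longrightarrow> value_of \<tau> e = value_of \<sigma> e"
  by (induction e) auto

section \<open>Polynomial running time\<close>

lemma bit_length_le_Suc_iff: "bit_length k \<le> Suc b \<longleftrightarrow> \<bar>k\<bar> < 2 ^ b"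
proof -
  have "bit_length k \<le> Suc b \<longleftrightarrow> nat \<bar>k\<bar> < 2 ^ b"
    by (simp add: bit_length_def floorlog_le_iff)
  also have "\<dots> \<longleftrightarrow> \<bar>k\<bar> < 2 ^ b"
    by (simp add: nat_less_iff)
  finally show ?thesis .
qed

lemma bit_length_pos: "0 < bit_length k"
  by (simp add: bit_length_def)

lemma abs_less_bit_length: "\<bar>k\<bar> < 2 ^ (bit_length k - 1)"
  using bit_length_le_Suc_iff[of k "bit_length k - 1"] bit_length_pos[of k] by simp

lemma bit_length_of_bool: "bit_length (of_bool b) \<le> 2"
  using bit_length_le_Suc_iff[of "of_bool b" 1] by (cases b) (auto simp: numeral_2_eq_2)

lemma abs_add_less_power:
  fixes a b :: int
  assumes "\<bar>a\<bar> < 2 ^ i" "\<bar>b\<bar> < 2 ^ j"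
  shows "\<bar>a\<bar> + \<bar>b\<bar> < 2 ^ Suc (max i j)"
proof -
  have "(2::int) ^ i \<le> 2 ^ max i j" "(2::int) ^ j \<le> 2 ^ max i j"
    by (auto intro: power_increasing)
  then show ?thesis using assms unfolding power_Suc by linarith
qed

lemma bit_length_add_le: "bit_length (a + b) \<le> Suc (max (bit_length a) (bit_length b))"
proof -
  have "\<bar>a + b\<bar> < 2 ^ Suc (max (bit_length a - 1) (bit_length b - 1))"
    using abs_add_less_power[OF abs_less_bit_length abs_less_bit_length, of a b] by linarith
  then have "bit_length (a + b) \<le> Suc (Suc (max (bit_length a - 1) (bit_length b - 1)))"
    by (simp only: bit_length_le_Suc_iff)
  then show ?thesis using bit_length_pos[of a] bit_length_pos[of b] by linarith
qed

lemma bit_length_minus: "bit_length (- a) = bit_length a"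
  by (simp add: bit_length_def)

lemma bit_length_diff_le: "bit_length (a - b) \<le> Suc (max (bit_length a) (bit_length b))"
  using bit_length_add_le[of a "- b"] by (simp add: bit_length_minus)

lemma bit_length_mult_le: "bit_length (a * b) \<le> bit_length a + bit_length b"
proof -
  have "\<bar>a * b\<bar> < 2 ^ (bit_length a - 1) * 2 ^ (bit_length b - 1)"
    unfolding abs_mult by (intro mult_strict_mono abs_less_bit_length) auto
  then have "\<bar>a * b\<bar> < 2 ^ ((bit_length a - 1) + (bit_length b - 1))"
    by (simp add: power_add)
  then have "bit_length (a * b) \<le> Suc ((bit_length a - 1) + (bit_length b - 1))"
    by (simp only: bit_length_le_Suc_iff)
  then show ?thesis using bit_length_pos[of a] bit_length_pos[of b] by linarith
qed

text \<open>Floor division moves negative quotients away from zero, but not past the dividend: for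
  \<open>a < 0 < c\<close>, the inequality \<open>a * c \<le> a\<close> gives
  \<open>a \<le> a div c < 0\<close>. A negative divisor is handled by changing both signs, and
  \<open>a div 0 = 0\<close>.\<close>

lemma abs_div_le:
  fixes a b :: int
  shows "\<bar>a div b\<bar> \<le> \<bar>a\<bar>"
proof (cases "b = 0")
  case False
  have *: "\<bar>a div c\<bar> \<le> \<bar>a\<bar>" if "0 < c" for a c :: int
  proof (cases "0 \<le> a")
    case True
    then show ?thesis using that zdiv_mono2[of a 1 c] by (simp add: pos_imp_zdiv_nonneg_iff)
  next
    case False
    have "a \<le> a div c"
    proof -
      have "a * c \<le> a" using False that mult_left_mono_neg[of 1 c a] by simp
      then have "(a * c) div c \<le> a div c" using that by (rule zdiv_mono1)
      then show ?thesis using that by simp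
    qed
    moreover have "a div c < 0" using False that by (simp add: neg_imp_zdiv_neg_iff div_neg_pos_less0)
    ultimately show ?thesis by simp
  qed
  show ?thesis
  proof (cases "0 < b")
    case True
    then show ?thesis by (rule *)
  next
    case False
    then have "a div b = (- a) div (- b)" by simp
    then show ?thesis using *[of "- b" "- a"] False \<open>b \<noteq> 0\<close> by simp
  qed
qed simp

lemma bit_length_div_le: "bit_length (a div b) \<le> bit_length a"
  using abs_div_le[of a b] by (auto simp: bit_length_def intro!: floorlog_mono nat_mono)

text \<open>Bit lengths are measured in units of \<open>b + 2\<close>, where \<open>b\<close> bounds
  the bit lengths in memory. The extra unit of a binary node pays for a carry and for the two bits
  of a comparison.\<close>

fun expr_size :: "expr \<Rightarrow> nat" where
  "expr_size (Const k) = bit_length k"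
| "expr_size (Read a e) = Suc (expr_size e)"
| "expr_size (Bin f e1 e2) = Suc (expr_size e1 + expr_size e2)"

fun expr_weight :: "expr \<Rightarrow> nat" where
  "expr_weight (Const k) = bit_length k"
| "expr_weight (Read a e) = Suc (expr_weight e)"
| "expr_weight (Bin f e1 e2) =
     expr_weight e1 + expr_weight e2 + Suc (expr_size e1 + expr_size e2)"

text \<open>
  The degree of an expression in the arrays of level \<open>l\<close>. If the value stored in an array of
  level \<open>l\<close> always has degree at most 1, every assignment increases the bit lengths at
  level \<open>l\<close> by at most an amount that is linear in the bit lengths at the levels below.
\<close>

fun degree_at :: "(nat \<Rightarrow> nat) \<Rightarrow> nat \<Rightarrow> expr \<Rightarrow> nat" where
  "degree_at lev l (Const k) = 0"
| "degree_at lev l (Read a e) = (if lev a < l then 0 else if lev a = l then 1 else 2)"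
| "degree_at lev l (Bin f e1 e2) =
     (case f of Mul \<Rightarrow> degree_at lev l e1 + degree_at lev l e2
      | Div \<Rightarrow> degree_at lev l e1
      | Less \<Rightarrow> 0
      | _ \<Rightarrow> max (degree_at lev l e1) (degree_at lev l e2))"

text \<open>Only the stored value is restricted. Addresses and conditions may use arrays of any
  level, because they cost time but do not enter the memory.\<close>

fun levelled :: "(nat \<Rightarrow> nat) \<Rightarrow> sprog \<Rightarrow> bool" where
  "levelled lev SSkip = True"
| "levelled lev (Asg a e1 e2) = (degree_at lev (lev a) e2 \<le> 1)"
| "levelled lev (SSeq p q) = (levelled lev p \<and> levelled lev q)"
| "levelled lev (SIf e p q) = (levelled lev p \<and> levelled lev q)"
| "levelled lev (For v e p) = levelled lev p"

text \<open>A product adds both degrees and bit lengths, a quotient is not longer than its dividend,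
  and a comparison has at most two bits whatever its operands are. With degree at most 1, the bound
  \<open>c\<close> of the own level is therefore counted at most once.\<close>

lemma bit_length_value_le_degree:
  assumes low: "\<And>a k. lev a < l \<Longrightarrow> bit_length (\<sigma> a k) \<le> b"
    and same: "\<And>a k. lev a = l \<Longrightarrow> bit_length (\<sigma> a k) \<le> c"
    and "degree_at lev l e \<le> 1"
  shows "bit_length (value_of \<sigma> e) \<le> degree_at lev l e * c + expr_size e * (b + 2)"
  using assms(3)
proof (induction e)
  case (Read a e)
  show ?case
  proof (cases "lev a < l")
    case True
    then show ?thesis using low[of a "value_of \<sigma> e"] by simp
  next
    case False
    then show ?thesis using same[of a "value_of \<sigma> e"] Read.prems by (auto split: if_splits)
  qed
next
  case (Bin f e1 e2)
  let ?d1 = "degree_at lev l e1" and ?d2 = "degree_at lev l e2"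
  let ?s1 = "expr_size e1 * (b + 2)" and ?s2 = "expr_size e2 * (b + 2)"
  have size: "expr_size (Bin f e1 e2) * (b + 2) = ?s1 + ?s2 + b + 2"
    by (simp add: algebra_simps)
  have mx: "?d1 * c \<le> max ?d1 ?d2 * c" "?d2 * c \<le> max ?d1 ?d2 * c"
    by (auto intro: mult_right_mono)
  have max_le: "bit_length x \<le> max ?d1 ?d2 * c + (?s1 + ?s2 + b + 2)"
    if "bit_length x \<le> Suc (max (bit_length (value_of \<sigma> e1)) (bit_length (value_of \<sigma> e2)))"
      "max ?d1 ?d2 \<le> 1" for x
    using that Bin.IH mx by linarith
  show ?case
  proof (cases f)
    case Add
    then show ?thesis
      using Bin.prems max_le[OF bit_length_add_le] unfolding size by simp
  next
    case Sub
    then show ?thesis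
      using Bin.prems max_le[OF bit_length_diff_le] unfolding size by simp
  next
    case Mul
    then show ?thesis
      using Bin bit_length_mult_le[of "value_of \<sigma> e1" "value_of \<sigma> e2"]
      unfolding size by (simp add: add_mult_distrib)
  next
    case Div
    then show ?thesis
      using Bin bit_length_div_le[of "value_of \<sigma> e1" "value_of \<sigma> e2"]
      unfolding size by simp
  next
    case Less
    then show ?thesis
      using bit_length_of_bool[of "value_of \<sigma> e1 < value_of \<sigma> e2"]
      unfolding size by simp
  qed
qed simp

text \<open>The crude bound without levels. It serves for the running time, where intermediate
  results have to be paid for but do not accumulate.\<close>

lemma bit_length_value_le:
  assumes "\<And>a k. bit_length (\<sigma> a k) \<le> b"
  shows "bit_length (value_of \<sigma> e) \<le> expr_size e * (b + 2)"
proof (induction e)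
  case (Read a e)
  then show ?case using assms[of a "value_of \<sigma> e"] by simp
next
  case (Bin f e1 e2)
  let ?s1 = "expr_size e1 * (b + 2)" and ?s2 = "expr_size e2 * (b + 2)"
  have size: "expr_size (Bin f e1 e2) * (b + 2) = ?s1 + ?s2 + b + 2"
    by (simp add: algebra_simps)
  show ?case
    using Bin bit_length_add_le[of "value_of \<sigma> e1" "value_of \<sigma> e2"]
      bit_length_diff_le[of "value_of \<sigma> e1" "value_of \<sigma> e2"]
      bit_length_mult_le[of "value_of \<sigma> e1" "value_of \<sigma> e2"]
      bit_length_div_le[of "value_of \<sigma> e1" "value_of \<sigma> e2"]
      bit_length_of_bool[of "value_of \<sigma> e1 < value_of \<sigma> e2"]
    unfolding size by (cases f) auto
qed simp

lemma expr_time_le: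
  assumes "\<And>a k. bit_length (\<sigma> a k) \<le> b"
  shows "expr_time \<sigma> e \<le> expr_weight e * (b + 2)"
proof (induction e)
  case (Read a e)
  then show ?case using assms[of a "value_of \<sigma> e"] by simp
next
  case (Bin f e1 e2)
  then show ?case
    using bit_length_value_le[of \<sigma> b "Bin f e1 e2", OF assms] by (simp add: algebra_simps)
qed simp

lemma expr_size_le_weight: "expr_size e \<le> expr_weight e"
  by (induction e) auto

text \<open>\<open>s\<close> stands for the bits of the input, \<open>c\<close> for the size of the
  program and \<open>k\<close> for a bound on the number of assignments so far. One assignment adds
  at most \<open>c * (b + 2)\<close> bits at its level, \<open>b\<close> being the bound of the
  level below; charging the current \<open>b\<close> to all earlier assignments too keeps the bound
  polynomial in \<open>s\<close> and \<open>k\<close> for every fixed level.\<close>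

primrec growth :: "nat \<Rightarrow> nat \<Rightarrow> nat \<Rightarrow> nat \<Rightarrow> nat" where
  "growth s c 0 k = s + k * (c * 2)"
| "growth s c (Suc l) k = s + k * (c * (growth s c l k + 2))"

lemma growth_mono: "k \<le> k' \<Longrightarrow> growth s c l k \<le> growth s c l k'"
  by (induction l) (auto intro!: mult_mono)

lemma growth_level_mono:
  assumes "l \<le> l'"
  shows "growth s c l k \<le> growth s c l' k"
proof -
  have "growth s c l k \<le> growth s c (Suc l) k" for l
    by (induction l) (auto intro!: mult_mono)
  then show ?thesis using assms by (rule lift_Suc_mono_le)
qed

lemma growth_Suc_0: "growth s c 0 k + c * 2 \<le> growth s c 0 (Suc k)"
  by simp

lemma growth_Suc_Suc:
  "growth s c (Suc l) k + c * (growth s c l k + 2) \<le> growth s c (Suc l) (Suc k)"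
proof -
  have "Suc k * (c * (growth s c l k + 2)) \<le> Suc k * (c * (growth s c l (Suc k) + 2))"
    using growth_mono[of k "Suc k" s c l] by (intro mult_le_mono) auto
  then show ?thesis by simp
qed

definition bits_bounded :: "(nat \<Rightarrow> nat) \<Rightarrow> nat \<Rightarrow> nat \<Rightarrow> nat \<Rightarrow> memory \<Rightarrow> bool" where
  "bits_bounded lev s c k \<sigma> \<longleftrightarrow> (\<forall>a i. bit_length (\<sigma> a i) \<le> growth s c (lev a) k)"

lemma bits_bounded_mono: "bits_bounded lev s c k \<sigma> \<Longrightarrow> k \<le> k' \<Longrightarrow> bits_bounded lev s c k' \<sigma>"
  unfolding bits_bounded_def by (meson growth_mono le_trans)

text \<open>As the own level enters the new value with coefficient at most 1, its old bound is not
  multiplied, and the remaining bits fit into one increment of \<open>growth\<close>.\<close>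

lemma bits_bounded_store:
  assumes bb: "bits_bounded lev s c k \<sigma>" and deg: "degree_at lev (lev a) e \<le> 1"
    and c: "expr_size e \<le> c"
  shows "bits_bounded lev s c (Suc k) (store \<sigma> a i (value_of \<sigma> e))"
proof -
  have same: "bit_length (\<sigma> b i) \<le> growth s c (lev a) k" if "lev b = lev a" for b i
    using bb that unfolding bits_bounded_def by metis
  have "bit_length (value_of \<sigma> e) \<le> growth s c (lev a) (Suc k)"
  proof (cases "lev a")
    case 0
    \<comment> \<open>No array lies below level 0, so \<open>b\<close> is 0 here.\<close>
    have "bit_length (value_of \<sigma> e) \<le> degree_at lev (lev a) e * growth s c 0 k + expr_size e * (0 + 2)"
      using same deg 0 by (intro bit_length_value_le_degree) auto
    also have "\<dots> \<le> 1 * growth s c 0 k + c * 2"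
      using deg c by (intro add_mono mult_mono) auto
    also have "\<dots> \<le> growth s c 0 (Suc k)"
      using growth_Suc_0 by simp
    finally show ?thesis by (simp add: 0)
  next
    case (Suc l)
    have low: "bit_length (\<sigma> b i) \<le> growth s c l k" if "lev b < lev a" for b i
    proof -
      have "growth s c (lev b) k \<le> growth s c l k"
        using that Suc by (intro growth_level_mono) simp
      then show ?thesis using bb unfolding bits_bounded_def by (meson le_trans)
    qed
    have "bit_length (value_of \<sigma> e)
      \<le> degree_at lev (lev a) e * growth s c (lev a) k + expr_size e * (growth s c l k + 2)"
      using same deg low by (intro bit_length_value_le_degree)
    also have "\<dots> \<le> 1 * growth s c (lev a) k + c * (growth s c l k + 2)"
      using deg c by (intro add_mono mult_mono) auto
    also have "\<dots> \<le> growth s c (lev a) (Suc k)"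
      using growth_Suc_Suc Suc by simp
    finally show ?thesis .
  qed
  moreover have "bits_bounded lev s c (Suc k) \<sigma>"
    using bb by (rule bits_bounded_mono) simp
  ultimately show ?thesis
    unfolding bits_bounded_def store_def by auto
qed

fun step_count :: "memory \<Rightarrow> sprog \<Rightarrow> nat" where
  "step_count \<sigma> SSkip = 1"
| "step_count \<sigma> (Asg a e1 e2) = 1"
| "step_count \<sigma> (SSeq p q) = Suc (step_count \<sigma> p + step_count \<sigma> q)"
| "step_count \<sigma> (SIf e p q) = Suc (step_count \<sigma> p + step_count \<sigma> q)"
| "step_count \<sigma> (For v e p) = 3 + nat (value_of \<sigma> e) * (step_count \<sigma> p + 3)"

text \<open>Dominates every expression of the compiled program, including those that compilation
  creates: the loop test has weight at most \<open>2 * expr_weight e + 5\<close>, and the increment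
  of the counter has weight 9.\<close>

fun sprog_weight :: "sprog \<Rightarrow> nat" where
  "sprog_weight SSkip = 1"
| "sprog_weight (Asg a e1 e2) = Suc (expr_weight e1 + expr_weight e2)"
| "sprog_weight (SSeq p q) = Suc (sprog_weight p + sprog_weight q)"
| "sprog_weight (SIf e p q) = Suc (expr_weight e + sprog_weight p + sprog_weight q)"
| "sprog_weight (For v e p) = sprog_weight p + 2 * expr_weight e + 30"

section \<open>Runs of compiled programs on the machine\<close>

lemma step_count_cong: "bounded_loops p \<Longrightarrow> \<tau> 0 = \<sigma> 0 \<Longrightarrow> step_count \<tau> p = step_count \<sigma> p"
proof (induction p)
  case (For v e p)
  then show ?case using limit_cong[of e \<tau> \<sigma>] by simp
qed auto

text \<open>A mixture is a point mass only if all its components are the same point mass, so every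
  outcome of the first instruction already leads to \<open>c'\<close>.\<close>

lemma steps_trans: "steps k c = return_pmf c' \<Longrightarrow> steps (k + l) c = steps l c'"
proof (induction k arbitrary: c c')
  case 0
  then show ?case by simp
next
  case (Suc k)
  have "set_pmf (bind_pmf (step c) (steps k)) = {c'}" using Suc.prems by simp
  then have sub: "\<And>x. x \<in> set_pmf (step c) \<Longrightarrow> set_pmf (steps k x) \<subseteq> {c'}" by auto
  have "steps k x = return_pmf c'" if "x \<in> set_pmf (step c)" for x
    using sub[OF that] set_pmf_subset_singleton by metis
  then have "bind_pmf (step c) (steps (k + l)) = bind_pmf (step c) (\<lambda>_. steps l c')"
    using Suc.IH by (intro bind_pmf_cong) auto
  then show ?case by simp
qed

text \<open>The number of steps is bounded by the time they take, since \<open>halts_within\<close>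
  uses one number for both. The starting time is arbitrary so that runs can be concatenated.\<close>

definition runs :: "prog list \<Rightarrow> memory \<Rightarrow> prog list \<Rightarrow> memory \<Rightarrow> nat \<Rightarrow> bool" where
  "runs ps \<sigma> qs \<tau> t \<longleftrightarrow>
     (\<forall>t0. \<exists>k\<le>t. steps k (ps, \<sigma>, t0) = return_pmf (qs, \<tau>, t0 + t))"

lemma runs_refl: "runs ps \<sigma> ps \<sigma> 0"
  by (auto simp: runs_def)

lemma runs_trans:
  assumes "runs ps \<sigma> qs \<tau> t" "runs qs \<tau> rs \<rho> u"
  shows "runs ps \<sigma> rs \<rho> (t + u)"
  unfolding runs_def
proof
  fix t0
  obtain k where k: "k \<le> t" "steps k (ps, \<sigma>, t0) = return_pmf (qs, \<tau>, t0 + t)"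
    using assms(1) unfolding runs_def by blast
  obtain l where l: "l \<le> u" "steps l (qs, \<tau>, t0 + t) = return_pmf (rs, \<rho>, t0 + t + u)"
    using assms(2) unfolding runs_def by blast
  have "steps (k + l) (ps, \<sigma>, t0) = return_pmf (rs, \<rho>, t0 + (t + u))"
    using steps_trans[OF k(2), of l] l by (simp add: add.assoc)
  then show "\<exists>k\<le>t + u. steps k (ps, \<sigma>, t0) = return_pmf (rs, \<rho>, t0 + (t + u))"
    using k l by (intro exI[of _ "k + l"]) auto
qed

lemma runs_step:
  assumes "\<And>t0. step (ps, \<sigma>, t0) = return_pmf (qs, \<tau>, t0 + t)" "0 < t"
  shows "runs ps \<sigma> qs \<tau> t"
  unfolding runs_def
proof
  fix t0
  show "\<exists>k\<le>t. steps k (ps, \<sigma>, t0) = return_pmf (qs, \<tau>, t0 + t)"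
    using assms by (intro exI[of _ 1]) (auto simp: bind_return_pmf)
qed

lemma runs_Skip: "runs (Skip # ps) \<sigma> ps \<sigma> 1"
  by (rule runs_step) auto

lemma runs_Write:
  "runs (Write a e1 e2 # ps) \<sigma> ps (store \<sigma> a (value_of \<sigma> e1) (value_of \<sigma> e2))
     (1 + expr_time \<sigma> e1 + expr_time \<sigma> e2)"
  by (rule runs_step) (auto simp: add.assoc)

lemma runs_Seq: "runs (Seq p q # ps) \<sigma> (p # q # ps) \<sigma> 1"
  by (rule runs_step) auto

lemma runs_Cond:
  "runs (Cond e p q # ps) \<sigma> ((if value_of \<sigma> e \<noteq> 0 then p else q) # ps) \<sigma> (1 + expr_time \<sigma> e)"
  by (rule runs_step) (auto simp: add.assoc)

lemma runs_While:
  "runs (While e p # ps) \<sigma> (if value_of \<sigma> e \<noteq> 0 then p # While e p # ps else ps) \<sigma>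
     (1 + expr_time \<sigma> e)"
  by (rule runs_step) (auto simp: add.assoc)

lemma expr_time_bounded:
  assumes bb: "bits_bounded lev s c k \<sigma>" and "\<And>a. lev a \<le> lm" "k \<le> N"
  shows "expr_time \<sigma> e \<le> expr_weight e * (growth s c lm N + 2)"
proof (rule expr_time_le)
  fix a i
  have "bit_length (\<sigma> a i) \<le> growth s c (lev a) k"
    using bb unfolding bits_bounded_def by blast
  also have "\<dots> \<le> growth s c lm k" by (rule growth_level_mono) (rule assms)
  also have "\<dots> \<le> growth s c lm N" by (rule growth_mono) (rule assms)
  finally show "bit_length (\<sigma> a i) \<le> growth s c lm N" .
qed

lemma weighted_time_le:
  fixes w c b x :: nat
  assumes "x \<le> w * (b + 2)" "Suc w \<le> c"
  shows "1 + x \<le> c * (b + 2)"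
proof -
  have "1 + x \<le> Suc w * (b + 2)" using assms by simp
  also have "\<dots> \<le> c * (b + 2)" using assms by (intro mult_right_mono) auto
  finally show ?thesis .
qed

lemma bit_length_0: "bit_length 0 = 1" and bit_length_1: "bit_length 1 = 2"
  by (simp_all add: bit_length_def floorlog_def)

text \<open>The bit lengths are bounded in terms of the number \<open>k\<close> of steps done
  before, but every instruction is charged the bound that holds after all \<open>N\<close> steps of
  the whole run. With this uniform charge the time is a product, and the times of consecutive parts
  simply add up.\<close>

lemma compile_runs:
  assumes "\<And>a. lev a \<le> lm"
    and "bounded_loops p" "levelled lev p" "sprog_weight p \<le> c" "bits_bounded lev s c k \<sigma>"
    and "k + step_count \<sigma> p \<le> N"
  shows "bits_bounded lev s c (k + step_count \<sigma> p) (sem p \<sigma>) \<and>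
    (\<exists>t \<le> step_count \<sigma> p * (c * (growth s c lm N + 2)).
       runs (compile p # ps) \<sigma> ps (sem p \<sigma>) t)"
  using assms(2-6)
proof (induction p arbitrary: \<sigma> k ps)
  case SSkip
  then have "1 \<le> c * (growth s c lm N + 2)" by simp
  then show ?case
    using SSkip runs_Skip[of ps \<sigma>] by (auto intro: bits_bounded_mono intro!: exI[of _ 1])
next
  case (Asg a e1 e2)
  have et: "expr_time \<sigma> e \<le> expr_weight e * (growth s c lm N + 2)" for e
    using Asg.prems assms(1) by (intro expr_time_bounded[where k = k]) auto
  have "1 + (expr_time \<sigma> e1 + expr_time \<sigma> e2) \<le> c * (growth s c lm N + 2)"
  proof (rule weighted_time_le)
    show "expr_time \<sigma> e1 + expr_time \<sigma> e2 \<le> (expr_weight e1 + expr_weight e2) * (growth s c lm N + 2)"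
      using et[of e1] et[of e2] by (simp add: add_mult_distrib)
  qed (use Asg.prems in simp)
  moreover have "bits_bounded lev s c (Suc k) (store \<sigma> a (value_of \<sigma> e1) (value_of \<sigma> e2))"
    using Asg.prems expr_size_le_weight[of e2] by (intro bits_bounded_store) auto
  ultimately show ?case
    using runs_Write[of a e1 e2 ps \<sigma>]
    by (auto intro!: exI[of _ "1 + expr_time \<sigma> e1 + expr_time \<sigma> e2"])
next
  case (SSeq p q)
  let ?U = "c * (growth s c lm N + 2)"
  have c: "1 \<le> ?U" using SSeq.prems by simp
  have 1: "bits_bounded lev s c (k + step_count \<sigma> p) (sem p \<sigma>) \<and>
    (\<exists>t \<le> step_count \<sigma> p * ?U. runs (compile p # compile q # ps) \<sigma> (compile q # ps) (sem p \<sigma>) t)"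
    using SSeq.prems by (intro SSeq.IH(1)) auto
  then obtain t where t: "t \<le> step_count \<sigma> p * ?U"
    "runs (compile p # compile q # ps) \<sigma> (compile q # ps) (sem p \<sigma>) t" by blast
  have sc: "step_count (sem p \<sigma>) q = step_count \<sigma> q"
    using SSeq.prems bounded_loops_zero sem_frame by (intro step_count_cong) auto
  have 2: "bits_bounded lev s c (k + step_count \<sigma> p + step_count (sem p \<sigma>) q) (sem q (sem p \<sigma>)) \<and>
    (\<exists>t \<le> step_count (sem p \<sigma>) q * ?U. runs (compile q # ps) (sem p \<sigma>) ps (sem q (sem p \<sigma>)) t)"
    using SSeq.prems 1 by (intro SSeq.IH(2)) (auto simp: sc)
  then obtain u where u: "u \<le> step_count \<sigma> q * ?U"
    "runs (compile q # ps) (sem p \<sigma>) ps (sem q (sem p \<sigma>)) u" by (auto simp: sc)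
  have "runs (compile (SSeq p q) # ps) \<sigma> ps (sem (SSeq p q) \<sigma>) (1 + (t + u))"
    using runs_trans[OF runs_Seq runs_trans[OF t(2) u(2)]] by simp
  moreover have "1 + (t + u) \<le> step_count \<sigma> (SSeq p q) * ?U"
    using t u c by (simp add: add_mult_distrib)
  moreover have "bits_bounded lev s c (k + step_count \<sigma> (SSeq p q)) (sem (SSeq p q) \<sigma>)"
    using 2 by (auto simp: sc elim!: bits_bounded_mono)
  ultimately show ?case by blast
next
  case (SIf e p q)
  let ?U = "c * (growth s c lm N + 2)"
  have et: "1 + expr_time \<sigma> e \<le> ?U"
    using SIf.prems assms(1)
    by (intro weighted_time_le[OF expr_time_bounded[where k = k]]) auto
  define b where "b = (if value_of \<sigma> e \<noteq> 0 then p else q)"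
  have b: "step_count \<sigma> b \<le> step_count \<sigma> p + step_count \<sigma> q" by (simp add: b_def)
  have 1: "bits_bounded lev s c (k + step_count \<sigma> b) (sem b \<sigma>) \<and>
    (\<exists>t \<le> step_count \<sigma> b * ?U. runs (compile b # ps) \<sigma> ps (sem b \<sigma>) t)"
    unfolding b_def using SIf.prems SIf.IH by auto
  then obtain t where t: "t \<le> step_count \<sigma> b * ?U" "runs (compile b # ps) \<sigma> ps (sem b \<sigma>) t"
    by blast
  have sem: "sem (SIf e p q) \<sigma> = sem b \<sigma>" by (simp add: b_def)
  have "runs (Cond e (compile p) (compile q) # ps) \<sigma> (compile b # ps) \<sigma> (1 + expr_time \<sigma> e)"
    using runs_Cond[of e "compile p" "compile q" ps \<sigma>] by (simp add: b_def if_distrib)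
  then have "runs (compile (SIf e p q) # ps) \<sigma> ps (sem (SIf e p q) \<sigma>) (1 + expr_time \<sigma> e + t)"
    unfolding sem compile.simps using t(2) by (rule runs_trans)
  moreover have "1 + expr_time \<sigma> e + t \<le> step_count \<sigma> (SIf e p q) * ?U"
  proof -
    have "step_count \<sigma> b * ?U \<le> (step_count \<sigma> p + step_count \<sigma> q) * ?U"
      using b by (rule mult_right_mono) simp
    then show ?thesis unfolding step_count.simps mult_Suc using et t(1) by linarith
  qed
  moreover have "bits_bounded lev s c (k + step_count \<sigma> (SIf e p q)) (sem (SIf e p q) \<sigma>)"
    unfolding sem using 1 b by (auto elim!: bits_bounded_mono)
  ultimately show ?case by blast
next
  case (For v e p)
  let ?U = "c * (growth s c lm N + 2)"
  define inc where "inc = Bin Add (Read v (Const 0)) (Const 1)"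
  define test where "test = Bin Less (Read v (Const 0)) e"
  define body where "body = Seq (compile p) (Write v (Const 0) inc)"
  define M where "M = nat (value_of \<sigma> e)"
  define \<sigma>' where "\<sigma>' i = loop v i (sem p) \<sigma>" for i
  \<comment> \<open>Only assignments lengthen numbers. Counted are the initial assignment to the
    counter and, per round, the body and the increment; tests and sequencing of the loop are left
    out.\<close>
  define k' where "k' i = k + 1 + i * (step_count \<sigma> p + 1)" for i
  have v: "v \<noteq> 0" "v \<notin> writes p" "limit e" and zero: "0 \<notin> writes p"
    using For.prems bounded_loops_zero[of p] by auto
  have ctr: "\<sigma>' i v = (\<sigma> v)(0 := int i)" for i
    unfolding \<sigma>'_def using v sem_frame by (intro loop_counter) auto
  have zero': "\<sigma>' i 0 = \<sigma> 0" for i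
    unfolding \<sigma>'_def using v zero sem_frame by (intro loop_frame) auto
  \<comment> \<open>The while loop evaluates its bound in every round, the semantics only
    once.\<close>
  have val_e: "value_of (\<sigma>' i) e = value_of \<sigma> e" for i
    using v zero' by (intro limit_cong) auto
  have w_inc: "expr_weight inc = 9" "expr_size inc = 5"
    by (auto simp: inc_def bit_length_0 bit_length_1)
  have w_test: "expr_weight test \<le> 2 * expr_weight e + 5"
    using expr_size_le_weight[of e] by (auto simp: test_def bit_length_0)
  have k'N: "k' i \<le> N" "k' i + step_count \<sigma> p + 1 \<le> N" if "i < M" for i
  proof -
    have "Suc i * (step_count \<sigma> p + 1) \<le> M * (step_count \<sigma> p + 1)"
      using that by (intro mult_right_mono) auto
    moreover have "M * (step_count \<sigma> p + 1) \<le> M * (step_count \<sigma> p + 3)"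
      by (intro mult_left_mono) auto
    moreover have "k + 3 + M * (step_count \<sigma> p + 3) \<le> N"
      using For.prems by (simp add: M_def)
    ultimately show "k' i + step_count \<sigma> p + 1 \<le> N" unfolding k'_def by simp
    then show "k' i \<le> N" by simp
  qed
  have k'M: "k' M \<le> N" "k' M \<le> k + step_count \<sigma> (For v e p)"
  proof -
    have "M * (step_count \<sigma> p + 1) \<le> M * (step_count \<sigma> p + 3)"
      by (intro mult_left_mono) auto
    then show "k' M \<le> k + step_count \<sigma> (For v e p)" unfolding k'_def by (simp add: M_def)
    then show "k' M \<le> N" using For.prems by simp
  qed
  have wr: "1 + (expr_time \<tau> (Const 0) + expr_time \<tau> x) \<le> ?U"
    if "bits_bounded lev s c j \<tau>" "j \<le> N" "expr_weight x \<le> 9" for \<tau> j x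
  proof (rule weighted_time_le[where w = 10])
    have "expr_time \<tau> y \<le> expr_weight y * (growth s c lm N + 2)" for y
      using that assms(1) by (intro expr_time_bounded[where k = j]) auto
    then have "expr_time \<tau> (Const 0) + expr_time \<tau> x
        \<le> (expr_weight (Const 0) + expr_weight x) * (growth s c lm N + 2)"
      unfolding add_mult_distrib by (intro add_mono)
    also have "\<dots> \<le> 10 * (growth s c lm N + 2)"
      using that(3) by (intro mult_right_mono) (auto simp: bit_length_0)
    finally show "expr_time \<tau> (Const 0) + expr_time \<tau> x \<le> 10 * (growth s c lm N + 2)" .
  qed (use For.prems in simp)
  have tst: "1 + expr_time \<tau> test \<le> ?U" if "bits_bounded lev s c j \<tau>" "j \<le> N" for \<tau> j
    using For.prems that assms(1) w_test
    by (intro weighted_time_le[OF expr_time_bounded[where k = j]]) auto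
  have iter: "bits_bounded lev s c (k' i) (\<sigma>' i) \<and>
    (\<exists>t \<le> i * (step_count \<sigma> p + 3) * ?U.
       runs (While test body # ps) (\<sigma>' 0) (While test body # ps) (\<sigma>' i) t)" if "i \<le> M" for i
    using that
  proof (induction i)
    case 0
    have "bits_bounded lev s c (Suc k) (store \<sigma> v 0 (value_of \<sigma> (Const 0)))"
      using For.prems by (intro bits_bounded_store) (auto simp: bit_length_0)
    then show ?case by (auto simp: \<sigma>'_def k'_def runs_refl)
  next
    case (Suc i)
    then obtain t where t: "t \<le> i * (step_count \<sigma> p + 3) * ?U"
      "runs (While test body # ps) (\<sigma>' 0) (While test body # ps) (\<sigma>' i) t"
      and bb: "bits_bounded lev s c (k' i) (\<sigma>' i)" by auto
    let ?\<tau> = "sem p (\<sigma>' i)"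
    have sc: "step_count (\<sigma>' i) p = step_count \<sigma> p"
      using For.prems zero' by (intro step_count_cong) auto
    have "bits_bounded lev s c (k' i + step_count (\<sigma>' i) p) ?\<tau> \<and>
      (\<exists>t \<le> step_count (\<sigma>' i) p * ?U.
         runs (compile p # Write v (Const 0) inc # While test body # ps) (\<sigma>' i)
           (Write v (Const 0) inc # While test body # ps) ?\<tau> t)"
      using For.prems bb k'N[of i] Suc.prems by (intro For.IH) (auto simp: sc)
    then obtain u where bb': "bits_bounded lev s c (k' i + step_count \<sigma> p) ?\<tau>"
      and u: "u \<le> step_count \<sigma> p * ?U"
        "runs (compile p # Write v (Const 0) inc # While test body # ps) (\<sigma>' i)
           (Write v (Const 0) inc # While test body # ps) ?\<tau> u"
      by (auto simp: sc)
    have val_inc: "value_of ?\<tau> inc = int (Suc i)"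
      using sem_frame[OF v(2), of "\<sigma>' i"] by (simp add: inc_def ctr)
    have new: "\<sigma>' (Suc i) = store ?\<tau> v 0 (value_of ?\<tau> inc)"
      unfolding val_inc by (simp add: \<sigma>'_def)
    have "bits_bounded lev s c (Suc (k' i + step_count \<sigma> p)) (\<sigma>' (Suc i))"
      unfolding new using bb' w_inc For.prems
      by (intro bits_bounded_store) (auto simp: inc_def)
    moreover have "k' (Suc i) = Suc (k' i + step_count \<sigma> p)" by (simp add: k'_def)
    ultimately have bbS: "bits_bounded lev s c (k' (Suc i)) (\<sigma>' (Suc i))" by simp
    let ?a = "1 + expr_time (\<sigma>' i) test"
    let ?b = "1 + expr_time ?\<tau> (Const 0) + expr_time ?\<tau> inc"
    have "value_of (\<sigma>' i) test \<noteq> 0"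
      using Suc.prems by (auto simp: test_def val_e ctr M_def)
    then have r1: "runs (While test body # ps) (\<sigma>' i) (body # While test body # ps) (\<sigma>' i) ?a"
      using runs_While[of test body ps "\<sigma>' i"] by simp
    have r2: "runs (body # While test body # ps) (\<sigma>' i)
      (compile p # Write v (Const 0) inc # While test body # ps) (\<sigma>' i) 1"
      unfolding body_def by (rule runs_Seq)
    have r3: "runs (Write v (Const 0) inc # While test body # ps) ?\<tau>
      (While test body # ps) (\<sigma>' (Suc i)) ?b"
      using runs_Write[of v "Const 0" inc "While test body # ps" ?\<tau>] by (simp add: new)
    have "runs (While test body # ps) (\<sigma>' 0) (While test body # ps) (\<sigma>' (Suc i))
        (t + (?a + (1 + (u + ?b))))"
      by (intro runs_trans[OF t(2)] runs_trans[OF r1] runs_trans[OF r2] runs_trans[OF u(2)] r3)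
    moreover have "t + (?a + (1 + (u + ?b))) \<le> Suc i * (step_count \<sigma> p + 3) * ?U"
    proof -
      have "?a \<le> ?U" using bb k'N(1)[of i] Suc.prems by (intro tst) auto
      moreover have "1 + (expr_time ?\<tau> (Const 0) + expr_time ?\<tau> inc) \<le> ?U"
        using k'N[of i] Suc.prems w_inc by (intro wr[OF bb']) auto
      moreover have "1 \<le> ?U" using For.prems by simp
      ultimately have "t + (?a + (1 + (u + ?b)))
          \<le> i * (step_count \<sigma> p + 3) * ?U + (step_count \<sigma> p * ?U + 3 * ?U)"
        using t u by linarith
      also have "\<dots> = Suc i * (step_count \<sigma> p + 3) * ?U"
        by (simp add: add_mult_distrib)
      finally show ?thesis .
    qed
    ultimately show ?case using bbS by blast
  qed
  then obtain t where bbM: "bits_bounded lev s c (k' M) (\<sigma>' M)"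
    and t: "t \<le> M * (step_count \<sigma> p + 3) * ?U"
      "runs (While test body # ps) (\<sigma>' 0) (While test body # ps) (\<sigma>' M) t" by blast
  have sem: "sem (For v e p) \<sigma> = \<sigma>' M" by (simp add: \<sigma>'_def M_def)
  let ?a = "1 + expr_time \<sigma> (Const 0) + expr_time \<sigma> (Const 0)"
  let ?b = "1 + expr_time (\<sigma>' M) test"
  have comp: "compile (For v e p) = Seq (Write v (Const 0) (Const 0)) (While test body)"
    by (simp add: test_def body_def inc_def)
  have r1: "runs (Seq (Write v (Const 0) (Const 0)) (While test body) # ps) \<sigma>
     (Write v (Const 0) (Const 0) # While test body # ps) \<sigma> 1" by (rule runs_Seq)
  have r2: "runs (Write v (Const 0) (Const 0) # While test body # ps) \<sigma>
     (While test body # ps) (\<sigma>' 0) ?a"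
    using runs_Write[of v "Const 0" "Const 0" "While test body # ps" \<sigma>] by (simp add: \<sigma>'_def)
  have "value_of (\<sigma>' M) test = 0" by (auto simp: test_def val_e ctr M_def)
  then have r3: "runs (While test body # ps) (\<sigma>' M) ps (\<sigma>' M) ?b"
    using runs_While[of test body ps "\<sigma>' M"] by simp
  have "runs (compile (For v e p) # ps) \<sigma> ps (sem (For v e p) \<sigma>) (1 + (?a + (t + ?b)))"
    unfolding comp sem by (intro runs_trans[OF r1] runs_trans[OF r2] runs_trans[OF t(2)] r3)
  moreover have "1 + (?a + (t + ?b)) \<le> step_count \<sigma> (For v e p) * ?U"
  proof -
    have "1 + (expr_time \<sigma> (Const 0) + expr_time \<sigma> (Const 0)) \<le> ?U"
      using For.prems by (intro wr[where j = k]) (auto simp: bit_length_0)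
    moreover have "?b \<le> ?U" using bbM k'M by (intro tst) auto
    moreover have "1 \<le> ?U" using For.prems by simp
    ultimately have "1 + (?a + (t + ?b)) \<le> 3 * ?U + M * (step_count \<sigma> p + 3) * ?U"
      using t by linarith
    also have "\<dots> = step_count \<sigma> (For v e p) * ?U" by (simp add: M_def add_mult_distrib)
    finally show ?thesis .
  qed
  moreover have "bits_bounded lev s c (k + step_count \<sigma> (For v e p)) (sem (For v e p) \<sigma>)"
    unfolding sem using bbM k'M(2) by (rule bits_bounded_mono)
  ultimately show ?case by blast
qed

section \<open>Polynomial bounds in the input size\<close>

fun limit_poly :: "expr \<Rightarrow> nat poly" where
  "limit_poly (Const k) = [:nat \<bar>k\<bar>:]"
| "limit_poly (Read a e) = [:0, 1:]"
| "limit_poly (Bin f e1 e2) =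
     (if f = Add then limit_poly e1 + limit_poly e2 else limit_poly e1 * limit_poly e2)"

lemma limit_poly:
  assumes "\<And>k. \<bar>\<sigma> 0 k\<bar> \<le> int s" "limit e"
  shows "\<bar>value_of \<sigma> e\<bar> \<le> int (poly (limit_poly e) s)"
  using assms(2)
proof (induction e)
  case (Bin f e1 e2)
  then consider "f = Add" | "f = Mul" by auto
  then show ?case
  proof cases
    case 1
    then show ?thesis using Bin by simp
  next
    case 2
    have "\<bar>value_of \<sigma> e1\<bar> * \<bar>value_of \<sigma> e2\<bar>
      \<le> int (poly (limit_poly e1) s) * int (poly (limit_poly e2) s)"
      using Bin by (intro mult_mono) auto
    then show ?thesis using 2 by (simp add: abs_mult)
  qed
qed (use assms(1) in auto)

fun count_poly :: "sprog \<Rightarrow> nat poly" where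
  "count_poly SSkip = [:1:]"
| "count_poly (Asg a e1 e2) = [:1:]"
| "count_poly (SSeq p q) = [:1:] + count_poly p + count_poly q"
| "count_poly (SIf e p q) = [:1:] + count_poly p + count_poly q"
| "count_poly (For v e p) = [:3:] + limit_poly e * (count_poly p + [:3:])"

lemma step_count_le_poly:
  assumes "\<And>k. \<bar>\<sigma> 0 k\<bar> \<le> int s" "bounded_loops p"
  shows "step_count \<sigma> p \<le> poly (count_poly p) s"
  using assms(2)
proof (induction p)
  case (For v e p)
  then have "nat (value_of \<sigma> e) \<le> poly (limit_poly e) s"
    using limit_poly[of \<sigma> s e, OF assms(1)] by simp
  then have "nat (value_of \<sigma> e) * (step_count \<sigma> p + 3)
      \<le> poly (limit_poly e) s * (poly (count_poly p) s + 3)"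
    using For by (intro mult_mono) auto
  then show ?case by simp
qed auto

primrec growth_poly :: "nat \<Rightarrow> nat poly \<Rightarrow> nat \<Rightarrow> nat poly" where
  "growth_poly c q 0 = [:0, 1:] + q * [:c * 2:]"
| "growth_poly c q (Suc l) = [:0, 1:] + q * ([:c:] * (growth_poly c q l + [:2:]))"

lemma poly_growth_poly: "poly (growth_poly c q l) s = growth s c l (poly q s)"
  by (induction l) (simp_all add: algebra_simps)

lemma input_tables_zero: "input_tables I ! 0 = [int (nsites I), int (nclients I)]"
  by (simp add: input_tables_def Let_def)

lemma length_le_sum_list_bit_length: "length xs \<le> sum_list (map bit_length xs)"
proof (induction xs)
  case (Cons x xs)
  then show ?case using bit_length_pos[of x] by simp
qed simp

text \<open>The numbers of sites and clients are written in binary, yet they do not exceed the input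
  size: every site and every client has an entry of its own in the tables, of at least one bit. This
  is what makes loops over them polynomial.\<close>

lemma input_memory_zero_le: "\<bar>input_memory I 0 k\<bar> \<le> int (input_size I)"
proof -
  have "nsites I + nclients I \<le> length (concat (input_tables I))"
    by (simp add: input_tables_def Let_def)
  also have "\<dots> \<le> input_size I"
    unfolding input_size_def by (rule length_le_sum_list_bit_length)
  finally have "nsites I + nclients I \<le> input_size I" .
  then have "\<forall>x \<in> set (input_tables I ! 0). \<bar>x\<bar> \<le> int (input_size I)"
    by (simp add: input_tables_zero)
  then show ?thesis
    unfolding input_memory_def using nth_mem[of "nat k" "input_tables I ! 0"] by auto
qed

lemma input_memory_bits: "input_size I \<noteq> 0 \<and> bit_length (input_memory I a k) \<le> input_size I"
proof -
  have "bit_length (int (nsites I)) \<le> input_size I"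
    unfolding input_size_def by (rule member_le_sum_list) (auto simp: input_tables_def Let_def)
  then have pos: "0 < input_size I"
    using bit_length_pos[of "int (nsites I)"] by linarith
  show ?thesis
  proof (cases "a < length (input_tables I) \<and> 0 \<le> k \<and> nat k < length (input_tables I ! a)")
    case True
    then have "input_memory I a k \<in> set (concat (input_tables I))"
      unfolding input_memory_def using nth_mem[of a "input_tables I"] by (auto intro!: bexI[of _ "input_tables I ! a"])
    then have "bit_length (input_memory I a k) \<le> input_size I"
      unfolding input_size_def by (intro member_le_sum_list) auto
    then show ?thesis using pos by simp
  next
    case False
    then have "input_memory I a k = 0"
      unfolding input_memory_def by auto
    then show ?thesis using pos by (simp add: bit_length_0)
  qed
qed

theorem structured_polynomial_time:
  assumes lev: "\<And>a. lev a \<le> lm" and "bounded_loops p" "levelled lev p"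
  obtains q where "\<And>I. halts_within (compile p) (input_memory I) (poly q (input_size I))"
    "\<And>I. final_memory (compile p) (input_memory I) (poly q (input_size I))
       = return_pmf (sem p (input_memory I))"
proof -
  define c where "c = sprog_weight p"
  define q where "q = count_poly p * ([:c:] * (growth_poly c (count_poly p) lm + [:2:]))"
  have main: "\<exists>t \<le> poly q (input_size I).
      steps (poly q (input_size I)) ([compile p], input_memory I, 0)
        = return_pmf ([], sem p (input_memory I), t)" for I
  proof -
    let ?s = "input_size I" and ?\<sigma> = "input_memory I"
    define N where "N = poly (count_poly p) ?s"
    have sc: "step_count ?\<sigma> p \<le> N"
      unfolding N_def using assms input_memory_zero_le by (intro step_count_le_poly) auto
    have "bits_bounded lev ?s c 0 ?\<sigma>"
      unfolding bits_bounded_def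
    proof (intro allI)
      fix a i
      have "growth ?s c l 0 = ?s" for l by (cases l) auto
      then show "bit_length (?\<sigma> a i) \<le> growth ?s c (lev a) 0"
        using input_memory_bits by simp
    qed
    then obtain t where t: "t \<le> step_count ?\<sigma> p * (c * (growth ?s c lm N + 2))"
      "runs [compile p] ?\<sigma> [] (sem p ?\<sigma>) t"
      using compile_runs[OF lev assms(2,3), of c ?s 0 ?\<sigma> N "[]"] sc by (auto simp: c_def)
    have "t \<le> N * (c * (growth ?s c lm N + 2))"
      using t(1) sc by (meson le_trans mult_le_mono1)
    also have "\<dots> = poly q ?s"
      by (simp add: q_def N_def poly_growth_poly algebra_simps)
    finally have tq: "t \<le> poly q ?s" .
    obtain k where k: "k \<le> t" "steps k ([compile p], ?\<sigma>, 0) = return_pmf ([], sem p ?\<sigma>, t)"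
      using t(2) unfolding runs_def by (metis add_0)
    \<comment> \<open>A stopped configuration repeats itself, so a run of exactly
      \<open>poly q ?s\<close> steps ends where the shorter run stopped.\<close>
    have stay: "steps l ([], \<tau>, u) = return_pmf ([], \<tau>, u)" for l \<tau> u
      by (induction l) (auto simp: bind_return_pmf)
    have "steps (k + (poly q ?s - k)) ([compile p], ?\<sigma>, 0) = return_pmf ([], sem p ?\<sigma>, t)"
      unfolding steps_trans[OF k(2)] stay ..
    then show ?thesis using k(1) tq by auto
  qed
  show thesis
  proof
    fix I
    obtain t where t: "t \<le> poly q (input_size I)"
      "steps (poly q (input_size I)) ([compile p], input_memory I, 0)
        = return_pmf ([], sem p (input_memory I), t)" using main by blast
    then show "halts_within (compile p) (input_memory I) (poly q (input_size I))"
      by (simp add: halts_within_def)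
    show "final_memory (compile p) (input_memory I) (poly q (input_size I))
       = return_pmf (sem p (input_memory I))"
      using t by (simp add: final_memory_def)
  qed
qed

section \<open>Program schemes\<close>

abbreviation scalar :: "nat \<Rightarrow> expr" where "scalar a \<equiv> Read a (Const 0)"
abbreviation add_expr (infixl "\<oplus>" 65) where "e1 \<oplus> e2 \<equiv> Bin Add e1 e2"
abbreviation sub_expr (infixl "\<ominus>" 65) where "e1 \<ominus> e2 \<equiv> Bin Sub e1 e2"
abbreviation mul_expr (infixl "\<odot>" 70) where "e1 \<odot> e2 \<equiv> Bin Mul e1 e2"
abbreviation div_expr (infixl "\<oslash>" 70) where "e1 \<oslash> e2 \<equiv> Bin Div e1 e2"
abbreviation less_expr (infix "\<lless>" 50) where "e1 \<lless> e2 \<equiv> Bin Less e1 e2"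
abbreviation not_expr where "not_expr e \<equiv> Const 1 \<ominus> e"
abbreviation eq_expr where "eq_expr e1 e2 \<equiv> not_expr (e1 \<lless> e2) \<odot> not_expr (e2 \<lless> e1)"

fun reads :: "expr \<Rightarrow> nat set" where
  "reads (Const k) = {}"
| "reads (Read a e) = insert a (reads e)"
| "reads (Bin f e1 e2) = reads e1 \<union> reads e2"

lemma value_of_cong: "(\<And>a. a \<in> reads e \<Longrightarrow> \<sigma> a = \<tau> a) \<Longrightarrow> value_of \<sigma> e = value_of \<tau> e"
  by (induction e) auto

lemma value_of_store [simp]: "a \<notin> reads e \<Longrightarrow> value_of (store \<sigma> a k x) e = value_of \<sigma> e"
  by (rule value_of_cong) (metis store_other)

lemma store_store [simp]: "store (store \<sigma> a k x) a k y = store \<sigma> a k y"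
  by (simp add: store_def)

lemma store_commute: "a \<noteq> b \<Longrightarrow> store (store \<sigma> a k x) b l y = store (store \<sigma> b l y) a k x"
  by (simp add: store_def fun_upd_twist)

lemma loop_invariant:
  assumes "Inv 0 (store \<sigma> v 0 0)"
    and "\<And>k \<tau>. k < N \<Longrightarrow> Inv k \<tau> \<Longrightarrow> Inv (Suc k) (store (g \<tau>) v 0 (int (Suc k)))"
  shows "Inv N (loop v N g \<sigma>)"
proof -
  have "k \<le> N \<Longrightarrow> Inv k (loop v k g \<sigma>)" for k
    using assms by (induction k) auto
  then show ?thesis by blast
qed

section \<open>Loops that compute sums, tables and minima\<close>

definition sum_prog :: "nat \<Rightarrow> nat \<Rightarrow> expr \<Rightarrow> expr \<Rightarrow> sprog" where
  "sum_prog acc v len e =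
     SSeq (Asg acc (Const 0) (Const 0)) (For v len (Asg acc (Const 0) (scalar acc \<oplus> e)))"

lemma sem_sum_prog:
  assumes "acc \<noteq> v" "acc \<notin> reads e" "acc \<notin> reads len"
  shows "sem (sum_prog acc v len e) \<sigma> =
    store (store \<sigma> v 0 (int (nat (value_of \<sigma> len)))) acc 0
      (\<Sum>j<nat (value_of \<sigma> len). value_of (store \<sigma> v 0 (int j)) e)"
proof -
  define N where "N = nat (value_of \<sigma> len)"
  have N: "nat (value_of (store \<sigma> acc 0 0) len) = N"
    using assms by (simp add: N_def)
  let ?Inv = "\<lambda>k \<tau>. \<tau> = store (store \<sigma> v 0 (int k)) acc 0
      (\<Sum>j<k. value_of (store \<sigma> v 0 (int j)) e)"
  have "?Inv N (loop v N (sem (Asg acc (Const 0) (scalar acc \<oplus> e))) (store \<sigma> acc 0 0))"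
  proof (rule loop_invariant[where Inv = ?Inv])
    show "?Inv 0 (store (store \<sigma> acc 0 0) v 0 0)"
      by (simp add: store_commute[OF assms(1)])
  next
    fix k \<tau>
    assume \<tau>: "?Inv k \<tau>"
    have "sem (Asg acc (Const 0) (scalar acc \<oplus> e)) \<tau> = store (store \<sigma> v 0 (int k)) acc 0
        (\<Sum>j<Suc k. value_of (store \<sigma> v 0 (int j)) e)"
      using assms by (simp add: \<tau>)
    then show "?Inv (Suc k) (store (sem (Asg acc (Const 0) (scalar acc \<oplus> e)) \<tau>) v 0 (int (Suc k)))"
      by (simp add: store_commute[OF assms(1)])
  qed
  then show ?thesis
    by (simp add: sum_prog_def N N_def[symmetric])
qed

definition map_prog :: "nat \<Rightarrow> nat \<Rightarrow> expr \<Rightarrow> expr \<Rightarrow> expr \<Rightarrow> sprog" where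
  "map_prog a v len idx e = For v len (Asg a idx e)"

text \<open>The expression may read the cell that it overwrites: by injectivity of
  \<open>\<iota>\<close> no earlier round has touched it, so updates in place are covered. Nothing
  else is assumed about the array \<open>a\<close> during the loop.\<close>

lemma sem_map_prog:
  assumes "v \<noteq> a" and N: "N = nat (value_of \<sigma> len)"
    and val: "\<And>j \<tau>. j < N \<Longrightarrow> (\<And>b. b \<noteq> a \<Longrightarrow> b \<noteq> v \<Longrightarrow> \<tau> b = \<sigma> b) \<Longrightarrow>
      \<tau> v = (\<sigma> v)(0 := int j) \<Longrightarrow> \<tau> a (\<iota> j) = \<sigma> a (\<iota> j) \<Longrightarrow>
      value_of \<tau> idx = \<iota> j \<and> value_of \<tau> e = \<phi> j"
    and inj: "inj_on \<iota> {..<N}"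
  shows "j < N \<Longrightarrow> sem (map_prog a v len idx e) \<sigma> a (\<iota> j) = \<phi> j"
    and "(\<And>j. j < N \<Longrightarrow> k \<noteq> \<iota> j) \<Longrightarrow> sem (map_prog a v len idx e) \<sigma> a k = \<sigma> a k"
proof -
  let ?Inv = "\<lambda>k \<tau>. (\<forall>b. b \<noteq> a \<longrightarrow> b \<noteq> v \<longrightarrow> \<tau> b = \<sigma> b) \<and> \<tau> v = (\<sigma> v)(0 := int k) \<and>
    (\<forall>j<k. \<tau> a (\<iota> j) = \<phi> j) \<and> (\<forall>i. (\<forall>j<k. i \<noteq> \<iota> j) \<longrightarrow> \<tau> a i = \<sigma> a i)"
  have "?Inv N (loop v N (sem (Asg a idx e)) \<sigma>)"
  proof (rule loop_invariant[where Inv = ?Inv])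
    show "?Inv 0 (store \<sigma> v 0 0)" using \<open>v \<noteq> a\<close> by auto
  next
    fix k \<tau>
    assume k: "k < N" and \<tau>: "?Inv k \<tau>"
    have new: "\<iota> k \<noteq> \<iota> j" if "j < k" for j
      using inj_onD[OF inj, of k j] k that by auto
    then have "\<tau> a (\<iota> k) = \<sigma> a (\<iota> k)" using \<tau> by blast
    then have vals: "value_of \<tau> idx = \<iota> k" "value_of \<tau> e = \<phi> k"
      using val[OF k, of \<tau>] \<tau> by blast+
    define \<rho> where "\<rho> = store (sem (Asg a idx e) \<tau>) v 0 (int (Suc k))"
    have \<rho>: "\<rho> a = (\<tau> a)(\<iota> k := \<phi> k)" "\<rho> v = (\<sigma> v)(0 := int (Suc k))"
      "\<And>b. b \<noteq> a \<Longrightarrow> b \<noteq> v \<Longrightarrow> \<rho> b = \<tau> b"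
      using \<open>v \<noteq> a\<close> \<tau> by (simp_all add: \<rho>_def vals fun_eq_iff)
    have "\<rho> a (\<iota> j) = \<phi> j" if "j < Suc k" for j
      using that \<tau> new[of j] by (cases "j = k") (simp_all add: \<rho>(1))
    moreover have "\<rho> a i = \<sigma> a i" if "\<forall>j<Suc k. i \<noteq> \<iota> j" for i
      using that \<tau> by (simp add: \<rho>(1))
    ultimately show "?Inv (Suc k) (store (sem (Asg a idx e) \<tau>) v 0 (int (Suc k)))"
      unfolding \<rho>_def[symmetric] using \<rho>(2,3) \<tau> by simp
  qed
  then have *: "?Inv N (sem (map_prog a v len idx e) \<sigma>)"
    by (simp add: map_prog_def N)
  show "j < N \<Longrightarrow> sem (map_prog a v len idx e) \<sigma> a (\<iota> j) = \<phi> j" using * by blast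
  show "(\<And>j. j < N \<Longrightarrow> k \<noteq> \<iota> j) \<Longrightarrow> sem (map_prog a v len idx e) \<sigma> a k = \<sigma> a k"
    using * by blast
qed

abbreviation "best_idx \<equiv> 13 :: nat"
abbreviation "best_num \<equiv> 37 :: nat"
abbreviation "best_den \<equiv> 38 :: nat"

text \<open>
  Minimises the quotient \<open>num / den\<close>, computed by \<open>body\<close>, over the iterations with a positive
  denominator; \<open>best_den\<close> is 0 if there are none.
\<close>

definition argmin_prog :: "nat \<Rightarrow> expr \<Rightarrow> sprog \<Rightarrow> expr \<Rightarrow> expr \<Rightarrow> sprog" where
  "argmin_prog v len body num den =
     SSeq (Asg best_den (Const 0) (Const 0))
      (For v len (SSeq body
        (SIf ((Const 0 \<lless> den) \<odot>
              ((scalar best_den \<lless> Const 1) \<oplus> (num \<odot> scalar best_den \<lless> scalar best_num \<odot> den)))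
          (SSeq (Asg best_num (Const 0) num)
            (SSeq (Asg best_den (Const 0) den) (Asg best_idx (Const 0) (scalar v))))
          SSkip)))"

text \<open>Transitivity along \<open>a / x < b / y \<le> c / z\<close>, with denominators cleared,
  as the machine compares quotients.\<close>

lemma cross_mult_less_trans:
  fixes a b c x y z :: int
  assumes "a * y < b * x" "b * z \<le> c * y" "0 < x" "0 < y" "0 < z"
  shows "a * z \<le> c * x"
proof -
  have "a * z * y < b * z * x" using assms(1,5) by (simp add: mult.assoc mult.commute mult.left_commute)
  also have "\<dots> \<le> c * y * x" using assms by (simp add: mult_right_mono)
  finally have "y * (a * z) < y * (c * x)" by (simp add: mult.commute mult.left_commute)
  then show ?thesis using assms by simp
qed

text \<open>The body works with scratch arrays, so \<open>val\<close> has to hold for every memory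
  that agrees with \<open>\<sigma>\<close> outside of them. With 0/1 denominators the search becomes
  a minimum over a set, a form in which it is used repeatedly.\<close>

lemma sem_argmin_prog:
  assumes v: "v \<notin> {best_idx, best_num, best_den}" "best_den \<notin> reads len"
    and body: "writes body \<inter> {v, best_idx, best_num, best_den} = {}"
    and reads: "(reads num \<union> reads den) \<inter> {best_idx, best_num, best_den} = {}"
    and N: "N = nat (value_of \<sigma> len)"
    and val: "\<And>k \<tau>. k < N \<Longrightarrow>
      (\<And>b. b \<notin> writes body \<Longrightarrow> b \<notin> {v, best_idx, best_num, best_den} \<Longrightarrow> \<tau> b = \<sigma> b) \<Longrightarrow>
      \<tau> v 0 = int k \<Longrightarrow>
      value_of (sem body \<tau>) num = \<nu> k \<and> value_of (sem body \<tau>) den = \<delta> k"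
  defines "\<sigma>' \<equiv> sem (argmin_prog v len body num den) \<sigma>"
  shows "\<sigma>' best_den 0 = 0 \<and> (\<forall>k<N. \<delta> k \<le> 0) \<or>
    (\<exists>k<N. \<sigma>' best_idx 0 = int k \<and> \<sigma>' best_den 0 = \<delta> k \<and> 0 < \<delta> k \<and> \<sigma>' best_num 0 = \<nu> k \<and>
      (\<forall>k'<N. 0 < \<delta> k' \<longrightarrow> \<nu> k * \<delta> k' \<le> \<nu> k' * \<delta> k))"
proof -
  define upd where "upd = SSeq (Asg best_num (Const 0) num)
            (SSeq (Asg best_den (Const 0) den) (Asg best_idx (Const 0) (scalar v)))"
  define cond where "cond = ((Const 0 \<lless> den) \<odot>
              ((scalar best_den \<lless> Const 1) \<oplus> (num \<odot> scalar best_den \<lless> scalar best_num \<odot> den)))"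
  define Best where "Best k \<tau> \<longleftrightarrow> \<tau> best_den 0 = 0 \<and> (\<forall>k'<k. \<delta> k' \<le> 0) \<or>
    (\<exists>i<k. \<tau> best_idx 0 = int i \<and> \<tau> best_den 0 = \<delta> i \<and> 0 < \<delta> i \<and> \<tau> best_num 0 = \<nu> i \<and>
      (\<forall>k'<k. 0 < \<delta> k' \<longrightarrow> \<nu> i * \<delta> k' \<le> \<nu> k' * \<delta> i))" for k and \<tau> :: memory
  let ?Inv = "\<lambda>k \<tau>. (\<forall>b. b \<notin> writes body \<longrightarrow> b \<notin> {v, best_idx, best_num, best_den} \<longrightarrow> \<tau> b = \<sigma> b) \<and>
    \<tau> v 0 = int k \<and> Best k \<tau>"
  have N': "nat (value_of (store \<sigma> best_den 0 0) len) = N"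
    using v by (simp add: N)
  have "?Inv N (loop v N (sem (SSeq body (SIf cond upd SSkip))) (store \<sigma> best_den 0 0))"
  proof (rule loop_invariant[where Inv = ?Inv])
    show "?Inv 0 (store (store \<sigma> best_den 0 0) v 0 0)"
      using v by (auto simp: Best_def)
  next
    fix k \<tau>
    assume k: "k < N" and \<tau>: "?Inv k \<tau>"
    define \<rho> where "\<rho> = sem body \<tau>"
    have frame: "\<rho> b = \<tau> b" if "b \<notin> writes body" for b
      unfolding \<rho>_def using that by (rule sem_frame)
    have vals: "value_of \<rho> num = \<nu> k" "value_of \<rho> den = \<delta> k"
      using val[OF k, of \<tau>] \<tau> by (auto simp: \<rho>_def)
    have keep: "\<rho> v 0 = int k" "\<rho> best_idx = \<tau> best_idx" "\<rho> best_num = \<tau> best_num"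
      "\<rho> best_den = \<tau> best_den"
      using body \<tau> frame by auto
    have "value_of (store \<rho> best_num 0 x) den = \<delta> k" for x
      using reads vals(2) by auto
    then have upd: "sem upd \<rho> = store (store (store \<rho> best_num 0 (\<nu> k)) best_den 0 (\<delta> k)) best_idx 0 (int k)"
      using v keep vals by (auto simp: upd_def)
    define \<rho>' where "\<rho>' = sem (SSeq body (SIf cond upd SSkip)) \<tau>"
    have nonneg: "0 \<le> \<tau> best_den 0" using \<tau> by (auto simp: Best_def)
    have cond: "value_of \<rho> cond \<noteq> 0 \<longleftrightarrow>
        0 < \<delta> k \<and> (\<tau> best_den 0 = 0 \<or> \<nu> k * \<tau> best_den 0 < \<tau> best_num 0 * \<delta> k)"
      using nonneg by (auto simp: cond_def vals keep)
    from \<tau> have "Best k \<tau>" by blast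
    then consider (none) "\<tau> best_den 0 = 0" "\<And>k'. k' < k \<Longrightarrow> \<delta> k' \<le> 0"
      | (some) i where "i < k" "\<tau> best_idx 0 = int i" "\<tau> best_den 0 = \<delta> i" "0 < \<delta> i"
        "\<tau> best_num 0 = \<nu> i" "\<And>k'. k' < k \<Longrightarrow> 0 < \<delta> k' \<Longrightarrow> \<nu> i * \<delta> k' \<le> \<nu> k' * \<delta> i"
      unfolding Best_def by blast
    note cases = this
    have "Best (Suc k) \<rho>'"
    proof (cases "value_of \<rho> cond \<noteq> 0")
      case True
      then have \<rho>': "\<rho>' best_idx 0 = int k" "\<rho>' best_den 0 = \<delta> k" "\<rho>' best_num 0 = \<nu> k"
        by (simp_all add: \<rho>'_def \<rho>_def[symmetric] upd)
      have pos: "0 < \<delta> k"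
        and better: "\<tau> best_den 0 = 0 \<or> \<nu> k * \<tau> best_den 0 < \<tau> best_num 0 * \<delta> k"
        using True cond by blast+
      have old: "\<nu> k * \<delta> k' \<le> \<nu> k' * \<delta> k" if "k' < k" "0 < \<delta> k'" for k'
        using cases
      proof cases
        case none
        then show ?thesis using none(2)[OF that(1)] that(2) by linarith
      next
        case (some i)
        then have "\<nu> k * \<delta> i < \<nu> i * \<delta> k" using better by simp
        then show ?thesis
          using some(6)[OF that] pos some(4) that(2) by (rule cross_mult_less_trans)
      qed
      show ?thesis unfolding Best_def
        by (rule disjI2, rule exI[of _ k]) (simp add: \<rho>' pos less_Suc_eq, use old in blast)
    next
      case False
      then have \<rho>': "\<rho>' best_idx 0 = \<tau> best_idx 0" "\<rho>' best_den 0 = \<tau> best_den 0"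
        "\<rho>' best_num 0 = \<tau> best_num 0"
        by (simp_all add: \<rho>'_def \<rho>_def[symmetric] keep)
      have neg: "\<not> (0 < \<delta> k \<and> (\<tau> best_den 0 = 0 \<or> \<nu> k * \<tau> best_den 0 < \<tau> best_num 0 * \<delta> k))"
        using False cond by blast
      show ?thesis
        using cases
      proof cases
        case none
        then show ?thesis
          unfolding Best_def \<rho>' using neg by (simp add: less_Suc_eq not_less)
      next
        case (some i)
        have "\<nu> i * \<delta> k \<le> \<nu> k * \<delta> i" if "0 < \<delta> k"
          using neg that some(3,5) by (simp add: not_less)
        then have "\<forall>k'<Suc k. 0 < \<delta> k' \<longrightarrow> \<nu> i * \<delta> k' \<le> \<nu> k' * \<delta> i"
          using some(6) less_Suc_eq by metis
        then show ?thesis unfolding Best_def \<rho>' using some(1-5) by (intro disjI2 exI[of _ i] conjI) simp_all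
      qed
    qed
    moreover have "\<rho>' b = \<sigma> b" if "b \<notin> writes body" "b \<notin> {v, best_idx, best_num, best_den}" for b
      using that \<tau> by (simp add: \<rho>'_def \<rho>_def[symmetric] upd frame)
    moreover have "Best (Suc k) (store \<rho>' v 0 (int (Suc k))) \<longleftrightarrow> Best (Suc k) \<rho>'"
      using v by (simp add: Best_def)
    ultimately show "?Inv (Suc k) (store (sem (SSeq body (SIf cond upd SSkip)) \<tau>) v 0 (int (Suc k)))"
      unfolding \<rho>'_def[symmetric] by simp
  qed
  moreover have "\<sigma>' = loop v N (sem (SSeq body (SIf cond upd SSkip))) (store \<sigma> best_den 0 0)"
    by (simp add: \<sigma>'_def argmin_prog_def upd_def cond_def N')
  ultimately have "Best N \<sigma>'" by (simp only:)
  then show ?thesis unfolding Best_def .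
qed

section \<open>Fractional solutions by multiplicative weights\<close>

text \<open>Costs are integers here, after scaling. Distances exist only between sites and clients,
  so the triangle inequality enters as \<open>hop\<close>, along the path from \<open>i\<close> over
  \<open>k\<close> and \<open>i'\<close> to \<open>j\<close>.\<close>

locale ftfp_costs =
  fixes m n :: nat and f :: "nat \<Rightarrow> int" and d :: "nat \<Rightarrow> nat \<Rightarrow> int"
  assumes f_nonneg: "i < m \<Longrightarrow> 0 \<le> f i"
    and d_nonneg: "i < m \<Longrightarrow> j < n \<Longrightarrow> 0 \<le> d i j"
    and hop: "i < m \<Longrightarrow> i' < m \<Longrightarrow> j < n \<Longrightarrow> k < n \<Longrightarrow> d i j \<le> d i' j + d i' k + d i k"
begin

definition frac_feasible :: "(nat \<Rightarrow> real) \<Rightarrow> (nat \<Rightarrow> nat \<Rightarrow> real) \<Rightarrow> (nat \<Rightarrow> real) \<Rightarrow> bool" where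
  "frac_feasible r x y \<longleftrightarrow> (\<forall>i<m. 0 \<le> y i) \<and> (\<forall>i<m. \<forall>j<n. 0 \<le> x i j \<and> x i j \<le> y i) \<and>
     (\<forall>j<n. r j \<le> (\<Sum>i<m. x i j))"

definition open_part :: "(nat \<Rightarrow> real) \<Rightarrow> real" where
  "open_part y = (\<Sum>i<m. real_of_int (f i) * y i)"

definition conn_part :: "(nat \<Rightarrow> nat \<Rightarrow> real) \<Rightarrow> real" where
  "conn_part x = (\<Sum>i<m. \<Sum>j<n. real_of_int (d i j) * x i j)"

lemma open_part_nonneg: "frac_feasible r x y \<Longrightarrow> 0 \<le> open_part y"
  unfolding open_part_def frac_feasible_def using f_nonneg by (intro sum_nonneg) simp

lemma conn_part_nonneg: "frac_feasible r x y \<Longrightarrow> 0 \<le> conn_part x"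
  unfolding conn_part_def frac_feasible_def using d_nonneg by (intro sum_nonneg) simp

text \<open>Weak duality for prices \<open>\<alpha>\<close> that may violate the constraints of the
  sites: what the prices offer beyond the distances is charged to \<open>y\<close> via
  \<open>x i j \<le> y i\<close>. The offers stay explicit because augmentation applies the bound to
  prices that become feasible only at the end.\<close>

lemma dual_bound:
  fixes \<alpha> :: "nat \<Rightarrow> real"
  assumes xy: "frac_feasible r x y" and \<alpha>: "\<And>j. j < n \<Longrightarrow> 0 \<le> \<alpha> j"
  shows "(\<Sum>j<n. r j * \<alpha> j) \<le> (\<Sum>i<m. y i * (\<Sum>j<n. max 0 (\<alpha> j - real_of_int (d i j)))) + conn_part x"
proof -
  have "(\<Sum>j<n. r j * \<alpha> j) \<le> (\<Sum>j<n. (\<Sum>i<m. x i j) * \<alpha> j)"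
    using xy \<alpha> by (intro sum_mono mult_right_mono) (auto simp: frac_feasible_def)
  also have "\<dots> = (\<Sum>i<m. \<Sum>j<n. x i j * \<alpha> j)"
    unfolding sum_distrib_right by (rule sum.swap)
  also have "\<dots> \<le> (\<Sum>i<m. \<Sum>j<n. y i * max 0 (\<alpha> j - real_of_int (d i j)) + real_of_int (d i j) * x i j)"
  proof (intro sum_mono)
    fix i j
    assume "i \<in> {..<m}" "j \<in> {..<n}"
    then have x: "0 \<le> x i j" "x i j \<le> y i" using xy by (auto simp: frac_feasible_def)
    have "x i j * (\<alpha> j - real_of_int (d i j)) \<le> x i j * max 0 (\<alpha> j - real_of_int (d i j))"
      using x by (intro mult_left_mono) auto
    also have "\<dots> \<le> y i * max 0 (\<alpha> j - real_of_int (d i j))"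
      using x by (intro mult_right_mono) auto
    finally show "x i j * \<alpha> j \<le> y i * max 0 (\<alpha> j - real_of_int (d i j)) + real_of_int (d i j) * x i j"
      by (simp add: algebra_simps)
  qed
  also have "\<dots> = (\<Sum>i<m. y i * (\<Sum>j<n. max 0 (\<alpha> j - real_of_int (d i j)))) + conn_part x"
    by (simp add: sum.distrib sum_distrib_left conn_part_def)
  finally show ?thesis .
qed

lemma weak_duality:
  fixes \<alpha> :: "nat \<Rightarrow> real"
  assumes xy: "frac_feasible r x y" and \<alpha>: "\<And>j. j < n \<Longrightarrow> 0 \<le> \<alpha> j"
    and feas: "\<And>i. i < m \<Longrightarrow> (\<Sum>j<n. max 0 (\<alpha> j - real_of_int (d i j))) \<le> real_of_int (f i)"
  shows "(\<Sum>j<n. r j * \<alpha> j) \<le> open_part y + conn_part x"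
proof -
  have "(\<Sum>i<m. y i * (\<Sum>j<n. max 0 (\<alpha> j - real_of_int (d i j)))) \<le> (\<Sum>i<m. y i * real_of_int (f i))"
    using xy feas by (intro sum_mono mult_left_mono) (auto simp: frac_feasible_def)
  also have "\<dots> = open_part y" by (simp add: open_part_def mult.commute)
  finally show ?thesis using dual_bound[where \<alpha> = \<alpha>, OF xy \<alpha>] by linarith
qed

end

text \<open>As \<open>1 / 99 - 1 / 100 = 1 / 9900\<close>, the product
  \<open>(1 - u / 100) * (1 + u / 99)\<close> equals \<open>1 + (u - u * u) / 9900\<close>, which is
  at least 1 on the unit interval. The ratio 100 / 99 of the two rates is the main part of the loss
  1.0112.\<close>

lemma exp_le_one_minus:
  fixes u :: real
  assumes "0 \<le> u" "u \<le> 1"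
  shows "exp (- (u / 99)) \<le> 1 - u / 100"
proof -
  have "exp (- (u / 99)) \<le> 1 / (1 + u / 99)"
    using exp_ge_add_one_self[of "u / 99"] assms by (simp add: exp_minus field_simps)
  also have "\<dots> \<le> 1 - u / 100"
  proof -
    have "u * u \<le> u * 1" using assms by (intro mult_left_mono) auto
    then have "1 \<le> (1 - u / 100) * (1 + u / 99)" by (simp add: field_simps)
    then show ?thesis using assms by (simp add: divide_le_eq)
  qed
  finally show ?thesis .
qed

lemma int_div_less:
  fixes a b c :: int
  assumes "0 < b" "a < c * b"
  shows "a div b < c"
proof -
  have "b * (a div b) \<le> a"
    using mult_div_mod_eq[of b a] pos_mod_sign[of b a] assms(1) by linarith
  moreover have "c * b = b * c" by (rule mult.commute)
  ultimately have "b * (a div b) < b * c" using assms(2) by linarith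
  then show ?thesis using assms(1) by (simp add: mult_less_cancel_left)
qed

section \<open>Multiplicative weights, compared with a fixed fractional solution\<close>

locale mult_weights = ftfp_costs +
  fixes r :: "nat \<Rightarrow> int" and K :: int and x :: "nat \<Rightarrow> nat \<Rightarrow> real" and y :: "nat \<Rightarrow> real"
  assumes r_pos: "j < n \<Longrightarrow> 1 \<le> r j" and K_pos: "0 < K" and lp: "frac_feasible (\<lambda>j. real_of_int (r j)) x y"
begin

definition active :: "(nat \<Rightarrow> int) \<Rightarrow> nat set" where
  "active cov = {j. j < n \<and> cov j < K * r j}"

text \<open>For a price level \<open>lam\<close>, the clients that profit from site \<open>i\<close>
  are those with \<open>d i j \<le> lam * p j\<close>, an initial segment in the order of
  \<open>d i j / p j\<close>. So it suffices to try the segments that end with a client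
  \<open>l\<close>, one star per pair instead of exponentially many. The comparison is
  cross-multiplied.\<close>

definition star :: "(nat \<Rightarrow> int) \<Rightarrow> (nat \<Rightarrow> int) \<Rightarrow> nat \<Rightarrow> nat \<Rightarrow> nat set" where
  "star p cov i l = {j \<in> active cov. \<not> d i l * p j < d i j * p l}"

text \<open>
  The weight of client \<open>j\<close> is \<open>w j = p j * r j / s\<close> for a common scaling factor \<open>s\<close>; it decays
  exponentially in the fraction \<open>cov j / r j\<close> of the demand that has been covered. The
  cost so far is charged to the logarithmic decrease of the total active weight.
\<close>

definition mw_inv ::
  "(nat \<Rightarrow> int) \<Rightarrow> (nat \<Rightarrow> nat \<Rightarrow> int) \<Rightarrow> (nat \<Rightarrow> int) \<Rightarrow> (nat \<Rightarrow> int) \<Rightarrow> bool" where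
  "mw_inv p X Y cov \<longleftrightarrow>
     (\<forall>j<n. 0 < p j) \<and> (\<forall>i<m. 0 \<le> Y i) \<and> (\<forall>i<m. \<forall>j<n. 0 \<le> X i j \<and> X i j \<le> Y i) \<and>
     (\<forall>j<n. cov j = (\<Sum>i<m. X i j)) \<and>
     (\<exists>s V :: real. 0 < s \<and> (\<forall>j<n. exp (- (real_of_int (cov j) / (99 * real_of_int (r j)))) \<le> real_of_int (p j) * real_of_int (r j) / s) \<and>
        exp (- ((real_of_int K + 1) / 99)) \<le> V \<and> (\<Sum>j\<in>active cov. real_of_int (p j) * real_of_int (r j) / s) \<le> V \<and>
        open_part (\<lambda>i. real_of_int (Y i)) + conn_part (\<lambda>i j. real_of_int (X i j))
          \<le> 100 * (open_part y + conn_part x) * (ln (real n + 1) - ln V))"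

lemma mw_invI:
  fixes s V :: real
  assumes "\<And>j. j < n \<Longrightarrow> 0 < p j" "\<And>i. i < m \<Longrightarrow> 0 \<le> Y i"
    "\<And>i j. i < m \<Longrightarrow> j < n \<Longrightarrow> 0 \<le> X i j \<and> X i j \<le> Y i"
    "\<And>j. j < n \<Longrightarrow> cov j = (\<Sum>i<m. X i j)" "0 < s"
    "\<And>j. j < n \<Longrightarrow> exp (- (real_of_int (cov j) / (99 * real_of_int (r j))))
       \<le> real_of_int (p j) * real_of_int (r j) / s"
    "exp (- ((real_of_int K + 1) / 99)) \<le> V"
    "(\<Sum>j\<in>active cov. real_of_int (p j) * real_of_int (r j) / s) \<le> V"
    "open_part (\<lambda>i. real_of_int (Y i)) + conn_part (\<lambda>i j. real_of_int (X i j))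
       \<le> 100 * (open_part y + conn_part x) * (ln (real n + 1) - ln V)"
  shows "mw_inv p X Y cov"
  unfolding mw_inv_def using assms by blast

lemma finite_active: "finite (active cov)"
  unfolding active_def by auto

text \<open>The prices \<open>lam * p j\<close> of the active clients are dual feasible: the clients
  that contribute at a site form the star of the contributor with the largest quotient
  \<open>d i j / p j\<close>, and no star is cheaper than \<open>lam\<close> per unit of
  \<open>p\<close>.\<close>

lemma best_ratio_bound:
  assumes p: "\<And>j. j < n \<Longrightarrow> 0 < p j" and lam: "0 \<le> (lam :: real)"
    and opt: "\<And>i l. i < m \<Longrightarrow> l \<in> active cov \<Longrightarrow>
      lam * real_of_int (\<Sum>j\<in>star p cov i l. p j) \<le> real_of_int (f i + (\<Sum>j\<in>star p cov i l. d i j))"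
  shows "lam * (\<Sum>j\<in>active cov. real_of_int (p j) * real_of_int (r j)) \<le> open_part y + conn_part x"
proof -
  define \<alpha> where "\<alpha> j = (if j \<in> active cov then lam * real_of_int (p j) else 0)" for j
  have nn: "0 \<le> \<alpha> j" if "j < n" for j
    using p[OF that] lam by (simp add: \<alpha>_def)
  have "(\<Sum>j<n. real_of_int (r j) * \<alpha> j) \<le> open_part y + conn_part x"
  proof (rule weak_duality[OF lp nn])
    fix i
    assume i: "i < m"
    define A where "A = {j \<in> active cov. real_of_int (d i j) \<le> lam * real_of_int (p j)}"
    have finA: "finite A" unfolding A_def using finite_active by simp
    have "(\<Sum>j<n. max 0 (\<alpha> j - real_of_int (d i j))) = (\<Sum>j\<in>A. lam * real_of_int (p j) - real_of_int (d i j))"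
    proof (rule sum.mono_neutral_cong_right)
      show "A \<subseteq> {..<n}" by (auto simp: A_def active_def)
      show "\<forall>j\<in>{..<n} - A. max 0 (\<alpha> j - real_of_int (d i j)) = 0"
      proof
        fix j
        assume j: "j \<in> {..<n} - A"
        then have "0 \<le> d i j" using d_nonneg[OF i] by simp
        then show "max 0 (\<alpha> j - real_of_int (d i j)) = 0"
          using j by (auto simp: A_def \<alpha>_def)
      qed
    qed (auto simp: A_def \<alpha>_def)
    also have "\<dots> \<le> real_of_int (f i)"
    proof (cases "A = {}")
      case True
      then show ?thesis using f_nonneg[OF i] by simp
    next
      case False
      let ?g = "\<lambda>j. real_of_int (d i j) / real_of_int (p j)"
      have "Max (?g ` A) \<in> ?g ` A" using finA False by (intro Max_in) auto
      then obtain l where l: "l \<in> A" "Max (?g ` A) = ?g l" by blast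
      have l_max: "?g j \<le> ?g l" if "j \<in> A" for j
        using Max_ge[of "?g ` A" "?g j"] finA that by (simp add: l(2))
      have pos: "0 < real_of_int (p j)" if "j \<in> active cov" for j
        using p that by (auto simp: active_def)
      have la: "l \<in> active cov" using l(1) by (simp add: A_def)
      have iff: "\<not> d i l * p j < d i j * p l \<longleftrightarrow>
          real_of_int (d i j) / real_of_int (p j) \<le> real_of_int (d i l) / real_of_int (p l)" if "j \<in> active cov" for j
      proof -
        have "real_of_int (d i j) / real_of_int (p j) \<le> real_of_int (d i l) / real_of_int (p l) \<longleftrightarrow>
            real_of_int (d i j * p l) \<le> real_of_int (d i l * p j)"
          using pos[OF that] pos[OF la] by (simp add: field_simps)
        then show ?thesis by (simp only: of_int_le_iff not_less)
      qed
      have "star p cov i l = A"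
      proof (intro equalityI subsetI)
        fix j
        assume "j \<in> A"
        then show "j \<in> star p cov i l"
          using l_max iff by (auto simp: star_def A_def)
      next
        fix j
        assume j: "j \<in> star p cov i l"
        then have ja: "j \<in> active cov" by (simp add: star_def)
        then have "real_of_int (d i j) / real_of_int (p j) \<le> real_of_int (d i l) / real_of_int (p l)"
          using j iff by (simp add: star_def)
        also have "\<dots> \<le> lam" using l(1) pos[OF la] by (simp add: A_def divide_le_eq)
        finally show "j \<in> A" using ja pos[OF ja] by (simp add: A_def divide_le_eq)
      qed
      then show ?thesis
        using opt[OF i la] by (simp add: sum_subtractf sum_distrib_left)
    qed
    finally show "(\<Sum>j<n. max 0 (\<alpha> j - real_of_int (d i j))) \<le> real_of_int (f i)" .
  qed
  moreover have "(\<Sum>j<n. real_of_int (r j) * \<alpha> j) = (\<Sum>j\<in>active cov. real_of_int (r j) * (lam * real_of_int (p j)))"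
    by (rule sum.mono_neutral_cong_right) (auto simp: active_def \<alpha>_def)
  moreover have "\<dots> = lam * (\<Sum>j\<in>active cov. real_of_int (p j) * real_of_int (r j))"
    by (simp add: sum_distrib_left mult.commute mult.left_commute)
  ultimately show ?thesis by simp
qed

text \<open>With \<open>s = R\<close> all weights are 1. The choice \<open>V = n + 1\<close> makes
  the two logarithms cancel and is positive even without clients.\<close>

lemma mw_init:
  assumes "\<And>j. j < n \<Longrightarrow> p j * r j = R" "0 < R"
    and "\<And>j. j < n \<Longrightarrow> cov j = 0" "\<And>i. i < m \<Longrightarrow> Y i = 0" "\<And>i j. i < m \<Longrightarrow> j < n \<Longrightarrow> X i j = 0"
  shows "mw_inv p X Y cov"
proof -
  have pos: "0 < p j" if "j < n" for j
  proof -
    have "0 < p j * r j" using assms that by simp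
    then show ?thesis using r_pos[OF that] by (simp add: zero_less_mult_iff)
  qed
  have one: "real_of_int (p j) * real_of_int (r j) / real_of_int R = 1" if "j < n" for j
  proof -
    have "real_of_int (p j) * real_of_int (r j) = real_of_int R"
      unfolding assms(1)[OF that, symmetric] by simp
    then show ?thesis using assms(2) by simp
  qed
  have "(\<Sum>j\<in>active cov. real_of_int (p j) * real_of_int (r j) / real_of_int R) = (\<Sum>j\<in>active cov. 1)"
    using one by (intro sum.cong) (auto simp: active_def)
  also have "\<dots> \<le> real n"
    using card_mono[of "{..<n}" "active cov"] by (auto simp: active_def)
  finally have W: "(\<Sum>j\<in>active cov. real_of_int (p j) * real_of_int (r j) / real_of_int R) \<le> real n + 1"
    by linarith
  have "exp (- ((real_of_int K + 1) / 99)) \<le> real n + 1"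
  proof -
    have "exp (- ((real_of_int K + 1) / 99)) \<le> exp 0"
      using K_pos unfolding exp_le_cancel_iff by simp
    then show ?thesis unfolding exp_zero by linarith
  qed
  then show ?thesis
    using assms(2-5) pos W
    by (intro mw_invI[where s = "real_of_int R" and V = "real n + 1"])
      (simp_all only: one, simp_all add: open_part_def conn_part_def)
qed

text \<open>Multiplying by \<open>100 * R\<close> makes the decay
  \<open>1 - \<delta> / (100 * r j)\<close> integral, as \<open>q j = R / r j\<close>. The step
  costs \<open>lam * s * \<Delta>\<close>, where \<open>\<Delta> = 100 * (W - W')\<close> and
  \<open>lam * s * W \<le> LP\<close>; this is at most \<open>100 * LP * (1 - W' / W)\<close>, which
  the logarithmic decrease covers.\<close>

lemma mw_step:
  assumes inv: "mw_inv p X Y cov" and i: "i < m" and S: "S \<subseteq> active cov" "S \<noteq> {}"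
    and \<delta>: "0 < \<delta>" "\<And>j. j \<in> S \<Longrightarrow> \<delta> \<le> r j"
    and opt: "\<And>i' l. i' < m \<Longrightarrow> l \<in> active cov \<Longrightarrow>
      (f i + (\<Sum>j\<in>S. d i j)) * (\<Sum>j\<in>star p cov i' l. p j)
        \<le> (f i' + (\<Sum>j\<in>star p cov i' l. d i' j)) * (\<Sum>j\<in>S. p j)"
    and R: "\<And>j. j < n \<Longrightarrow> q j * r j = R" "0 < R"
    and p': "\<And>j. j < n \<Longrightarrow> p' j = p j * (100 * R - \<delta> * q j * of_bool (j \<in> S))"
    and Y': "\<And>i'. i' < m \<Longrightarrow> Y' i' = Y i' + \<delta> * of_bool (i' = i)"
    and X': "\<And>i' j. i' < m \<Longrightarrow> j < n \<Longrightarrow> X' i' j = X i' j + \<delta> * of_bool (i' = i \<and> j \<in> S)"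
    and cov': "\<And>j. j < n \<Longrightarrow> cov' j = cov j + \<delta> * of_bool (j \<in> S)"
  shows "mw_inv p' X' Y' cov'"
proof -
  define LP where "LP = open_part y + conn_part x"
  have LP: "0 \<le> LP"
    unfolding LP_def using open_part_nonneg[OF lp] conn_part_nonneg[OF lp] by simp
  obtain s V where s: "0 < s" and w_ge: "\<And>j. j < n \<Longrightarrow> exp (- (real_of_int (cov j) / (99 * real_of_int (r j)))) \<le> real_of_int (p j) * real_of_int (r j) / s"
    and V: "(\<Sum>j\<in>active cov. real_of_int (p j) * real_of_int (r j) / s) \<le> V"
    and cost: "open_part (\<lambda>i. real_of_int (Y i)) + conn_part (\<lambda>i j. real_of_int (X i j)) \<le> 100 * LP * (ln (real n + 1) - ln V)"
    using inv unfolding mw_inv_def LP_def[symmetric] by blast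
  have p: "0 < p j" if "j < n" for j using inv that by (simp add: mw_inv_def)
  have Sn: "j < n" if "j \<in> S" for j using S that by (auto simp: active_def)
  have finS: "finite S" using S finite_active finite_subset by blast
  define w where "w j = real_of_int (p j) * real_of_int (r j) / s" for j
  define w' where "w' j = real_of_int (p' j) * real_of_int (r j) / (s * (100 * real_of_int R))" for j
  have w'_eq: "w' j = w j * (1 - real_of_int \<delta> * of_bool (j \<in> S) / (100 * real_of_int (r j)))" if "j < n" for j
  proof -
    have rj: "real_of_int (r j) \<noteq> 0" using r_pos[OF that] by simp
    have qj: "real_of_int R = real_of_int (q j) * real_of_int (r j)" using R(1)[OF that] by (metis of_int_mult)
    have "real_of_int (q j) \<noteq> 0" using qj R(2) by auto
    then show ?thesis
      unfolding w'_def w_def p'[OF that] using rj s R(2)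
      by (simp add: qj field_simps)
  qed
  have w_pos: "0 < w j" if "j < n" for j
    unfolding w_def using p[OF that] r_pos[OF that] s by simp
  have u: "0 \<le> real_of_int \<delta> * of_bool (j \<in> S) / real_of_int (r j)" "real_of_int \<delta> * of_bool (j \<in> S) / real_of_int (r j) \<le> 1"
    if "j < n" for j
    using \<delta> r_pos[OF that] by (auto simp: divide_le_eq)
  have w'_ge: "exp (- (real_of_int (cov' j) / (99 * real_of_int (r j)))) \<le> w' j" if "j < n" for j
  proof -
    let ?u = "real_of_int \<delta> * of_bool (j \<in> S) / real_of_int (r j)"
    have "real_of_int (cov' j) / (99 * real_of_int (r j)) = real_of_int (cov j) / (99 * real_of_int (r j)) + ?u / 99"
      unfolding cov'[OF that] using r_pos[OF that] by (simp add: field_simps)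
    then have "exp (- (real_of_int (cov' j) / (99 * real_of_int (r j)))) = exp (- (real_of_int (cov j) / (99 * real_of_int (r j)))) * exp (- (?u / 99))"
      by (simp add: exp_add[symmetric])
    also have "\<dots> \<le> w j * (1 - ?u / 100)"
      using w_ge[OF that] u[OF that] w_pos[OF that]
      by (intro mult_mono exp_le_one_minus) (auto simp: w_def)
    also have "\<dots> = w' j" unfolding w'_eq[OF that] by simp
    finally show ?thesis .
  qed
  have w'_pos: "0 < w' j" if "j < n" for j
    using w'_ge[OF that] exp_gt_zero less_le_trans by blast
  have p'_pos: "0 < p' j" if "j < n" for j
  proof -
    have "real_of_int (p' j) * real_of_int (r j) = w' j * (s * (100 * real_of_int R))"
      using s R(2) by (simp add: w'_def)
    then have "0 < real_of_int (p' j) * real_of_int (r j)"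
      using w'_pos[OF that] s R(2) by simp
    then show ?thesis using r_pos[OF that] by (simp add: zero_less_mult_iff)
  qed
  define W where "W = (\<Sum>j\<in>active cov. w j)"
  \<comment> \<open>The sum runs over the clients that were active before the step, so it stays
    positive even if the step finishes all of them.\<close>
  define W' where "W' = (\<Sum>j\<in>active cov. w' j)"
  define \<Delta> where "\<Delta> = (\<Sum>j\<in>S. w j * real_of_int \<delta> / real_of_int (r j))"
  have act: "active cov \<noteq> {}" using S by auto
  have W_pos: "0 < W" unfolding W_def using w_pos act finite_active
    by (intro sum_pos) (auto simp: active_def)
  have W'_pos: "0 < W'" unfolding W'_def using w'_pos act finite_active
    by (intro sum_pos) (auto simp: active_def)
  have W'_eq: "W' = W - \<Delta> / 100"
  proof -
    have "W' = (\<Sum>j\<in>active cov. w j - of_bool (j \<in> S) * (w j * real_of_int \<delta> / real_of_int (r j)) / 100)"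
      unfolding W'_def by (intro sum.cong) (auto simp: w'_eq active_def algebra_simps)
    also have "\<dots> = W - (\<Sum>j\<in>active cov. of_bool (j \<in> S) * (w j * real_of_int \<delta> / real_of_int (r j))) / 100"
      by (simp add: W_def sum_subtractf sum_divide_distrib)
    also have "(\<Sum>j\<in>active cov. of_bool (j \<in> S) * (w j * real_of_int \<delta> / real_of_int (r j))) = \<Delta>"
      unfolding \<Delta>_def using S finite_active by (intro sum.mono_neutral_cong_right) auto
    finally show ?thesis .
  qed
  define pS where "pS = (\<Sum>j\<in>S. p j)"
  define cS where "cS = f i + (\<Sum>j\<in>S. d i j)"
  have pS: "0 < real_of_int pS" unfolding pS_def using p Sn finS S by (simp add: sum_pos)
  have cS: "0 \<le> real_of_int cS"
    unfolding cS_def using f_nonneg[OF i] d_nonneg[OF i] Sn by (simp add: sum_nonneg)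
  define lam where "lam = real_of_int cS / real_of_int pS"
  have "lam * (\<Sum>j\<in>active cov. real_of_int (p j) * real_of_int (r j)) \<le> LP"
    unfolding LP_def
  proof (rule best_ratio_bound[OF p])
    show "0 \<le> lam" using pS cS by (simp add: lam_def)
    fix i' l
    assume i': "i' < m" "l \<in> active cov"
    have "real_of_int (cS * (\<Sum>j\<in>star p cov i' l. p j))
        \<le> real_of_int ((f i' + (\<Sum>j\<in>star p cov i' l. d i' j)) * pS)"
      using opt[OF i'] unfolding of_int_le_iff cS_def pS_def .
    then show "lam * real_of_int (\<Sum>j\<in>star p cov i' l. p j) \<le> real_of_int (f i' + (\<Sum>j\<in>star p cov i' l. d i' j))"
      using pS by (simp add: lam_def field_simps)
  qed auto
  moreover have "(\<Sum>j\<in>active cov. real_of_int (p j) * real_of_int (r j)) = s * W"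
    using s by (simp add: W_def w_def sum_distrib_left)
  ultimately have lamW: "lam * s * W \<le> LP" by (simp add: mult.assoc)
  have inc: "real_of_int \<delta> * real_of_int cS = lam * s * \<Delta>"
  proof -
    have "s * \<Delta> = (\<Sum>j\<in>S. real_of_int \<delta> * real_of_int (p j))"
      unfolding \<Delta>_def sum_distrib_left
    proof (rule sum.cong)
      fix j
      assume "j \<in> S"
      then have "real_of_int (r j) \<noteq> 0" using r_pos[OF Sn] by fastforce
      then show "s * (w j * real_of_int \<delta> / real_of_int (r j)) = real_of_int \<delta> * real_of_int (p j)"
        using s by (simp add: w_def)
    qed simp
    also have "\<dots> = real_of_int \<delta> * real_of_int pS" by (simp add: pS_def sum_distrib_left)
    finally have "lam * (s * \<Delta>) = lam * (real_of_int \<delta> * real_of_int pS)" by simp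
    then show ?thesis using pS by (simp add: lam_def mult.commute mult.left_commute)
  qed
  have \<Delta>_nonneg: "0 \<le> \<Delta>"
    unfolding \<Delta>_def using w_pos \<delta>(1) r_pos Sn
    by (intro sum_nonneg divide_nonneg_nonneg mult_nonneg_nonneg) (auto intro: less_imp_le order.trans[of 0 1])
  have charge: "real_of_int \<delta> * real_of_int cS \<le> 100 * LP * (ln W - ln W')"
  proof -
    have "real_of_int \<delta> * real_of_int cS * W = (lam * s * W) * \<Delta>" unfolding inc by simp
    also have "\<dots> \<le> LP * \<Delta>" using lamW \<Delta>_nonneg by (rule mult_right_mono)
    finally have "real_of_int \<delta> * real_of_int cS \<le> LP * (\<Delta> / W)"
      using W_pos by (simp add: field_simps)
    also have "\<Delta> / W = 100 * (1 - W' / W)" unfolding W'_eq using W_pos by (simp add: field_simps)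
    also have "LP * (100 * (1 - W' / W)) \<le> LP * (100 * (ln W - ln W'))"
    proof (intro mult_left_mono)
      have "ln (W' / W) \<le> W' / W - 1" using W_pos W'_pos by (intro ln_le_minus_one) simp
      then show "1 - W' / W \<le> ln W - ln W'" using W_pos W'_pos by (simp add: ln_div)
    qed (use LP in auto)
    finally show ?thesis by (simp add: algebra_simps)
  qed
  have cost_eq: "open_part (\<lambda>i. real_of_int (Y' i)) + conn_part (\<lambda>i j. real_of_int (X' i j))
      = open_part (\<lambda>i. real_of_int (Y i)) + conn_part (\<lambda>i j. real_of_int (X i j)) + real_of_int \<delta> * real_of_int cS"
  proof -
    have "open_part (\<lambda>i. real_of_int (Y' i)) = (\<Sum>i'<m. real_of_int (f i') * real_of_int (Y i') + (if i' = i then real_of_int (f i) * real_of_int \<delta> else 0))"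
      unfolding open_part_def by (intro sum.cong) (auto simp: Y' algebra_simps)
    also have "\<dots> = open_part (\<lambda>i. real_of_int (Y i)) + real_of_int (f i) * real_of_int \<delta>"
      using i by (simp add: sum.distrib open_part_def)
    finally have o: "open_part (\<lambda>i. real_of_int (Y' i)) = open_part (\<lambda>i. real_of_int (Y i)) + real_of_int (f i) * real_of_int \<delta>" .
    have "conn_part (\<lambda>i j. real_of_int (X' i j)) = (\<Sum>i'<m. (\<Sum>j<n. real_of_int (d i' j) * real_of_int (X i' j)) +
        (if i' = i then \<Sum>j<n. real_of_int (d i j) * real_of_int \<delta> * of_bool (j \<in> S) else 0))"
      unfolding conn_part_def
      by (intro sum.cong) (auto simp: X' algebra_simps sum.distrib[symmetric] intro!: sum.cong)
    also have "\<dots> = conn_part (\<lambda>i j. real_of_int (X i j)) + (\<Sum>j<n. real_of_int (d i j) * real_of_int \<delta> * of_bool (j \<in> S))"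
      using i by (simp add: sum.distrib conn_part_def)
    also have "(\<Sum>j<n. real_of_int (d i j) * real_of_int \<delta> * of_bool (j \<in> S)) = (\<Sum>j\<in>S. real_of_int (d i j) * real_of_int \<delta>)"
      using Sn by (intro sum.mono_neutral_cong_right) auto
    finally show ?thesis
      unfolding o cS_def by (simp add: algebra_simps sum_distrib_left)
  qed
  have W_le_V: "ln W \<le> ln V"
    using V W_pos by (subst ln_le_cancel_iff) (auto simp: W_def w_def)
  have new_cost: "open_part (\<lambda>i. real_of_int (Y' i)) + conn_part (\<lambda>i j. real_of_int (X' i j)) \<le> 100 * LP * (ln (real n + 1) - ln W')"
  proof -
    have "100 * LP * (ln W - ln V) \<le> 0" using LP W_le_V by (simp add: mult_nonneg_nonpos)
    moreover have "100 * LP * (ln (real n + 1) - ln W') =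
      100 * LP * (ln (real n + 1) - ln V) - 100 * LP * (ln W - ln V) + 100 * LP * (ln W - ln W')"
      by (simp add: algebra_simps)
    ultimately show ?thesis using cost charge unfolding cost_eq by linarith
  qed
  have act_sub: "active cov' \<subseteq> active cov"
    using \<delta> cov' by (auto simp: active_def of_bool_def split: if_splits)
  have "(\<Sum>j\<in>active cov'. w' j) \<le> W'"
    unfolding W'_def using act_sub finite_active w'_pos
    by (intro sum_mono2) (auto simp: active_def intro: less_imp_le)
  \<comment> \<open>A client of \<open>S\<close> was below \<open>K * r j\<close> and gained at most
    \<open>r j\<close>, so its coverage is at most \<open>(K + 1) * r j\<close>; its weight alone
    bounds the sum from below.\<close>
  moreover have "exp (- ((real_of_int K + 1) / 99)) \<le> W'"
  proof -
    obtain j where j: "j \<in> S" using S by auto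
    then have ja: "j \<in> active cov" "j < n" using S Sn by auto
    have rj: "0 < real_of_int (r j)" using r_pos[OF ja(2)] by simp
    have "cov' j \<le> (K + 1) * r j"
      using cov'[OF ja(2)] ja \<delta>(2)[OF j] j by (simp add: active_def algebra_simps)
    then have "real_of_int (cov' j) \<le> (real_of_int K + 1) * real_of_int (r j)"
      by (metis of_int_1 of_int_add of_int_le_iff of_int_mult)
    then have "real_of_int (cov' j) / (99 * real_of_int (r j)) \<le> (real_of_int K + 1) / 99"
      using rj by (simp add: field_simps)
    then have "exp (- ((real_of_int K + 1) / 99)) \<le> exp (- (real_of_int (cov' j) / (99 * real_of_int (r j))))" by simp
    also have "\<dots> \<le> w' j" by (rule w'_ge) (rule ja)
    also have "\<dots> \<le> W'" unfolding W'_def using ja finite_active w'_pos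
      by (intro member_le_sum) (auto simp: active_def intro: less_imp_le)
    finally show ?thesis .
  qed
  moreover have "\<forall>j<n. cov' j = (\<Sum>i<m. X' i j)"
  proof (intro allI impI)
    fix j
    assume j: "j < n"
    have "(\<Sum>i'<m. X' i' j) = (\<Sum>i'<m. X i' j) + (\<Sum>i'<m. if i' = i then \<delta> * of_bool (j \<in> S) else 0)"
      unfolding sum.distrib[symmetric] by (intro sum.cong) (auto simp: X' j)
    also have "\<dots> = (\<Sum>i'<m. X i' j) + \<delta> * of_bool (j \<in> S)"
      using i by simp
    finally show "cov' j = (\<Sum>i<m. X' i j)"
      using inv j by (simp add: cov' mw_inv_def)
  qed
  moreover have "\<forall>i'<m. 0 \<le> Y' i'" "\<forall>i'<m. \<forall>j<n. 0 \<le> X' i' j \<and> X' i' j \<le> Y' i'"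
    using inv \<delta>(1) by (auto simp: mw_inv_def X' Y' add_increasing2)
  ultimately show ?thesis
    using p'_pos s R(2) w'_ge new_cost
    by (intro mw_invI[where s = "s * (100 * real_of_int R)" and V = W'])
      (simp_all only: w'_def[symmetric] LP_def[symmetric], simp_all)
qed

text \<open>Counts how many full multiples of the demands are missing. The floor matters: a step
  adds \<open>\<delta> = r j\<close> for the client of smallest demand in the star, so its quotient
  grows by exactly 1, and the count starts at \<open>n * K\<close> whatever the demands are.\<close>

definition mw_potential :: "(nat \<Rightarrow> int) \<Rightarrow> nat" where
  "mw_potential cov = (\<Sum>j<n. nat (K - cov j div r j))"

lemma mw_potential_decreases:
  assumes S: "S \<subseteq> active cov" "j \<in> S" "r j = \<delta>" and \<delta>: "0 < \<delta>"
    and cov': "\<And>j. j < n \<Longrightarrow> cov' j = cov j + \<delta> * of_bool (j \<in> S)"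
  shows "mw_potential cov' < mw_potential cov"
  unfolding mw_potential_def
proof (rule sum_strict_mono_ex1)
  have jn: "j < n" and act: "cov j < K * r j" using S by (auto simp: active_def)
  show "\<forall>k\<in>{..<n}. nat (K - cov' k div r k) \<le> nat (K - cov k div r k)"
  proof
    fix k
    assume "k \<in> {..<n}"
    then have "cov k div r k \<le> cov' k div r k"
      using cov'[of k] \<delta> r_pos[of k] by (intro zdiv_mono1) auto
    then show "nat (K - cov' k div r k) \<le> nat (K - cov k div r k)" by simp
  qed
  have "cov j div r j < K" using r_pos[OF jn] act by (intro int_div_less) auto
  moreover have "cov' j div r j = cov j div r j + 1"
    using cov'[OF jn] S \<delta> by simp
  ultimately show "\<exists>k\<in>{..<n}. nat (K - cov' k div r k) < nat (K - cov k div r k)"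
    using jn by (intro bexI[of _ j]) auto
qed simp

text \<open>Since \<open>ln (n + 1) \<le> n + 1 = K / 200000\<close>, the logarithm contributes at
  most \<open>K / 2000\<close>, and the rate 99 contributes \<open>100 * (K + 1) / 99\<close>,
  together below \<open>1.0112 * K\<close>. So a value of \<open>K\<close> linear in
  \<open>n\<close> suffices.\<close>

lemma mw_final:
  assumes inv: "mw_inv p X Y cov" and K: "K = 200000 * (int n + 1)"
  shows "open_part (\<lambda>i. real_of_int (Y i)) + conn_part (\<lambda>i j. real_of_int (X i j)) \<le> 1.0112 * real_of_int K * (open_part y + conn_part x)"
proof -
  define LP where "LP = open_part y + conn_part x"
  have LP: "0 \<le> LP"
    unfolding LP_def using open_part_nonneg[OF lp] conn_part_nonneg[OF lp] by simp
  obtain V where V: "exp (- ((real_of_int K + 1) / 99)) \<le> V"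
    and cost: "open_part (\<lambda>i. real_of_int (Y i)) + conn_part (\<lambda>i j. real_of_int (X i j)) \<le> 100 * LP * (ln (real n + 1) - ln V)"
    using inv unfolding mw_inv_def LP_def[symmetric] by blast
  have "- ((real_of_int K + 1) / 99) \<le> ln V"
    using V by (metis exp_gt_zero less_le_trans ln_exp ln_le_cancel_iff)
  moreover have "ln (real n + 1) \<le> real n + 1"
    using ln_le_minus_one[of "real n + 1"] by simp
  moreover have "real_of_int K = 200000 * (real n + 1)" using K by simp
  ultimately have "100 * (ln (real n + 1) - ln V) \<le> 1.0112 * real_of_int K"
    by (simp add: field_simps)
  then have "LP * (100 * (ln (real n + 1) - ln V)) \<le> LP * (1.0112 * real_of_int K)"
    using LP by (rule mult_left_mono)
  moreover have "100 * LP * (ln (real n + 1) - ln V) = LP * (100 * (ln (real n + 1) - ln V))"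
    "LP * (1.0112 * real_of_int K) = 1.0112 * real_of_int K * (open_part y + conn_part x)"
    by (simp_all add: LP_def algebra_simps)
  ultimately show ?thesis using cost by linarith
qed

end

section \<open>Rounding\<close>

text \<open>Peel off the last radius: fewer than \<open>(k + 1) * h\<close> of the at least
  \<open>(k + 2) * h\<close> tokens are closer than \<open>rad k\<close>, so \<open>h\<close> tokens
  at distance \<open>rad k\<close> or more pay for it, and the others satisfy the hypotheses for the
  remaining radii. One block of \<open>h\<close> tokens beyond the number of radii is required,
  because almost \<open>(l + 1) * h\<close> tokens may be closer than the radius with index
  \<open>l\<close>.\<close>

lemma quantile_sum_le:
  fixes c :: "'a \<Rightarrow> int" and rad :: "nat \<Rightarrow> int"
  assumes "finite T" "\<And>t. t \<in> T \<Longrightarrow> 0 \<le> c t" "h * (k + 1) \<le> card T"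
    and "\<And>l. l < k \<Longrightarrow> card {t \<in> T. c t < rad l} < (l + 1) * h"
  shows "int h * (\<Sum>l<k. rad l) \<le> (\<Sum>t\<in>T. c t)"
  using assms
proof (induction k arbitrary: T)
  case 0
  then show ?case by (simp add: sum_nonneg)
next
  case (Suc k)
  let ?far = "{t \<in> T. rad k \<le> c t}"
  have "T = ?far \<union> {t \<in> T. c t < rad k}" by auto
  then have "card T \<le> card ?far + card {t \<in> T. c t < rad k}"
    by (metis (no_types, lifting) card_Un_le)
  moreover have "card {t \<in> T. c t < rad k} < (k + 1) * h" using Suc.prems(4)[of k] by simp
  moreover have "h * (k + 2) \<le> card T" using Suc.prems(3) by simp
  ultimately have "h \<le> card ?far" by (simp add: algebra_simps)
  then obtain U where U: "U \<subseteq> ?far" "card U = h"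
    using obtain_subset_with_card_n by metis
  have UT: "U \<subseteq> T" using U by auto
  have finU: "finite U" using UT Suc.prems(1) by (rule finite_subset)
  have "int h * rad k = (\<Sum>t\<in>U. rad k)" using U by simp
  also have "\<dots> \<le> (\<Sum>t\<in>U. c t)" using U by (intro sum_mono) auto
  finally have far: "int h * rad k \<le> (\<Sum>t\<in>U. c t)" .
  have "int h * (\<Sum>l<k. rad l) \<le> (\<Sum>t\<in>T - U. c t)"
  proof (rule Suc.IH)
    show "h * (k + 1) \<le> card (T - U)"
      using Suc.prems(3) U UT finU by (simp add: card_Diff_subset algebra_simps)
    fix l
    assume l: "l < k"
    have "card {t \<in> T - U. c t < rad l} \<le> card {t \<in> T. c t < rad l}"
      using Suc.prems(1) by (intro card_mono) auto
    also have "\<dots> < (l + 1) * h" using Suc.prems(4)[of l] l by simp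
    finally show "card {t \<in> T - U. c t < rad l} < (l + 1) * h" .
  qed (use Suc.prems in auto)
  moreover have "(\<Sum>t\<in>T. c t) = (\<Sum>t\<in>T - U. c t) + (\<Sum>t\<in>U. c t)"
    using UT Suc.prems(1) by (rule sum.subset_diff)
  ultimately show ?case using far by (simp add: algebra_simps)
qed

text \<open>
  The fractional solution is cut into tokens, \<open>2 * h\<close> of which make up one facility: site
  \<open>site t\<close> carries token \<open>t\<close>, the clients may use the tokens in \<open>own0 j\<close>, and every
  client has at least \<open>2 * h\<close> tokens per unit of demand. A cluster consists of \<open>h\<close> tokens
  and becomes one facility, so the facility cost doubles.
\<close>

locale token_rounding = ftfp_costs +
  fixes T :: "nat set" and site :: "nat \<Rightarrow> nat" and own0 :: "nat \<Rightarrow> nat set"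
    and dem :: "nat \<Rightarrow> nat" and h :: nat
  assumes finite_T: "finite T" and site: "t \<in> T \<Longrightarrow> site t < m"
    and own0_subset: "own0 j \<subseteq> T"
    and own0_card: "j < n \<Longrightarrow> 2 * h * dem j \<le> card (own0 j)" and h_pos: "0 < h"
begin

definition near :: "(nat \<Rightarrow> nat set) \<Rightarrow> nat \<Rightarrow> int \<Rightarrow> nat set" where
  "near own j R = {t \<in> own j. d (site t) j \<le> R}"

text \<open>Radii are taken from the distances \<open>d i j\<close>. A candidate is thus a pair of a
  client and a site, where the site serves as a name for the radius, and the search is over
  \<open>m * n\<close> pairs.\<close>

definition candidate :: "(nat \<Rightarrow> nat set) \<Rightarrow> (nat \<Rightarrow> nat) \<Rightarrow> nat \<Rightarrow> nat \<Rightarrow> bool" where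
  "candidate own rem i j \<longleftrightarrow> 0 < rem j \<and> h \<le> card (near own j (d i j))"

definition clusters :: "(nat \<Rightarrow> nat) \<Rightarrow> nat set" where
  "clusters cl = {c. 0 < c \<and> (\<exists>t\<in>T. cl t = c)}"

text \<open>
  Here \<open>cl t\<close> is the cluster of token \<open>t\<close> (0 if there is none) and \<open>J j\<close> the set of clusters
  that client \<open>j\<close> has joined. The radii \<open>R\<close> of successive steps increase, so a cluster that
  meets the tokens near to \<open>j\<close> has its centre within \<open>2 * R\<close> and its facility within
  \<open>3 * R\<close>.
\<close>

definition round_inv :: "(nat \<Rightarrow> nat set) \<Rightarrow> (nat \<Rightarrow> nat) \<Rightarrow> (nat \<Rightarrow> nat) \<Rightarrow> (nat \<Rightarrow> nat) \<Rightarrow>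
    (nat \<Rightarrow> nat set) \<Rightarrow> int \<Rightarrow> (nat \<Rightarrow> nat \<Rightarrow> int) \<Rightarrow> bool" where
  "round_inv own rem cl cs J R rad \<longleftrightarrow>
     (\<forall>j<n. own j \<subseteq> own0 j \<and> rem j \<le> dem j \<and> card (J j) = dem j - rem j \<and> finite (J j) \<and>
        J j \<subseteq> clusters cl \<and> (\<forall>c\<in>J j. \<forall>t\<in>own j. cl t \<noteq> c) \<and>
        card (own0 j - own j) \<le> h * (dem j - rem j) \<and>
        (\<Sum>c\<in>J j. d (cs c) j) \<le> 3 * (\<Sum>l<dem j - rem j. rad j l) \<and>
        (\<forall>l<dem j - rem j. card {t \<in> own0 j. d (site t) j < rad j l} < (l + 1) * h)) \<and>
     (\<forall>c\<in>clusters cl. cs c < m \<and> card {t\<in>T. cl t = c} = h \<and> (\<forall>t\<in>T. cl t = c \<longrightarrow> f (cs c) \<le> f (site t)) \<and>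
        (\<exists>k<n. d (cs c) k \<le> R \<and> (\<forall>t\<in>T. cl t = c \<longrightarrow> d (site t) k \<le> R))) \<and>
     (\<forall>i<m. \<forall>j<n. candidate own rem i j \<longrightarrow> R \<le> d i j)"

lemma finite_clusters: "finite (clusters cl)"
proof -
  have "clusters cl \<subseteq> cl ` T" by (auto simp: clusters_def)
  then show ?thesis using finite_T finite_surj by blast
qed

lemma round_init:
  assumes "\<And>j. j < n \<Longrightarrow> own j = own0 j" "\<And>j. j < n \<Longrightarrow> rem j = dem j" "\<And>t. t \<in> T \<Longrightarrow> cl t = 0"
  shows "round_inv own rem cl cs (\<lambda>_. {}) 0 (\<lambda>_ _. 0)"
  unfolding round_inv_def using assms d_nonneg by (auto simp: clusters_def)

text \<open>Each joined cluster has cost the client at most \<open>h\<close> of its at least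
  \<open>2 * h * dem j\<close> tokens, and fewer than \<open>dem j\<close> clusters have been
  joined. So \<open>h\<close> tokens are left, and the distance of the farthest one is a radius that
  contains them all.\<close>

lemma exists_candidate:
  assumes inv: "round_inv own rem cl cs J R rad" and j: "j < n" "0 < rem j"
  shows "\<exists>i<m. candidate own rem i j"
proof -
  have o: "own j \<subseteq> own0 j" "rem j \<le> dem j" "card (own0 j - own j) \<le> h * (dem j - rem j)"
    using inv j by (auto simp: round_inv_def)
  have fin: "finite (own0 j)" using own0_subset finite_T finite_subset by blast
  have "card (own0 j) = card (own j) + card (own0 j - own j)"
    using o(1) fin card_mono[OF fin o(1)] finite_subset[OF o(1) fin]
    by (simp add: card_Diff_subset)
  then have "2 * h * dem j \<le> card (own j) + h * (dem j - rem j)"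
    using own0_card[OF j(1)] o(3) by linarith
  moreover have "h * (dem j - rem j) \<le> h * (dem j - 1)" using j by (intro mult_left_mono) auto
  moreover have "h * (dem j - 1) + h \<le> 2 * h * dem j"
    using o(2) j(2) by (cases "dem j") auto
  ultimately have card: "h \<le> card (own j)" by linarith
  then have ne: "own j \<noteq> {}" using h_pos by auto
  have fin': "finite (own j)" using o(1) fin finite_subset by blast
  let ?g = "\<lambda>t. d (site t) j"
  have "Max (?g ` own j) \<in> ?g ` own j" using ne fin' by (intro Max_in) auto
  then obtain t where t: "t \<in> own j" "Max (?g ` own j) = ?g t" by blast
  have "near own j (?g t) = own j"
  proof (intro equalityI subsetI)
    fix u
    assume u: "u \<in> own j"
    then have "?g u \<le> Max (?g ` own j)" using fin' by (intro Max_ge) auto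
    then show "u \<in> near own j (?g t)" using u unfolding t(2) by (simp add: near_def)
  qed (simp add: near_def)
  moreover have "site t < m" using t(1) o(1) own0_subset site by blast
  ultimately show ?thesis using card j(2) by (auto simp: candidate_def)
qed

text \<open>Otherwise the farthest of the tokens closer than \<open>R\<close> would itself give a
  candidate of smaller radius.\<close>

lemma card_closer_less:
  assumes j: "j < n" "0 < rem j" and own: "own j \<subseteq> T"
    and min: "\<And>i. i < m \<Longrightarrow> candidate own rem i j \<Longrightarrow> R \<le> d i j"
  shows "card {t \<in> own j. d (site t) j < R} < h"
proof (rule ccontr)
  assume "\<not> ?thesis"
  then have big: "h \<le> card {t \<in> own j. d (site t) j < R}" (is "h \<le> card ?C") by simp
  have fin: "finite ?C" using finite_subset[OF own finite_T] by simp
  have ne: "?C \<noteq> {}" using big h_pos by force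
  let ?g = "\<lambda>t. d (site t) j"
  have "Max (?g ` ?C) \<in> ?g ` ?C" using ne fin by (intro Max_in) auto
  then obtain t where t: "t \<in> ?C" "Max (?g ` ?C) = ?g t" by blast
  have "?C \<subseteq> near own j (?g t)"
  proof
    fix u
    assume u: "u \<in> ?C"
    then have "?g u \<le> Max (?g ` ?C)" using fin by (intro Max_ge) auto
    then show "u \<in> near own j (?g t)" using u unfolding t(2) by (auto simp: near_def)
  qed
  moreover have "finite (near own j (?g t))"
    using finite_subset[OF own finite_T] by (simp add: near_def)
  ultimately have "h \<le> card (near own j (?g t))" using big card_mono le_trans by blast
  then have "candidate own rem (site t) j" using j by (simp add: candidate_def)
  then have "R \<le> ?g t" using t own site by (intro min) auto
  then show False using t by simp
qed

text \<open>Joining a cluster and founding one are treated at once: \<open>cl'\<close> and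
  \<open>cs'\<close> describe the clusters after a possible foundation, \<open>new\<close> and
  \<open>fresh\<close> the cluster founded, and \<open>t0\<close> is a token near \<open>j\<close>
  in the cluster that is joined in either case.\<close>

lemma round_join:
  assumes inv: "round_inv own rem cl cs J R rad" and i: "i < m" and j: "j < n"
    and cand: "candidate own rem i j" and R': "R' = d i j"
    and min: "\<And>i' j'. i' < m \<Longrightarrow> j' < n \<Longrightarrow> candidate own rem i' j' \<Longrightarrow> R' \<le> d i' j'"
    and cl': "\<And>t. t \<in> T \<Longrightarrow> cl t \<noteq> 0 \<Longrightarrow> cl' t = cl t" "\<And>c. c \<in> clusters cl \<Longrightarrow> cs' c = cs c"
    and new: "\<And>t. t \<in> T \<Longrightarrow> cl t = 0 \<Longrightarrow> cl' t \<noteq> 0 \<Longrightarrow> cl' t = c \<and> t \<in> near own j R' \<and> c \<notin> clusters cl"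
    and c: "c \<in> clusters cl'" "t0 \<in> near own j R'" "cl' t0 = c"
    and fresh: "c \<notin> clusters cl \<Longrightarrow> cs' c < m \<and> d (cs' c) j \<le> R' \<and> card {t \<in> T. cl' t = c} = h \<and>
      (\<forall>t\<in>T. cl' t = c \<longrightarrow> f (cs' c) \<le> f (site t))"
    and own': "\<And>j'. j' < n \<Longrightarrow> own' j' = (if j' = j then {t \<in> own j. cl' t \<noteq> c} else own j')"
    and rem': "\<And>j'. j' < n \<Longrightarrow> rem' j' = (if j' = j then rem j - 1 else rem j')"
  shows "round_inv own' rem' cl' cs' (J(j := insert c (J j))) R' (rad(j := (rad j)(dem j - rem j := R')))"
    and "c \<notin> J j"
proof -
  have remj: "0 < rem j" and near: "h \<le> card (near own j R')"
    using cand unfolding R' candidate_def by auto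
  have R: "R \<le> R'" using inv i j cand unfolding R' round_inv_def by blast
  have inv_j: "own k \<subseteq> own0 k" "rem k \<le> dem k" "card (J k) = dem k - rem k" "finite (J k)"
      "J k \<subseteq> clusters cl" "\<And>c t. c \<in> J k \<Longrightarrow> t \<in> own k \<Longrightarrow> cl t \<noteq> c"
      "card (own0 k - own k) \<le> h * (dem k - rem k)"
      "(\<Sum>c\<in>J k. d (cs c) k) \<le> 3 * (\<Sum>l<dem k - rem k. rad k l)"
      "\<And>l. l < dem k - rem k \<Longrightarrow> card {t \<in> own0 k. d (site t) k < rad k l} < (l + 1) * h"
    if "k < n" for k
    using inv that unfolding round_inv_def by blast+
  have ownT: "own k \<subseteq> T" if "k < n" for k using inv_j(1)[OF that] own0_subset by blast
  have cl_sub: "clusters cl \<subseteq> clusters cl'"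
    unfolding clusters_def using cl'(1) by (auto intro!: bexI)
  have cl'_new: "c' = c" if "c' \<in> clusters cl'" "c' \<notin> clusters cl" for c'
  proof -
    obtain t where t: "t \<in> T" "cl' t = c'" "0 < c'" using \<open>c' \<in> clusters cl'\<close> by (auto simp: clusters_def)
    have "cl t = 0"
    proof (rule ccontr)
      assume "cl t \<noteq> 0"
      then have "cl t \<in> clusters cl" "cl' t = cl t" using t cl'(1) by (auto simp: clusters_def)
      then show False using t that by simp
    qed
    then show ?thesis using new t by blast
  qed
  have old_eq: "{t \<in> T. cl' t = c'} = {t \<in> T. cl t = c'}" if "c' \<in> clusters cl" for c'
  proof (intro equalityI subsetI)
    fix t
    assume t: "t \<in> {t \<in> T. cl' t = c'}"
    have "c' \<noteq> 0" using that by (simp add: clusters_def)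
    then have "cl t \<noteq> 0" using t new[of t] that by auto
    then show "t \<in> {t \<in> T. cl t = c'}" using t cl'(1) by auto
  next
    fix t
    assume t: "t \<in> {t \<in> T. cl t = c'}"
    then show "t \<in> {t \<in> T. cl' t = c'}" using cl'(1) that by (auto simp: clusters_def)
  qed
  have t0: "t0 \<in> own j" "t0 \<in> T" "d (site t0) j \<le> R'"
    using c(2) ownT[OF j] by (auto simp: near_def)
  have old: "cs c' < m \<and> card {t\<in>T. cl t = c'} = h \<and> (\<forall>t\<in>T. cl t = c' \<longrightarrow> f (cs c') \<le> f (site t)) \<and>
      (\<exists>k<n. d (cs c') k \<le> R \<and> (\<forall>t\<in>T. cl t = c' \<longrightarrow> d (site t) k \<le> R))" if "c' \<in> clusters cl" for c'
    using inv that unfolding round_inv_def by blast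
  have new_clusters: "cs' c' < m \<and> card {t\<in>T. cl' t = c'} = h \<and> (\<forall>t\<in>T. cl' t = c' \<longrightarrow> f (cs' c') \<le> f (site t)) \<and>
      (\<exists>k<n. d (cs' c') k \<le> R' \<and> (\<forall>t\<in>T. cl' t = c' \<longrightarrow> d (site t) k \<le> R'))" if "c' \<in> clusters cl'" for c'
  proof (cases "c' \<in> clusters cl")
    case True
    have same: "cl' t = c' \<longleftrightarrow> cl t = c'" if "t \<in> T" for t using old_eq[OF True] that by blast
    obtain k where k: "k < n" "d (cs c') k \<le> R" "\<forall>t\<in>T. cl t = c' \<longrightarrow> d (site t) k \<le> R"
      using old[OF True] by blast
    have "\<exists>k<n. d (cs' c') k \<le> R' \<and> (\<forall>t\<in>T. cl' t = c' \<longrightarrow> d (site t) k \<le> R')"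
      using k R same cl'(2)[OF True] by (intro exI[of _ k]) (auto intro: order.trans)
    then show ?thesis using old[OF True] old_eq[OF True] same cl'(2)[OF True] by auto
  next
    case False
    then have c': "c' = c" using cl'_new that by blast
    have "d (site t) j \<le> R'" if "t \<in> T" "cl' t = c" for t
    proof -
      have "cl t = 0"
      proof (rule ccontr)
        assume "cl t \<noteq> 0"
        then have "c \<in> clusters cl" using cl'(1) that by (auto simp: clusters_def)
        then show False using False c' by simp
      qed
      moreover have "c \<noteq> 0" using c by (simp add: clusters_def)
      ultimately show ?thesis using new[of t] that by (auto simp: near_def)
    qed
    then show ?thesis using fresh False j unfolding c' by blast
  qed
  \<comment> \<open>The client gave up its tokens of every cluster that it joined, but it still owns
    \<open>t0\<close>.\<close>
  show cJ: "c \<notin> J j"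
  proof
    assume cJ: "c \<in> J j"
    then have "c \<in> clusters cl" using inv_j(5)[OF j] by blast
    then have "cl t0 = c" using old_eq[of c] t0 c by blast
    then show False using inv_j(6)[OF j cJ t0(1)] by simp
  qed
  \<comment> \<open>From \<open>j\<close> to \<open>t0\<close>, from \<open>t0\<close> to the centre
    \<open>k\<close> of the cluster, and on to its site: three distances of at most
    \<open>R'\<close>, since the radii do not decrease.\<close>
  have dist: "d (cs' c) j \<le> 3 * R'"
  proof -
    obtain k where k: "k < n" "d (cs' c) k \<le> R'" "d (site t0) k \<le> R'"
      using new_clusters[OF c(1)] t0 c by blast
    have "d (cs' c) j \<le> d (site t0) j + d (site t0) k + d (cs' c) k"
      using new_clusters[OF c(1)] site[OF t0(2)] j k(1) by (intro hop) auto
    then show ?thesis using k t0 by linarith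
  qed
  have sum_eq: "(\<Sum>c\<in>J k. d (cs' c) k) = (\<Sum>c\<in>J k. d (cs c) k)" if "k < n" for k
    using inv_j(5)[OF that] cl'(2) by (intro sum.cong) auto
  let ?l = "dem j - rem j"
  have dr: "dem j - (rem j - 1) = Suc ?l" using remj inv_j(2)[OF j] by simp
  have own_sub: "own' k \<subseteq> own k" if "k < n" for k using own'[OF that] by auto
  \<comment> \<open>Fewer than \<open>h\<close> of the tokens still owned are closer, and at most
    \<open>?l * h\<close> tokens were given up before.\<close>
  have closer: "card {t \<in> own0 j. d (site t) j < R'} < (?l + 1) * h"
  proof -
    have fin0: "finite (own0 j)" using own0_subset finite_T finite_subset by blast
    have "{t \<in> own0 j. d (site t) j < R'} \<subseteq> {t \<in> own j. d (site t) j < R'} \<union> (own0 j - own j)"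
      by auto
    then have "card {t \<in> own0 j. d (site t) j < R'} \<le> card ({t \<in> own j. d (site t) j < R'} \<union> (own0 j - own j))"
      using fin0 finite_subset[OF inv_j(1)[OF j] fin0] by (intro card_mono) auto
    also have "\<dots> \<le> card {t \<in> own j. d (site t) j < R'} + card (own0 j - own j)" by (rule card_Un_le)
    also have "card {t \<in> own j. d (site t) j < R'} < h"
      using remj ownT[OF j] min j by (intro card_closer_less) auto
    finally show ?thesis using inv_j(7)[OF j] by (simp add: algebra_simps)
  qed
  have removed: "card (own0 j - own' j) \<le> h * Suc ?l"
  proof -
    have fin0: "finite (own0 j)" using own0_subset finite_T finite_subset by blast
    have "own0 j - own' j \<subseteq> (own0 j - own j) \<union> {t \<in> T. cl' t = c}"
      using own'[OF j] own0_subset by auto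
    then have "card (own0 j - own' j) \<le> card ((own0 j - own j) \<union> {t \<in> T. cl' t = c})"
      using fin0 finite_T by (intro card_mono) auto
    also have "\<dots> \<le> card (own0 j - own j) + card {t \<in> T. cl' t = c}" by (rule card_Un_le)
    also have "card {t \<in> T. cl' t = c} = h" using new_clusters[OF c(1)] by blast
    finally show ?thesis using inv_j(7)[OF j] by (simp add: algebra_simps)
  qed
  \<comment> \<open>Owned tokens and remaining demands only shrink, so no candidate of smaller
    radius can appear.\<close>
  have cand_mono: "candidate own rem i' k" if "candidate own' rem' i' k" "k < n" for i' k
  proof -
    have "near own' k (d i' k) \<subseteq> near own k (d i' k)" using own_sub[OF that(2)] by (auto simp: near_def)
    moreover have "finite (near own k (d i' k))"
      using finite_subset[OF ownT[OF that(2)] finite_T] by (simp add: near_def)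
    ultimately have "card (near own' k (d i' k)) \<le> card (near own k (d i' k))" using card_mono by blast
    then show ?thesis using that rem'[OF that(2)] unfolding candidate_def by (auto split: if_splits)
  qed
  let ?J = "J(j := insert c (J j))" and ?rad = "rad(j := (rad j)(?l := R'))"
  have client: "own' k \<subseteq> own0 k \<and> rem' k \<le> dem k \<and> card (?J k) = dem k - rem' k \<and> finite (?J k) \<and>
        ?J k \<subseteq> clusters cl' \<and> (\<forall>c\<in>?J k. \<forall>t\<in>own' k. cl' t \<noteq> c) \<and>
        card (own0 k - own' k) \<le> h * (dem k - rem' k) \<and>
        (\<Sum>c\<in>?J k. d (cs' c) k) \<le> 3 * (\<Sum>l<dem k - rem' k. ?rad k l) \<and>
        (\<forall>l<dem k - rem' k. card {t \<in> own0 k. d (site t) k < ?rad k l} < (l + 1) * h)"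
    if k: "k < n" for k
  proof -
    have disj: "cl' t \<noteq> c'" if "c' \<in> J k" "t \<in> own k" for c' t
    proof
      assume "cl' t = c'"
      moreover have "c' \<in> clusters cl" using inv_j(5)[OF k] that by blast
      moreover have "t \<in> T" using ownT[OF k] that by blast
      ultimately have "cl t = c'" using old_eq[of c'] by blast
      then show False using inv_j(6)[OF k that] by simp
    qed
    show ?thesis
    proof (cases "k = j")
      case True
      have "(\<Sum>l<Suc ?l. ((rad j)(?l := R')) l) = (\<Sum>l<?l. rad j l) + R'" by simp
      moreover have "(\<Sum>c'\<in>insert c (J j). d (cs' c') j) = d (cs' c) j + (\<Sum>c\<in>J j. d (cs c) j)"
        using cJ inv_j(4)[OF j] sum_eq[OF j] by simp
      ultimately have "(\<Sum>c'\<in>insert c (J j). d (cs' c') j) \<le> 3 * (\<Sum>l<Suc ?l. ((rad j)(?l := R')) l)"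
        using dist inv_j(8)[OF j] by simp
      moreover have "card {t \<in> own0 j. d (site t) j < ((rad j)(?l := R')) l} < (l + 1) * h" if "l < Suc ?l" for l
        using that closer inv_j(9)[OF j, of l] by (cases "l = ?l") auto
      moreover have "\<forall>c'\<in>insert c (J j). \<forall>t\<in>own' j. cl' t \<noteq> c'"
        using disj own'[OF j] True by auto
      moreover have "card (insert c (J j)) = Suc ?l" using cJ inv_j(3,4)[OF j] by simp
      moreover have "insert c (J j) \<subseteq> clusters cl'" using c(1) cl_sub inv_j(5)[OF j] by blast
      moreover have "own' j \<subseteq> own0 j" using own_sub[OF j] inv_j(1)[OF j] by blast
      ultimately show ?thesis
        using True removed rem'[OF j] dr inv_j(2,4)[OF j] by auto
    next
      case False
      have "own' k = own k" "rem' k = rem k" using False own'[OF k] rem'[OF k] by auto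
      then show ?thesis
        using False inv_j[OF k] disj sum_eq[OF k] cl_sub by auto
    qed
  qed
  show "round_inv own' rem' cl' cs' ?J R' ?rad"
    unfolding round_inv_def
  proof (intro conjI ballI allI impI)
    fix i' j'
    assume "i' < m" "j' < n" "candidate own' rem' i' j'"
    then show "R' \<le> d i' j'" using min cand_mono by blast
  qed (use client new_clusters in auto)
qed

text \<open>Every cluster is charged to its own \<open>h\<close> tokens, disjoint from those of
  other clusters. A connection is charged through its radius, and different clients may charge the
  same token, each at its own distance.\<close>

lemma round_final:
  assumes inv: "round_inv own rem cl cs J R rad" and empty: "\<And>j. j < n \<Longrightarrow> rem j = 0"
  shows "int h * (\<Sum>c\<in>clusters cl. f (cs c)) \<le> (\<Sum>t\<in>{t \<in> T. cl t \<noteq> 0}. f (site t))"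
    and "j < n \<Longrightarrow> int h * (\<Sum>c\<in>J j. d (cs c) j) \<le> 3 * (\<Sum>t\<in>own0 j. d (site t) j)"
proof -
  have cl: "card {t\<in>T. cl t = c} = h" "\<And>t. t \<in> T \<Longrightarrow> cl t = c \<Longrightarrow> f (cs c) \<le> f (site t)"
    if "c \<in> clusters cl" for c
    using inv that unfolding round_inv_def by blast+
  have "int h * (\<Sum>c\<in>clusters cl. f (cs c)) = (\<Sum>c\<in>clusters cl. \<Sum>t\<in>{t\<in>T. cl t = c}. f (cs c))"
    using cl(1) by (simp add: sum_distrib_left)
  also have "\<dots> \<le> (\<Sum>c\<in>clusters cl. \<Sum>t\<in>{t\<in>T. cl t = c}. f (site t))"
    using cl(2) by (intro sum_mono) auto
  also have "\<dots> = (\<Sum>t\<in>(\<Union>c\<in>clusters cl. {t\<in>T. cl t = c}). f (site t))"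
    using finite_clusters finite_T by (intro sum.UNION_disjoint[symmetric]) auto
  also have "(\<Union>c\<in>clusters cl. {t\<in>T. cl t = c}) = {t \<in> T. cl t \<noteq> 0}"
    by (auto simp: clusters_def)
  finally show "int h * (\<Sum>c\<in>clusters cl. f (cs c)) \<le> (\<Sum>t\<in>{t \<in> T. cl t \<noteq> 0}. f (site t))" .
  assume j: "j < n"
  have fin0: "finite (own0 j)" using own0_subset finite_T finite_subset by blast
  have nn: "0 \<le> d (site t) j" if "t \<in> own0 j" for t
    using that own0_subset site d_nonneg j by blast
  have conn: "(\<Sum>c\<in>J j. d (cs c) j) \<le> 3 * (\<Sum>l<dem j. rad j l)"
    and rad: "\<And>l. l < dem j \<Longrightarrow> card {t \<in> own0 j. d (site t) j < rad j l} < (l + 1) * h"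
    using inv j empty[OF j] unfolding round_inv_def by auto
  have "int h * (\<Sum>l<dem j. rad j l) \<le> (\<Sum>t\<in>own0 j. d (site t) j)"
  proof (cases "dem j = 0")
    case True
    then show ?thesis using nn by (simp add: sum_nonneg)
  next
    case False
    \<comment> \<open>Owning \<open>2 * h\<close> tokens per unit of demand provides the additional
      block of \<open>h\<close> tokens for the quantile bound.\<close>
    then have "h * (dem j + 1) \<le> 2 * h * dem j" by (cases "dem j") auto
    then have "h * (dem j + 1) \<le> card (own0 j)" using own0_card[OF j] by linarith
    with fin0 nn show ?thesis using rad by (rule quantile_sum_le)
  qed
  moreover have "int h * (\<Sum>c\<in>J j. d (cs c) j) \<le> int h * (3 * (\<Sum>l<dem j. rad j l))"
    using conn by (intro mult_left_mono) auto
  ultimately show "int h * (\<Sum>c\<in>J j. d (cs c) j) \<le> 3 * (\<Sum>t\<in>own0 j. d (site t) j)"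
    by (simp add: mult.left_commute)
qed

end

section \<open>Greedy augmentation\<close>

text \<open>
  An upper bound for the final cost of greedy augmentation, started with connection cost \<open>A\<close>,
  against a fractional solution with facility cost \<open>F\<close> and connection cost \<open>C\<close>. It is
  concave with derivative \<open>min 1 (F / (A - C))\<close>.
\<close>

definition aug_bound :: "real \<Rightarrow> real \<Rightarrow> real \<Rightarrow> real" where
  "aug_bound F C A = (if A - C \<le> F then A else C + F + F * ln ((A - C) / F))"

text \<open>By concavity, lowering \<open>A\<close> by \<open>g\<close> lowers the bound by at least
  \<open>g\<close> times the slope at \<open>A\<close>, that is by \<open>g\<close> or by
  \<open>g * F / (A - C)\<close>; in both cases the hypotheses make this at least \<open>c\<close>.
  In the calculation, \<open>ln t \<le> t - 1\<close> takes the place of concavity.\<close>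

lemma aug_bound_step:
  assumes F: "0 < F" and g: "0 \<le> c" "c \<le> g" "c * (A - C) \<le> g * F"
  shows "c + aug_bound F C (A - g) \<le> aug_bound F C A"
proof (cases "A - C \<le> F")
  case True
  then show ?thesis using g by (simp add: aug_bound_def)
next
  case False
  define a where "a = A - C"
  have a: "F < a" "0 < a" using False F by (auto simp: a_def)
  have c: "c \<le> g * F / a" using g(3) a by (simp add: a_def le_divide_eq)
  show ?thesis
  proof (cases "a - g \<le> F")
    \<comment> \<open>The step crosses the point \<open>A - C = F\<close> where the two branches
      meet.\<close>
    case True
    define z where "z = a / F"
    have z: "1 < z" "a = z * F" using a F by (auto simp: z_def)
    have "(F * (z - 1)) * (1 - 1 / z) \<le> g * (1 - 1 / z)"
      using True z F by (intro mult_right_mono) (auto simp: algebra_simps)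
    moreover have "g * F / a = g / z" using z F by simp
    ultimately have "c - g \<le> - ((F * (z - 1)) * (1 - 1 / z))"
      using c by (simp add: algebra_simps)
    then have "c + (A - g) \<le> C + z * F - (F * (z - 1)) * (1 - 1 / z)"
      using z(2) by (simp add: a_def)
    also have "\<dots> = C + F + F * (1 - 1 / z)" using z by (simp add: field_simps)
    also have "\<dots> \<le> C + F + F * ln z"
    proof -
      have "ln (1 / z) \<le> 1 / z - 1" using z by (intro ln_le_minus_one) simp
      then have "1 - 1 / z \<le> ln z" using z by (simp add: ln_div)
      then show ?thesis using F by simp
    qed
    finally show ?thesis using False True by (simp add: aug_bound_def a_def z_def algebra_simps)
  next
    case gF: False
    then have pos: "0 < a - g" using F by simp
    have "ln ((a - g) / a) \<le> (a - g) / a - 1" using pos a by (intro ln_le_minus_one) simp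
    then have "g / a \<le> ln a - ln (a - g)" using pos a by (simp add: ln_div field_simps)
    then have "F * (g / a) \<le> F * (ln a - ln (a - g))" using F by (intro mult_left_mono) auto
    then have "c + F * ln (a - g) \<le> F * ln a" using c by (simp add: algebra_simps)
    then have "c + F * ln ((a - g) / F) \<le> F * ln (a / F)"
      using pos a F by (simp add: ln_div algebra_simps)
    then show ?thesis using False gF by (simp add: aug_bound_def a_def algebra_simps)
  qed
qed

lemma aug_bound_mono:
  assumes F: "0 < F" and AB: "A \<le> B"
  shows "aug_bound F C A \<le> aug_bound F C B"
proof (cases "B - C \<le> F")
  case True
  then show ?thesis using AB by (simp add: aug_bound_def)
next
  case B: False
  show ?thesis
  proof (cases "A - C \<le> F")
    case True
    have "0 \<le> F * ln ((B - C) / F)" using B F by (intro mult_nonneg_nonneg ln_ge_zero) auto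
    then show ?thesis using True B by (simp add: aug_bound_def)
  next
    case False
    have "ln ((A - C) / F) \<le> ln ((B - C) / F)"
      using False B AB F by (subst ln_le_cancel_iff) (auto simp: divide_right_mono)
    then show ?thesis using False B F by (simp add: aug_bound_def)
  qed
qed

text \<open>In terms of \<open>z = 5 * C / F\<close>, the tangent of \<open>ln\<close> at
  \<open>exp 0.96\<close> gives \<open>ln z \<le> z / exp 0.96 - 0.04\<close>. Then \<open>F\<close>
  has the coefficient \<open>2 + 1 - 0.04 = 2.96\<close>, and \<open>C\<close> has at most
  \<open>1 + 5 / 2.59\<close>, which is below 2.94; the point 0.96 nearly balances the two.\<close>

lemma aug_bound_ratio:
  assumes F: "0 < F" and C: "0 \<le> C"
  shows "2 * F + aug_bound F C (6 * C) \<le> 2.96 * (F + C)"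
proof (cases "6 * C - C \<le> F")
  case True
  then show ?thesis using C by (simp add: aug_bound_def)
next
  case False
  define z where "z = 5 * C / F"
  have z: "0 < z" "F * z = 5 * C" using False F by (auto simp: z_def)
  \<comment> \<open>The quadratic Taylor bound at 0.96 is too weak, so it is taken at 0.24 and
    raised to the fourth power.\<close>
  have e: "2.59 \<le> exp (0.96 :: real)"
  proof -
    have "1 + 0.24 + 0.24\<^sup>2 / 2 \<le> exp (0.24 :: real)"
      by (rule exp_lower_Taylor_quadratic) simp
    then have "(1.2688 :: real) ^ 4 \<le> exp 0.24 ^ 4"
      by (intro power_mono) (auto simp: power2_eq_square)
    also have "exp (0.24 :: real) ^ 4 = exp 0.96"
      by (simp add: exp_of_nat_mult[symmetric])
    finally show ?thesis by (simp add: power4_eq_xxxx)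
  qed
  have "ln (z / exp 0.96) \<le> z / exp 0.96 - 1" using z by (intro ln_le_minus_one) simp
  then have "ln z \<le> z / exp 0.96 - 0.04" using z by (simp add: ln_div)
  also have "\<dots> \<le> z / 2.59 - 0.04"
    using e z by (intro diff_right_mono divide_left_mono) auto
  finally have "F * ln z \<le> F * (z / 2.59 - 0.04)" using F by (intro mult_left_mono) auto
  also have "\<dots> = 5 * C / 2.59 - 0.04 * F" using z(2) by (simp add: algebra_simps)
  finally have "F * ln z \<le> 5 * C / 2.59 - 0.04 * F" .
  moreover have "aug_bound F C (6 * C) = C + F + F * ln z"
    using False by (simp add: aug_bound_def z_def)
  ultimately show ?thesis using C by simp
qed

section \<open>Augmentation of an integral solution\<close>

locale augmentation = ftfp_costs +
  fixes dem :: "nat \<Rightarrow> int" and xs :: "nat \<Rightarrow> nat \<Rightarrow> real" and ys :: "nat \<Rightarrow> real"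
  assumes lp: "frac_feasible (\<lambda>j. real_of_int (dem j)) xs ys"
begin

text \<open>Demands are met with equality, so that the connection cost is at most the sum of
  \<open>dem j * D j\<close> for the farthest distances \<open>D\<close>. Exchanging one connection
  for another preserves this.\<close>

definition int_solution :: "(nat \<Rightarrow> nat \<Rightarrow> int) \<Rightarrow> (nat \<Rightarrow> int) \<Rightarrow> bool" where
  "int_solution x y \<longleftrightarrow> (\<forall>i<m. 0 \<le> y i) \<and> (\<forall>i<m. \<forall>j<n. 0 \<le> x i j \<and> x i j \<le> y i) \<and>
     (\<forall>j<n. (\<Sum>i<m. x i j) = dem j)"

definition int_conn :: "(nat \<Rightarrow> nat \<Rightarrow> int) \<Rightarrow> int" where
  "int_conn x = (\<Sum>j<n. \<Sum>i<m. d i j * x i j)"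

definition int_open :: "(nat \<Rightarrow> int) \<Rightarrow> int" where
  "int_open y = (\<Sum>i<m. f i * y i)"

definition farthest :: "(nat \<Rightarrow> nat \<Rightarrow> int) \<Rightarrow> (nat \<Rightarrow> int) \<Rightarrow> bool" where
  "farthest x D \<longleftrightarrow> (\<forall>j<n. 0 \<le> D j \<and> (\<forall>i<m. 0 < x i j \<longrightarrow> d i j \<le> D j))"

definition gain :: "(nat \<Rightarrow> int) \<Rightarrow> nat \<Rightarrow> int" where
  "gain D i = (\<Sum>j<n. max 0 (D j - d i j))"

definition rank :: "nat \<Rightarrow> nat \<Rightarrow> int" where
  "rank j i = int (card {i'. i' < m \<and> d i' j < d i j})"

text \<open>Bounds the number of steps. The connection cost may be exponential in the input size,
  whereas ranks are at most the number of sites, and a client always moves to a strictly closer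
  site.\<close>

definition aug_potential :: "(nat \<Rightarrow> nat \<Rightarrow> int) \<Rightarrow> int" where
  "aug_potential x = (\<Sum>j<n. \<Sum>i<m. rank j i * x i j)"

text \<open>The facility cost of the fractional solution may be 0, where the quotient inside
  \<open>aug_bound\<close> breaks down. So the invariant is stated for all positive \<open>F\<close>
  from this cost upwards, and the limit is taken at the end.\<close>

definition aug_inv :: "(nat \<Rightarrow> nat \<Rightarrow> int) \<Rightarrow> (nat \<Rightarrow> int) \<Rightarrow> bool" where
  "aug_inv x y \<longleftrightarrow> int_solution x y \<and>
     (\<forall>F > 0. open_part ys \<le> F \<longrightarrow> real_of_int (int_open y) + aug_bound F (conn_part xs) (real_of_int (int_conn x))
        \<le> 2 * F + aug_bound F (conn_part xs) (6 * conn_part xs))"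

lemma aug_init:
  assumes "int_solution x y" "real_of_int (int_open y) \<le> 2 * open_part ys"
    "real_of_int (int_conn x) \<le> 6 * conn_part xs"
  shows "aug_inv x y"
  unfolding aug_inv_def using assms
  by (auto intro!: add_mono aug_bound_mono)

text \<open>The client \<open>j\<close> has \<open>dem j\<close> connections of length at most
  \<open>D j\<close>, and \<open>D\<close> may be used as prices in the duality bound, whether
  feasible or not.\<close>

lemma conn_le_farthest:
  assumes sol: "int_solution x y" and far: "farthest x D"
  shows "real_of_int (int_conn x) \<le> (\<Sum>i<m. ys i * real_of_int (gain D i)) + conn_part xs"
proof -
  have "int_conn x \<le> (\<Sum>j<n. dem j * D j)"
    unfolding int_conn_def
  proof (rule sum_mono)
    fix j
    assume "j \<in> {..<n}"
    then have j: "j < n" by simp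
    have "(\<Sum>i<m. d i j * x i j) \<le> (\<Sum>i<m. D j * x i j)"
    proof (rule sum_mono)
      fix i
      assume "i \<in> {..<m}"
      then have i: "i < m" by simp
      have x: "0 \<le> x i j" using sol i j by (auto simp: int_solution_def)
      show "d i j * x i j \<le> D j * x i j"
        using x far i j by (cases "x i j = 0") (auto simp: farthest_def intro!: mult_right_mono)
    qed
    also have "\<dots> = dem j * D j"
      using sol j by (simp add: sum_distrib_left[symmetric] int_solution_def)
    finally show "(\<Sum>i<m. d i j * x i j) \<le> dem j * D j" .
  qed
  then have "real_of_int (int_conn x) \<le> (\<Sum>j<n. real_of_int (dem j) * real_of_int (D j))"
    by (metis (mono_tags, lifting) of_int_le_iff of_int_mult of_int_sum sum.cong)
  also have "\<dots> \<le> (\<Sum>i<m. ys i * (\<Sum>j<n. max 0 (real_of_int (D j) - real_of_int (d i j)))) + conn_part xs"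
    using far by (intro dual_bound[OF lp]) (simp add: farthest_def)
  also have "\<dots> = (\<Sum>i<m. ys i * real_of_int (gain D i)) + conn_part xs"
    by (simp add: gain_def of_int_max)
  finally show ?thesis .
qed

text \<open>By duality, \<open>int_conn x - conn_part xs\<close> is at most the sum of all
  \<open>ys i * gain D i\<close>. Since no site has a better ratio of gain to cost than
  \<open>b\<close>, this sum times \<open>f b\<close> is at most \<open>gain D b\<close> times the
  fractional facility cost, which is the premise of \<open>aug_bound_step\<close>.\<close>

lemma aug_step:
  assumes inv: "aug_inv x y" and far: "farthest x D" and b: "b < m" "f b < gain D b"
    and opt: "\<And>i. i < m \<Longrightarrow> f i < gain D i \<Longrightarrow> f b * gain D i \<le> f i * gain D b"
    and w: "\<And>j. j < n \<Longrightarrow> d b j < D j \<Longrightarrow> w j < m \<and> 0 < x (w j) j \<and> d (w j) j = D j"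
    and y': "\<And>i. i < m \<Longrightarrow> y' i = y i + of_bool (i = b)"
    and x': "\<And>i j. i < m \<Longrightarrow> j < n \<Longrightarrow>
      x' i j = x i j - of_bool (d b j < D j \<and> i = w j) + of_bool (d b j < D j \<and> i = b)"
  shows "aug_inv x' y'" and "aug_potential x' < aug_potential x"
proof -
  have sol: "int_solution x y" using inv by (simp add: aug_inv_def)
  have move: "(\<Sum>i<m. g i * x' i j) = (\<Sum>i<m. g i * x i j) - (if d b j < D j then g (w j) - g b else 0)"
    if j: "j < n" for g :: "nat \<Rightarrow> int" and j
  proof (cases "d b j < D j")
    case True
    have "(\<Sum>i<m. g i * x' i j) = (\<Sum>i<m. g i * x i j - (if i = w j then g i else 0) + (if i = b then g i else 0))"
      using True j by (intro sum.cong) (auto simp: x' algebra_simps)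
    also have "\<dots> = (\<Sum>i<m. g i * x i j) - g (w j) + g b"
      using w[OF j True] b by (simp add: sum.distrib sum_subtractf)
    finally show ?thesis using True by simp
  next
    case False
    then show ?thesis using j by (auto simp: x' intro!: sum.cong)
  qed
  have conn: "int_conn x' = int_conn x - gain D b"
  proof -
    have "int_conn x' = (\<Sum>j<n. (\<Sum>i<m. d i j * x i j) - max 0 (D j - d b j))"
      unfolding int_conn_def using move w by (intro sum.cong) auto
    then show ?thesis by (simp add: int_conn_def gain_def sum_subtractf)
  qed
  have opn: "int_open y' = int_open y + f b"
  proof -
    have "int_open y' = (\<Sum>i<m. f i * y i + (if i = b then f i else 0))"
      unfolding int_open_def by (intro sum.cong) (auto simp: y' algebra_simps)
    then show ?thesis using b by (simp add: int_open_def sum.distrib)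
  qed
  have sol': "int_solution x' y'"
    unfolding int_solution_def
  proof (intro conjI allI impI)
    fix i
    assume i: "i < m"
    show "0 \<le> y' i" using sol i y' by (simp add: int_solution_def)
    fix j
    assume j: "j < n"
    have xy: "0 \<le> x i j" "x i j \<le> y i" using sol i j by (auto simp: int_solution_def)
    show "0 \<le> x' i j" using xy w[OF j] by (auto simp: x' i j)
    show "x' i j \<le> y' i" using xy by (auto simp: x' y' i j)
  next
    fix j
    assume j: "j < n"
    show "(\<Sum>i<m. x' i j) = dem j" using move[OF j, of "\<lambda>_. 1"] sol j by (simp add: int_solution_def)
  qed
  have fb: "0 \<le> f b" using f_nonneg b by blast
  have nn: "0 \<le> gain D i" for i unfolding gain_def by (intro sum_nonneg) auto
  \<comment> \<open>A site that does not pay off gains at most what it costs, so it cannot beat the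
    ratio of \<open>b\<close> either.\<close>
  have ratio: "f b * gain D i \<le> f i * gain D b" if i: "i < m" for i
  proof (cases "f i < gain D i")
    case True
    then show ?thesis using opt i by blast
  next
    case False
    have "f b * gain D i \<le> gain D b * f i"
      using False b nn fb f_nonneg[OF i] by (intro mult_mono) auto
    then show ?thesis by (simp add: mult.commute)
  qed
  have gap: "real_of_int (f b) * (real_of_int (int_conn x) - conn_part xs) \<le> real_of_int (gain D b) * open_part ys"
  proof -
    have "real_of_int (f b) * (real_of_int (int_conn x) - conn_part xs)
        \<le> real_of_int (f b) * (\<Sum>i<m. ys i * real_of_int (gain D i))"
      using conn_le_farthest[OF sol far] fb by (intro mult_left_mono) auto
    also have "\<dots> = (\<Sum>i<m. ys i * real_of_int (f b * gain D i))"
      by (simp add: sum_distrib_left mult.commute mult.left_commute)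
    also have "\<dots> \<le> (\<Sum>i<m. ys i * real_of_int (f i * gain D b))"
      using ratio lp by (intro sum_mono mult_left_mono) (auto simp: frac_feasible_def simp del: of_int_mult)
    also have "\<dots> = real_of_int (gain D b) * open_part ys"
      unfolding open_part_def sum_distrib_left by (intro sum.cong) simp_all
    finally show ?thesis .
  qed
  have "real_of_int (int_open y') + aug_bound F (conn_part xs) (real_of_int (int_conn x'))
        \<le> 2 * F + aug_bound F (conn_part xs) (6 * conn_part xs)" if F: "0 < F" "open_part ys \<le> F" for F
  proof -
    have "real_of_int (gain D b) * open_part ys \<le> real_of_int (gain D b) * F"
      using F(2) nn by (intro mult_left_mono) auto
    then have "real_of_int (f b) * (real_of_int (int_conn x) - conn_part xs) \<le> real_of_int (gain D b) * F"
      using gap by linarith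
    then have "real_of_int (f b) + aug_bound F (conn_part xs) (real_of_int (int_conn x) - real_of_int (gain D b))
        \<le> aug_bound F (conn_part xs) (real_of_int (int_conn x))"
      using F fb b by (intro aug_bound_step) auto
    moreover have "real_of_int (int_open y) + aug_bound F (conn_part xs) (real_of_int (int_conn x))
        \<le> 2 * F + aug_bound F (conn_part xs) (6 * conn_part xs)"
      using inv F by (simp add: aug_inv_def)
    ultimately show ?thesis by (simp add: conn opn)
  qed
  then show "aug_inv x' y'" using sol' by (simp add: aug_inv_def)
  have rank_less: "rank j b < rank j (w j)" if "j < n" "d b j < D j" for j
  proof -
    have "{i'. i' < m \<and> d i' j < d b j} \<subset> {i'. i' < m \<and> d i' j < d (w j) j}"
      using w[OF that] that b by auto
    then show ?thesis unfolding rank_def by (simp add: psubset_card_mono)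
  qed
  \<comment> \<open>The gain of \<open>b\<close> exceeds a nonnegative cost, so at least one client
    moves and the potential drops strictly.\<close>
  have "\<exists>j<n. d b j < D j"
  proof (rule ccontr)
    assume "\<not> ?thesis"
    then have "D j \<le> d b j" if "j < n" for j using that not_less by blast
    then have "max 0 (D j - d b j) = 0" if "j < n" for j using that by simp
    then have "gain D b = 0" unfolding gain_def by (intro sum.neutral) simp
    then show False using b fb by simp
  qed
  then show "aug_potential x' < aug_potential x"
    unfolding aug_potential_def using move rank_less
    by (intro sum_strict_mono_ex1) (auto intro: less_imp_le)
qed

text \<open>Once no site pays off, the duality bound yields
  \<open>int_conn x \<le> open_part ys + conn_part xs\<close>, so \<open>aug_bound\<close> is in its
  linear branch and equals the connection cost.\<close>

lemma aug_final:
  assumes inv: "aug_inv x y" and far: "farthest x D" and stop: "\<And>i. i < m \<Longrightarrow> gain D i \<le> f i"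
  shows "real_of_int (int_open y) + real_of_int (int_conn x) \<le> 2.96 * (open_part ys + conn_part xs)"
proof -
  have sol: "int_solution x y" using inv by (simp add: aug_inv_def)
  have "(\<Sum>i<m. ys i * real_of_int (gain D i)) \<le> (\<Sum>i<m. ys i * real_of_int (f i))"
    using stop lp by (intro sum_mono mult_left_mono) (auto simp: frac_feasible_def)
  also have "\<dots> = open_part ys" by (simp add: open_part_def mult.commute)
  finally have conn: "real_of_int (int_conn x) \<le> open_part ys + conn_part xs"
    using conn_le_farthest[OF sol far] by linarith
  have C: "0 \<le> conn_part xs" "0 \<le> open_part ys"
    using conn_part_nonneg[OF lp] open_part_nonneg[OF lp] by auto
  have "real_of_int (int_open y) + real_of_int (int_conn x) \<le> 2.96 * (open_part ys + conn_part xs) + e"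
    if "0 < e" for e
  proof -
    \<comment> \<open>Positive even if the fractional facility cost is 0; the excess contributes
      exactly \<open>e\<close> after multiplication by 2.96.\<close>
    define F where "F = open_part ys + e / 2.96"
    have F: "0 < F" "open_part ys \<le> F" using C that by (auto simp: F_def add_nonneg_pos)
    have "real_of_int (int_open y) + aug_bound F (conn_part xs) (real_of_int (int_conn x))
        \<le> 2 * F + aug_bound F (conn_part xs) (6 * conn_part xs)"
      using inv F by (simp add: aug_inv_def)
    also have "\<dots> \<le> 2.96 * (F + conn_part xs)" using F C by (intro aug_bound_ratio)
    also have "\<dots> = 2.96 * (open_part ys + conn_part xs) + e" by (simp add: F_def algebra_simps)
    finally show ?thesis using conn F by (simp add: aug_bound_def)
  qed
  then show ?thesis by (rule field_le_epsilon)
qed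

lemma aug_potential_bounds:
  assumes "int_solution x y" "\<And>j. j < n \<Longrightarrow> dem j \<le> 2 * int m"
  shows "0 \<le> aug_potential x" "aug_potential x \<le> int n * (int m * (2 * int m))"
proof -
  have x: "0 \<le> x i j" if "i < m" "j < n" for i j using assms(1) that by (auto simp: int_solution_def)
  show "0 \<le> aug_potential x"
    unfolding aug_potential_def rank_def using x by (intro sum_nonneg mult_nonneg_nonneg) auto
  have "aug_potential x \<le> (\<Sum>j<n. int m * (2 * int m))"
    unfolding aug_potential_def
  proof (rule sum_mono)
    fix j
    assume "j \<in> {..<n}"
    then have j: "j < n" by simp
    have rank: "rank j i \<le> int m" for i
      unfolding rank_def using card_mono[of "{..<m}" "{i'. i' < m \<and> d i' j < d i j}"] by auto
    have "(\<Sum>i<m. rank j i * x i j) \<le> (\<Sum>i<m. int m * x i j)"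
      using rank x j by (intro sum_mono mult_right_mono) auto
    also have "\<dots> = int m * dem j"
      using assms(1) j by (simp add: sum_distrib_left[symmetric] int_solution_def)
    also have "\<dots> \<le> int m * (2 * int m)" using assms(2)[OF j] by (intro mult_left_mono) auto
    finally show "(\<Sum>i<m. rank j i * x i j) \<le> int m * (2 * int m)" .
  qed
  then show "aug_potential x \<le> int n * (int m * (2 * int m))" by simp
qed

end

section \<open>The program\<close>

fun seq :: "sprog list \<Rightarrow> sprog" where
  "seq [] = SSkip"
| "seq (p # ps) = SSeq p (seq ps)"

lemma writes_schemes [simp]:
  "writes (sum_prog acc v len e) = {acc, v}"
  "writes (map_prog a v len idx e) = {a, v}"
  "writes (argmin_prog v len body num den) = {best_idx, best_num, best_den, v} \<union> writes body"
  by (auto simp: sum_prog_def map_prog_def argmin_prog_def)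

abbreviation "sites_expr \<equiv> Read 0 (Const 0)"
abbreviation "clients_expr \<equiv> Read 0 (Const 1)"
abbreviation "half_expr \<equiv> Const 100000 \<odot> (clients_expr \<oplus> Const 1)"
abbreviation "unit_expr \<equiv> Const 200000 \<odot> (clients_expr \<oplus> Const 1)"
abbreviation "cap_expr \<equiv> Const 400000 \<odot> (clients_expr \<oplus> Const 1)"
abbreviation "tokens_expr \<equiv> sites_expr \<odot> cap_expr"
abbreviation "row_expr k \<equiv> k \<oslash> clients_expr"
abbreviation "col_expr k \<equiv> k \<ominus> (clients_expr \<odot> (k \<oslash> clients_expr))"
abbreviation "at_expr a i j \<equiv> Read a (i \<odot> clients_expr \<oplus> j)"

text \<open>
  Arrays: 20 common denominator, 21 product of the demands, 22 and 23 integral costs, 24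
  quotients of 21 by the demands.
\<close>

definition prod_prog :: "nat \<Rightarrow> nat \<Rightarrow> expr \<Rightarrow> expr \<Rightarrow> sprog" where
  "prod_prog acc v len e = For v len (Asg acc (Const 0) (scalar acc \<odot> e))"

lemma writes_prod_prog [simp]: "writes (prod_prog acc v len e) = {acc, v}"
  by (auto simp: prod_prog_def)

lemma sem_prod_prog:
  assumes "acc \<noteq> v" "acc \<notin> reads e"
  shows "sem (prod_prog acc v len e) \<sigma> acc 0 =
    \<sigma> acc 0 * (\<Prod>j<nat (value_of \<sigma> len). value_of (store \<sigma> v 0 (int j)) e)"
proof -
  let ?P = "\<lambda>k. \<sigma> acc 0 * (\<Prod>j<k. value_of (store \<sigma> v 0 (int j)) e)"
  define N where "N = nat (value_of \<sigma> len)"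
  let ?Inv = "\<lambda>k \<tau>. \<tau> = store (store \<sigma> v 0 (int k)) acc 0 (?P k)"
  have "?Inv N (loop v N (sem (Asg acc (Const 0) (scalar acc \<odot> e))) \<sigma>)"
  proof (rule loop_invariant[where Inv = ?Inv])
    show "?Inv 0 (store \<sigma> v 0 0)"
      using assms by (simp add: store_def fun_eq_iff)
  next
    fix k \<tau>
    assume \<tau>: "?Inv k \<tau>"
    have "sem (Asg acc (Const 0) (scalar acc \<odot> e)) \<tau> = store (store \<sigma> v 0 (int k)) acc 0 (?P (Suc k))"
      using assms by (simp add: \<tau> mult.assoc)
    then show "?Inv (Suc k) (store (sem (Asg acc (Const 0) (scalar acc \<odot> e)) \<tau>) v 0 (int (Suc k)))"
      by (simp add: store_commute[OF assms(1)])
  qed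
  then show ?thesis by (simp add: prod_prog_def N_def)
qed

section \<open>Integral costs over a common denominator\<close>

definition prep_prog :: sprog where
  "prep_prog = seq [
     Asg 20 (Const 0) (Const 1),
     prod_prog 20 10 sites_expr (Read 2 (scalar 10)),
     prod_prog 20 10 (sites_expr \<odot> clients_expr) (Read 4 (scalar 10)),
     map_prog 22 10 sites_expr (scalar 10)
       (Read 1 (scalar 10) \<odot> (scalar 20 \<oslash> Read 2 (scalar 10))),
     map_prog 23 10 (sites_expr \<odot> clients_expr) (scalar 10)
       (Read 3 (scalar 10) \<odot> (scalar 20 \<oslash> Read 4 (scalar 10))),
     Asg 21 (Const 0) (Const 1),
     prod_prog 21 10 clients_expr (Read 5 (scalar 10)),
     map_prog 24 10 clients_expr (scalar 10) (scalar 21 \<oslash> Read 5 (scalar 10)),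
     map_prog 30 10 clients_expr (scalar 10) (Read 24 (scalar 10))]"

text \<open>The product \<open>L\<close> of all denominators takes the place of their least common
  multiple: its bit length is at most the sum of theirs, hence still small enough. The same holds
  for the product \<open>R\<close> of the demands.\<close>

lemma sem_prep_prog:
  assumes \<sigma>0: "\<sigma> 0 0 = int m" "\<sigma> 0 1 = int n"
  defines "\<sigma>' \<equiv> sem prep_prog \<sigma>"
    and "L \<equiv> (\<Prod>i<m. \<sigma> 2 (int i)) * (\<Prod>k<m * n. \<sigma> 4 (int k))"
    and "R \<equiv> (\<Prod>j<n. \<sigma> 5 (int j))"
  shows "i < m \<Longrightarrow> \<sigma>' 22 (int i) = \<sigma> 1 (int i) * (L div \<sigma> 2 (int i))"
    and "k < m * n \<Longrightarrow> \<sigma>' 23 (int k) = \<sigma> 3 (int k) * (L div \<sigma> 4 (int k))"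
    and "\<sigma>' 21 0 = R"
    and "j < n \<Longrightarrow> \<sigma>' 24 (int j) = R div \<sigma> 5 (int j)"
    and "j < n \<Longrightarrow> \<sigma>' 30 (int j) = R div \<sigma> 5 (int j)"
    and "b \<notin> {10, 20, 21, 22, 23, 24, 30} \<Longrightarrow> \<sigma>' b = \<sigma> b"
proof -
  define \<sigma>1 where "\<sigma>1 = sem (Asg 20 (Const 0) (Const 1)) \<sigma>"
  define \<sigma>2 where "\<sigma>2 = sem (prod_prog 20 10 sites_expr (Read 2 (scalar 10))) \<sigma>1"
  define \<sigma>3 where "\<sigma>3 = sem (prod_prog 20 10 (sites_expr \<odot> clients_expr) (Read 4 (scalar 10))) \<sigma>2"
  define p4 where "p4 = map_prog 22 10 sites_expr (scalar 10)
       (Read 1 (scalar 10) \<odot> (scalar 20 \<oslash> Read 2 (scalar 10)))"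
  define \<sigma>4 where "\<sigma>4 = sem p4 \<sigma>3"
  define p5 where "p5 = map_prog 23 10 (sites_expr \<odot> clients_expr) (scalar 10)
       (Read 3 (scalar 10) \<odot> (scalar 20 \<oslash> Read 4 (scalar 10)))"
  define \<sigma>5 where "\<sigma>5 = sem p5 \<sigma>4"
  define \<sigma>6 where "\<sigma>6 = sem (Asg 21 (Const 0) (Const 1)) \<sigma>5"
  define \<sigma>7 where "\<sigma>7 = sem (prod_prog 21 10 clients_expr (Read 5 (scalar 10))) \<sigma>6"
  define p8 where "p8 = map_prog 24 10 clients_expr (scalar 10) (scalar 21 \<oslash> Read 5 (scalar 10))"
  define \<sigma>8 where "\<sigma>8 = sem p8 \<sigma>7"
  define p9 where "p9 = map_prog 30 10 clients_expr (scalar 10) (Read 24 (scalar 10))"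
  have \<sigma>': "\<sigma>' = sem p9 \<sigma>8"
    by (simp add: \<sigma>'_def prep_prog_def \<sigma>1_def \<sigma>2_def \<sigma>3_def \<sigma>4_def \<sigma>5_def \<sigma>6_def \<sigma>7_def \<sigma>8_def
        p4_def p5_def p8_def p9_def)
  have f1: "\<sigma>1 b = \<sigma> b" if "b \<noteq> 20" for b
    using that by (simp add: \<sigma>1_def)
  have f2: "\<sigma>2 b = \<sigma> b" if "b \<notin> {10, 20}" for b
    using that f1 sem_frame[of b] by (simp add: \<sigma>2_def)
  have f3: "\<sigma>3 b = \<sigma> b" if "b \<notin> {10, 20}" for b
    using that f2 sem_frame[of b] by (simp add: \<sigma>3_def)
  have f4: "\<sigma>4 b = \<sigma>3 b" if "b \<notin> {10, 22}" for b
    using that sem_frame[of b] by (simp add: \<sigma>4_def p4_def)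
  have f5: "\<sigma>5 b = \<sigma>4 b" if "b \<notin> {10, 23}" for b
    using that sem_frame[of b] by (simp add: \<sigma>5_def p5_def)
  have f6: "\<sigma>6 b = \<sigma>5 b" if "b \<noteq> 21" for b
    using that by (simp add: \<sigma>6_def)
  have f7: "\<sigma>7 b = \<sigma>6 b" if "b \<notin> {10, 21}" for b
    using that sem_frame[of b] by (simp add: \<sigma>7_def)
  have f8: "\<sigma>8 b = \<sigma>7 b" if "b \<notin> {10, 24}" for b
    using that sem_frame[of b] by (simp add: \<sigma>8_def p8_def)
  have f9: "\<sigma>' b = \<sigma>8 b" if "b \<notin> {10, 30}" for b
    using that sem_frame[of b] by (simp add: \<sigma>' p9_def)
  have nat_mn: "nat (int m * int n) = m * n" by (simp add: nat_mult_distrib)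
  have "\<sigma>2 20 0 = (\<Prod>i<m. \<sigma> 2 (int i))"
    unfolding \<sigma>2_def by (subst sem_prod_prog) (auto simp: f1 \<sigma>0 \<sigma>1_def)
  then have L: "\<sigma>3 20 0 = L"
    unfolding \<sigma>3_def L_def by (subst sem_prod_prog) (auto simp: f2 \<sigma>0 nat_mn)
  show "b \<notin> {10, 20, 21, 22, 23, 24, 30} \<Longrightarrow> \<sigma>' b = \<sigma> b"
    using f9 f8 f7 f6 f5 f4 f3 by simp
  have "\<sigma>4 22 (int i) = \<sigma> 1 (int i) * (L div \<sigma> 2 (int i))" if "i < m" for i
    unfolding \<sigma>4_def p4_def
    by (rule sem_map_prog(1)[where N = m and \<iota> = int and \<phi> = "\<lambda>i. \<sigma> 1 (int i) * (L div \<sigma> 2 (int i))"])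
      (auto simp: f3 \<sigma>0 L that)
  then show "i < m \<Longrightarrow> \<sigma>' 22 (int i) = \<sigma> 1 (int i) * (L div \<sigma> 2 (int i))"
    using f9 f8 f7 f6 f5 by simp
  have "\<sigma>5 23 (int k) = \<sigma> 3 (int k) * (L div \<sigma> 4 (int k))" if "k < m * n" for k
    unfolding \<sigma>5_def p5_def
    by (rule sem_map_prog(1)[where N = "m * n" and \<iota> = int and \<phi> = "\<lambda>i. \<sigma> 3 (int i) * (L div \<sigma> 4 (int i))"])
      (auto simp: f3 f4 \<sigma>0 L that nat_mn)
  then show "k < m * n \<Longrightarrow> \<sigma>' 23 (int k) = \<sigma> 3 (int k) * (L div \<sigma> 4 (int k))"
    using f9 f8 f7 f6 by simp
  have R: "\<sigma>7 21 0 = R"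
    unfolding \<sigma>7_def R_def by (subst sem_prod_prog) (auto simp: f6 f5 f4 f3 \<sigma>0 \<sigma>6_def)
  then show "\<sigma>' 21 0 = R" using f9 f8 by simp
  have Q: "\<sigma>8 24 (int j) = R div \<sigma> 5 (int j)" if "j < n" for j
    unfolding \<sigma>8_def p8_def
    by (rule sem_map_prog(1)[where N = n and \<iota> = int and \<phi> = "\<lambda>i. R div \<sigma> 5 (int i)"])
      (auto simp: f7 f6 f5 f4 f3 \<sigma>0 R that)
  then show "j < n \<Longrightarrow> \<sigma>' 24 (int j) = R div \<sigma> 5 (int j)" using f9 by simp
  show "\<sigma>' 30 (int j) = R div \<sigma> 5 (int j)" if "j < n"
    unfolding \<sigma>' p9_def
    by (rule sem_map_prog(1)[where N = n and \<iota> = int and \<phi> = "\<lambda>i. R div \<sigma> 5 (int i)"])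
      (auto simp: f8 f7 f6 f5 f4 f3 \<sigma>0 Q that)
qed

text \<open>
  Arrays: 30 weights \<open>p\<close>, 31 connections \<open>X\<close>, 32 facilities \<open>Y\<close>, 33 coverage, 34 the clients
  of the chosen star, 41 its amount \<open>\<delta>\<close>, 42 its index.
\<close>

abbreviation "active_expr j \<equiv> Read 33 j \<lless> unit_expr \<odot> Read 5 j"
abbreviation "star_expr k j \<equiv> active_expr j \<odot>
  not_expr (Read 23 k \<odot> Read 30 j \<lless> at_expr 23 (row_expr k) j \<odot> Read 30 (col_expr k))"

section \<open>Program for the multiplicative weights\<close>

definition mw_candidate :: sprog where
  "mw_candidate = SSeq
     (sum_prog 35 11 clients_expr
       (star_expr (scalar 10) (scalar 11) \<odot> at_expr 23 (row_expr (scalar 10)) (scalar 11)))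
     (sum_prog 36 11 clients_expr (star_expr (scalar 10) (scalar 11) \<odot> Read 30 (scalar 11)))"

text \<open>The loop variable encodes a pair of a site and a client in one number. Multiplying the
  denominator by the activity of the client makes the search skip the stars of finished
  clients.\<close>

definition mw_search :: sprog where
  "mw_search = argmin_prog 10 (sites_expr \<odot> clients_expr) mw_candidate
     (Read 22 (row_expr (scalar 10)) \<oplus> scalar 35)
     (active_expr (col_expr (scalar 10)) \<odot> scalar 36)"

text \<open>Array 42 saves the index of the star, since the second search, for the smallest demand
  in the star, overwrites \<open>best_idx\<close>. Array 34 is filled before any weight or coverage
  changes, because membership in the star depends on them.\<close>

definition mw_update :: sprog where
  "mw_update = seq [
     Asg 42 (Const 0) (scalar best_idx),
     map_prog 34 11 clients_expr (scalar 11) (star_expr (scalar 42) (scalar 11)),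
     argmin_prog 11 clients_expr SSkip (Read 5 (scalar 11)) (Read 34 (scalar 11)),
     Asg 41 (Const 0) (Read 5 (scalar best_idx)),
     Asg 32 (row_expr (scalar 42)) (Read 32 (row_expr (scalar 42)) \<oplus> scalar 41),
     map_prog 31 11 clients_expr (row_expr (scalar 42) \<odot> clients_expr \<oplus> scalar 11)
       (at_expr 31 (row_expr (scalar 42)) (scalar 11) \<oplus> Read 34 (scalar 11) \<odot> scalar 41),
     map_prog 33 11 clients_expr (scalar 11)
       (Read 33 (scalar 11) \<oplus> Read 34 (scalar 11) \<odot> scalar 41),
     map_prog 30 11 clients_expr (scalar 11)
       (Read 30 (scalar 11) \<odot>
         (Const 100 \<odot> scalar 21 \<ominus> scalar 41 \<odot> Read 24 (scalar 11) \<odot> Read 34 (scalar 11)))]"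

definition mw_prog :: sprog where
  "mw_prog = For 12 (clients_expr \<odot> unit_expr)
     (SSeq mw_search (SIf (scalar best_den) mw_update SSkip))"

lemma row_index: "l < n \<Longrightarrow> int (i * n + l) div int n = int i"
  by (simp flip: of_nat_div)

lemma col_index: "l < n \<Longrightarrow> int (i * n + l) - int n * (int (i * n + l) div int n) = int l"
  by (subst row_index) (simp_all add: algebra_simps)

lemma index_less: "(i :: nat) < m \<Longrightarrow> l < n \<Longrightarrow> i * n + l < m * n"
proof -
  assume "i < m" "l < n"
  then have "i * n + l < Suc i * n" by simp
  also have "\<dots> \<le> m * n" using \<open>i < m\<close> by (intro mult_right_mono) auto
  finally show ?thesis .
qed

lemma index_split:
  assumes "k < m * (n :: nat)"
  obtains i l where "i < m" "l < n" "k = i * n + l"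
proof
  show "k = (k div n) * n + k mod n" by simp
  show "k div n < m" using assms by (simp add: less_mult_imp_div_less)
  show "k mod n < n" using assms by (cases n) auto
qed

lemma index_inj: "l < n \<Longrightarrow> l' < n \<Longrightarrow> i * n + l = i' * n + l' \<longleftrightarrow> i = i' \<and> l = (l' :: nat)"
  by (metis div_mult_self3 div_less mod_mult_self3 mod_less add.left_neutral add.right_neutral not_less_zero)

lemma sum_of_bool_mult:
  fixes g :: "nat \<Rightarrow> int"
  assumes "A \<subseteq> {..<n}"
  shows "(\<Sum>j<n. of_bool (j \<in> A) * g j) = (\<Sum>j\<in>A. g j)"
  using assms by (intro sum.mono_neutral_cong_right) auto

context ftfp_costs
begin

definition costs_in :: "memory \<Rightarrow> bool" where
  "costs_in \<sigma> \<longleftrightarrow> \<sigma> 0 0 = int m \<and> \<sigma> 0 1 = int n \<and> (\<forall>i<m. \<sigma> 22 (int i) = f i) \<and>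
     (\<forall>i<m. \<forall>j<n. \<sigma> 23 (int (i * n + j)) = d i j)"

lemma costs_in_cong: "\<sigma>' 0 = \<sigma> 0 \<Longrightarrow> \<sigma>' 22 = \<sigma> 22 \<Longrightarrow> \<sigma>' 23 = \<sigma> 23 \<Longrightarrow> costs_in \<sigma>' = costs_in \<sigma>"
  by (simp add: costs_in_def)

end

context mult_weights
begin

abbreviation "weights \<sigma> \<equiv> (\<lambda>j. \<sigma> (30::nat) (int j) :: int)"
abbreviation "conns \<sigma> \<equiv> (\<lambda>i j. \<sigma> (31::nat) (int (i * n + j)) :: int)"
abbreviation "opens \<sigma> \<equiv> (\<lambda>i. \<sigma> (32::nat) (int i) :: int)"
abbreviation "coverage \<sigma> \<equiv> (\<lambda>j. \<sigma> (33::nat) (int j) :: int)"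

lemma value_active:
  assumes "\<tau> 0 1 = int n" "K = 200000 * (int n + 1)" "\<And>j. j < n \<Longrightarrow> \<tau> 5 (int j) = r j"
    "value_of \<tau> e = int j" "j < n"
  shows "value_of \<tau> (active_expr e) = of_bool (j \<in> active (coverage \<tau>))"
proof -
  have "200000 * (\<tau> 0 1 + 1) = K" using assms(1,2) by simp
  then show ?thesis unfolding active_def using assms(3-5) by simp
qed

lemma value_star:
  assumes base: "costs_in \<tau>" and K: "K = 200000 * (int n + 1)"
    and r: "\<And>j. j < n \<Longrightarrow> \<tau> 5 (int j) = r j"
    and k: "value_of \<tau> k = int (i * n + l)" "i < m" "l < n"
    and j: "value_of \<tau> e = int j" "j < n"
  shows "value_of \<tau> (star_expr k e) = of_bool (j \<in> star (weights \<tau>) (coverage \<tau>) i l)"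
proof -
  have \<tau>0: "\<tau> 0 1 = int n" using base by (simp add: costs_in_def)
  have row: "value_of \<tau> (row_expr k) = int i" using k \<tau>0 row_index[of l n i] by simp
  have col: "value_of \<tau> (col_expr k) = int l" using k \<tau>0 col_index[of l n i] by simp
  have at: "value_of \<tau> (at_expr 23 (row_expr k) e) = d i j"
    using base row j k by (simp add: costs_in_def \<tau>0 flip: of_nat_mult of_nat_add)
  have at': "value_of \<tau> (Read 23 k) = d i l"
    using base k by (simp add: costs_in_def)
  have col': "value_of \<tau> (Read 30 (col_expr k)) = \<tau> 30 (int l)" using col by simp
  have e: "value_of \<tau> (Read 30 e) = \<tau> 30 (int j)" using j by simp
  have act: "value_of \<tau> (active_expr e) = of_bool (j \<in> active (coverage \<tau>))"
    using \<tau>0 K r j by (rule value_active)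
  have "value_of \<tau> (star_expr k e) = value_of \<tau> (active_expr e) *
      (1 - of_bool (value_of \<tau> (Read 23 k) * value_of \<tau> (Read 30 e)
        < value_of \<tau> (at_expr 23 (row_expr k) e) * value_of \<tau> (Read 30 (col_expr k))))"
    by (simp only: value_of.simps apply_binop.simps)
  also have "\<dots> = of_bool (j \<in> star (weights \<tau>) (coverage \<tau>) i l)"
    unfolding act at at' col' e by (auto simp: star_def of_bool_def)
  finally show ?thesis .
qed

lemma star_subset: "star p cov i l \<subseteq> {..<n}"
  by (auto simp: star_def active_def)

lemma sem_mw_candidate:
  assumes base: "costs_in \<tau>" and K: "K = 200000 * (int n + 1)"
    and r: "\<And>j. j < n \<Longrightarrow> \<tau> 5 (int j) = r j"
    and k: "\<tau> 10 0 = int (i * n + l)" "i < m" "l < n"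
  defines "S \<equiv> star (weights \<tau>) (coverage \<tau>) i l"
  shows "sem mw_candidate \<tau> 35 0 = (\<Sum>j\<in>S. d i j)" "sem mw_candidate \<tau> 36 0 = (\<Sum>j\<in>S. weights \<tau> j)"
proof -
  have \<tau>0: "\<tau> 0 1 = int n" using base by (simp add: costs_in_def)
  have val: "value_of (store \<rho> 11 0 (int j)) (star_expr (scalar 10) (scalar 11)) = of_bool (j \<in> S)"
    "value_of (store \<rho> 11 0 (int j)) (at_expr 23 (row_expr (scalar 10)) (scalar 11)) = d i j"
    "value_of (store \<rho> 11 0 (int j)) (Read 30 (scalar 11)) = weights \<tau> j"
    if j: "j < n" and \<rho>: "\<And>b. b \<notin> {11, 35} \<Longrightarrow> \<rho> b = \<tau> b" for \<rho> j
  proof -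
    let ?\<rho> = "store \<rho> 11 0 (int j)"
    have base': "costs_in ?\<rho>" using base costs_in_cong[of ?\<rho> \<tau>] \<rho> by simp
    have "value_of ?\<rho> (star_expr (scalar 10) (scalar 11))
      = of_bool (j \<in> star (weights ?\<rho>) (coverage ?\<rho>) i l)"
      using base' K r k j \<rho> by (intro value_star) auto
    then show "value_of ?\<rho> (star_expr (scalar 10) (scalar 11)) = of_bool (j \<in> S)"
      using \<rho> by (simp add: S_def)
    have "value_of ?\<rho> (row_expr (scalar 10)) = int i"
      using k \<rho> \<tau>0 row_index[of l n i] by simp
    then show "value_of ?\<rho> (at_expr 23 (row_expr (scalar 10)) (scalar 11)) = d i j"
      using base' k j \<rho> by (simp add: costs_in_def \<tau>0 flip: of_nat_mult of_nat_add)
    show "value_of ?\<rho> (Read 30 (scalar 11)) = weights \<tau> j" using \<rho> by simp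
  qed
  define \<rho> where "\<rho> = sem (sum_prog 35 11 clients_expr
       (star_expr (scalar 10) (scalar 11) \<odot> at_expr 23 (row_expr (scalar 10)) (scalar 11))) \<tau>"
  have \<rho>: "\<rho> b = \<tau> b" if "b \<notin> {11, 35}" for b
    using that sem_frame[of b] by (simp add: \<rho>_def)
  have S: "S \<subseteq> {..<n}" unfolding S_def by (rule star_subset)
  have "\<rho> 35 0 = (\<Sum>j<n. value_of (store \<tau> 11 0 (int j))
      (star_expr (scalar 10) (scalar 11) \<odot> at_expr 23 (row_expr (scalar 10)) (scalar 11)))"
    unfolding \<rho>_def by (subst sem_sum_prog) (simp_all add: \<tau>0)
  also have "\<dots> = (\<Sum>j<n. of_bool (j \<in> S) * d i j)"
    unfolding value_of.simps(3)[of _ Mul] apply_binop.simps using val by (intro sum.cong) auto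
  finally have "\<rho> 35 0 = (\<Sum>j\<in>S. d i j)" by (simp only: sum_of_bool_mult[OF S])
  moreover have "sem mw_candidate \<tau> 35 = \<rho> 35"
    using sem_frame[of 35] by (simp add: mw_candidate_def \<rho>_def)
  ultimately show "sem mw_candidate \<tau> 35 0 = (\<Sum>j\<in>S. d i j)" by simp
  have "sem mw_candidate \<tau> 36 0 = (\<Sum>j<n. value_of (store \<rho> 11 0 (int j))
      (star_expr (scalar 10) (scalar 11) \<odot> Read 30 (scalar 11)))"
    unfolding mw_candidate_def sem.simps \<rho>_def[symmetric]
    by (subst sem_sum_prog) (simp_all add: \<tau>0 \<rho>)
  also have "\<dots> = (\<Sum>j<n. of_bool (j \<in> S) * weights \<tau> j)"
    unfolding value_of.simps(3)[of _ Mul] apply_binop.simps using val \<rho> by (intro sum.cong) auto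
  finally show "sem mw_candidate \<tau> 36 0 = (\<Sum>j\<in>S. weights \<tau> j)"
    by (simp only: sum_of_bool_mult[OF S])
qed

lemma writes_mw_candidate: "writes mw_candidate = {11, 35, 36}"
  by (auto simp: mw_candidate_def)

text \<open>A star whose last client is active contains this client, so its denominator is positive;
  if the search finds nothing, there is no site or no active client.\<close>

lemma sem_mw_search:
  assumes base: "costs_in \<sigma>" and K: "K = 200000 * (int n + 1)"
    and r: "\<And>j. j < n \<Longrightarrow> \<sigma> 5 (int j) = r j" and p: "\<And>j. j < n \<Longrightarrow> 0 < weights \<sigma> j"
  defines "St \<equiv> star (weights \<sigma>) (coverage \<sigma>)" and "\<sigma>' \<equiv> sem mw_search \<sigma>"
  shows "\<sigma>' best_den 0 = 0 \<and> (m = 0 \<or> active (coverage \<sigma>) = {}) \<or>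
    (\<exists>i<m. \<exists>l \<in> active (coverage \<sigma>). \<sigma>' best_idx 0 = int (i * n + l) \<and> \<sigma>' best_den 0 \<noteq> 0 \<and>
      (\<forall>i'<m. \<forall>l' \<in> active (coverage \<sigma>). (f i + (\<Sum>j\<in>St i l. d i j)) * (\<Sum>j\<in>St i' l'. weights \<sigma> j)
          \<le> (f i' + (\<Sum>j\<in>St i' l'. d i' j)) * (\<Sum>j\<in>St i l. weights \<sigma> j)))"
proof -
  define \<nu> where "\<nu> k = f (k div n) + (\<Sum>j\<in>St (k div n) (k mod n). d (k div n) j)" for k
  define \<delta> where "\<delta> k = of_bool (k mod n \<in> active (coverage \<sigma>)) * (\<Sum>j\<in>St (k div n) (k mod n). weights \<sigma> j)" for k
  have \<sigma>0: "\<sigma> 0 0 = int m" "\<sigma> 0 1 = int n" using base by (auto simp: costs_in_def)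
  have dm: "(i * n + l) div n = i" "(i * n + l) mod n = l" if "l < n" for i l :: nat
    using that by auto
  have "\<sigma>' best_den 0 = 0 \<and> (\<forall>k<m * n. \<delta> k \<le> 0) \<or>
    (\<exists>k<m * n. \<sigma>' best_idx 0 = int k \<and> \<sigma>' best_den 0 = \<delta> k \<and> 0 < \<delta> k \<and> \<sigma>' best_num 0 = \<nu> k \<and>
      (\<forall>k'<m * n. 0 < \<delta> k' \<longrightarrow> \<nu> k * \<delta> k' \<le> \<nu> k' * \<delta> k))"
    unfolding \<sigma>'_def mw_search_def
  proof (rule sem_argmin_prog)
    show "m * n = nat (value_of \<sigma> (sites_expr \<odot> clients_expr))"
      using \<sigma>0 by (simp add: nat_mult_distrib)
    fix k \<tau>
    assume k: "k < m * n" and fr: "\<And>b. b \<notin> writes mw_candidate \<Longrightarrow> b \<notin> {10, best_idx, best_num, best_den} \<Longrightarrow> \<tau> b = \<sigma> b"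
      and \<tau>10: "\<tau> 10 0 = int k"
    obtain i l where il: "i < m" "l < n" "k = i * n + l" using k by (rule index_split)
    have fr': "\<tau> b = \<sigma> b" if "b \<in> {0, 5, 22, 23, 30, 33}" for b
      using that by (intro fr) (auto simp: writes_mw_candidate)
    have base': "costs_in \<tau>" using base costs_in_cong[of \<tau> \<sigma>] fr' by simp
    let ?\<rho> = "sem mw_candidate \<tau>"
    have fr\<rho>: "?\<rho> b = \<tau> b" if "b \<notin> {11, 35, 36}" for b
      using that by (intro sem_frame) (simp add: writes_mw_candidate)
    have cand: "?\<rho> 35 0 = (\<Sum>j\<in>St i l. d i j)" "?\<rho> 36 0 = (\<Sum>j\<in>St i l. weights \<sigma> j)"
      using sem_mw_candidate[OF base' K, of i l] r il \<tau>10 fr' by (simp_all add: St_def)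
    have base\<rho>: "costs_in ?\<rho>" using base' costs_in_cong[of ?\<rho> \<tau>] fr\<rho> by simp
    have row: "value_of ?\<rho> (row_expr (scalar 10)) = int i"
      using \<tau>10 il \<sigma>0 row_index[of l n i] by (simp add: fr\<rho> fr')
    have col: "value_of ?\<rho> (col_expr (scalar 10)) = int l"
      using \<tau>10 il \<sigma>0 col_index[of l n i] by (simp add: fr\<rho> fr')
    have act: "value_of ?\<rho> (active_expr (col_expr (scalar 10))) = of_bool (l \<in> active (coverage ?\<rho>))"
      using K r col il \<sigma>0 by (intro value_active) (simp_all add: fr\<rho> fr')
    have "value_of ?\<rho> (Read 22 (row_expr (scalar 10)) \<oplus> scalar 35) = \<nu> k"
      using row cand base\<rho> il by (simp add: \<nu>_def costs_in_def dm del: value_of.simps(3))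
        (simp add: costs_in_def)
    moreover have "value_of ?\<rho> (active_expr (col_expr (scalar 10)) \<odot> scalar 36) = \<delta> k"
      unfolding value_of.simps(3)[of _ Mul "active_expr (col_expr (scalar 10))"] act
      using cand il by (simp add: \<delta>_def dm fr\<rho> fr')
    ultimately show "value_of ?\<rho> (Read 22 (row_expr (scalar 10)) \<oplus> scalar 35) = \<nu> k \<and>
      value_of ?\<rho> (active_expr (col_expr (scalar 10)) \<odot> scalar 36) = \<delta> k" by blast
  qed (auto simp: writes_mw_candidate)
  moreover have \<delta>_pos: "0 < \<delta> (i * n + l)" "\<delta> (i * n + l) = (\<Sum>j\<in>St i l. weights \<sigma> j)"
    if "i < m" "l \<in> active (coverage \<sigma>)" for i l
  proof -
    have l: "l < n" using that by (simp add: active_def)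
    have "l \<in> St i l" using that by (simp add: St_def star_def)
    moreover have "finite (St i l)" unfolding St_def by (rule finite_subset[OF star_subset]) simp
    moreover have "0 < weights \<sigma> j" if "j \<in> St i l" for j
      using that p star_subset[of "weights \<sigma>" "coverage \<sigma>" i l] by (auto simp: St_def)
    ultimately have "0 < (\<Sum>j\<in>St i l. weights \<sigma> j)" by (intro sum_pos) auto
    then show "0 < \<delta> (i * n + l)" "\<delta> (i * n + l) = (\<Sum>j\<in>St i l. weights \<sigma> j)"
      using that by (auto simp: \<delta>_def dm l)
  qed
  ultimately consider (none) "\<sigma>' best_den 0 = 0" "\<And>k. k < m * n \<Longrightarrow> \<delta> k \<le> 0"
    | (some) k where "k < m * n" "\<sigma>' best_idx 0 = int k" "\<sigma>' best_den 0 = \<delta> k" "0 < \<delta> k"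
      "\<And>k'. k' < m * n \<Longrightarrow> 0 < \<delta> k' \<Longrightarrow> \<nu> k * \<delta> k' \<le> \<nu> k' * \<delta> k"
    by blast
  then show ?thesis
  proof cases
    case none
    have "m = 0 \<or> active (coverage \<sigma>) = {}"
    proof (rule ccontr)
      assume "\<not> ?thesis"
      then obtain l where l: "0 < m" "l \<in> active (coverage \<sigma>)" by auto
      then have "l < n" by (simp add: active_def)
      then have "0 * n + l < m * n" using l by (intro index_less)
      then show False using none(2) \<delta>_pos(1)[OF l] by fastforce
    qed
    then show ?thesis using none(1) by blast
  next
    case (some k)
    obtain i l where il: "i < m" "l < n" "k = i * n + l" using some(1) by (rule index_split)
    have l: "l \<in> active (coverage \<sigma>)"
    proof (rule ccontr)
      assume "l \<notin> active (coverage \<sigma>)"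
      then have "\<delta> k = 0" using il by (simp add: \<delta>_def dm)
      then show False using some by simp
    qed
    have "(f i + (\<Sum>j\<in>St i l. d i j)) * (\<Sum>j\<in>St i' l'. weights \<sigma> j)
          \<le> (f i' + (\<Sum>j\<in>St i' l'. d i' j)) * (\<Sum>j\<in>St i l. weights \<sigma> j)"
      if "i' < m" "l' \<in> active (coverage \<sigma>)" for i' l'
    proof -
      have l': "l' < n" using that by (simp add: active_def)
      have "\<nu> k * \<delta> (i' * n + l') \<le> \<nu> (i' * n + l') * \<delta> k"
        using that l' by (intro some(5) index_less \<delta>_pos(1))
      then show ?thesis
        unfolding il(3) \<delta>_pos(2)[OF that] \<delta>_pos(2)[OF il(1) l] by (simp add: \<nu>_def dm il(2) l')
    qed
    then show ?thesis using il l some(2,3,4) by (intro disjI2 exI[of _ i] bexI[of _ l] conjI) auto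
  qed
qed

lemma writes_mw_update: "writes mw_update = {11, best_idx, 30, 31, 32, 33, 34, best_num, best_den, 41, 42}"
  by (auto simp: mw_update_def)

lemma sem_mw_update:
  assumes base: "costs_in \<sigma>" and K: "K = 200000 * (int n + 1)"
    and r: "\<And>j. j < n \<Longrightarrow> \<sigma> 5 (int j) = r j"
    and R: "\<sigma> 21 0 = R" "\<And>j. j < n \<Longrightarrow> \<sigma> 24 (int j) * r j = R" "0 < R"
    and inv: "mw_inv (weights \<sigma>) (conns \<sigma>) (opens \<sigma>) (coverage \<sigma>)"
    and il: "i < m" "l \<in> active (coverage \<sigma>)" "\<sigma> best_idx 0 = int (i * n + l)"
  defines "St \<equiv> star (weights \<sigma>) (coverage \<sigma>)" and "\<sigma>' \<equiv> sem mw_update \<sigma>"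
  assumes opt: "\<And>i' l'. i' < m \<Longrightarrow> l' \<in> active (coverage \<sigma>) \<Longrightarrow>
      (f i + (\<Sum>j\<in>St i l. d i j)) * (\<Sum>j\<in>St i' l'. weights \<sigma> j)
          \<le> (f i' + (\<Sum>j\<in>St i' l'. d i' j)) * (\<Sum>j\<in>St i l. weights \<sigma> j)"
  shows "mw_inv (weights \<sigma>') (conns \<sigma>') (opens \<sigma>') (coverage \<sigma>')"
    and "mw_potential (coverage \<sigma>') < mw_potential (coverage \<sigma>)"
proof -
  define S where "S = St i l"
  have l: "l < n" using il(2) by (simp add: active_def)
  have lS: "l \<in> S" using il(2) by (simp add: S_def St_def star_def)
  have \<sigma>0: "\<sigma> 0 1 = int n" using base by (simp add: costs_in_def)
  define \<sigma>1 where "\<sigma>1 = sem (Asg 42 (Const 0) (scalar best_idx)) \<sigma>"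
  define p2 where "p2 = map_prog 34 11 clients_expr (scalar 11) (star_expr (scalar 42) (scalar 11))"
  define \<sigma>2 where "\<sigma>2 = sem p2 \<sigma>1"
  define p3 where "p3 = argmin_prog 11 clients_expr SSkip (Read 5 (scalar 11)) (Read 34 (scalar 11))"
  define \<sigma>3 where "\<sigma>3 = sem p3 \<sigma>2"
  define \<sigma>4 where "\<sigma>4 = sem (Asg 41 (Const 0) (Read 5 (scalar best_idx))) \<sigma>3"
  define \<sigma>5 where "\<sigma>5 = sem (Asg 32 (row_expr (scalar 42)) (Read 32 (row_expr (scalar 42)) \<oplus> scalar 41)) \<sigma>4"
  define p6 where "p6 = map_prog 31 11 clients_expr (row_expr (scalar 42) \<odot> clients_expr \<oplus> scalar 11)
       (at_expr 31 (row_expr (scalar 42)) (scalar 11) \<oplus> Read 34 (scalar 11) \<odot> scalar 41)"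
  define \<sigma>6 where "\<sigma>6 = sem p6 \<sigma>5"
  define p7 where "p7 = map_prog 33 11 clients_expr (scalar 11)
       (Read 33 (scalar 11) \<oplus> Read 34 (scalar 11) \<odot> scalar 41)"
  define \<sigma>7 where "\<sigma>7 = sem p7 \<sigma>6"
  define p8 where "p8 = map_prog 30 11 clients_expr (scalar 11)
       (Read 30 (scalar 11) \<odot>
         (Const 100 \<odot> scalar 21 \<ominus> scalar 41 \<odot> Read 24 (scalar 11) \<odot> Read 34 (scalar 11)))"
  have \<sigma>': "\<sigma>' = sem p8 \<sigma>7"
    by (simp add: \<sigma>'_def mw_update_def \<sigma>1_def \<sigma>2_def \<sigma>3_def \<sigma>4_def \<sigma>5_def \<sigma>6_def \<sigma>7_def
        p2_def p3_def p6_def p7_def p8_def)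
  have f1: "\<sigma>1 b = \<sigma> b" if "b \<noteq> 42" for b using that by (simp add: \<sigma>1_def)
  have f2: "\<sigma>2 b = \<sigma>1 b" if "b \<notin> {11, 34}" for b
    using that sem_frame[of b] by (simp add: \<sigma>2_def p2_def)
  have f3: "\<sigma>3 b = \<sigma>2 b" if "b \<notin> {11, 13, 37, 38}" for b
    using that sem_frame[of b] by (simp add: \<sigma>3_def p3_def)
  have f4: "\<sigma>4 b = \<sigma>3 b" if "b \<noteq> 41" for b using that by (simp add: \<sigma>4_def)
  have f5: "\<sigma>5 b = \<sigma>4 b" if "b \<noteq> 32" for b using that by (simp add: \<sigma>5_def)
  have f6: "\<sigma>6 b = \<sigma>5 b" if "b \<notin> {11, 31}" for b
    using that sem_frame[of b] by (simp add: \<sigma>6_def p6_def)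
  have f7: "\<sigma>7 b = \<sigma>6 b" if "b \<notin> {11, 33}" for b
    using that sem_frame[of b] by (simp add: \<sigma>7_def p7_def)
  have f8: "\<sigma>' b = \<sigma>7 b" if "b \<notin> {11, 30}" for b
    using that sem_frame[of b] by (simp add: \<sigma>' p8_def)
  have idx: "\<sigma>1 42 0 = int (i * n + l)" using il by (simp add: \<sigma>1_def)
  have S2: "\<sigma>2 34 (int j) = of_bool (j \<in> S)" if "j < n" for j
    unfolding \<sigma>2_def p2_def
  proof (rule sem_map_prog(1)[where N = n and \<iota> = int and \<phi> = "\<lambda>j. of_bool (j \<in> S)"])
    fix j \<tau>
    assume j: "j < n" and \<tau>: "\<And>b. b \<noteq> 34 \<Longrightarrow> b \<noteq> 11 \<Longrightarrow> \<tau> b = \<sigma>1 b" "\<tau> 11 = (\<sigma>1 11)(0 := int j)"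
    have base': "costs_in \<tau>" using base costs_in_cong[of \<tau> \<sigma>] \<tau>(1) f1 by simp
    have "value_of \<tau> (star_expr (scalar 42) (scalar 11)) = of_bool (j \<in> star (weights \<tau>) (coverage \<tau>) i l)"
      using base' K
    proof (rule value_star)
      show "value_of \<tau> (scalar 42) = int (i * n + l)" using \<tau>(1) idx by simp
      show "value_of \<tau> (scalar 11) = int j" using \<tau>(2) by simp
    qed (use \<tau>(1) f1 r il l j in auto)
    then show "value_of \<tau> (scalar 11) = int j \<and> value_of \<tau> (star_expr (scalar 42) (scalar 11)) = of_bool (j \<in> S)"
      using \<tau> f1 by (simp add: S_def St_def)
  qed (use that \<sigma>0 f1 in auto)
  have "\<sigma>3 best_den 0 = 0 \<and> (\<forall>k<n. of_bool (k \<in> S) \<le> (0::int)) \<or>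
    (\<exists>k<n. \<sigma>3 best_idx 0 = int k \<and> \<sigma>3 best_den 0 = of_bool (k \<in> S) \<and> 0 < (of_bool (k \<in> S) :: int) \<and> \<sigma>3 best_num 0 = r k \<and>
      (\<forall>k'<n. 0 < (of_bool (k' \<in> S) :: int) \<longrightarrow> r k * of_bool (k' \<in> S) \<le> r k' * of_bool (k \<in> S)))"
    unfolding \<sigma>3_def p3_def
  proof (rule sem_argmin_prog)
    show "n = nat (value_of \<sigma>2 clients_expr)" using \<sigma>0 f1 f2 by simp
    fix k \<tau>
    assume k: "k < n" and fr: "\<And>b. b \<notin> writes SSkip \<Longrightarrow> b \<notin> {11, best_idx, best_num, best_den} \<Longrightarrow> \<tau> b = \<sigma>2 b"
      and \<tau>11: "\<tau> 11 0 = int k"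
    show "value_of (sem SSkip \<tau>) (Read 5 (scalar 11)) = r k \<and> value_of (sem SSkip \<tau>) (Read 34 (scalar 11)) = of_bool (k \<in> S)"
      using k \<tau>11 S2[OF k] r[OF k] fr[of 5] fr[of 34] f1 f2 by simp
  qed auto
  then obtain j0 where j0: "j0 < n" "j0 \<in> S" "\<sigma>3 best_idx 0 = int j0" "\<And>j. j < n \<Longrightarrow> j \<in> S \<Longrightarrow> r j0 \<le> r j"
    using lS l by fastforce
  define \<delta> where "\<delta> = r j0"
  have \<delta>: "0 < \<delta>" using r_pos[OF j0(1)] by (simp add: \<delta>_def)
  have d4: "\<sigma>4 41 0 = \<delta>" using j0 r[OF j0(1)] f1 f2 f3 by (simp add: \<sigma>4_def \<delta>_def)
  have n4: "\<sigma>4 0 1 = int n" using \<sigma>0 f1 f2 f3 f4 by simp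
  have i4: "\<sigma>4 42 0 = int (i * n + l)" using idx f2 f3 f4 by simp
  have row4: "value_of \<sigma>4 (row_expr (scalar 42)) = int i"
    using i4 n4 row_index[OF l, of i] by simp
  have Y': "opens \<sigma>' i' = opens \<sigma> i' + \<delta> * of_bool (i' = i)" for i'
  proof -
    have "\<sigma>5 32 = (\<sigma>4 32)(int i := \<sigma>4 32 (int i) + \<delta>)"
      using row4 d4 by (simp add: \<sigma>5_def)
    then show ?thesis using f8 f7 f6 f4 f3 f2 f1 by simp
  qed
  have idx_inj: "inj_on (\<lambda>j. int (i * n + j)) A" for A by (auto simp: inj_on_def)
  have val6: "value_of \<tau> (row_expr (scalar 42) \<odot> clients_expr \<oplus> scalar 11) = int (i * n + j) \<and>
      value_of \<tau> (at_expr 31 (row_expr (scalar 42)) (scalar 11) \<oplus> Read 34 (scalar 11) \<odot> scalar 41)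
        = conns \<sigma> i j + of_bool (j \<in> S) * \<delta>"
    if j: "j < n" and \<tau>: "\<And>b. b \<noteq> 31 \<Longrightarrow> b \<noteq> 11 \<Longrightarrow> \<tau> b = \<sigma>5 b" "\<tau> 11 = (\<sigma>5 11)(0 := int j)"
      "\<tau> 31 (int (i * n + j)) = \<sigma>5 31 (int (i * n + j))" for j \<tau>
  proof -
    have row: "value_of \<tau> (row_expr (scalar 42)) = int i"
      using row4 \<tau>(1) f5 by simp
    have ix: "value_of \<tau> (row_expr (scalar 42) \<odot> clients_expr \<oplus> scalar 11) = int (i * n + j)"
      using row \<tau>(1)[of 0] \<tau>(2) f5 n4 by simp
    have "value_of \<tau> (at_expr 31 (row_expr (scalar 42)) (scalar 11)) = \<tau> 31 (int (i * n + j))"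
      unfolding value_of.simps(2) ix ..
    also have "\<dots> = conns \<sigma> i j" using \<tau>(3) f5 f4 f3 f2 f1 by simp
    moreover have "value_of \<tau> (Read 34 (scalar 11) \<odot> scalar 41) = of_bool (j \<in> S) * \<delta>"
      using \<tau>(1,2) f5 f4 f3 S2[OF j] d4 by simp
    ultimately show ?thesis using ix by (simp only: value_of.simps(3)[of _ Add] apply_binop.simps)
  qed
  have X6: "\<sigma>6 31 (int (i * n + j)) = conns \<sigma> i j + of_bool (j \<in> S) * \<delta>" if "j < n" for j
    unfolding \<sigma>6_def p6_def
    by (rule sem_map_prog(1)[where N = n and \<iota> = "\<lambda>j. int (i * n + j)"
          and \<phi> = "\<lambda>j. conns \<sigma> i j + of_bool (j \<in> S) * \<delta>"])
      (use that n4 f5 val6 idx_inj in auto)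
  have X6': "\<sigma>6 31 k = \<sigma>5 31 k" if "\<And>j. j < n \<Longrightarrow> k \<noteq> int (i * n + j)" for k
    unfolding \<sigma>6_def p6_def
  proof (rule sem_map_prog(2)[where N = n and \<iota> = "\<lambda>j. int (i * n + j)"
        and \<phi> = "\<lambda>j. conns \<sigma> i j + of_bool (j \<in> S) * \<delta>"])
    show "n = nat (value_of \<sigma>5 clients_expr)" using n4 f5 by simp
    show "inj_on (\<lambda>j. int (i * n + j)) {..<n}" by (rule idx_inj)
  qed (simp, rule val6, assumption+, rule that)
  have X': "conns \<sigma>' i' j = conns \<sigma> i' j + \<delta> * of_bool (i' = i \<and> j \<in> S)" if "j < n" for i' j
  proof (cases "i' = i")
    case True
    then show ?thesis using X6[OF that] f8 f7 by simp
  next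
    case False
    have "\<sigma>6 31 (int (i' * n + j)) = \<sigma>5 31 (int (i' * n + j))"
      using False that index_inj[of j n _ i' i] by (intro X6') (metis of_nat_eq_iff)
    then show ?thesis using False f8 f7 f5 f4 f3 f2 f1 by simp
  qed
  have cov': "coverage \<sigma>' j = coverage \<sigma> j + \<delta> * of_bool (j \<in> S)" if "j < n" for j
  proof -
    have "\<sigma>7 33 (int j) = coverage \<sigma> j + of_bool (j \<in> S) * \<delta>"
      unfolding \<sigma>7_def p7_def
      by (rule sem_map_prog(1)[where N = n and \<iota> = int and \<phi> = "\<lambda>j. coverage \<sigma> j + of_bool (j \<in> S) * \<delta>"])
        (use that n4 in \<open>auto simp: f6 f5 f4 f3 f2 f1 S2 d4 \<sigma>0\<close>)
    then show ?thesis using f8 by simp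
  qed
  have p': "weights \<sigma>' j = weights \<sigma> j * (100 * R - \<delta> * \<sigma> 24 (int j) * of_bool (j \<in> S))" if "j < n" for j
    unfolding \<sigma>' p8_def
    by (rule sem_map_prog(1)[where N = n and \<iota> = int
          and \<phi> = "\<lambda>j. weights \<sigma> j * (100 * R - \<delta> * \<sigma> 24 (int j) * of_bool (j \<in> S))"])
      (use that n4 in \<open>auto simp: f7 f6 f5 f4 f3 f2 f1 S2 d4 R(1) \<sigma>0\<close>)
  have S_active: "S \<subseteq> active (coverage \<sigma>)" by (auto simp: S_def St_def star_def)
  show "mw_inv (weights \<sigma>') (conns \<sigma>') (opens \<sigma>') (coverage \<sigma>')"
  proof (rule mw_step[where q = "\<lambda>j. \<sigma> 24 (int j)" and R = R and \<delta> = \<delta>, OF inv il(1) S_active])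
    show "S \<noteq> {}" using lS by auto
    show "\<delta> \<le> r j" if "j \<in> S" for j
      using that S_active j0(4)[of j] by (auto simp: \<delta>_def active_def)
  qed (use \<delta> opt R p' Y' X' cov' in \<open>auto simp: S_def St_def\<close>)
  show "mw_potential (coverage \<sigma>') < mw_potential (coverage \<sigma>)"
    by (rule mw_potential_decreases[OF S_active j0(2) \<delta>_def[symmetric] \<delta> cov'])
qed

lemma mw_potential_zero:
  assumes "mw_potential cov = 0"
  shows "active cov = {}"
proof -
  have "\<not> cov j < K * r j" if "j < n" for j
  proof
    assume "cov j < K * r j"
    then have "cov j div r j < K"
      using r_pos[OF that] by (intro int_div_less) auto
    moreover have "nat (K - cov j div r j) = 0"
      using assms that by (simp add: mw_potential_def)
    ultimately show False by simp
  qed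
  then show ?thesis by (auto simp: active_def)
qed

lemma writes_mw_search: "writes mw_search = {10, 11, best_idx, 35, 36, best_num, best_den}"
  by (auto simp: mw_search_def writes_mw_candidate)

text \<open>The number of rounds is fixed in advance, so the invariant says that either no client is
  active, and the remaining rounds idle, or the potential has dropped by at least one in every
  round.\<close>

lemma sem_mw_prog:
  assumes base: "costs_in \<sigma>" and K: "K = 200000 * (int n + 1)"
    and r: "\<And>j. j < n \<Longrightarrow> \<sigma> 5 (int j) = r j"
    and R: "\<sigma> 21 0 = R" "\<And>j. j < n \<Longrightarrow> \<sigma> 24 (int j) * r j = R" "0 < R"
    and init: "\<And>j. j < n \<Longrightarrow> \<sigma> 30 (int j) = \<sigma> 24 (int j)"
      "\<And>k. \<sigma> 31 k = 0" "\<And>k. \<sigma> 32 k = 0" "\<And>k. \<sigma> 33 k = 0"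
  defines "\<sigma>' \<equiv> sem mw_prog \<sigma>"
  shows "mw_inv (weights \<sigma>') (conns \<sigma>') (opens \<sigma>') (coverage \<sigma>')" "active (coverage \<sigma>') = {}"
proof -
  define body where "body = SSeq mw_search (SIf (scalar best_den) mw_update SSkip)"
  define W where "W = {10, 11, best_idx, 30, 31, 32, 33, 34, 35, 36, best_num, best_den, 41, 42}"
  have writes_body: "writes body = W"
    by (auto simp: body_def W_def writes_mw_search writes_mw_update)
  define N where "N = n * nat K"
  let ?ok = "\<lambda>\<tau>. mw_inv (weights \<tau>) (conns \<tau>) (opens \<tau>) (coverage \<tau>)"
  let ?Inv = "\<lambda>t \<tau>. (\<forall>b. b \<notin> W \<longrightarrow> b \<noteq> 12 \<longrightarrow> \<tau> b = \<sigma> b) \<and> ?ok \<tau> \<and>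
    (active (coverage \<tau>) = {} \<or> mw_potential (coverage \<tau>) + t \<le> N)"
  have "?Inv N (loop 12 N (sem body) \<sigma>)"
  proof (rule loop_invariant[where Inv = ?Inv])
    have "?ok \<sigma>"
    proof (rule mw_init[where R = R])
      show "weights \<sigma> j * r j = R" if "j < n" for j using init(1) R(2) that by simp
    qed (use init R(3) in auto)
    moreover have "mw_potential (coverage \<sigma>) = N"
      by (simp add: mw_potential_def init N_def)
    ultimately show "?Inv 0 (store \<sigma> 12 0 0)" by simp
  next
    fix t \<tau>
    assume "t < N" and Inv: "?Inv t \<tau>"
    define \<tau>1 where "\<tau>1 = sem mw_search \<tau>"
    define \<tau>2 where "\<tau>2 = sem body \<tau>"
    have fr: "\<tau> b = \<sigma> b" if "b \<in> {0, 5, 21, 22, 23, 24}" for b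
      using Inv that unfolding W_def by auto
    have fr1: "\<tau>1 b = \<tau> b" if "b \<notin> {10, 11, best_idx, 35, 36, best_num, best_den}" for b
      unfolding \<tau>1_def using that by (intro sem_frame) (simp add: writes_mw_search)
    have base': "costs_in \<tau>" using base costs_in_cong[of \<tau> \<sigma>] fr by simp
    have base1: "costs_in \<tau>1" using base' costs_in_cong[of \<tau>1 \<tau>] fr1 by simp
    have p: "0 < weights \<tau> j" if "j < n" for j using Inv that by (simp add: mw_inv_def)
    have r': "\<tau> 5 (int j) = r j" if "j < n" for j using fr r that by simp
    \<comment> \<open>The fractional solution can serve a client of positive demand only if there is
      a site.\<close>
    have m: "\<not> m = 0" if "active (coverage \<tau>) \<noteq> {}"
    proof
      assume "m = 0"
      obtain j where j: "j < n" using \<open>active (coverage \<tau>) \<noteq> {}\<close> by (auto simp: active_def)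
      have "real_of_int (r j) \<le> (\<Sum>i<m. x i j)" using lp j by (simp add: frac_feasible_def)
      then show False using r_pos[OF j] \<open>m = 0\<close> by simp
    qed
    have same: "weights \<tau>1 = weights \<tau>" "conns \<tau>1 = conns \<tau>" "opens \<tau>1 = opens \<tau>" "coverage \<tau>1 = coverage \<tau>"
      using fr1 by auto
    have frame2: "\<forall>b. b \<notin> W \<longrightarrow> b \<noteq> 12 \<longrightarrow> \<tau>2 b = \<sigma> b"
      using Inv sem_frame[of _ body \<tau>] by (simp add: \<tau>2_def writes_body)
    have "?ok \<tau>2 \<and> (active (coverage \<tau>2) = {} \<or> mw_potential (coverage \<tau>2) + Suc t \<le> N)"
    proof (cases "\<tau>1 best_den 0 = 0")
      case True
      then have \<tau>2: "\<tau>2 = \<tau>1" by (simp add: \<tau>2_def body_def \<tau>1_def)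
      have "active (coverage \<tau>) = {}"
        using sem_mw_search[OF base' K r' p] True m unfolding \<tau>1_def by auto
      then show ?thesis using Inv unfolding \<tau>2 same by blast
    next
      case False
      then have \<tau>2: "\<tau>2 = sem mw_update \<tau>1" by (simp add: \<tau>2_def body_def \<tau>1_def)
      have ok1: "?ok \<tau>1" unfolding same using Inv by blast
      obtain i l where il: "i < m" "l \<in> active (coverage \<tau>)" "\<tau>1 best_idx 0 = int (i * n + l)"
        and opt: "\<And>i' l'. i' < m \<Longrightarrow> l' \<in> active (coverage \<tau>) \<Longrightarrow>
          (f i + (\<Sum>j\<in>star (weights \<tau>) (coverage \<tau>) i l. d i j)) * (\<Sum>j\<in>star (weights \<tau>) (coverage \<tau>) i' l'. weights \<tau> j)
          \<le> (f i' + (\<Sum>j\<in>star (weights \<tau>) (coverage \<tau>) i' l'. d i' j)) * (\<Sum>j\<in>star (weights \<tau>) (coverage \<tau>) i l. weights \<tau> j)"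
        using sem_mw_search[OF base' K r' p] False unfolding \<tau>1_def by blast
      have rR: "\<tau>1 21 0 = R" "\<And>j. j < n \<Longrightarrow> \<tau>1 24 (int j) * r j = R" "\<And>j. j < n \<Longrightarrow> \<tau>1 5 (int j) = r j"
        using fr fr1 R r by auto
      have upd: "?ok \<tau>2" "mw_potential (coverage \<tau>2) < mw_potential (coverage \<tau>1)"
        unfolding \<tau>2 using sem_mw_update[OF base1 K rR(3,1,2) R(3) ok1, of i l] il opt
        unfolding same by blast+
      have "mw_potential (coverage \<tau>) + t \<le> N" using Inv il(2) by blast
      then show ?thesis using upd unfolding same by simp
    qed
    then show "?Inv (Suc t) (store (sem body \<tau>) 12 0 (int (Suc t)))"
      using frame2 by (simp add: \<tau>2_def[symmetric])
  qed
  moreover have "\<sigma>' = loop 12 N (sem body) \<sigma>"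
  proof -
    have "nat (value_of \<sigma> (clients_expr \<odot> unit_expr)) = N"
      using base K by (simp add: costs_in_def N_def nat_mult_distrib)
    then show ?thesis by (simp only: \<sigma>'_def mw_prog_def sem.simps body_def)
  qed
  ultimately have fin: "?ok \<sigma>'" "active (coverage \<sigma>') = {} \<or> mw_potential (coverage \<sigma>') = 0" by auto
  show "?ok \<sigma>'" by (rule fin)
  show "active (coverage \<sigma>') = {}" using fin(2) mw_potential_zero by blast
qed

end

text \<open>
  Arrays: 53 residual demands, 54 token ownership (client by client), 55 and 56 facilities and
  connections, 57 cluster of a token, 58 site of a cluster, 59 current cluster.
\<close>

abbreviation "near_expr k t \<equiv> Read 54 (col_expr k \<odot> tokens_expr \<oplus> t) \<odot>
  not_expr (Read 23 k \<lless> at_expr 23 (t \<oslash> cap_expr) (col_expr k))"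

section \<open>Program for the token rounding\<close>

definition round_search :: sprog where
  "round_search = argmin_prog 10 (sites_expr \<odot> clients_expr)
     (sum_prog 36 11 tokens_expr (near_expr (scalar 10) (scalar 11)))
     (Read 23 (scalar 10))
     ((Const 0 \<lless> Read 53 (col_expr (scalar 10))) \<odot> not_expr (scalar 36 \<lless> half_expr))"

text \<open>Adding the number of the cluster assigns it, because the tokens concerned are free and
  carry 0. Array 60 counts the tokens taken and ends the selection at \<open>h\<close>.\<close>

definition round_fill :: sprog where
  "round_fill = seq [
     Asg 61 (Const 0) (near_expr (scalar 42) (scalar 10) \<odot> (scalar 60 \<lless> half_expr)),
     Asg 57 (scalar 10) (Read 57 (scalar 10) \<oplus> scalar 61 \<odot> scalar 59),
     Asg 60 (Const 0) (scalar 60 \<oplus> scalar 61)]"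

text \<open>Clusters are numbered by the round that founds them, plus 1, so that numbers are fresh
  and 0 can mean that there is no cluster.\<close>

definition round_new :: sprog where
  "round_new = seq [
     Asg 59 (Const 0) (scalar 12 \<oplus> Const 1),
     Asg 60 (Const 0) (Const 0),
     For 10 tokens_expr round_fill,
     argmin_prog 10 tokens_expr SSkip (Read 22 (scalar 10 \<oslash> cap_expr))
       (eq_expr (Read 57 (scalar 10)) (scalar 59)),
     Asg 58 (scalar 59) (scalar best_idx \<oslash> cap_expr),
     Asg 55 (scalar best_idx \<oslash> cap_expr) (Read 55 (scalar best_idx \<oslash> cap_expr) \<oplus> Const 1)]"

text \<open>The minimum search looks for a near token that already has a cluster; a positive
  \<open>best_den\<close> signals that there is one.\<close>

definition round_choose :: sprog where
  "round_choose = seq [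
     argmin_prog 10 tokens_expr SSkip (scalar 10)
       (near_expr (scalar 42) (scalar 10) \<odot> (Const 0 \<lless> Read 57 (scalar 10))),
     SIf (scalar best_den) (Asg 59 (Const 0) (Read 57 (scalar best_idx))) round_new]"

abbreviation "joined_expr \<equiv> Read 58 (scalar 59) \<odot> clients_expr \<oplus> col_expr (scalar 42)"

definition round_join_prog :: sprog where
  "round_join_prog = seq [
     Asg 56 joined_expr (Read 56 joined_expr \<oplus> Const 1),
     Asg 53 (col_expr (scalar 42)) (Read 53 (col_expr (scalar 42)) \<ominus> Const 1),
     map_prog 54 10 tokens_expr (col_expr (scalar 42) \<odot> tokens_expr \<oplus> scalar 10)
       (Read 54 (col_expr (scalar 42) \<odot> tokens_expr \<oplus> scalar 10) \<odot>
         not_expr (eq_expr (Read 57 (scalar 10)) (scalar 59)))]"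

definition round_prog :: sprog where
  "round_prog = For 12 (Const 2 \<odot> (sites_expr \<odot> clients_expr))
     (SSeq round_search (SIf (scalar best_den)
       (seq [Asg 42 (Const 0) (scalar best_idx), round_choose, round_join_prog]) SSkip))"

lemma writes_round_fill: "writes round_fill = {57, 60, 61}"
  by (auto simp: round_fill_def)

lemma writes_round_new: "writes round_new = {10, best_idx, best_num, best_den, 55, 57, 58, 59, 60, 61}"
  by (auto simp: round_new_def writes_round_fill)

lemma writes_round_choose:
  "writes round_choose = {10, best_idx, best_num, best_den, 55, 57, 58, 59, 60, 61}"
  by (auto simp: round_choose_def writes_round_new)

lemma writes_round_join_prog: "writes round_join_prog = {10, 53, 54, 56}"
  by (auto simp: round_join_prog_def)

lemma writes_round_search: "writes round_search = {10, 11, best_idx, 36, best_num, best_den}"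
  by (auto simp: round_search_def)

lemma sum_of_bool_int:
  fixes n :: nat
  shows "(\<Sum>j<n. of_bool (j \<in> A)) = int (card (A \<inter> {..<n}))"
proof -
  have "(\<Sum>j<n. of_bool (j \<in> A)) = (\<Sum>j\<in>A \<inter> {..<n}. 1 :: int)"
    by (intro sum.mono_neutral_cong_right) auto
  then show ?thesis by simp
qed

text \<open>The scale fits the other phases: a facility amounts to \<open>200000 * (n + 1)\<close>
  tokens, of which \<open>h\<close> is one half, and the residual of a site is less than two
  facilities, so \<open>cap\<close> tokens per site suffice. Token \<open>t\<close> belongs to site
  \<open>t div cap\<close>.\<close>

locale token_program = ftfp_costs +
  fixes own0 :: "nat \<Rightarrow> nat set" and dem :: "nat \<Rightarrow> nat" and h cap :: nat
  assumes h: "h = 100000 * (n + 1)" and cap: "cap = 400000 * (n + 1)"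
    and own0_sub: "own0 j \<subseteq> {..<m * cap}"
    and own0_crd: "j < n \<Longrightarrow> 2 * h * dem j \<le> card (own0 j)"

sublocale token_program \<subseteq> token_rounding m n f d "{..<m * cap}" "\<lambda>t. t div cap" own0 dem h
  using h cap own0_sub own0_crd by unfold_locales (auto simp: less_mult_imp_div_less)

context token_program
begin

definition owns :: "memory \<Rightarrow> (nat \<Rightarrow> nat set) \<Rightarrow> bool" where
  "owns \<sigma> own \<longleftrightarrow> (\<forall>j<n. own j \<subseteq> {..<m * cap} \<and>
     (\<forall>t<m * cap. \<sigma> 54 (int (j * (m * cap) + t)) = of_bool (t \<in> own j)))"

text \<open>The clusters joined by a client are not stored, only counted by site in array 56.
  Together with array 55 this is already the integral solution from which augmentation
  starts.\<close>

definition represents :: "memory \<Rightarrow> (nat \<Rightarrow> nat set) \<Rightarrow> (nat \<Rightarrow> nat) \<Rightarrow> (nat \<Rightarrow> nat) \<Rightarrow> (nat \<Rightarrow> nat) \<Rightarrow>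
    (nat \<Rightarrow> nat set) \<Rightarrow> bool" where
  "represents \<sigma> own rem cl cs J \<longleftrightarrow> owns \<sigma> own \<and>
     (\<forall>j<n. \<sigma> 53 (int j) = int (rem j)) \<and> (\<forall>t<m * cap. \<sigma> 57 (int t) = int (cl t)) \<and>
     (\<forall>c\<in>clusters cl. \<sigma> 58 (int c) = int (cs c)) \<and>
     (\<forall>i<m. \<sigma> 55 (int i) = int (card {c \<in> clusters cl. cs c = i})) \<and>
     (\<forall>i<m. \<forall>j<n. \<sigma> 56 (int (i * n + j)) = int (card {c \<in> J j. cs c = i}))"

lemma size_values:
  assumes "costs_in \<tau>"
  shows "\<tau> 0 0 = int m" "\<tau> 0 1 = int n" "value_of \<tau> tokens_expr = int (m * cap)"
    "value_of \<tau> cap_expr = int cap" "value_of \<tau> half_expr = int h"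
  using assms by (auto simp: costs_in_def cap h)

lemma value_near:
  assumes base: "costs_in \<tau>" and own: "owns \<tau> own"
    and k: "value_of \<tau> k = int (i * n + j)" "i < m" "j < n"
    and t: "value_of \<tau> e = int t" "t < m * cap"
  shows "value_of \<tau> (near_expr k e) = of_bool (t \<in> near own j (d i j))"
proof -
  note sz = size_values[OF base]
  have col: "value_of \<tau> (col_expr k) = int j" using k sz col_index[of j n i] by simp
  have o: "value_of \<tau> (Read 54 (col_expr k \<odot> tokens_expr \<oplus> e)) = of_bool (t \<in> own j)"
  proof -
    have "value_of \<tau> (col_expr k \<odot> tokens_expr \<oplus> e) = int j * int (m * cap) + int t"
      using col sz(3) t(1) by (simp only: value_of.simps(3)[of _ Add] value_of.simps(3)[of _ Mul] apply_binop.simps)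
    also have "\<dots> = int (j * (m * cap) + t)" by simp
    finally show ?thesis using own k t by (simp only: value_of.simps(2) owns_def)
  qed
  have at: "value_of \<tau> (Read 23 k) = d i j" using base k by (simp add: costs_in_def)
  have tm: "t div cap < m" using t(2) by (simp add: less_mult_imp_div_less)
  have at': "value_of \<tau> (at_expr 23 (e \<oslash> cap_expr) (col_expr k)) = d (t div cap) j"
  proof -
    have "value_of \<tau> (e \<oslash> cap_expr) = int (t div cap)"
      using sz(4) t(1) by (simp only: value_of.simps(3)[of _ Div] apply_binop.simps of_nat_div)
    then have "value_of \<tau> ((e \<oslash> cap_expr) \<odot> clients_expr \<oplus> col_expr k) = int (t div cap * n + j)"
      using col sz(2) by (simp only: value_of.simps apply_binop.simps) simp
    then show ?thesis using base k tm by (simp only: value_of.simps(2) costs_in_def)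
  qed
  have "value_of \<tau> (near_expr k e) = value_of \<tau> (Read 54 (col_expr k \<odot> tokens_expr \<oplus> e)) *
      (1 - of_bool (value_of \<tau> (Read 23 k) < value_of \<tau> (at_expr 23 (e \<oslash> cap_expr) (col_expr k))))"
    by (simp only: value_of.simps apply_binop.simps)
  also have "\<dots> = of_bool (t \<in> near own j (d i j))"
    unfolding o at at' by (auto simp: near_def)
  finally show ?thesis .
qed

lemma owns_cong: "\<sigma>' 54 = \<sigma> 54 \<Longrightarrow> owns \<sigma>' own = owns \<sigma> own"
  by (simp add: owns_def)

lemma sem_round_search:
  assumes base: "costs_in \<sigma>" and own: "owns \<sigma> own" and rem: "\<And>j. j < n \<Longrightarrow> \<sigma> 53 (int j) = int (rem j)"
  defines "\<sigma>' \<equiv> sem round_search \<sigma>"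
  shows "\<sigma>' best_den 0 = 0 \<and> (\<forall>i<m. \<forall>j<n. \<not> candidate own rem i j) \<or>
    (\<exists>i<m. \<exists>j<n. \<sigma>' best_idx 0 = int (i * n + j) \<and> \<sigma>' best_den 0 \<noteq> 0 \<and> candidate own rem i j \<and>
      (\<forall>i'<m. \<forall>j'<n. candidate own rem i' j' \<longrightarrow> d i j \<le> d i' j'))"
proof -
  define \<nu> where "\<nu> k = d (k div n) (k mod n)" for k
  define \<delta> :: "nat \<Rightarrow> int" where "\<delta> k = of_bool (candidate own rem (k div n) (k mod n))" for k
  have dm: "(i * n + l) div n = i" "(i * n + l) mod n = l" if "l < n" for i l :: nat
    using that by auto
  have "\<sigma>' best_den 0 = 0 \<and> (\<forall>k<m * n. \<delta> k \<le> 0) \<or>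
    (\<exists>k<m * n. \<sigma>' best_idx 0 = int k \<and> \<sigma>' best_den 0 = \<delta> k \<and> 0 < \<delta> k \<and> \<sigma>' best_num 0 = \<nu> k \<and>
      (\<forall>k'<m * n. 0 < \<delta> k' \<longrightarrow> \<nu> k * \<delta> k' \<le> \<nu> k' * \<delta> k))"
    unfolding \<sigma>'_def round_search_def
  proof (rule sem_argmin_prog)
    show "m * n = nat (value_of \<sigma> (sites_expr \<odot> clients_expr))"
      using base by (simp add: costs_in_def nat_mult_distrib)
    fix k \<tau>
    let ?count = "sum_prog 36 11 tokens_expr (near_expr (scalar 10) (scalar 11))"
    assume k: "k < m * n" and fr: "\<And>b. b \<notin> writes ?count \<Longrightarrow> b \<notin> {10, best_idx, best_num, best_den} \<Longrightarrow> \<tau> b = \<sigma> b"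
      and \<tau>10: "\<tau> 10 0 = int k"
    obtain i j where ij: "i < m" "j < n" "k = i * n + j" using k by (rule index_split)
    have fr': "\<tau> b = \<sigma> b" if "b \<in> {0, 22, 23, 53, 54}" for b
      using that by (intro fr) auto
    have base': "costs_in \<tau>" using base costs_in_cong[of \<tau> \<sigma>] fr' by simp
    have own': "owns \<tau> own" using own owns_cong[of \<tau> \<sigma>] fr' by simp
    note sz = size_values[OF base']
    let ?\<rho> = "sem ?count \<tau>"
    have fr\<rho>: "?\<rho> b = \<tau> b" if "b \<notin> {11, 36}" for b
      using that by (intro sem_frame) simp
    have base\<rho>: "costs_in ?\<rho>" using base' costs_in_cong[of ?\<rho> \<tau>] fr\<rho> by simp
    note sz\<rho> = size_values[OF base\<rho>]
    have val: "value_of (store \<tau> 11 0 (int t)) (near_expr (scalar 10) (scalar 11))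
        = of_bool (t \<in> near own j (d i j))" if "t < m * cap" for t
    proof (rule value_near)
      let ?\<tau> = "store \<tau> 11 0 (int t)"
      show "costs_in ?\<tau>" using base' costs_in_cong[of ?\<tau> \<tau>] by simp
      show "owns ?\<tau> own" using own' owns_cong[of ?\<tau> \<tau>] by simp
    qed (use that ij \<tau>10 in auto)
    have "?\<rho> 36 0 = (\<Sum>t<m * cap. value_of (store \<tau> 11 0 (int t)) (near_expr (scalar 10) (scalar 11)))"
      by (subst sem_sum_prog) (simp_all only: sz(3) nat_int, simp_all)
    also have "\<dots> = (\<Sum>t<m * cap. of_bool (t \<in> near own j (d i j)))"
      using val by (intro sum.cong) auto
    also have "\<dots> = int (card (near own j (d i j) \<inter> {..<m * cap}))" by (rule sum_of_bool_int)
    also have "near own j (d i j) \<inter> {..<m * cap} = near own j (d i j)"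
      using own ij by (auto simp: near_def owns_def)
    finally have cnt: "?\<rho> 36 0 = int (card (near own j (d i j)))" .
    have col: "value_of ?\<rho> (col_expr (scalar 10)) = int j"
      using \<tau>10 ij sz\<rho> col_index[of j n i] fr\<rho> by simp
    have "value_of ?\<rho> (Read 23 (scalar 10)) = \<nu> k"
      using base\<rho> ij fr\<rho> \<tau>10 by (simp add: \<nu>_def dm costs_in_def)
    moreover have "value_of ?\<rho> (Read 53 (col_expr (scalar 10))) = int (rem j)"
      using col rem[OF ij(2)] fr\<rho>[of 53] fr'[of 53] by (simp only: value_of.simps(2)) simp
    moreover have "value_of ?\<rho> ((Const 0 \<lless> Read 53 (col_expr (scalar 10))) \<odot> not_expr (scalar 36 \<lless> half_expr))
      = of_bool (0 < value_of ?\<rho> (Read 53 (col_expr (scalar 10)))) * (1 - of_bool (?\<rho> 36 0 < value_of ?\<rho> half_expr))"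
      by (simp only: value_of.simps apply_binop.simps)
    ultimately show "value_of ?\<rho> (Read 23 (scalar 10)) = \<nu> k \<and>
      value_of ?\<rho> ((Const 0 \<lless> Read 53 (col_expr (scalar 10))) \<odot> not_expr (scalar 36 \<lless> half_expr)) = \<delta> k"
      unfolding cnt sz\<rho>(5) by (auto simp: \<delta>_def dm ij candidate_def)
  qed auto
  then consider (none) "\<sigma>' best_den 0 = 0" "\<And>k. k < m * n \<Longrightarrow> \<delta> k \<le> 0"
    | (some) k where "k < m * n" "\<sigma>' best_idx 0 = int k" "\<sigma>' best_den 0 = \<delta> k" "0 < \<delta> k"
      "\<And>k'. k' < m * n \<Longrightarrow> 0 < \<delta> k' \<Longrightarrow> \<nu> k * \<delta> k' \<le> \<nu> k' * \<delta> k"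
    by blast
  then show ?thesis
  proof cases
    case none
    have "\<not> candidate own rem i j" if "i < m" "j < n" for i j
      using none(2)[OF index_less[OF that]] that
      by (auto simp: \<delta>_def dm of_bool_def split: if_splits)
    then show ?thesis using none(1) by blast
  next
    case (some k)
    obtain i j where ij: "i < m" "j < n" "k = i * n + j" using some(1) by (rule index_split)
    have cand: "candidate own rem i j" using some(4) ij by (simp add: \<delta>_def dm)
    have "d i j \<le> d i' j'" if "i' < m" "j' < n" "candidate own rem i' j'" for i' j'
      using some(5)[OF index_less[OF that(1,2)]] that cand ij by (simp add: \<delta>_def \<nu>_def dm)
    then show ?thesis using ij cand some(2,3,4)
      by (intro disjI2 exI[of _ i] exI[of _ j] conjI) auto
  qed
qed

lemma near_sub: "owns \<sigma> own \<Longrightarrow> j < n \<Longrightarrow> near own j R \<subseteq> {..<m * cap}"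
  by (auto simp: near_def owns_def)

text \<open>The set \<open>U\<close> grows by every near token until it has \<open>h\<close>
  elements, so it collects those with the smallest numbers. By \<open>free\<close>, the addition of
  \<open>c\<close> always meets a 0.\<close>

lemma sem_round_fill_loop:
  assumes base: "costs_in \<sigma>" and own: "owns \<sigma> own" and ij: "i < m" "j < n" "\<sigma> 42 0 = int (i * n + j)"
    and \<sigma>: "\<sigma> 59 0 = int c" "\<sigma> 60 0 = 0"
    and cl: "\<And>t. t < m * cap \<Longrightarrow> \<sigma> 57 (int t) = int (cl t)"
    and free: "\<And>t. t \<in> near own j (d i j) \<Longrightarrow> cl t = 0"
  shows "\<exists>U \<subseteq> near own j (d i j). card U = min h (card (near own j (d i j))) \<and>
    (\<forall>t<m * cap. sem (For 10 tokens_expr round_fill) \<sigma> 57 (int t) = int (if t \<in> U then c else cl t))"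
proof -
  define A where "A = near own j (d i j)"
  define N where "N = m * cap"
  have A: "A \<subseteq> {..<N}" unfolding A_def N_def using own ij by (intro near_sub)
  let ?Inv = "\<lambda>k \<tau>. (\<forall>b. b \<notin> {10, 57, 60, 61} \<longrightarrow> \<tau> b = \<sigma> b) \<and> \<tau> 10 0 = int k \<and>
    (\<exists>U \<subseteq> A \<inter> {..<k}. card U = min h (card (A \<inter> {..<k})) \<and> \<tau> 60 0 = int (card U) \<and>
      (\<forall>t<N. \<tau> 57 (int t) = int (if t \<in> U then c else cl t)))"
  have L: "?Inv N (loop 10 N (sem round_fill) \<sigma>)"
  proof (rule loop_invariant[where Inv = ?Inv])
    show "?Inv 0 (store \<sigma> 10 0 0)" using \<sigma> cl by (auto simp: N_def)
  next
    fix k \<tau>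
    assume k: "k < N" and Inv: "?Inv k \<tau>"
    then obtain U where U: "U \<subseteq> A \<inter> {..<k}" "card U = min h (card (A \<inter> {..<k}))"
      "\<tau> 60 0 = int (card U)" "\<And>t. t < N \<Longrightarrow> \<tau> 57 (int t) = int (if t \<in> U then c else cl t)"
      and fr: "\<And>b. b \<notin> {10, 57, 60, 61} \<Longrightarrow> \<tau> b = \<sigma> b" and \<tau>10: "\<tau> 10 0 = int k" by blast
    have finU: "finite U" using U(1) by (rule finite_subset) simp
    have kU: "k \<notin> U" using U(1) by auto
    have base': "costs_in \<tau>" using base costs_in_cong[of \<tau> \<sigma>] fr by simp
    have own': "owns \<tau> own" using own owns_cong[of \<tau> \<sigma>] fr by simp
    have near: "value_of \<tau> (near_expr (scalar 42) (scalar 10)) = of_bool (k \<in> A)"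
      unfolding A_def using base' own'
    proof (rule value_near)
      show "value_of \<tau> (scalar 42) = int (i * n + j)" using ij(3) fr by simp
    qed (use ij k \<tau>10 in \<open>auto simp: N_def\<close>)
    define s where "s = (k \<in> A \<and> card U < h)"
    have "value_of \<tau> (near_expr (scalar 42) (scalar 10) \<odot> (scalar 60 \<lless> half_expr)) =
        value_of \<tau> (near_expr (scalar 42) (scalar 10)) * of_bool (value_of \<tau> (scalar 60) < value_of \<tau> half_expr)"
      by (simp only: value_of.simps apply_binop.simps)
    also have "\<dots> = of_bool s"
      unfolding near size_values(5)[OF base'] using U(3) by (simp add: s_def)
    finally have sel: "value_of \<tau> (near_expr (scalar 42) (scalar 10) \<odot> (scalar 60 \<lless> half_expr)) = of_bool s" .
    define \<tau>1 where "\<tau>1 = store \<tau> 61 0 (of_bool s)"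
    have sem: "sem round_fill \<tau> = store (store \<tau>1 57 (int k) (\<tau> 57 (int k) + of_bool s * int c)) 60 0 (\<tau> 60 0 + of_bool s)"
    proof -
      have "sem (Asg 61 (Const 0) (near_expr (scalar 42) (scalar 10) \<odot> (scalar 60 \<lless> half_expr))) \<tau> = \<tau>1"
        unfolding sem.simps sel \<tau>1_def by simp
      then show ?thesis using \<tau>10 fr[of 59] \<sigma> by (simp add: round_fill_def) (simp add: \<tau>1_def)
    qed
    define \<rho> where "\<rho> = store (sem round_fill \<tau>) 10 0 (int (Suc k))"
    have \<rho>: "\<And>b. b \<notin> {10, 57, 60, 61} \<Longrightarrow> \<rho> b = \<sigma> b" "\<rho> 10 0 = int (Suc k)" "\<rho> 60 0 = int (card U) + of_bool s"
      "\<rho> 57 = (\<tau> 57)(int k := \<tau> 57 (int k) + of_bool s * int c)"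
      using fr U(3) by (simp_all add: \<rho>_def sem \<tau>1_def fun_eq_iff)
    define U' where "U' = (if s then insert k U else U)"
    have Suc_eq: "A \<inter> {..<Suc k} = (if k \<in> A then insert k (A \<inter> {..<k}) else A \<inter> {..<k})"
      by (auto simp: less_Suc_eq)
    have cardS: "card (A \<inter> {..<Suc k}) = card (A \<inter> {..<k}) + of_bool (k \<in> A)"
      unfolding Suc_eq by simp
    have cardU': "card U' = card U + of_bool s" unfolding U'_def using finU kU by simp
    have "card U' = min h (card (A \<inter> {..<Suc k}))"
      unfolding cardU' cardS using U(2) by (auto simp: s_def)
    moreover have "U' \<subseteq> A \<inter> {..<Suc k}" using U(1) by (auto simp: U'_def s_def)
    moreover have "\<rho> 57 (int t) = int (if t \<in> U' then c else cl t)" if "t < N" for t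
      using U(4)[OF that] U(4)[OF k] kU free[of k] by (auto simp: \<rho>(4) U'_def s_def A_def)
    ultimately show "?Inv (Suc k) (store (sem round_fill \<tau>) 10 0 (int (Suc k)))"
      unfolding \<rho>_def[symmetric] using \<rho>(1,2,3) cardU' by (intro conjI exI[of _ U']) auto
  qed
  have sem: "sem (For 10 tokens_expr round_fill) \<sigma> = loop 10 N (sem round_fill) \<sigma>"
    unfolding sem.simps size_values(3)[OF base] N_def by (simp only: nat_int)
  have AN: "A \<inter> {..<N} = A" using A by auto
  from L obtain U where "U \<subseteq> A" "card U = min h (card A)"
    "\<forall>t<N. loop 10 N (sem round_fill) \<sigma> 57 (int t) = int (if t \<in> U then c else cl t)"
    unfolding AN by blast
  then show ?thesis unfolding sem A_def N_def by blast
qed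

lemma round_inv_site: "round_inv own rem cl cs J R rad \<Longrightarrow> c \<in> clusters cl \<Longrightarrow> cs c < m"
  by (simp add: round_inv_def)

lemma round_inv_own: "round_inv own rem cl cs J R rad \<Longrightarrow> j < n \<Longrightarrow> own j \<subseteq> own0 j"
  by (simp add: round_inv_def)

text \<open>The existential conclusion collects the premises of \<open>round_join\<close>. If a near
  token has a cluster, \<open>cl\<close> and \<open>cs\<close> are kept and this cluster is joined;
  otherwise all near tokens are free, and \<open>Suc s\<close> is a fresh number, because all
  numbers in use are at most \<open>s\<close>.\<close>

lemma sem_round_choose:
  assumes base: "costs_in \<sigma>" and rep: "represents \<sigma> own rem cl cs J"
    and ij: "i < m" "j < n" "\<sigma> 42 0 = int (i * n + j)" and cand: "candidate own rem i j"
    and fresh: "\<And>t. t < m * cap \<Longrightarrow> cl t \<le> s" "\<sigma> 12 0 = int s"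
    and J: "\<And>j. j < n \<Longrightarrow> J j \<subseteq> clusters cl"
  defines "\<sigma>' \<equiv> sem round_choose \<sigma>" and "A \<equiv> near own j (d i j)"
  shows "\<exists>cl' cs' c t0. represents \<sigma>' own rem cl' cs' J \<and> \<sigma>' 59 0 = int c \<and>
    (\<forall>t<m * cap. cl' t \<le> Suc s) \<and>
    (\<forall>t<m * cap. cl t \<noteq> 0 \<longrightarrow> cl' t = cl t) \<and> (\<forall>c \<in> clusters cl. cs' c = cs c) \<and>
    (\<forall>t<m * cap. cl t = 0 \<longrightarrow> cl' t \<noteq> 0 \<longrightarrow> cl' t = c \<and> t \<in> A \<and> c \<notin> clusters cl) \<and>
    c \<in> clusters cl' \<and> t0 \<in> A \<and> cl' t0 = c \<and>
    (c \<notin> clusters cl \<longrightarrow> cs' c < m \<and> d (cs' c) j \<le> d i j \<and> card {t \<in> {..<m * cap}. cl' t = c} = h \<and>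
      (\<forall>t<m * cap. cl' t = c \<longrightarrow> f (cs' c) \<le> f (t div cap)))"
proof -
  define N where "N = m * cap"
  have own: "owns \<sigma> own" and rem: "\<And>j. j < n \<Longrightarrow> \<sigma> 53 (int j) = int (rem j)"
    and cl: "\<And>t. t < N \<Longrightarrow> \<sigma> 57 (int t) = int (cl t)"
    and cs: "\<And>c. c \<in> clusters cl \<Longrightarrow> \<sigma> 58 (int c) = int (cs c)"
    and y: "\<And>i. i < m \<Longrightarrow> \<sigma> 55 (int i) = int (card {c \<in> clusters cl. cs c = i})"
    and x: "\<And>i j. i < m \<Longrightarrow> j < n \<Longrightarrow> \<sigma> 56 (int (i * n + j)) = int (card {c \<in> J j. cs c = i})"
    using rep unfolding represents_def N_def by blast+
  have A: "A \<subseteq> {..<N}" unfolding A_def N_def using own ij by (intro near_sub)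
  define p1 where "p1 = argmin_prog 10 tokens_expr SSkip (scalar 10)
       (near_expr (scalar 42) (scalar 10) \<odot> (Const 0 \<lless> Read 57 (scalar 10)))"
  define \<sigma>1 where "\<sigma>1 = sem p1 \<sigma>"
  have f1: "\<sigma>1 b = \<sigma> b" if "b \<notin> {10, 13, 37, 38}" for b
    using that sem_frame[of b] by (simp add: \<sigma>1_def p1_def)
  let ?\<delta> = "\<lambda>t. of_bool (t \<in> A \<and> 0 < cl t) :: int"
  have "\<sigma>1 best_den 0 = 0 \<and> (\<forall>k<N. ?\<delta> k \<le> 0) \<or>
    (\<exists>k<N. \<sigma>1 best_idx 0 = int k \<and> \<sigma>1 best_den 0 = ?\<delta> k \<and> 0 < ?\<delta> k \<and> \<sigma>1 best_num 0 = int k \<and>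
      (\<forall>k'<N. 0 < ?\<delta> k' \<longrightarrow> int k * ?\<delta> k' \<le> int k' * ?\<delta> k))"
    unfolding \<sigma>1_def p1_def
  proof (rule sem_argmin_prog[where \<nu> = int and \<delta> = ?\<delta>])
    show "N = nat (value_of \<sigma> tokens_expr)" unfolding size_values(3)[OF base] N_def by (simp only: nat_int)
    fix k \<tau>
    assume k: "k < N" and fr: "\<And>b. b \<notin> writes SSkip \<Longrightarrow> b \<notin> {10, best_idx, best_num, best_den} \<Longrightarrow> \<tau> b = \<sigma> b"
      and \<tau>10: "\<tau> 10 0 = int k"
    have fr': "\<tau> b = \<sigma> b" if "b \<in> {0, 22, 23, 42, 54, 57}" for b using that by (intro fr) auto
    have base': "costs_in \<tau>" using base costs_in_cong[of \<tau> \<sigma>] fr' by simp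
    have own': "owns \<tau> own" using own owns_cong[of \<tau> \<sigma>] fr' by simp
    have near: "value_of \<tau> (near_expr (scalar 42) (scalar 10)) = of_bool (k \<in> A)"
      unfolding A_def using base' own'
    proof (rule value_near)
      show "value_of \<tau> (scalar 42) = int (i * n + j)" using ij(3) fr' by simp
    qed (use ij k \<tau>10 in \<open>auto simp: N_def\<close>)
    have "value_of \<tau> (near_expr (scalar 42) (scalar 10) \<odot> (Const 0 \<lless> Read 57 (scalar 10))) =
        value_of \<tau> (near_expr (scalar 42) (scalar 10)) * of_bool (0 < value_of \<tau> (Read 57 (scalar 10)))"
      by (simp only: value_of.simps apply_binop.simps)
    also have "\<dots> = ?\<delta> k" unfolding near using \<tau>10 fr' cl[OF k] by simp
    finally show "value_of (sem SSkip \<tau>) (scalar 10) = int k \<and>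
      value_of (sem SSkip \<tau>) (near_expr (scalar 42) (scalar 10) \<odot> (Const 0 \<lless> Read 57 (scalar 10))) = ?\<delta> k"
      using \<tau>10 by simp
  qed auto
  note search = this
  have dpos: "0 < ?\<delta> t \<longleftrightarrow> t \<in> A \<and> 0 < cl t" for t by simp
  consider (none) "\<sigma>1 best_den 0 = 0" "\<And>t. t \<in> A \<Longrightarrow> cl t = 0"
    | (some) t0 where "t0 < N" "\<sigma>1 best_idx 0 = int t0" "\<sigma>1 best_den 0 \<noteq> 0" "t0 \<in> A" "0 < cl t0"
  proof (cases "\<sigma>1 best_den 0 = 0")
    case True
    then have le: "\<forall>k<N. \<not> 0 < ?\<delta> k" using search by (metis (no_types, lifting) less_irrefl not_less)
    have "cl t = 0" if "t \<in> A" for t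
      using le that A dpos[of t] by (metis lessThan_iff not_gr0 subsetD)
    then show thesis using True none by blast
  next
    case False
    then obtain k where "k < N" "\<sigma>1 best_idx 0 = int k" "0 < ?\<delta> k" using search by blast
    then show thesis using False dpos[of k] some by blast
  qed
  then show ?thesis
  proof cases
    case (some t0)
    have \<sigma>': "\<sigma>' = store \<sigma>1 59 0 (\<sigma>1 57 (int t0))"
      using some by (simp add: \<sigma>'_def round_choose_def p1_def[symmetric] \<sigma>1_def[symmetric])
    have f': "\<sigma>' b = \<sigma> b" if "b \<in> {53, 54, 55, 56, 57, 58}" for b
      using that f1 by (auto simp: \<sigma>')
    have "represents \<sigma>' own rem cl cs J"
      using rep f' unfolding represents_def owns_def by simp
    moreover have "\<sigma>' 59 0 = int (cl t0)" using cl[OF some(1)] f1 by (simp add: \<sigma>')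
    moreover have c: "cl t0 \<in> clusters cl" using some by (auto simp: clusters_def N_def)
    ultimately show ?thesis
      using some fresh(1) by (intro exI[of _ cl] exI[of _ cs] exI[of _ "cl t0"] exI[of _ t0]) (auto intro: le_SucI)
  next
    case none
    define c where "c = Suc s"
    define \<sigma>2 where "\<sigma>2 = store (store \<sigma>1 59 0 (int c)) 60 0 0"
    define \<sigma>3 where "\<sigma>3 = sem (For 10 tokens_expr round_fill) \<sigma>2"
    define p4 where "p4 = argmin_prog 10 tokens_expr SSkip (Read 22 (scalar 10 \<oslash> cap_expr))
       (eq_expr (Read 57 (scalar 10)) (scalar 59))"
    define \<sigma>4 where "\<sigma>4 = sem p4 \<sigma>3"
    define \<sigma>5 where "\<sigma>5 = sem (Asg 58 (scalar 59) (scalar best_idx \<oslash> cap_expr)) \<sigma>4"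
    have "sem round_choose \<sigma> = sem round_new \<sigma>1"
      using none(1) by (simp add: round_choose_def p1_def[symmetric] \<sigma>1_def[symmetric])
    then have \<sigma>': "\<sigma>' = sem (Asg 55 (scalar best_idx \<oslash> cap_expr) (Read 55 (scalar best_idx \<oslash> cap_expr) \<oplus> Const 1)) \<sigma>5"
      using fresh(2) f1[of 12]
      by (simp add: \<sigma>'_def round_new_def \<sigma>5_def \<sigma>4_def p4_def \<sigma>3_def \<sigma>2_def c_def add.commute)
    have f2: "\<sigma>2 b = \<sigma> b" if "b \<notin> {10, 13, 37, 38, 59, 60}" for b using that f1 by (simp add: \<sigma>2_def)
    have f3: "\<sigma>3 b = \<sigma>2 b" if "b \<notin> {10, 57, 60, 61}" for b
      unfolding \<sigma>3_def using that by (intro sem_frame) (simp add: writes_round_fill)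
    have f4: "\<sigma>4 b = \<sigma>3 b" if "b \<notin> {10, 13, 37, 38}" for b
      using that sem_frame[of b] by (simp add: \<sigma>4_def p4_def)
    have f5: "\<sigma>5 b = \<sigma>4 b" if "b \<noteq> 58" for b using that by (simp add: \<sigma>5_def)
    have f': "\<sigma>' b = \<sigma>5 b" if "b \<noteq> 55" for b using that by (simp add: \<sigma>')
    have base2: "costs_in \<sigma>2" using base costs_in_cong[of \<sigma>2 \<sigma>] f2 by simp
    have own2: "owns \<sigma>2 own" using own owns_cong[of \<sigma>2 \<sigma>] f2 by simp
    obtain U where U: "U \<subseteq> A" "card U = min h (card A)"
      "\<And>t. t < N \<Longrightarrow> \<sigma>3 57 (int t) = int (if t \<in> U then c else cl t)"
      using sem_round_fill_loop[OF base2 own2 ij(1,2), of c cl] ij(3) none(2) cl f2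
      unfolding \<sigma>3_def N_def A_def by (auto simp: \<sigma>2_def f1)
    have "h \<le> card A" using cand by (simp add: candidate_def A_def)
    then have cU: "card U = h" using U(2) by simp
    have UN: "U \<subseteq> {..<N}" using U(1) A by blast
    define cl' where "cl' t = (if t \<in> U then c else cl t)" for t
    have cl'_c: "cl' t = c \<longleftrightarrow> t \<in> U" if "t < N" for t
      using fresh(1)[of t] that by (auto simp: cl'_def c_def N_def)
    have c59: "\<sigma>3 59 0 = int c" using f3 by (simp add: \<sigma>2_def)
    have base3: "costs_in \<sigma>3" using base2 costs_in_cong[of \<sigma>3 \<sigma>2] f3 by simp
    have best: "\<sigma>4 best_den 0 = 0 \<and> (\<forall>k<N. of_bool (k \<in> U) \<le> (0::int)) \<or>
      (\<exists>k<N. \<sigma>4 best_idx 0 = int k \<and> \<sigma>4 best_den 0 = of_bool (k \<in> U) \<and> 0 < (of_bool (k \<in> U) :: int) \<and>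
        \<sigma>4 best_num 0 = f (k div cap) \<and>
        (\<forall>k'<N. 0 < (of_bool (k' \<in> U) :: int) \<longrightarrow> f (k div cap) * of_bool (k' \<in> U) \<le> f (k' div cap) * of_bool (k \<in> U)))"
      unfolding \<sigma>4_def p4_def
    proof (rule sem_argmin_prog[where \<nu> = "\<lambda>k. f (k div cap)" and \<delta> = "\<lambda>k. of_bool (k \<in> U)"])
      show "N = nat (value_of \<sigma>3 tokens_expr)" unfolding size_values(3)[OF base3] N_def by (simp only: nat_int)
      fix k \<tau>
      assume k: "k < N" and fr: "\<And>b. b \<notin> writes SSkip \<Longrightarrow> b \<notin> {10, best_idx, best_num, best_den} \<Longrightarrow> \<tau> b = \<sigma>3 b"
        and \<tau>10: "\<tau> 10 0 = int k"
      have fr': "\<tau> b = \<sigma>3 b" if "b \<in> {0, 22, 23, 57, 59}" for b using that by (intro fr) auto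
      have base': "costs_in \<tau>" using base3 costs_in_cong[of \<tau> \<sigma>3] fr' by simp
      have "value_of \<tau> (scalar 10 \<oslash> cap_expr) = int (k div cap)"
        unfolding value_of.simps(3)[of _ Div] size_values(4)[OF base'] using \<tau>10 by (simp add: of_nat_div)
      moreover have "k div cap < m" using k by (simp add: N_def less_mult_imp_div_less)
      ultimately have "value_of \<tau> (Read 22 (scalar 10 \<oslash> cap_expr)) = f (k div cap)"
        using base' by (simp only: value_of.simps(2) costs_in_def)
      moreover have "value_of \<tau> (eq_expr (Read 57 (scalar 10)) (scalar 59)) = of_bool (k \<in> U)"
        using U(3)[OF k] cl'_c[OF k] \<tau>10 c59 fr' by (auto simp: cl'_def)
      ultimately show "value_of (sem SSkip \<tau>) (Read 22 (scalar 10 \<oslash> cap_expr)) = f (k div cap) \<and>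
        value_of (sem SSkip \<tau>) (eq_expr (Read 57 (scalar 10)) (scalar 59)) = of_bool (k \<in> U)"
        by simp
    qed auto
    have "U \<noteq> {}" using cU h_pos by auto
    obtain t1 where t1: "t1 < N" "t1 \<in> U" "\<sigma>4 best_idx 0 = int t1"
      "\<And>t. t < N \<Longrightarrow> t \<in> U \<Longrightarrow> f (t1 div cap) \<le> f (t div cap)"
    proof -
      assume that: "\<And>t1. t1 < N \<Longrightarrow> t1 \<in> U \<Longrightarrow> \<sigma>4 best_idx 0 = int t1 \<Longrightarrow>
        (\<And>t. t < N \<Longrightarrow> t \<in> U \<Longrightarrow> f (t1 div cap) \<le> f (t div cap)) \<Longrightarrow> thesis"
      obtain u where u: "u \<in> U" "u < N" using \<open>U \<noteq> {}\<close> UN by auto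
      have "\<not> (\<forall>k<N. of_bool (k \<in> U) \<le> (0::int))" using u by auto
      then obtain k where k: "k < N" "\<sigma>4 best_idx 0 = int k" "0 < (of_bool (k \<in> U) :: int)"
        "\<forall>k'<N. 0 < (of_bool (k' \<in> U) :: int) \<longrightarrow>
          f (k div cap) * of_bool (k' \<in> U) \<le> f (k' div cap) * of_bool (k \<in> U)"
        using best by blast
      have kU: "k \<in> U" using k(3) by simp
      show thesis
      proof (rule that[OF k(1) kU k(2)])
        fix t
        assume "t < N" "t \<in> U"
        then show "f (k div cap) \<le> f (t div cap)" using k(4) kU by auto
      qed
    qed
    define cs' where "cs' = cs(c := t1 div cap)"
    have c_new: "c \<notin> clusters cl" using fresh(1) by (force simp: clusters_def c_def)
    have clusters': "clusters cl' = insert c (clusters cl)"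
    proof (intro equalityI subsetI)
      fix c'
      assume "c' \<in> clusters cl'"
      then show "c' \<in> insert c (clusters cl)" by (auto simp: clusters_def cl'_def split: if_splits)
    next
      fix c'
      assume "c' \<in> insert c (clusters cl)"
      then show "c' \<in> clusters cl'"
      proof
        assume "c' = c"
        then show ?thesis using t1(1,2) by (auto simp: clusters_def cl'_def c_def N_def)
      next
        assume "c' \<in> clusters cl"
        then obtain t where t: "t < N" "cl t = c'" "0 < c'" by (auto simp: clusters_def N_def)
        then have "t \<notin> U" using U(1) none(2) by auto
        then show ?thesis using t by (auto simp: clusters_def cl'_def N_def)
      qed
    qed
    have site: "t1 div cap < m" using t1(1) by (simp add: N_def less_mult_imp_div_less)
    have base4: "costs_in \<sigma>4" using base3 costs_in_cong[of \<sigma>4 \<sigma>3] f4 by simp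
    have base5: "costs_in \<sigma>5" using base4 costs_in_cong[of \<sigma>5 \<sigma>4] f5 by simp
    have val4: "value_of \<sigma>4 (scalar best_idx \<oslash> cap_expr) = int (t1 div cap)"
      unfolding value_of.simps(3)[of _ Div] size_values(4)[OF base4] using t1(3) by (simp add: of_nat_div)
    have val5: "value_of \<sigma>5 (scalar best_idx \<oslash> cap_expr) = int (t1 div cap)"
      unfolding value_of.simps(3)[of _ Div] size_values(4)[OF base5] using t1(3) f5 by (simp add: of_nat_div)
    have m58: "\<sigma>' 58 = (\<sigma> 58)(int c := int (t1 div cap))"
    proof -
      have "\<sigma>5 58 = (\<sigma>4 58)(value_of \<sigma>4 (scalar 59) := int (t1 div cap))"
        unfolding \<sigma>5_def sem.simps val4 by simp
      then show ?thesis using c59 f' f4 f3 f2 by simp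
    qed
    have m55: "\<sigma>' 55 = (\<sigma> 55)(int (t1 div cap) := \<sigma> 55 (int (t1 div cap)) + 1)"
    proof -
      have "\<sigma>' 55 = (\<sigma>5 55)(int (t1 div cap) := value_of \<sigma>5 (Read 55 (scalar best_idx \<oslash> cap_expr)) + 1)"
        unfolding \<sigma>' sem.simps val5 by simp
      also have "value_of \<sigma>5 (Read 55 (scalar best_idx \<oslash> cap_expr)) = \<sigma>5 55 (int (t1 div cap))"
        unfolding value_of.simps(2) val5 ..
      finally show ?thesis using f5 f4 f3 f2 by (simp add: fun_eq_iff)
    qed
    have keep: "\<sigma>' b = \<sigma> b" if "b \<in> {53, 54, 56}" for b using that f' f5 f4 f3 f2 by auto
    have m57: "\<sigma>' 57 (int t) = int (cl' t)" if "t < N" for t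
      using U(3)[OF that] f' f5 f4 by (simp add: cl'_def)
    have cs'_old: "cs' c' = cs c'" if "c' \<in> clusters cl" for c' using that c_new by (auto simp: cs'_def)
    have y': "\<sigma>' 55 (int i') = int (card {c' \<in> clusters cl'. cs' c' = i'})" if "i' < m" for i'
    proof -
      have "{c' \<in> clusters cl'. cs' c' = i'} =
          {c' \<in> clusters cl. cs c' = i'} \<union> (if i' = t1 div cap then {c} else {})"
        unfolding clusters' using c_new by (auto simp: cs'_def)
      then have "card {c' \<in> clusters cl'. cs' c' = i'} =
          card {c' \<in> clusters cl. cs c' = i'} + of_bool (i' = t1 div cap)"
        using c_new finite_clusters[of cl] by simp
      then show ?thesis using y[OF that] by (auto simp: m55)
    qed
    have x': "{c' \<in> J j'. cs' c' = i'} = {c' \<in> J j'. cs c' = i'}" if "j' < n" for i' j'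
      using J[OF that] cs'_old by auto
    have r1: "represents \<sigma>' own rem cl' cs' J"
      unfolding represents_def
    proof (intro conjI allI impI ballI)
      show "owns \<sigma>' own" using own owns_cong[of \<sigma>' \<sigma>] keep by simp
      fix c'
      assume c': "c' \<in> clusters cl'"
      show "\<sigma>' 58 (int c') = int (cs' c')"
        using c' cs cs'_old unfolding clusters' m58 by (auto simp: cs'_def)
    qed (use keep rem x x' y' m57 in \<open>auto simp: N_def\<close>)
    have r2: "\<sigma>' 59 0 = int c" using c59 f' f5 f4 by simp
    have q1: "d (cs' c) j \<le> d i j" using t1(2) U(1) by (auto simp: cs'_def A_def near_def)
    have q2: "{t \<in> {..<m * cap}. cl' t = c} = U" using cl'_c UN by (auto simp: N_def)
    have q3: "\<forall>t<m * cap. cl' t = c \<longrightarrow> f (cs' c) \<le> f (t div cap)"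
      using t1(4) cl'_c by (auto simp: N_def cs'_def)
    have r3: "\<forall>t<m * cap. cl' t \<le> Suc s" using fresh(1) by (auto simp: cl'_def c_def intro: le_SucI)
    have r4: "\<forall>t<m * cap. cl t \<noteq> 0 \<longrightarrow> cl' t = cl t" using U(1) none(2) by (auto simp: cl'_def)
    have r6: "\<forall>t<m * cap. cl t = 0 \<longrightarrow> cl' t \<noteq> 0 \<longrightarrow> cl' t = c \<and> t \<in> A \<and> c \<notin> clusters cl"
      using U(1) c_new by (auto simp: cl'_def)
    have r7: "c \<in> clusters cl'" "t1 \<in> A" "cl' t1 = c" "cs' c < m"
      using clusters' t1(2) U(1) site by (auto simp: cl'_def cs'_def)
    have r5: "\<forall>c \<in> clusters cl. cs' c = cs c" using cs'_old by blast
    have r8: "c \<notin> clusters cl \<longrightarrow> cs' c < m \<and> d (cs' c) j \<le> d i j \<and>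
        card {t \<in> {..<m * cap}. cl' t = c} = h \<and> (\<forall>t<m * cap. cl' t = c \<longrightarrow> f (cs' c) \<le> f (t div cap))"
      unfolding q2 cU using r7(4) q1 q3 by blast
    show ?thesis
      by (rule exI[of _ cl'], rule exI[of _ cs'], rule exI[of _ c], rule exI[of _ t1])
        (intro conjI r1 r2 r3 r4 r5 r6 r7(1-3) r8)
  qed
qed

lemma sem_round_join:
  assumes base: "costs_in \<sigma>" and rep: "represents \<sigma> own rem cl cs J"
    and ij: "i < m" "j < n" "\<sigma> 42 0 = int (i * n + j)"
    and c: "\<sigma> 59 0 = int c" "c \<in> clusters cl" "cs c < m" "c \<notin> J j" "finite (J j)" and rem_pos: "0 < rem j"
  defines "\<sigma>' \<equiv> sem round_join_prog \<sigma>"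
  shows "represents \<sigma>' (own(j := {t \<in> own j. cl t \<noteq> c})) (rem(j := rem j - 1)) cl cs (J(j := insert c (J j)))"
proof -
  define N where "N = m * cap"
  have own: "owns \<sigma> own" and rem: "\<And>j. j < n \<Longrightarrow> \<sigma> 53 (int j) = int (rem j)"
    and cl: "\<And>t. t < N \<Longrightarrow> \<sigma> 57 (int t) = int (cl t)"
    and cs: "\<And>c. c \<in> clusters cl \<Longrightarrow> \<sigma> 58 (int c) = int (cs c)"
    and y: "\<And>i. i < m \<Longrightarrow> \<sigma> 55 (int i) = int (card {c \<in> clusters cl. cs c = i})"
    and x: "\<And>i j. i < m \<Longrightarrow> j < n \<Longrightarrow> \<sigma> 56 (int (i * n + j)) = int (card {c \<in> J j. cs c = i})"
    using rep unfolding represents_def N_def by blast+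
  note sz = size_values[OF base]
  have col: "value_of \<sigma> (col_expr (scalar 42)) = int j" using ij sz col_index[of j n i] by simp
  have joined: "value_of \<sigma> joined_expr = int (cs c * n + j)"
  proof -
    have "value_of \<sigma> joined_expr = value_of \<sigma> (Read 58 (scalar 59)) * value_of \<sigma> clients_expr + value_of \<sigma> (col_expr (scalar 42))"
      by (simp only: value_of.simps apply_binop.simps)
    then show ?thesis unfolding col using c cs sz(2) by simp
  qed
  define \<sigma>1 where "\<sigma>1 = store \<sigma> 56 (int (cs c * n + j)) (\<sigma> 56 (int (cs c * n + j)) + 1)"
  have s1: "sem (Asg 56 joined_expr (Read 56 joined_expr \<oplus> Const 1)) \<sigma> = \<sigma>1"
    unfolding sem.simps value_of.simps(3)[of _ Add "Read 56 joined_expr"] value_of.simps(2)[of _ 56] joined \<sigma>1_def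
    by simp
  have base1: "costs_in \<sigma>1" using base costs_in_cong[of \<sigma>1 \<sigma>] by (simp add: \<sigma>1_def)
  have col1: "value_of \<sigma>1 (col_expr (scalar 42)) = int j"
    using ij size_values(2)[OF base1] col_index[of j n i] by (simp add: \<sigma>1_def)
  define \<sigma>2 where "\<sigma>2 = store \<sigma>1 53 (int j) (\<sigma> 53 (int j) - 1)"
  have s2: "sem (Asg 53 (col_expr (scalar 42)) (Read 53 (col_expr (scalar 42)) \<ominus> Const 1)) \<sigma>1 = \<sigma>2"
    unfolding sem.simps value_of.simps(3)[of _ Sub "Read 53 (col_expr (scalar 42))"]
      value_of.simps(2)[of _ 53] col1 \<sigma>2_def by (simp add: \<sigma>1_def)
  define ix where "ix = col_expr (scalar 42) \<odot> tokens_expr \<oplus> scalar 10"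
  define ex where "ex = Read 54 ix \<odot> not_expr (eq_expr (Read 57 (scalar 10)) (scalar 59))"
  have \<sigma>': "\<sigma>' = sem (map_prog 54 10 tokens_expr ix ex) \<sigma>2"
    unfolding \<sigma>'_def round_join_prog_def seq.simps sem.simps(3) s1 s2 ix_def ex_def by simp
  have f2: "\<sigma>2 b = \<sigma> b" if "b \<notin> {53, 56}" for b using that by (simp add: \<sigma>2_def \<sigma>1_def)
  have f': "\<sigma>' b = \<sigma>2 b" if "b \<notin> {10, 54}" for b
    using that sem_frame[of b] by (simp add: \<sigma>')
  have base2: "costs_in \<sigma>2" using base costs_in_cong[of \<sigma>2 \<sigma>] f2 by simp
  let ?\<phi> = "\<lambda>t. of_bool (t \<in> own j \<and> cl t \<noteq> c) :: int"
  have val: "value_of \<tau> ix = int (j * N + t) \<and> value_of \<tau> ex = ?\<phi> t"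
    if t: "t < N" and \<tau>: "\<And>b. b \<noteq> 54 \<Longrightarrow> b \<noteq> 10 \<Longrightarrow> \<tau> b = \<sigma>2 b" "\<tau> 10 = (\<sigma>2 10)(0 := int t)"
      "\<tau> 54 (int (j * N + t)) = \<sigma>2 54 (int (j * N + t))" for t \<tau>
  proof -
    have base': "costs_in \<tau>" using base2 costs_in_cong[of \<tau> \<sigma>2] \<tau>(1) by simp
    note sz' = size_values[OF base']
    have c': "value_of \<tau> (col_expr (scalar 42)) = int j"
      using ij sz'(2) col_index[of j n i] \<tau>(1) f2 by simp
    have "value_of \<tau> ix = value_of \<tau> (col_expr (scalar 42)) * value_of \<tau> tokens_expr + value_of \<tau> (scalar 10)"
      unfolding ix_def by (simp only: value_of.simps apply_binop.simps)
    then have ix: "value_of \<tau> ix = int (j * N + t)"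
      unfolding c' sz'(3) N_def using \<tau>(2) by simp
    have "value_of \<tau> (Read 54 ix) = of_bool (t \<in> own j)"
      unfolding value_of.simps(2) ix \<tau>(3) using own t ij f2 by (simp add: owns_def N_def)
    moreover have "value_of \<tau> (eq_expr (Read 57 (scalar 10)) (scalar 59)) = of_bool (cl t = c)"
      using \<tau>(1,2) f2 cl[OF t] c(1) by auto
    moreover have "value_of \<tau> ex = value_of \<tau> (Read 54 ix) * (1 - value_of \<tau> (eq_expr (Read 57 (scalar 10)) (scalar 59)))"
      unfolding ex_def by (simp only: value_of.simps apply_binop.simps)
    ultimately show ?thesis using ix by auto
  qed
  have N: "N = nat (value_of \<sigma>2 tokens_expr)" unfolding size_values(3)[OF base2] N_def by (simp only: nat_int)
  have inj: "inj_on (\<lambda>t. int (j * N + t)) {..<N}" by (auto simp: inj_on_def)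
  have new: "\<sigma>' 54 (int (j * N + t)) = ?\<phi> t" if "t < N" for t
    unfolding \<sigma>' by (rule sem_map_prog(1)[where N = N and \<iota> = "\<lambda>t. int (j * N + t)" and \<phi> = ?\<phi>])
      (simp, rule N, rule val, assumption+, rule inj, rule that)
  have old: "\<sigma>' 54 k = \<sigma>2 54 k" if "\<And>t. t < N \<Longrightarrow> k \<noteq> int (j * N + t)" for k
    unfolding \<sigma>' by (rule sem_map_prog(2)[where N = N and \<iota> = "\<lambda>t. int (j * N + t)" and \<phi> = ?\<phi>])
      (simp, rule N, rule val, assumption+, rule inj, rule that)
  show ?thesis
    unfolding represents_def
  proof (intro conjI allI impI ballI)
    show "owns \<sigma>' (own(j := {t \<in> own j. cl t \<noteq> c}))"
      unfolding owns_def
    proof (intro allI impI conjI)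
      fix j'
      assume j': "j' < n"
      have sub: "own j' \<subseteq> {..<m * cap}" using own j' by (simp add: owns_def)
      then show "(own(j := {t \<in> own j. cl t \<noteq> c})) j' \<subseteq> {..<m * cap}" by auto
      fix t
      assume t: "t < m * cap"
      show "\<sigma>' 54 (int (j' * (m * cap) + t)) = of_bool (t \<in> (own(j := {t \<in> own j. cl t \<noteq> c})) j')"
      proof (cases "j' = j")
        case True
        then show ?thesis using new[of t] t by (simp add: N_def)
      next
        case False
        have "\<sigma>' 54 (int (j' * N + t)) = \<sigma>2 54 (int (j' * N + t))"
        proof (rule old)
          fix t'
          assume "t' < N"
          then show "int (j' * N + t) \<noteq> int (j * N + t')"
            using False t index_inj[of t N t' j' j] unfolding of_nat_eq_iff by (simp add: N_def)
        qed
        then show ?thesis using False own j' t f2 by (simp add: owns_def N_def)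
      qed
    qed
  next
    fix j'
    assume "j' < n"
    then show "\<sigma>' 53 (int j') = int ((rem(j := rem j - 1)) j')"
      using f' rem rem_pos by (auto simp: \<sigma>2_def \<sigma>1_def)
  next
    fix i' j'
    assume i': "i' < m" and j': "j' < n"
    have eq: "int (i' * n + j') = int (cs c * n + j) \<longleftrightarrow> i' = cs c \<and> j' = j"
      unfolding of_nat_eq_iff using j' ij(2) by (rule index_inj)
    have "\<sigma>' 56 (int (i' * n + j')) = \<sigma> 56 (int (i' * n + j')) + of_bool (i' = cs c \<and> j' = j)"
      using f' eq by (auto simp: \<sigma>2_def \<sigma>1_def simp del: of_nat_add of_nat_mult)
    also have "\<dots> = int (card {c' \<in> (J(j := insert c (J j))) j'. cs c' = i'})"
    proof (cases "j' = j")
      case True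
      have "{c' \<in> insert c (J j). cs c' = i'} = {c' \<in> J j. cs c' = i'} \<union> (if cs c = i' then {c} else {})"
        by auto
      then have "card {c' \<in> insert c (J j). cs c' = i'} = card {c' \<in> J j. cs c' = i'} + of_bool (i' = cs c)"
        using c by simp
      then show ?thesis using True x[OF i' j'] by simp
    next
      case False
      then show ?thesis using x[OF i' j'] by simp
    qed
    finally show "\<sigma>' 56 (int (i' * n + j')) = int (card {c' \<in> (J(j := insert c (J j))) j'. cs c' = i'})" .
  qed (use f' f2 cl cs y in \<open>auto simp: N_def\<close>)
qed

text \<open>While demand remains, every round serves one unit of it, and the demands add up to at
  most \<open>2 * m * n\<close>, the number of rounds. That clustered tokens lie in some
  \<open>own0 j\<close> is recorded in order to charge facilities to the residual solution
  later.\<close>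

lemma sem_round_prog:
  assumes base: "costs_in \<sigma>"
    and own: "owns \<sigma> own0" and dem: "\<And>j. j < n \<Longrightarrow> \<sigma> 53 (int j) = int (dem j)"
    and zero: "\<And>k. \<sigma> 55 k = 0" "\<And>k. \<sigma> 56 k = 0" "\<And>k. \<sigma> 57 k = 0"
    and dem_le: "\<And>j. j < n \<Longrightarrow> dem j \<le> 2 * m"
  defines "\<sigma>' \<equiv> sem round_prog \<sigma>"
  shows "\<exists>own rem cl cs J R rad. represents \<sigma>' own rem cl cs J \<and> round_inv own rem cl cs J R rad \<and>
    (\<forall>j<n. rem j = 0) \<and> (\<forall>t<m * cap. cl t \<noteq> 0 \<longrightarrow> (\<exists>j<n. t \<in> own0 j))"
proof -
  define act where "act = seq [Asg 42 (Const 0) (scalar best_idx), round_choose, round_join_prog]"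
  define body where "body = SSeq round_search (SIf (scalar best_den) act SSkip)"
  define W where "W = {10, 11, best_idx, 36, best_num, best_den, 42, 53, 54, 55, 56, 57, 58, 59, 60, 61}"
  have writes_body: "writes body = W"
    by (auto simp: body_def act_def W_def writes_round_search writes_round_choose writes_round_join_prog)
  define N where "N = 2 * (m * n)"
  let ?ok = "\<lambda>s \<tau>. \<exists>own rem cl cs J R rad. represents \<tau> own rem cl cs J \<and> round_inv own rem cl cs J R rad \<and>
    ((\<forall>j<n. rem j = 0) \<or> (\<Sum>j<n. rem j) + s \<le> N) \<and> (\<forall>t<m * cap. cl t \<le> s) \<and>
    (\<forall>t<m * cap. cl t \<noteq> 0 \<longrightarrow> (\<exists>j<n. t \<in> own0 j))"
  let ?Inv = "\<lambda>s \<tau>. (\<forall>b. b \<notin> W \<longrightarrow> b \<noteq> 12 \<longrightarrow> \<tau> b = \<sigma> b) \<and> \<tau> 12 0 = int s \<and> ?ok s \<tau>"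
  have rep_store: "represents (store \<tau> 12 0 v) own rem cl cs J = represents \<tau> own rem cl cs J"
    for \<tau> v own rem cl cs J by (simp add: represents_def owns_def)
  have "?Inv N (loop 12 N (sem body) \<sigma>)"
  proof (rule loop_invariant[where Inv = ?Inv])
    have "represents \<sigma> own0 dem (\<lambda>_. 0) (\<lambda>_. 0) (\<lambda>_. {})"
      unfolding represents_def using own dem zero by (auto simp: clusters_def)
    moreover have "round_inv own0 dem (\<lambda>_. 0) (\<lambda>_. 0) (\<lambda>_. {}) 0 (\<lambda>_ _. 0)"
      by (rule round_init) auto
    moreover have "(\<Sum>j<n. dem j) \<le> N"
      using sum_mono[of "{..<n}" dem "\<lambda>_. 2 * m"] dem_le by (simp add: N_def mult.commute mult.left_commute)
    ultimately have "?ok 0 \<sigma>"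
      by (intro exI[of _ own0] exI[of _ dem] exI[of _ "\<lambda>_. 0"] exI[of _ "\<lambda>_. {}"] exI[of _ 0] exI[of _ "\<lambda>_ _. 0"]) simp
    then show "?Inv 0 (store \<sigma> 12 0 0)" unfolding rep_store by simp
  next
    fix s \<tau>
    assume "s < N" and Inv: "?Inv s \<tau>"
    then obtain own rem cl cs J R rad where rep: "represents \<tau> own rem cl cs J"
      and rinv: "round_inv own rem cl cs J R rad"
      and pot: "(\<forall>j<n. rem j = 0) \<or> (\<Sum>j<n. rem j) + s \<le> N" and le: "\<And>t. t < m * cap \<Longrightarrow> cl t \<le> s"
      and used: "\<And>t. t < m * cap \<Longrightarrow> cl t \<noteq> 0 \<Longrightarrow> \<exists>j<n. t \<in> own0 j"
      and fr: "\<And>b. b \<notin> W \<Longrightarrow> b \<noteq> 12 \<Longrightarrow> \<tau> b = \<sigma> b" and \<tau>12: "\<tau> 12 0 = int s" by blast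
    define \<tau>1 where "\<tau>1 = sem round_search \<tau>"
    define \<tau>4 where "\<tau>4 = sem body \<tau>"
    have base': "costs_in \<tau>" using base costs_in_cong[of \<tau> \<sigma>] fr by (simp add: W_def)
    have f1: "\<tau>1 b = \<tau> b" if "b \<notin> {10, 11, best_idx, 36, best_num, best_den}" for b
      unfolding \<tau>1_def using that by (intro sem_frame) (simp add: writes_round_search)
    have rep1: "represents \<tau>1 own rem cl cs J" using rep f1 by (simp add: represents_def owns_def)
    have base1: "costs_in \<tau>1" using base' costs_in_cong[of \<tau>1 \<tau>] f1 by simp
    have search: "\<tau>1 best_den 0 = 0 \<and> (\<forall>i<m. \<forall>j<n. \<not> candidate own rem i j) \<or>
      (\<exists>i<m. \<exists>j<n. \<tau>1 best_idx 0 = int (i * n + j) \<and> \<tau>1 best_den 0 \<noteq> 0 \<and> candidate own rem i j \<and>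
        (\<forall>i'<m. \<forall>j'<n. candidate own rem i' j' \<longrightarrow> d i j \<le> d i' j'))"
      unfolding \<tau>1_def using base' rep by (intro sem_round_search) (auto simp: represents_def)
    have frame4: "\<forall>b. b \<notin> W \<longrightarrow> b \<noteq> 12 \<longrightarrow> \<tau>4 b = \<sigma> b"
      using fr sem_frame[of _ body \<tau>] by (simp add: \<tau>4_def writes_body)
    have "?ok (Suc s) \<tau>4"
    proof (cases "\<tau>1 best_den 0 = 0")
      case True
      then have \<tau>4: "\<tau>4 = \<tau>1" by (simp add: \<tau>4_def body_def \<tau>1_def)
      \<comment> \<open>A client with remaining demand always yields a candidate, so an unsuccessful
        search means that all demand is served.\<close>
      have "\<forall>j<n. rem j = 0" using search True exists_candidate[OF rinv] by blast
      then have pot': "(\<forall>j<n. rem j = 0) \<or> (\<Sum>j<n. rem j) + Suc s \<le> N" ..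
      have le': "\<forall>t<m * cap. cl t \<le> Suc s" using le le_SucI by blast
      have used': "\<forall>t<m * cap. cl t \<noteq> 0 \<longrightarrow> (\<exists>j<n. t \<in> own0 j)" using used by blast
      show ?thesis unfolding \<tau>4
        by (rule exI[of _ own], rule exI[of _ rem], rule exI[of _ cl], rule exI[of _ cs],
            rule exI[of _ J], rule exI[of _ R], rule exI[of _ rad])
          (intro conjI rep1 rinv pot' le' used')
    next
      case False
      then obtain i j where ij: "i < m" "j < n" "\<tau>1 best_idx 0 = int (i * n + j)" "candidate own rem i j"
        "\<And>i' j'. i' < m \<Longrightarrow> j' < n \<Longrightarrow> candidate own rem i' j' \<Longrightarrow> d i j \<le> d i' j'"
        using search by blast
      define \<tau>2 where "\<tau>2 = store \<tau>1 42 0 (int (i * n + j))"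
      have rep2: "represents \<tau>2 own rem cl cs J" using rep1 by (simp add: represents_def owns_def \<tau>2_def)
      have base2: "costs_in \<tau>2" using base1 costs_in_cong[of \<tau>2 \<tau>1] by (simp add: \<tau>2_def)
      have \<tau>2: "\<tau>2 42 0 = int (i * n + j)" "\<tau>2 12 0 = int s" using f1 \<tau>12 by (auto simp: \<tau>2_def)
      have J: "J k \<subseteq> clusters cl" "finite (J k)" if "k < n" for k using rinv that by (auto simp: round_inv_def)
      define \<tau>3 where "\<tau>3 = sem round_choose \<tau>2"
      obtain cl' cs' c t0 where rep3: "represents \<tau>3 own rem cl' cs' J" and c3: "\<tau>3 59 0 = int c"
        and le': "\<forall>t<m * cap. cl' t \<le> Suc s"
        and keep: "\<forall>t<m * cap. cl t \<noteq> 0 \<longrightarrow> cl' t = cl t" "\<forall>c \<in> clusters cl. cs' c = cs c"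
        and new: "\<forall>t<m * cap. cl t = 0 \<longrightarrow> cl' t \<noteq> 0 \<longrightarrow> cl' t = c \<and> t \<in> near own j (d i j) \<and> c \<notin> clusters cl"
        and c: "c \<in> clusters cl'" "t0 \<in> near own j (d i j)" "cl' t0 = c"
        and fresh: "c \<notin> clusters cl \<longrightarrow> cs' c < m \<and> d (cs' c) j \<le> d i j \<and> card {t \<in> {..<m * cap}. cl' t = c} = h \<and>
          (\<forall>t<m * cap. cl' t = c \<longrightarrow> f (cs' c) \<le> f (t div cap))"
        using sem_round_choose[OF base2 rep2 ij(1,2) \<tau>2(1) ij(4) le \<tau>2(2) J(1)] unfolding \<tau>3_def by blast
      have f3: "\<tau>3 b = \<tau>2 b" if "b \<in> {0, 22, 23, 42}" for b
        unfolding \<tau>3_def using that by (intro sem_frame) (auto simp: writes_round_choose)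
      have base3: "costs_in \<tau>3" using base2 costs_in_cong[of \<tau>3 \<tau>2] f3 by simp
      let ?own = "own(j := {t \<in> own j. cl' t \<noteq> c})" and ?rem = "rem(j := rem j - 1)"
        and ?J = "J(j := insert c (J j))" and ?rad = "rad(j := (rad j)(dem j - rem j := d i j))"
      have keep': "\<And>t. t \<in> {..<m * cap} \<Longrightarrow> cl t \<noteq> 0 \<Longrightarrow> cl' t = cl t"
        "\<And>c. c \<in> clusters cl \<Longrightarrow> cs' c = cs c" using keep by simp_all
      have new': "\<And>t. t \<in> {..<m * cap} \<Longrightarrow> cl t = 0 \<Longrightarrow> cl' t \<noteq> 0 \<Longrightarrow>
          cl' t = c \<and> t \<in> near own j (d i j) \<and> c \<notin> clusters cl" using new by blast
      have fresh': "c \<notin> clusters cl \<Longrightarrow> cs' c < m \<and> d (cs' c) j \<le> d i j \<and>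
          card {t \<in> {..<m * cap}. cl' t = c} = h \<and>
          (\<forall>t\<in>{..<m * cap}. cl' t = c \<longrightarrow> f (cs' c) \<le> f (t div cap))" using fresh by blast
      have upd: "\<And>k. k < n \<Longrightarrow> ?own k = (if k = j then {t \<in> own j. cl' t \<noteq> c} else own k)"
        "\<And>k. k < n \<Longrightarrow> ?rem k = (if k = j then rem j - 1 else rem k)" by simp_all
      note join = round_join[OF rinv ij(1,2,4) refl ij(5) keep' new' c fresh' upd]
      have remj: "0 < rem j" using ij(4) by (simp add: candidate_def)
      have csm: "cs' c < m" using join(1) c(1) by (rule round_inv_site)
      have "represents (sem round_join_prog \<tau>3) ?own ?rem cl' cs' ?J"
      proof (rule sem_round_join[OF base3 rep3 ij(1,2) _ c3 c(1) csm join(2) J(2)[OF ij(2)] remj])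
        show "\<tau>3 42 0 = int (i * n + j)" using f3 \<tau>2 by simp
      qed
      moreover have "\<tau>4 = sem round_join_prog \<tau>3"
        using False ij(3) by (simp add: \<tau>4_def body_def \<tau>1_def[symmetric] act_def \<tau>3_def \<tau>2_def)
      ultimately have rep4: "represents \<tau>4 ?own ?rem cl' cs' ?J" by simp
      have "(\<Sum>k<n. ?rem k) + Suc s \<le> N"
      proof -
        have "(\<Sum>k<n. rem k) = rem j + (\<Sum>k\<in>{..<n} - {j}. rem k)"
          using ij(2) by (intro sum.remove) auto
        moreover have "(\<Sum>k<n. ?rem k) = ?rem j + (\<Sum>k\<in>{..<n} - {j}. ?rem k)"
          using ij(2) by (intro sum.remove) auto
        moreover have "(\<Sum>k\<in>{..<n} - {j}. ?rem k) = (\<Sum>k\<in>{..<n} - {j}. rem k)" by (intro sum.cong) auto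
        moreover have "(\<Sum>k<n. rem k) + s \<le> N" using pot remj ij(2) by auto
        ultimately show ?thesis using remj by simp
      qed
      then have pot': "(\<forall>k<n. ?rem k = 0) \<or> (\<Sum>k<n. ?rem k) + Suc s \<le> N" ..
      have "\<exists>j<n. t \<in> own0 j" if "t < m * cap" "cl' t \<noteq> 0" for t
      proof (cases "cl t = 0")
        case True
        then have "t \<in> own j" using new that by (auto simp: near_def)
        then show ?thesis using round_inv_own[OF rinv ij(2)] ij(2) by blast
      next
        case False
        then show ?thesis using used that by blast
      qed
      then have used': "\<forall>t<m * cap. cl' t \<noteq> 0 \<longrightarrow> (\<exists>j<n. t \<in> own0 j)" by blast
      show ?thesis
        by (rule exI[of _ ?own], rule exI[of _ ?rem], rule exI[of _ cl'], rule exI[of _ cs'],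
            rule exI[of _ ?J], rule exI[of _ "d i j"], rule exI[of _ ?rad])
          (intro conjI rep4 join(1) pot' le' used')
    qed
    then show "?Inv (Suc s) (store (sem body \<tau>) 12 0 (int (Suc s)))"
      unfolding \<tau>4_def[symmetric] rep_store using frame4 by simp
  qed
  moreover have "\<sigma>' = loop 12 N (sem body) \<sigma>"
  proof -
    have "nat (value_of \<sigma> (Const 2 \<odot> (sites_expr \<odot> clients_expr))) = N"
      using base by (simp add: costs_in_def N_def nat_mult_distrib)
    then show ?thesis by (simp only: \<sigma>'_def round_prog_def sem.simps body_def act_def)
  qed
  ultimately have "?ok N \<sigma>'" by simp
  then obtain own rem cl cs J R rad where fin: "represents \<sigma>' own rem cl cs J"
    "round_inv own rem cl cs J R rad" "(\<forall>j<n. rem j = 0) \<or> (\<Sum>j<n. rem j) + N \<le> N"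
    "\<forall>t<m * cap. cl t \<noteq> 0 \<longrightarrow> (\<exists>j<n. t \<in> own0 j)" by blast
  have "\<forall>j<n. rem j = 0" using fin(3) by auto
  then show ?thesis using fin(1,2,4)
    by (intro exI[of _ own] exI[of _ rem] exI[of _ cl] exI[of _ cs] exI[of _ J] exI[of _ R] exI[of _ rad] conjI)
qed

end

text \<open>Arrays: 50 and 51 the integral part of the fractional solution.\<close>

abbreviation "token_of_expr k \<equiv> k \<ominus> (tokens_expr \<odot> (k \<oslash> tokens_expr))"
abbreviation "slot_expr t \<equiv> t \<ominus> (cap_expr \<odot> (t \<oslash> cap_expr))"

section \<open>Integral part of the fractional solution\<close>

definition bulk_prog :: sprog where
  "bulk_prog = seq [
     map_prog 50 10 sites_expr (scalar 10)
       ((Const 0 \<lless> Read 32 (scalar 10) \<oslash> unit_expr) \<odot> (Read 32 (scalar 10) \<oslash> unit_expr \<ominus> Const 1)),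
     map_prog 51 10 (sites_expr \<odot> clients_expr) (scalar 10)
       (Read 31 (scalar 10) \<oslash> unit_expr \<oplus>
         (Read 50 (row_expr (scalar 10)) \<lless> Read 31 (scalar 10) \<oslash> unit_expr) \<odot>
         (Read 50 (row_expr (scalar 10)) \<ominus> Read 31 (scalar 10) \<oslash> unit_expr)),
     For 11 clients_expr (SSeq
       (sum_prog 35 10 sites_expr (at_expr 51 (scalar 10) (scalar 11)))
       (Asg 53 (scalar 11) ((scalar 35 \<lless> Read 5 (scalar 11)) \<odot> (Read 5 (scalar 11) \<ominus> scalar 35)))),
     map_prog 54 10 (clients_expr \<odot> tokens_expr) (scalar 10)
       (slot_expr (token_of_expr (scalar 10)) \<lless>
         at_expr 31 (token_of_expr (scalar 10) \<oslash> cap_expr) (scalar 10 \<oslash> tokens_expr) \<ominus>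
         unit_expr \<odot> at_expr 51 (token_of_expr (scalar 10) \<oslash> cap_expr) (scalar 10 \<oslash> tokens_expr))]"

text \<open>One facility less than the floor is kept. With the full floor, the residual
  \<open>X mod K\<close> of a client could exceed the residual \<open>Y mod K\<close> of the site.
  Leaving one more unit at the site avoids this, at the price that almost \<open>2 * K\<close> may
  remain.\<close>

lemma integral_part:
  fixes X Y K :: int
  assumes K: "0 < K" and X: "0 \<le> X" "X \<le> Y"
  defines "a \<equiv> (if 0 < Y div K then Y div K - 1 else 0)"
  defines "b \<equiv> min (X div K) a"
  shows "0 \<le> b" "b \<le> a" "0 \<le> a" "0 \<le> X - K * b" "X - K * b \<le> Y - K * a" "Y - K * a < 2 * K"
proof -
  have Xd: "X = K * (X div K) + X mod K" and Yd: "Y = K * (Y div K) + Y mod K" by simp_all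
  have mods: "0 \<le> X mod K" "X mod K < K" "0 \<le> Y mod K" "Y mod K < K" using K by simp_all
  have nn: "0 \<le> X div K" "X div K \<le> Y div K" using K X by (simp_all add: pos_imp_zdiv_nonneg_iff zdiv_mono1)
  show "0 \<le> a" by (simp add: a_def)
  then show "0 \<le> b" "b \<le> a" using nn by (simp_all add: b_def)
  have Kb: "K * b \<le> K * (X div K)" using K by (intro mult_left_mono) (simp_all add: b_def)
  then show "0 \<le> X - K * b" using Xd mods by linarith
  have "X - K * b \<le> Y - K * a \<and> Y - K * a < 2 * K"
  proof (cases "0 < Y div K")
    case True
    then have a: "a = Y div K - 1" by (simp add: a_def)
    have Ka: "Y - K * a = Y mod K + K" unfolding a by (simp add: right_diff_distrib minus_mult_div_eq_mod)
    show ?thesis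
    proof (cases "b = a")
      case True
      then show ?thesis using X Ka mods by simp
    next
      case False
      then have "b = X div K" by (auto simp: b_def)
      then have "X - K * b = X mod K" by (simp add: minus_mult_div_eq_mod)
      then show ?thesis using Ka mods by linarith
    qed
  next
    case False
    then have "X div K = 0" "Y div K = 0" "a = 0" "b = 0" using nn by (auto simp: a_def b_def)
    then show ?thesis using X Yd mods by auto
  qed
  then show "X - K * b \<le> Y - K * a" "Y - K * a < 2 * K" by auto
qed

context ftfp_costs
begin

lemma sem_bulk_prog:
  assumes base: "costs_in \<sigma>" and K: "K = 200000 * (int n + 1)" and cap: "cap = 400000 * (n + 1)"
  defines "\<sigma>' \<equiv> sem bulk_prog \<sigma>"
  shows "i < m \<Longrightarrow> \<sigma>' 50 (int i) = (if 0 < \<sigma> 32 (int i) div K then \<sigma> 32 (int i) div K - 1 else 0)"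
    and "i < m \<Longrightarrow> j < n \<Longrightarrow> \<sigma>' 51 (int (i * n + j)) = min (\<sigma> 31 (int (i * n + j)) div K) (\<sigma>' 50 (int i))"
    and "j < n \<Longrightarrow> \<sigma>' 53 (int j) = max 0 (\<sigma> 5 (int j) - (\<Sum>i<m. \<sigma>' 51 (int (i * n + j))))"
    and "j < n \<Longrightarrow> t < m * cap \<Longrightarrow> \<sigma>' 54 (int (j * (m * cap) + t)) = of_bool (int (t mod cap) <
       \<sigma> 31 (int (t div cap * n + j)) - K * \<sigma>' 51 (int (t div cap * n + j)))"
    and "b \<notin> {10, 11, 35, 50, 51, 53, 54} \<Longrightarrow> \<sigma>' b = \<sigma> b"
proof -
  have \<sigma>0: "\<sigma> 0 0 = int m" "\<sigma> 0 1 = int n" using base by (auto simp: costs_in_def)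
  have Ku: "200000 * (int n + 1) = K" using K by simp
  define p1 where "p1 = map_prog 50 10 sites_expr (scalar 10)
       ((Const 0 \<lless> Read 32 (scalar 10) \<oslash> unit_expr) \<odot> (Read 32 (scalar 10) \<oslash> unit_expr \<ominus> Const 1))"
  define \<sigma>1 where "\<sigma>1 = sem p1 \<sigma>"
  define e2 where "e2 = Read 31 (scalar 10) \<oslash> unit_expr \<oplus>
         (Read 50 (row_expr (scalar 10)) \<lless> Read 31 (scalar 10) \<oslash> unit_expr) \<odot>
         (Read 50 (row_expr (scalar 10)) \<ominus> Read 31 (scalar 10) \<oslash> unit_expr)"
  define \<sigma>2 where "\<sigma>2 = sem (map_prog 51 10 (sites_expr \<odot> clients_expr) (scalar 10) e2) \<sigma>1"
  define s3 where "s3 = sum_prog 35 10 sites_expr (at_expr 51 (scalar 10) (scalar 11))"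
  define b3 where "b3 = SSeq s3
       (Asg 53 (scalar 11) ((scalar 35 \<lless> Read 5 (scalar 11)) \<odot> (Read 5 (scalar 11) \<ominus> scalar 35)))"
  define \<sigma>3 where "\<sigma>3 = sem (For 11 clients_expr b3) \<sigma>2"
  define e4 where "e4 = (slot_expr (token_of_expr (scalar 10)) \<lless>
         at_expr 31 (token_of_expr (scalar 10) \<oslash> cap_expr) (scalar 10 \<oslash> tokens_expr) \<ominus>
         unit_expr \<odot> at_expr 51 (token_of_expr (scalar 10) \<oslash> cap_expr) (scalar 10 \<oslash> tokens_expr))"
  have \<sigma>': "\<sigma>' = sem (map_prog 54 10 (clients_expr \<odot> tokens_expr) (scalar 10) e4) \<sigma>3"
    by (simp only: \<sigma>'_def bulk_prog_def p1_def e2_def s3_def b3_def e4_def \<sigma>1_def \<sigma>2_def \<sigma>3_def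
        seq.simps sem.simps(1,3))
  have f1: "\<sigma>1 b = \<sigma> b" if "b \<notin> {10, 50}" for b
    using that sem_frame[of b] by (simp add: \<sigma>1_def p1_def)
  have f2: "\<sigma>2 b = \<sigma>1 b" if "b \<notin> {10, 51}" for b
    using that sem_frame[of b] by (simp add: \<sigma>2_def)
  have f3: "\<sigma>3 b = \<sigma>2 b" if "b \<notin> {10, 11, 35, 53}" for b
    using that sem_frame[of b] by (simp add: \<sigma>3_def b3_def s3_def del: sem.simps)
  have f4: "\<sigma>' b = \<sigma>3 b" if "b \<notin> {10, 54}" for b
    using that sem_frame[of b] by (simp add: \<sigma>')
  show "b \<notin> {10, 11, 35, 50, 51, 53, 54} \<Longrightarrow> \<sigma>' b = \<sigma> b" using f1 f2 f3 f4 by simp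
  have A1: "\<sigma>1 50 (int i) = (if 0 < \<sigma> 32 (int i) div K then \<sigma> 32 (int i) div K - 1 else 0)" if "i < m" for i
    unfolding \<sigma>1_def p1_def
  proof (rule sem_map_prog(1)[where N = m and \<iota> = int
        and \<phi> = "\<lambda>i. if 0 < \<sigma> 32 (int i) div K then \<sigma> 32 (int i) div K - 1 else 0"])
    fix j \<tau>
    assume \<tau>: "\<And>b. b \<noteq> 50 \<Longrightarrow> b \<noteq> 10 \<Longrightarrow> \<tau> b = \<sigma> b" "\<tau> 10 = (\<sigma> 10)(0 := int j)"
    have "value_of \<tau> (Read 32 (scalar 10) \<oslash> unit_expr) = \<sigma> 32 (int j) div K"
      using \<tau> \<sigma>0 by (simp add: K)
    then show "value_of \<tau> (scalar 10) = int j \<and>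
      value_of \<tau> ((Const 0 \<lless> Read 32 (scalar 10) \<oslash> unit_expr) \<odot> (Read 32 (scalar 10) \<oslash> unit_expr \<ominus> Const 1))
        = (if 0 < \<sigma> 32 (int j) div K then \<sigma> 32 (int j) div K - 1 else 0)"
      using \<tau>(2) unfolding value_of.simps(3)[of _ Mul "Const 0 \<lless> _"] value_of.simps(3)[of _ Less] value_of.simps(3)[of _ Sub]
      by (simp del: value_of.simps(3))
  qed (use that \<sigma>0 in auto)
  then show A: "i < m \<Longrightarrow> \<sigma>' 50 (int i) = (if 0 < \<sigma> 32 (int i) div K then \<sigma> 32 (int i) div K - 1 else 0)" for i
    using f2 f3 f4 by simp
  have same50: "\<sigma>' 50 = \<sigma>1 50" using f2 f3 f4 by simp
  define B where "B k = min (\<sigma> 31 (int k) div K) (\<sigma>1 50 (int (k div n)))" for k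
  have B2: "\<sigma>2 51 (int k) = B k" if "k < m * n" for k
    unfolding \<sigma>2_def
  proof (rule sem_map_prog(1)[where N = "m * n" and \<iota> = int and \<phi> = B])
    show "m * n = nat (value_of \<sigma>1 (sites_expr \<odot> clients_expr))"
      using \<sigma>0 f1 by (simp add: nat_mult_distrib)
    fix k \<tau>
    assume k: "k < m * n" and \<tau>: "\<And>b. b \<noteq> 51 \<Longrightarrow> b \<noteq> 10 \<Longrightarrow> \<tau> b = \<sigma>1 b" "\<tau> 10 = (\<sigma>1 10)(0 := int k)"
    have x: "value_of \<tau> (Read 31 (scalar 10) \<oslash> unit_expr) = \<sigma> 31 (int k) div K"
      using \<tau> \<sigma>0 f1 by (simp add: K)
    have a: "value_of \<tau> (Read 50 (row_expr (scalar 10))) = \<sigma>1 50 (int (k div n))"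
      using \<tau> \<sigma>0 f1 by (simp add: of_nat_div)
    have "value_of \<tau> e2 = value_of \<tau> (Read 31 (scalar 10) \<oslash> unit_expr) +
        of_bool (value_of \<tau> (Read 50 (row_expr (scalar 10))) < value_of \<tau> (Read 31 (scalar 10) \<oslash> unit_expr)) *
        (value_of \<tau> (Read 50 (row_expr (scalar 10))) - value_of \<tau> (Read 31 (scalar 10) \<oslash> unit_expr))"
      unfolding e2_def by (simp only: value_of.simps apply_binop.simps)
    also have "\<dots> = B k" unfolding x a B_def by auto
    finally show "value_of \<tau> (scalar 10) = int k \<and> value_of \<tau> e2 = B k" using \<tau>(2) by simp
  qed (use that in auto)
  have same51: "\<sigma>' 51 = \<sigma>2 51" using f3 f4 by simp
  have B: "\<sigma>' 51 (int (i * n + j)) = min (\<sigma> 31 (int (i * n + j)) div K) (\<sigma>' 50 (int i))" if "i < m" "j < n" for i j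
  proof -
    have "(i * n + j) div n = i" using that by simp
    then show ?thesis using B2[OF index_less[OF that]] unfolding same51 same50 B_def by simp
  qed
  then show "i < m \<Longrightarrow> j < n \<Longrightarrow> \<sigma>' 51 (int (i * n + j)) = min (\<sigma> 31 (int (i * n + j)) div K) (\<sigma>' 50 (int i))" .
  have R3: "\<sigma>3 53 (int j) = max 0 (\<sigma> 5 (int j) - (\<Sum>i<m. \<sigma>2 51 (int (i * n + j))))" if "j < n" for j
  proof -
    let ?Inv = "\<lambda>k \<tau>. (\<forall>b. b \<notin> {10, 11, 35, 53} \<longrightarrow> \<tau> b = \<sigma>2 b) \<and> \<tau> 11 0 = int k \<and>
      (\<forall>j<k. \<tau> 53 (int j) = max 0 (\<sigma> 5 (int j) - (\<Sum>i<m. \<sigma>2 51 (int (i * n + j)))))"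
    have "?Inv n (loop 11 n (sem b3) \<sigma>2)"
    proof (rule loop_invariant[where Inv = ?Inv])
      show "?Inv 0 (store \<sigma>2 11 0 0)" by simp
    next
      fix k \<tau>
      assume "k < n" and Inv: "?Inv k \<tau>"
      define \<tau>1 where "\<tau>1 = sem s3 \<tau>"
      have fr: "\<tau> b = \<sigma>2 b" if "b \<notin> {10, 11, 35, 53}" for b using Inv that by blast
      have g1: "\<tau>1 b = \<tau> b" if "b \<notin> {10, 35}" for b
        using that sem_frame[of b] by (simp add: \<tau>1_def s3_def)
      have \<tau>0: "\<tau> 0 0 = int m" "\<tau> 0 1 = int n" "\<tau> 11 0 = int k" using fr f2 f1 \<sigma>0 Inv by simp_all
      have "\<tau>1 35 0 = (\<Sum>i<m. value_of (store \<tau> 10 0 (int i)) (at_expr 51 (scalar 10) (scalar 11)))"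
        unfolding \<tau>1_def s3_def by (subst sem_sum_prog) (simp_all add: \<tau>0)
      also have "\<dots> = (\<Sum>i<m. \<sigma>2 51 (int (i * n + k)))"
        using \<tau>0 fr by (intro sum.cong) simp_all
      finally have sum: "\<tau>1 35 0 = (\<Sum>i<m. \<sigma>2 51 (int (i * n + k)))" .
      have "sem b3 \<tau> = store \<tau>1 53 (int k) (max 0 (\<sigma> 5 (int k) - \<tau>1 35 0))"
        using g1[of 11] g1[of 5] fr[of 5] f2[of 5] f1[of 5] \<tau>0(3)
        by (simp add: b3_def \<tau>1_def[symmetric] max_def)
      then show "?Inv (Suc k) (store (sem b3 \<tau>) 11 0 (int (Suc k)))"
        using Inv g1 by (simp add: less_Suc_eq sum del: of_nat_add of_nat_mult)
    qed
    moreover have "\<sigma>3 = loop 11 n (sem b3) \<sigma>2" using \<sigma>0 f1 f2 by (simp add: \<sigma>3_def)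
    ultimately show ?thesis using that by simp
  qed
  then show "j < n \<Longrightarrow> \<sigma>' 53 (int j) = max 0 (\<sigma> 5 (int j) - (\<Sum>i<m. \<sigma>' 51 (int (i * n + j))))"
    unfolding same51 using f4 by simp
  define T where "T = m * cap"
  show "\<sigma>' 54 (int (j * (m * cap) + t)) = of_bool (int (t mod cap) <
       \<sigma> 31 (int (t div cap * n + j)) - K * \<sigma>' 51 (int (t div cap * n + j)))"
    if jt: "j < n" "t < m * cap"
  proof -
    define \<phi> where "\<phi> k = (of_bool (int (k mod T mod cap) <
       \<sigma> 31 (int (k mod T div cap * n + k div T)) - K * \<sigma>' 51 (int (k mod T div cap * n + k div T))) :: int)" for k
    have "\<sigma>' 54 (int (j * T + t)) = \<phi> (j * T + t)"
      unfolding \<sigma>'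
    proof (rule sem_map_prog(1)[where N = "n * T" and \<iota> = int and \<phi> = \<phi>])
      have three: "\<sigma>3 0 = \<sigma> 0" using f3 f2 f1 by simp
      show "n * T = nat (value_of \<sigma>3 (clients_expr \<odot> tokens_expr))"
      proof -
        have "value_of \<sigma>3 (clients_expr \<odot> tokens_expr) = int (n * T)"
          using \<sigma>0 by (simp add: three T_def cap algebra_simps)
        then show ?thesis by (simp only: nat_int)
      qed
      show "j * T + t < n * T" using jt by (intro index_less) (simp_all add: T_def)
      fix k \<tau>
      assume k: "k < n * T" and \<tau>: "\<And>b. b \<noteq> 54 \<Longrightarrow> b \<noteq> 10 \<Longrightarrow> \<tau> b = \<sigma>3 b" "\<tau> 10 = (\<sigma>3 10)(0 := int k)"
      have \<tau>0: "\<tau> 0 0 = int m" "\<tau> 0 1 = int n" using \<tau>(1) three \<sigma>0 by simp_all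
      have v10: "value_of \<tau> (scalar 10) = int k" using \<tau>(2) by simp
      have vT: "value_of \<tau> tokens_expr = int T" using \<tau>0 by (simp add: T_def cap)
      have vcap: "value_of \<tau> cap_expr = int cap" using \<tau>0 by (simp add: cap)
      have vK: "value_of \<tau> unit_expr = K" using \<tau>0 by (simp add: K)
      have tok: "value_of \<tau> (token_of_expr (scalar 10)) = int (k mod T)"
      proof -
        have "value_of \<tau> (token_of_expr (scalar 10)) = value_of \<tau> (scalar 10) -
            value_of \<tau> tokens_expr * (value_of \<tau> (scalar 10) div value_of \<tau> tokens_expr)"
          by (simp only: value_of.simps apply_binop.simps)
        then show ?thesis unfolding v10 vT by (simp add: minus_mult_div_eq_mod of_nat_mod)
      qed
      have cl: "value_of \<tau> (scalar 10 \<oslash> tokens_expr) = int (k div T)"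
        unfolding value_of.simps(3)[of _ Div] vT v10 by (simp add: of_nat_div)
      have st: "value_of \<tau> (token_of_expr (scalar 10) \<oslash> cap_expr) = int (k mod T div cap)"
        unfolding value_of.simps(3)[of _ Div "token_of_expr (scalar 10)"] vcap tok by (simp add: of_nat_div)
      have slot: "value_of \<tau> (slot_expr (token_of_expr (scalar 10))) = int (k mod T mod cap)"
      proof -
        have "value_of \<tau> (slot_expr (token_of_expr (scalar 10))) = value_of \<tau> (token_of_expr (scalar 10)) -
            value_of \<tau> cap_expr * (value_of \<tau> (token_of_expr (scalar 10)) div value_of \<tau> cap_expr)"
          by (simp only: value_of.simps apply_binop.simps)
        then show ?thesis unfolding tok vcap by (simp add: minus_mult_div_eq_mod of_nat_mod)
      qed
      let ?ix = "(token_of_expr (scalar 10) \<oslash> cap_expr) \<odot> clients_expr \<oplus> (scalar 10 \<oslash> tokens_expr)"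
      have ix: "value_of \<tau> ?ix = int (k mod T div cap * n + k div T)"
      proof -
        have "value_of \<tau> ?ix = value_of \<tau> (token_of_expr (scalar 10) \<oslash> cap_expr) * value_of \<tau> clients_expr +
            value_of \<tau> (scalar 10 \<oslash> tokens_expr)"
          by (simp only: value_of.simps apply_binop.simps)
        then show ?thesis unfolding st cl using \<tau>0 by simp
      qed
      have "value_of \<tau> e4 = of_bool (value_of \<tau> (slot_expr (token_of_expr (scalar 10))) <
          \<tau> 31 (value_of \<tau> ?ix) - value_of \<tau> unit_expr * \<tau> 51 (value_of \<tau> ?ix))"
        unfolding e4_def by (simp only: value_of.simps apply_binop.simps)
      also have "\<dots> = \<phi> k"
        unfolding slot ix vK \<phi>_def same51 using \<tau>(1) f3 f2 f1 by simp
      finally show "value_of \<tau> (scalar 10) = int k \<and> value_of \<tau> e4 = \<phi> k" using v10 by simp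
    qed auto
    moreover have "t < T" using jt by (simp add: T_def)
    then have "(j * T + t) mod T = t" "(j * T + t) div T = j" by simp_all
    ultimately show ?thesis by (simp only: \<phi>_def T_def)
  qed
qed

end

text \<open>
  Arrays: 62 the distance \<open>D\<close> of the farthest connection, 63 the position of this connection
  in array 56.
\<close>

definition far_step :: sprog where
  "far_step = seq [
     argmin_prog 10 sites_expr SSkip (Const 0 \<ominus> at_expr 23 (scalar 10) (scalar 11))
       (Const 0 \<lless> at_expr 56 (scalar 10) (scalar 11)),
     Asg 62 (scalar 11) ((Const 0 \<lless> scalar best_den) \<odot> (Const 0 \<ominus> scalar best_num)),
     Asg 63 (scalar 11) (scalar best_idx \<odot> clients_expr \<oplus> scalar 11)]"

section \<open>Program for the augmentation\<close>

definition aug_search :: sprog where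
  "aug_search = argmin_prog 10 sites_expr
     (sum_prog 36 11 clients_expr ((at_expr 23 (scalar 10) (scalar 11) \<lless> Read 62 (scalar 11)) \<odot>
       (Read 62 (scalar 11) \<ominus> at_expr 23 (scalar 10) (scalar 11))))
     (Read 22 (scalar 10)) ((Read 22 (scalar 10) \<lless> scalar 36) \<odot> scalar 36)"

text \<open>Removing the farthest connections and adding the new ones are separate loops, each with
  an injective index map. Array 34 records beforehand which clients move, for use in both.\<close>

definition aug_update :: sprog where
  "aug_update = seq [
     Asg 42 (Const 0) (scalar best_idx),
     Asg 55 (scalar 42) (Read 55 (scalar 42) \<oplus> Const 1),
     map_prog 34 11 clients_expr (scalar 11) (at_expr 23 (scalar 42) (scalar 11) \<lless> Read 62 (scalar 11)),
     map_prog 56 11 clients_expr (Read 63 (scalar 11))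
       (Read 56 (Read 63 (scalar 11)) \<ominus> Read 34 (scalar 11)),
     map_prog 56 11 clients_expr (scalar 42 \<odot> clients_expr \<oplus> scalar 11)
       (at_expr 56 (scalar 42) (scalar 11) \<oplus> Read 34 (scalar 11))]"

text \<open>The number of rounds exceeds the bound for the initial potential by 1, so not every
  round can decrease it.\<close>

definition aug_prog :: sprog where
  "aug_prog = For 12 (clients_expr \<odot> (sites_expr \<odot> (Const 2 \<odot> sites_expr)) \<oplus> Const 1)
     (seq [For 11 clients_expr far_step, aug_search, SIf (scalar best_den) aug_update SSkip])"

lemma writes_far_step: "writes far_step = {10, best_idx, best_num, best_den, 62, 63}"
  by (auto simp: far_step_def)

lemma writes_aug_search: "writes aug_search = {10, 11, best_idx, 36, best_num, best_den}"
  by (auto simp: aug_search_def)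

lemma writes_aug_update: "writes aug_update = {11, 34, 42, 55, 56}"
  by (auto simp: aug_update_def)

context augmentation
begin

abbreviation "xm \<sigma> \<equiv> (\<lambda>i j. \<sigma> (56::nat) (int (i * n + j)) :: int)"
abbreviation "ym \<sigma> \<equiv> (\<lambda>i. \<sigma> (55::nat) (int i) :: int)"
abbreviation "Dm \<sigma> \<equiv> (\<lambda>j. \<sigma> (62::nat) (int j) :: int)"

text \<open>If \<open>D = 0\<close>, the row \<open>z\<close> may be left over from an earlier
  search. Such a client never moves, but even then the position lies in column \<open>j\<close>,
  which keeps the positions of different clients distinct.\<close>

definition far_ok :: "(nat \<Rightarrow> nat \<Rightarrow> int) \<Rightarrow> nat \<Rightarrow> int \<Rightarrow> int \<Rightarrow> bool" where
  "far_ok x j D w \<longleftrightarrow> 0 \<le> D \<and> (\<forall>i<m. 0 < x i j \<longrightarrow> d i j \<le> D) \<and>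
     (\<exists>z. w = z * int n + int j \<and> (0 < D \<longrightarrow> (\<exists>i<m. z = int i \<and> 0 < x i j \<and> d i j = D)))"

text \<open>The maximum is obtained as a minimum of negated distances, with the connections in use
  as denominators. A client without connections gets the distance 0.\<close>

lemma sem_far_step:
  assumes base: "costs_in \<sigma>" and j: "j < n" "\<sigma> 11 0 = int j"
  defines "\<sigma>' \<equiv> sem far_step \<sigma>"
  shows "far_ok (xm \<sigma>) j (\<sigma>' 62 (int j)) (\<sigma>' 63 (int j))"
    "k \<noteq> int j \<Longrightarrow> \<sigma>' 62 k = \<sigma> 62 k \<and> \<sigma>' 63 k = \<sigma> 63 k"
proof -
  have \<sigma>0: "\<sigma> 0 0 = int m" "\<sigma> 0 1 = int n" using base by (auto simp: costs_in_def)
  define p1 where "p1 = argmin_prog 10 sites_expr SSkip (Const 0 \<ominus> at_expr 23 (scalar 10) (scalar 11))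
       (Const 0 \<lless> at_expr 56 (scalar 10) (scalar 11))"
  define \<sigma>1 where "\<sigma>1 = sem p1 \<sigma>"
  have f1: "\<sigma>1 b = \<sigma> b" if "b \<notin> {10, 13, 37, 38}" for b
    using that sem_frame[of b] by (simp add: \<sigma>1_def p1_def)
  let ?\<delta> = "\<lambda>i. of_bool (0 < xm \<sigma> i j) :: int"
  have best: "\<sigma>1 best_den 0 = 0 \<and> (\<forall>i<m. ?\<delta> i \<le> 0) \<or>
    (\<exists>i<m. \<sigma>1 best_idx 0 = int i \<and> \<sigma>1 best_den 0 = ?\<delta> i \<and> 0 < ?\<delta> i \<and> \<sigma>1 best_num 0 = - d i j \<and>
      (\<forall>i'<m. 0 < ?\<delta> i' \<longrightarrow> - d i j * ?\<delta> i' \<le> - d i' j * ?\<delta> i))"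
    unfolding \<sigma>1_def p1_def
  proof (rule sem_argmin_prog[where \<nu> = "\<lambda>i. - d i j" and \<delta> = ?\<delta>])
    fix i \<tau>
    assume i: "i < m" and fr: "\<And>b. b \<notin> writes SSkip \<Longrightarrow> b \<notin> {10, best_idx, best_num, best_den} \<Longrightarrow> \<tau> b = \<sigma> b"
      and \<tau>10: "\<tau> 10 0 = int i"
    have fr': "\<tau> b = \<sigma> b" if "b \<in> {0, 11, 23, 56}" for b using that by (intro fr) auto
    have ix: "value_of \<tau> (scalar 10 \<odot> clients_expr \<oplus> scalar 11) = int (i * n + j)"
      using \<tau>10 fr' \<sigma>0 j by simp
    have "value_of \<tau> (at_expr 23 (scalar 10) (scalar 11)) = d i j"
      unfolding value_of.simps(2)[of _ 23] ix using fr'[of 23] base i j by (simp only: costs_in_def) simp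
    moreover have "value_of \<tau> (at_expr 56 (scalar 10) (scalar 11)) = xm \<sigma> i j"
      unfolding value_of.simps(2)[of _ 56] ix using fr'[of 56] by simp
    ultimately show "value_of (sem SSkip \<tau>) (Const 0 \<ominus> at_expr 23 (scalar 10) (scalar 11)) = - d i j \<and>
      value_of (sem SSkip \<tau>) (Const 0 \<lless> at_expr 56 (scalar 10) (scalar 11)) = ?\<delta> i"
      unfolding sem.simps(1) value_of.simps(3)[of _ Sub] value_of.simps(3)[of _ Less] by simp
  qed (use \<sigma>0 in auto)
  have s': "\<sigma>' = store (store \<sigma>1 62 (int j) (of_bool (0 < \<sigma>1 best_den 0) * - \<sigma>1 best_num 0)) 63 (int j)
      (\<sigma>1 best_idx 0 * int n + int j)"
    using j f1 \<sigma>0 by (simp add: \<sigma>'_def far_step_def p1_def[symmetric] \<sigma>1_def[symmetric])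
  then show "k \<noteq> int j \<Longrightarrow> \<sigma>' 62 k = \<sigma> 62 k \<and> \<sigma>' 63 k = \<sigma> 63 k" using f1 by simp
  have v: "\<sigma>' 62 (int j) = of_bool (0 < \<sigma>1 best_den 0) * - \<sigma>1 best_num 0"
    "\<sigma>' 63 (int j) = \<sigma>1 best_idx 0 * int n + int j" using s' by simp_all
  have dpos: "0 < ?\<delta> i \<longleftrightarrow> 0 < xm \<sigma> i j" for i by simp
  show "far_ok (xm \<sigma>) j (\<sigma>' 62 (int j)) (\<sigma>' 63 (int j))"
  proof (cases "\<sigma>1 best_den 0 = 0")
    case True
    then have "\<forall>i<m. \<not> 0 < ?\<delta> i" using best by (metis (no_types, lifting) less_irrefl not_less)
    then have "\<forall>i<m. \<not> 0 < xm \<sigma> i j" using dpos by blast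
    then show ?thesis unfolding far_ok_def v using True by auto
  next
    case False
    then obtain i where i: "i < m" "\<sigma>1 best_idx 0 = int i" "\<sigma>1 best_den 0 = ?\<delta> i" "0 < ?\<delta> i"
      "\<sigma>1 best_num 0 = - d i j" "\<forall>i'<m. 0 < ?\<delta> i' \<longrightarrow> - d i j * ?\<delta> i' \<le> - d i' j * ?\<delta> i"
      using best by blast
    have xi: "0 < xm \<sigma> i j" using i(4) dpos by blast
    have D: "\<sigma>' 62 (int j) = d i j" unfolding v using i(3,4,5) by simp
    have "d i' j \<le> d i j" if "i' < m" "0 < xm \<sigma> i' j" for i'
      using i(6)[rule_format, OF that(1)] that(2) xi by simp
    then show ?thesis unfolding far_ok_def D v(2) i(2) using d_nonneg[OF i(1) j(1)] i(1) xi by auto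
  qed
qed

lemma sem_far:
  assumes base: "costs_in \<sigma>"
  defines "\<sigma>' \<equiv> sem (For 11 clients_expr far_step) \<sigma>"
  shows "j < n \<Longrightarrow> far_ok (xm \<sigma>) j (\<sigma>' 62 (int j)) (\<sigma>' 63 (int j))"
proof -
  let ?Inv = "\<lambda>k \<tau>. (\<forall>b. b \<notin> {10, 11, best_idx, best_num, best_den, 62, 63} \<longrightarrow> \<tau> b = \<sigma> b) \<and> \<tau> 11 0 = int k \<and>
    (\<forall>j<k. far_ok (xm \<sigma>) j (\<tau> 62 (int j)) (\<tau> 63 (int j)))"
  have "?Inv n (loop 11 n (sem far_step) \<sigma>)"
  proof (rule loop_invariant[where Inv = ?Inv])
    show "?Inv 0 (store \<sigma> 11 0 0)" by simp
  next
    fix k \<tau>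
    assume k: "k < n" and Inv: "?Inv k \<tau>"
    have fr: "\<tau> b = \<sigma> b" if "b \<notin> {10, 11, best_idx, best_num, best_den, 62, 63}" for b using Inv that by blast
    have base': "costs_in \<tau>" using base costs_in_cong[of \<tau> \<sigma>] fr by simp
    have \<tau>11: "\<tau> 11 0 = int k" using Inv by blast
    have x: "xm \<tau> = xm \<sigma>" using fr by simp
    note step = sem_far_step[OF base' k \<tau>11, unfolded x]
    have frame: "sem far_step \<tau> b = \<sigma> b" if "b \<notin> {10, 11, best_idx, best_num, best_den, 62, 63}" for b
      using that fr sem_frame[of b far_step \<tau>] by (simp add: writes_far_step)
    have "far_ok (xm \<sigma>) j (sem far_step \<tau> 62 (int j)) (sem far_step \<tau> 63 (int j))" if "j < Suc k" for j
    proof (cases "j = k")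
      case True
      then show ?thesis using step(1) by simp
    next
      case False
      then have "far_ok (xm \<sigma>) j (\<tau> 62 (int j)) (\<tau> 63 (int j))" using Inv that by auto
      then show ?thesis using step(2)[of "int j"] False by simp
    qed
    then show "?Inv (Suc k) (store (sem far_step \<tau>) 11 0 (int (Suc k)))"
      using frame by simp
  qed
  moreover have "\<sigma>' = loop 11 n (sem far_step) \<sigma>" using base by (simp add: \<sigma>'_def costs_in_def)
  ultimately show "j < n \<Longrightarrow> far_ok (xm \<sigma>) j (\<sigma>' 62 (int j)) (\<sigma>' 63 (int j))" by simp
qed

lemma sem_aug_search:
  assumes base: "costs_in \<sigma>"
  defines "\<sigma>' \<equiv> sem aug_search \<sigma>"
  shows "\<sigma>' best_den 0 = 0 \<and> (\<forall>i<m. gain (Dm \<sigma>) i \<le> f i) \<or>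
    (\<exists>b<m. \<sigma>' best_idx 0 = int b \<and> \<sigma>' best_den 0 \<noteq> 0 \<and> f b < gain (Dm \<sigma>) b \<and>
      (\<forall>i<m. f i < gain (Dm \<sigma>) i \<longrightarrow> f b * gain (Dm \<sigma>) i \<le> f i * gain (Dm \<sigma>) b))"
proof -
  have \<sigma>0: "\<sigma> 0 0 = int m" "\<sigma> 0 1 = int n" using base by (auto simp: costs_in_def)
  let ?e = "(at_expr 23 (scalar 10) (scalar 11) \<lless> Read 62 (scalar 11)) \<odot>
       (Read 62 (scalar 11) \<ominus> at_expr 23 (scalar 10) (scalar 11))"
  define \<delta> where "\<delta> i = of_bool (f i < gain (Dm \<sigma>) i) * gain (Dm \<sigma>) i" for i
  have best: "\<sigma>' best_den 0 = 0 \<and> (\<forall>i<m. \<delta> i \<le> 0) \<or>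
    (\<exists>i<m. \<sigma>' best_idx 0 = int i \<and> \<sigma>' best_den 0 = \<delta> i \<and> 0 < \<delta> i \<and> \<sigma>' best_num 0 = f i \<and>
      (\<forall>i'<m. 0 < \<delta> i' \<longrightarrow> f i * \<delta> i' \<le> f i' * \<delta> i))"
    unfolding \<sigma>'_def aug_search_def
  proof (rule sem_argmin_prog[where \<nu> = f and \<delta> = \<delta>])
    fix i \<tau>
    assume i: "i < m" and fr: "\<And>b. b \<notin> writes (sum_prog 36 11 clients_expr ?e) \<Longrightarrow> b \<notin> {10, best_idx, best_num, best_den} \<Longrightarrow> \<tau> b = \<sigma> b"
      and \<tau>10: "\<tau> 10 0 = int i"
    have fr': "\<tau> b = \<sigma> b" if "b \<in> {0, 22, 23, 62}" for b using that by (intro fr) auto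
    let ?\<rho> = "sem (sum_prog 36 11 clients_expr ?e) \<tau>"
    have fr\<rho>: "?\<rho> b = \<tau> b" if "b \<notin> {11, 36}" for b
      using that by (intro sem_frame) simp
    have val: "value_of (store \<tau> 11 0 (int j)) ?e = max 0 (Dm \<sigma> j - d i j)" if j: "j < n" for j
    proof -
      let ?\<tau> = "store \<tau> 11 0 (int j)"
      have ix: "value_of ?\<tau> (scalar 10 \<odot> clients_expr \<oplus> scalar 11) = int (i * n + j)"
        using \<tau>10 fr' \<sigma>0 j by simp
      have "value_of ?\<tau> (at_expr 23 (scalar 10) (scalar 11)) = d i j"
        unfolding value_of.simps(2)[of _ 23] ix using fr'[of 23] base i j by (simp add: costs_in_def del: of_nat_add of_nat_mult)
      moreover have "value_of ?\<tau> (Read 62 (scalar 11)) = Dm \<sigma> j" using fr' by simp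
      ultimately show ?thesis
        unfolding value_of.simps(3)[of _ Mul "at_expr 23 (scalar 10) (scalar 11) \<lless> Read 62 (scalar 11)"]
          value_of.simps(3)[of _ Less] value_of.simps(3)[of _ Sub] by simp
    qed
    have "?\<rho> 36 0 = (\<Sum>j<n. value_of (store \<tau> 11 0 (int j)) ?e)"
      by (subst sem_sum_prog) (simp_all add: \<sigma>0 fr')
    also have "\<dots> = gain (Dm \<sigma>) i" unfolding gain_def using val by (intro sum.cong) auto
    finally have "?\<rho> 36 0 = gain (Dm \<sigma>) i" .
    moreover have "value_of ?\<rho> (Read 22 (scalar 10)) = f i"
      using base i fr\<rho> fr' \<tau>10 by (simp add: costs_in_def)
    ultimately show "value_of ?\<rho> (Read 22 (scalar 10)) = f i \<and>
      value_of ?\<rho> ((Read 22 (scalar 10) \<lless> scalar 36) \<odot> scalar 36) = \<delta> i"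
      unfolding value_of.simps(3)[of _ Mul] value_of.simps(3)[of _ Less] by (simp add: \<delta>_def)
  qed (use \<sigma>0 in auto)
  have dpos: "0 < \<delta> i \<longleftrightarrow> f i < gain (Dm \<sigma>) i" if "i < m" for i
    using f_nonneg[OF that] by (auto simp: \<delta>_def)
  show ?thesis
  proof (cases "\<sigma>' best_den 0 = 0")
    case True
    then have "\<forall>i<m. \<not> 0 < \<delta> i" using best by (metis less_irrefl not_less)
    then show ?thesis using True dpos not_less by blast
  next
    case False
    then obtain b where b: "b < m" "\<sigma>' best_idx 0 = int b" "0 < \<delta> b"
      "\<forall>i'<m. 0 < \<delta> i' \<longrightarrow> f b * \<delta> i' \<le> f i' * \<delta> b" using best by blast
    have fb: "f b < gain (Dm \<sigma>) b" using b dpos by blast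
    have "f b * gain (Dm \<sigma>) i \<le> f i * gain (Dm \<sigma>) b" if "i < m" "f i < gain (Dm \<sigma>) i" for i
      using b(4)[rule_format, OF that(1)] dpos[OF that(1)] that(2) fb by (simp add: \<delta>_def)
    then show ?thesis using False b(1,2) fb by blast
  qed
qed

lemma sem_aug_update:
  assumes base: "costs_in \<sigma>" and b: "b < m" "\<sigma> best_idx 0 = int b"
    and z: "\<And>j. j < n \<Longrightarrow> \<sigma> 63 (int j) = z j * int n + int j"
  defines "\<sigma>' \<equiv> sem aug_update \<sigma>"
  shows "i < m \<Longrightarrow> ym \<sigma>' i = ym \<sigma> i + of_bool (i = b)"
    and "i < m \<Longrightarrow> j < n \<Longrightarrow> xm \<sigma>' i j = xm \<sigma> i j - of_bool (d b j < Dm \<sigma> j \<and> z j = int i) +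
      of_bool (d b j < Dm \<sigma> j \<and> i = b)"
proof -
  have \<sigma>0: "\<sigma> 0 0 = int m" "\<sigma> 0 1 = int n" using base by (auto simp: costs_in_def)
  define \<sigma>1 where "\<sigma>1 = store (store \<sigma> 42 0 (int b)) 55 (int b) (\<sigma> 55 (int b) + 1)"
  define p2 where "p2 = map_prog 34 11 clients_expr (scalar 11) (at_expr 23 (scalar 42) (scalar 11) \<lless> Read 62 (scalar 11))"
  define \<sigma>2 where "\<sigma>2 = sem p2 \<sigma>1"
  define p3 where "p3 = map_prog 56 11 clients_expr (Read 63 (scalar 11))
       (Read 56 (Read 63 (scalar 11)) \<ominus> Read 34 (scalar 11))"
  define \<sigma>3 where "\<sigma>3 = sem p3 \<sigma>2"
  define p4 where "p4 = map_prog 56 11 clients_expr (scalar 42 \<odot> clients_expr \<oplus> scalar 11)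
       (at_expr 56 (scalar 42) (scalar 11) \<oplus> Read 34 (scalar 11))"
  have \<sigma>': "\<sigma>' = sem p4 \<sigma>3"
    using b by (simp add: \<sigma>'_def aug_update_def p2_def p3_def p4_def \<sigma>1_def \<sigma>2_def \<sigma>3_def)
  have f1: "\<sigma>1 b = \<sigma> b" if "b \<notin> {42, 55}" for b using that by (simp add: \<sigma>1_def)
  have f2: "\<sigma>2 b = \<sigma>1 b" if "b \<notin> {11, 34}" for b
    using that sem_frame[of b] by (simp add: \<sigma>2_def p2_def)
  have f3: "\<sigma>3 b = \<sigma>2 b" if "b \<notin> {11, 56}" for b
    using that sem_frame[of b] by (simp add: \<sigma>3_def p3_def)
  have f4: "\<sigma>' b = \<sigma>3 b" if "b \<notin> {11, 56}" for b
    using that sem_frame[of b] by (simp add: \<sigma>' p4_def)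
  show "i < m \<Longrightarrow> ym \<sigma>' i = ym \<sigma> i + of_bool (i = b)"
    using f4 f3 f2 by (simp add: \<sigma>1_def)
  define mv where "mv j = (of_bool (d b j < Dm \<sigma> j) :: int)" for j
  have M: "\<sigma>2 34 (int j) = mv j" if "j < n" for j
    unfolding \<sigma>2_def p2_def
  proof (rule sem_map_prog(1)[where N = n and \<iota> = int and \<phi> = mv])
    fix j \<tau>
    assume j: "j < n" and \<tau>: "\<And>b. b \<noteq> 34 \<Longrightarrow> b \<noteq> 11 \<Longrightarrow> \<tau> b = \<sigma>1 b" "\<tau> 11 = (\<sigma>1 11)(0 := int j)"
    have ix: "value_of \<tau> (scalar 42 \<odot> clients_expr \<oplus> scalar 11) = int (b * n + j)"
      using \<tau> f1 \<sigma>0 by (simp add: \<sigma>1_def)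
    have "value_of \<tau> (at_expr 23 (scalar 42) (scalar 11)) = d b j"
      unfolding value_of.simps(2)[of _ 23] ix using \<tau>(1)[of 23] f1 base b j
      by (simp add: costs_in_def del: of_nat_add of_nat_mult)
    moreover have "value_of \<tau> (Read 62 (scalar 11)) = Dm \<sigma> j" using \<tau> f1 by simp
    ultimately show "value_of \<tau> (scalar 11) = int j \<and>
      value_of \<tau> (at_expr 23 (scalar 42) (scalar 11) \<lless> Read 62 (scalar 11)) = mv j"
      unfolding value_of.simps(3)[of _ Less] using \<tau>(2) by (simp add: mv_def)
  qed (use that \<sigma>0 f1 in auto)
  have n2: "\<sigma>2 0 1 = int n" using \<sigma>0 f1 f2 by simp
  \<comment> \<open>Rows are arbitrary integers here; the column is recovered modulo
    \<open>n\<close>.\<close>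
  have z_eq: "z j * int n + int j = z j' * int n + int j' \<longleftrightarrow> z j = z j' \<and> j = j'"
    if "j < n" "j' < n" for j j' and z :: "nat \<Rightarrow> int"
  proof
    assume eq: "z j * int n + int j = z j' * int n + int j'"
    then have "(z j * int n + int j) mod int n = (z j' * int n + int j') mod int n" by simp
    then have "j = j'" using that by simp
    then show "z j = z j' \<and> j = j'" by simp
  qed simp
  have inj3: "inj_on (\<lambda>j. z j * int n + int j) {..<n}"
    using z_eq[of _ _ z] by (auto simp: inj_on_def)
  let ?\<phi>3 = "\<lambda>j. \<sigma> 56 (z j * int n + int j) - mv j"
  have val3: "value_of \<tau> (Read 63 (scalar 11)) = z j * int n + int j \<and>
      value_of \<tau> (Read 56 (Read 63 (scalar 11)) \<ominus> Read 34 (scalar 11)) = ?\<phi>3 j"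
    if j: "j < n" and \<tau>: "\<And>b. b \<noteq> 56 \<Longrightarrow> b \<noteq> 11 \<Longrightarrow> \<tau> b = \<sigma>2 b" "\<tau> 11 = (\<sigma>2 11)(0 := int j)"
      "\<tau> 56 (z j * int n + int j) = \<sigma>2 56 (z j * int n + int j)" for j \<tau>
    using \<tau> z[OF j] f2 f1 M[OF j] by simp
  have N3: "n = nat (value_of \<sigma>2 clients_expr)" using n2 by simp
  have X3: "\<sigma>3 56 (z j * int n + int j) = ?\<phi>3 j" if "j < n" for j
    unfolding \<sigma>3_def p3_def
    by (rule sem_map_prog(1)[where N = n and \<iota> = "\<lambda>j. z j * int n + int j" and \<phi> = ?\<phi>3])
      (simp, rule N3, rule val3, assumption+, rule inj3, rule that)
  have X3': "\<sigma>3 56 k = \<sigma>2 56 k" if "\<And>j. j < n \<Longrightarrow> k \<noteq> z j * int n + int j" for k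
    unfolding \<sigma>3_def p3_def
    by (rule sem_map_prog(2)[where N = n and \<iota> = "\<lambda>j. z j * int n + int j" and \<phi> = ?\<phi>3])
      (simp, rule N3, rule val3, assumption+, rule inj3, rule that)
  have x3: "\<sigma>3 56 (int (i * n + j)) = xm \<sigma> i j - of_bool (z j = int i) * mv j" if j: "j < n" for i j
  proof (cases "z j = int i")
    case True
    then show ?thesis using X3[OF j] by simp
  next
    case False
    have "\<sigma>3 56 (int (i * n + j)) = \<sigma>2 56 (int (i * n + j))"
    proof (rule X3')
      fix j'
      assume j': "j' < n"
      show "int (i * n + j) \<noteq> z j' * int n + int j'"
      proof
        assume "int (i * n + j) = z j' * int n + int j'"
        then have eq: "int i * int n + int j = z j' * int n + int j'" by simp
        then have "(int i * int n + int j) mod int n = (z j' * int n + int j') mod int n" by simp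
        then have "j = j'" using j j' by simp
        then have "int i * int n = z j * int n" using eq by simp
        then show False using False j by simp
      qed
    qed
    then show ?thesis using False f2 f1 by simp
  qed
  let ?\<phi>4 = "\<lambda>j. \<sigma>3 56 (int (b * n + j)) + mv j"
  have val4: "value_of \<tau> (scalar 42 \<odot> clients_expr \<oplus> scalar 11) = int (b * n + j) \<and>
      value_of \<tau> (at_expr 56 (scalar 42) (scalar 11) \<oplus> Read 34 (scalar 11)) = ?\<phi>4 j"
    if j: "j < n" and \<tau>: "\<And>b. b \<noteq> 56 \<Longrightarrow> b \<noteq> 11 \<Longrightarrow> \<tau> b = \<sigma>3 b" "\<tau> 11 = (\<sigma>3 11)(0 := int j)"
      "\<tau> 56 (int (b * n + j)) = \<sigma>3 56 (int (b * n + j))" for j \<tau>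
  proof -
    have ix: "value_of \<tau> (scalar 42 \<odot> clients_expr \<oplus> scalar 11) = int (b * n + j)"
      using \<tau> f3 n2 f2 by (simp add: \<sigma>1_def)
    have "value_of \<tau> (Read 34 (scalar 11)) = mv j" using \<tau>(1,2) f3 M[OF j] by simp
    then show ?thesis
      using ix \<tau>(3) unfolding value_of.simps(3)[of _ Add "at_expr 56 (scalar 42) (scalar 11)"] value_of.simps(2)[of _ 56]
      by simp
  qed
  have N4: "n = nat (value_of \<sigma>3 clients_expr)" using n2 f3 by simp
  have inj4: "inj_on (\<lambda>j. int (b * n + j)) {..<n}" by (auto simp: inj_on_def)
  have X4: "\<sigma>' 56 (int (b * n + j)) = ?\<phi>4 j" if "j < n" for j
    unfolding \<sigma>' p4_def
    by (rule sem_map_prog(1)[where N = n and \<iota> = "\<lambda>j. int (b * n + j)" and \<phi> = ?\<phi>4])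
      (simp, rule N4, rule val4, assumption+, rule inj4, rule that)
  have X4': "\<sigma>' 56 k = \<sigma>3 56 k" if "\<And>j. j < n \<Longrightarrow> k \<noteq> int (b * n + j)" for k
    unfolding \<sigma>' p4_def
    by (rule sem_map_prog(2)[where N = n and \<iota> = "\<lambda>j. int (b * n + j)" and \<phi> = ?\<phi>4])
      (simp, rule N4, rule val4, assumption+, rule inj4, rule that)
  show "xm \<sigma>' i j = xm \<sigma> i j - of_bool (d b j < Dm \<sigma> j \<and> z j = int i) +
      of_bool (d b j < Dm \<sigma> j \<and> i = b)" if "i < m" and j: "j < n"
  proof (cases "i = b")
    case True
    then show ?thesis using X4[OF j] x3[OF j, of i] by (auto simp: mv_def)
  next
    case False
    have "\<sigma>' 56 (int (i * n + j)) = \<sigma>3 56 (int (i * n + j))"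
    proof (rule X4')
      fix j'
      assume "j' < n"
      then show "int (i * n + j) \<noteq> int (b * n + j')"
        unfolding of_nat_eq_iff using index_inj[of j n j' i b] j False by simp
    qed
    then show ?thesis using False x3[OF j, of i] by (auto simp: mv_def)
  qed
qed

lemma far_ok_farthest: "(\<And>j. j < n \<Longrightarrow> far_ok x j (D j) (w j)) \<Longrightarrow> farthest x D"
  by (simp add: far_ok_def farthest_def)

text \<open>The computed distance is 0 or attained by a connection, so it is the smallest bound in
  the sense of \<open>farthest\<close>. If any such bound certifies that no site pays off, then so
  does the computed one.\<close>

lemma far_ok_le_farthest:
  assumes "far_ok x j D w" "farthest x D'" "j < n"
  shows "D \<le> D' j"
  using assms unfolding far_ok_def farthest_def by (metis not_less order.trans)

lemma gain_mono: "(\<And>j. j < n \<Longrightarrow> D j \<le> D' j) \<Longrightarrow> gain D i \<le> gain D' i"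
  unfolding gain_def by (intro sum_mono) fastforce

lemma sem_aug_prog:
  assumes base: "costs_in \<sigma>" and inv: "aug_inv (xm \<sigma>) (ym \<sigma>)"
    and dem: "\<And>j. j < n \<Longrightarrow> dem j \<le> 2 * int m"
  defines "\<sigma>' \<equiv> sem aug_prog \<sigma>"
  shows "int_solution (xm \<sigma>') (ym \<sigma>')"
    "real_of_int (int_open (ym \<sigma>')) + real_of_int (int_conn (xm \<sigma>')) \<le> 2.96 * (open_part ys + conn_part xs)"
proof -
  define body where "body = seq [For 11 clients_expr far_step, aug_search, SIf (scalar best_den) aug_update SSkip]"
  define W where "W = {10, 11, best_idx, 34, 36, best_num, best_den, 42, 55, 56, 62, 63}"
  have writes_body: "writes body = W"
    by (auto simp: body_def W_def writes_far_step writes_aug_search writes_aug_update)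
  define N where "N = n * (m * (2 * m))"
  let ?stop = "\<lambda>\<tau>. \<exists>D. farthest (xm \<tau>) D \<and> (\<forall>i<m. gain D i \<le> f i)"
  let ?Inv = "\<lambda>t \<tau>. (\<forall>b. b \<notin> W \<longrightarrow> b \<noteq> 12 \<longrightarrow> \<tau> b = \<sigma> b) \<and> aug_inv (xm \<tau>) (ym \<tau>) \<and>
    (?stop \<tau> \<or> aug_potential (xm \<tau>) + int t \<le> int N)"
  have "?Inv (Suc N) (loop 12 (Suc N) (sem body) \<sigma>)"
  proof (rule loop_invariant[where Inv = ?Inv])
    have "aug_potential (xm \<sigma>) \<le> int N"
      using aug_potential_bounds(2)[of "xm \<sigma>" "ym \<sigma>"] inv dem by (simp add: aug_inv_def N_def)
    then show "?Inv 0 (store \<sigma> 12 0 0)" using inv by simp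
  next
    fix t \<tau>
    assume Inv: "?Inv t \<tau>"
    have fr: "\<tau> b = \<sigma> b" if "b \<notin> W" "b \<noteq> 12" for b using Inv that by blast
    have ainv: "aug_inv (xm \<tau>) (ym \<tau>)" using Inv by blast
    have base0: "costs_in \<tau>" using base costs_in_cong[of \<tau> \<sigma>] fr by (simp add: W_def)
    define \<tau>1 where "\<tau>1 = sem (For 11 clients_expr far_step) \<tau>"
    define \<tau>2 where "\<tau>2 = sem aug_search \<tau>1"
    define \<tau>3 where "\<tau>3 = sem body \<tau>"
    have g1: "\<tau>1 b = \<tau> b" if "b \<notin> {10, 11, best_idx, best_num, best_den, 62, 63}" for b
      unfolding \<tau>1_def using that by (intro sem_frame) (simp add: writes_far_step)
    have g2: "\<tau>2 b = \<tau>1 b" if "b \<notin> {10, 11, best_idx, 36, best_num, best_den}" for b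
      unfolding \<tau>2_def using that by (intro sem_frame) (simp add: writes_aug_search)
    have base1: "costs_in \<tau>1" using base0 costs_in_cong[of \<tau>1 \<tau>] g1 by simp
    have base2: "costs_in \<tau>2" using base1 costs_in_cong[of \<tau>2 \<tau>1] g2 by simp
    have far: "far_ok (xm \<tau>) j (Dm \<tau>1 j) (\<tau>1 63 (int j))" if "j < n" for j
      unfolding \<tau>1_def using base0 that by (rule sem_far)
    have farth: "farthest (xm \<tau>) (Dm \<tau>1)" using far by (rule far_ok_farthest)
    have same2: "xm \<tau>2 = xm \<tau>" "ym \<tau>2 = ym \<tau>" "Dm \<tau>2 = Dm \<tau>1" using g1 g2 by auto
    have search: "\<tau>2 best_den 0 = 0 \<and> (\<forall>i<m. gain (Dm \<tau>1) i \<le> f i) \<or>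
      (\<exists>b<m. \<tau>2 best_idx 0 = int b \<and> \<tau>2 best_den 0 \<noteq> 0 \<and> f b < gain (Dm \<tau>1) b \<and>
        (\<forall>i<m. f i < gain (Dm \<tau>1) i \<longrightarrow> f b * gain (Dm \<tau>1) i \<le> f i * gain (Dm \<tau>1) b))"
      unfolding \<tau>2_def using base1 by (rule sem_aug_search)
    have frame3: "\<forall>b. b \<notin> W \<longrightarrow> b \<noteq> 12 \<longrightarrow> \<tau>3 b = \<sigma> b"
      using fr sem_frame[of _ body \<tau>] by (simp add: \<tau>3_def writes_body)
    have "aug_inv (xm \<tau>3) (ym \<tau>3) \<and> (?stop \<tau>3 \<or> aug_potential (xm \<tau>3) + int (Suc t) \<le> int N)"
    proof (cases "\<tau>2 best_den 0 = 0")
      case True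
      then have \<tau>3: "\<tau>3 = \<tau>2" by (simp add: \<tau>3_def body_def \<tau>1_def \<tau>2_def)
      have "?stop \<tau>" using search True farth by blast
      then show ?thesis unfolding \<tau>3 same2 using ainv by blast
    next
      case False
      then have \<tau>3: "\<tau>3 = sem aug_update \<tau>2" by (simp add: \<tau>3_def body_def \<tau>1_def \<tau>2_def)
      obtain b where b: "b < m" "\<tau>2 best_idx 0 = int b" "f b < gain (Dm \<tau>1) b"
        "\<And>i. i < m \<Longrightarrow> f i < gain (Dm \<tau>1) i \<Longrightarrow> f b * gain (Dm \<tau>1) i \<le> f i * gain (Dm \<tau>1) b"
        using search False by blast
      have "\<forall>j. \<exists>z. j < n \<longrightarrow> \<tau>1 63 (int j) = z * int n + int j \<and>
          (0 < Dm \<tau>1 j \<longrightarrow> (\<exists>i<m. z = int i \<and> 0 < xm \<tau> i j \<and> d i j = Dm \<tau>1 j))"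
        using far unfolding far_ok_def by blast
      then obtain z where z: "\<And>j. j < n \<Longrightarrow> \<tau>1 63 (int j) = z j * int n + int j"
        "\<And>j. j < n \<Longrightarrow> 0 < Dm \<tau>1 j \<Longrightarrow> \<exists>i<m. z j = int i \<and> 0 < xm \<tau> i j \<and> d i j = Dm \<tau>1 j"
        by metis
      have z2: "\<tau>2 63 (int j) = z j * int n + int j" if "j < n" for j using z(1)[OF that] g2 by simp
      have upd_y: "ym \<tau>3 i = ym \<tau> i + of_bool (i = b)" if "i < m" for i
        using sem_aug_update(1)[OF base2 b(1,2), of z i] z2 that g1 g2 by (simp add: \<tau>3)
      have upd_x: "xm \<tau>3 i j = xm \<tau> i j - of_bool (d b j < Dm \<tau>1 j \<and> z j = int i) +
          of_bool (d b j < Dm \<tau>1 j \<and> i = b)" if "i < m" "j < n" for i j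
        using sem_aug_update(2)[OF base2 b(1,2), of z i j] z2 that g1 g2
        by (simp add: \<tau>3 del: of_nat_add of_nat_mult)
      \<comment> \<open>A certificate by some \<open>D\<close> would apply to the computed
        distances, which are smallest, as gains are monotone; but \<open>b\<close> pays off. So the
        invariant provides the bound on the potential.\<close>
      have "\<not> ?stop \<tau>"
      proof
        assume "?stop \<tau>"
        then obtain D where D: "farthest (xm \<tau>) D" "\<forall>i<m. gain D i \<le> f i" by blast
        have "gain (Dm \<tau>1) b \<le> gain D b"
          using far_ok_le_farthest[OF far D(1)] by (rule gain_mono)
        then show False using D(2) b(1,3) by force
      qed
      then have pot: "aug_potential (xm \<tau>) + int t \<le> int N" using Inv by blast
      define w where "w j = nat (z j)" for j
      have zw: "z j = int i \<longleftrightarrow> i = w j" if "j < n" "d b j < Dm \<tau>1 j" for i j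
      proof -
        have "0 < Dm \<tau>1 j" using d_nonneg[OF b(1) that(1)] that(2) by linarith
        then have "\<exists>i'. z j = int i'" using z(2)[OF that(1)] by blast
        then show ?thesis by (auto simp: w_def)
      qed
      have w: "w j < m \<and> 0 < xm \<tau> (w j) j \<and> d (w j) j = Dm \<tau>1 j" if "j < n" "d b j < Dm \<tau>1 j" for j
      proof -
        have "0 < Dm \<tau>1 j" using d_nonneg[OF b(1) that(1)] that(2) by linarith
        then have "\<exists>i<m. i = w j \<and> 0 < xm \<tau> i j \<and> d i j = Dm \<tau>1 j"
          using z(2)[OF that(1)] by (simp only: zw[OF that])
        then show ?thesis by blast
      qed
      have x3: "xm \<tau>3 i j = xm \<tau> i j - of_bool (d b j < Dm \<tau>1 j \<and> i = w j) + of_bool (d b j < Dm \<tau>1 j \<and> i = b)"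
        if "i < m" "j < n" for i j
        using upd_x[OF that] zw[OF that(2), of i] by (cases "d b j < Dm \<tau>1 j") simp_all
      note step = aug_step[OF ainv farth b(1,3,4) w upd_y x3]
      show ?thesis using step pot by simp
    qed
    then show "?Inv (Suc t) (store (sem body \<tau>) 12 0 (int (Suc t)))"
      using frame3 by (simp add: \<tau>3_def[symmetric])
  qed
  moreover have "\<sigma>' = loop 12 (Suc N) (sem body) \<sigma>"
  proof -
    have "value_of \<sigma> (clients_expr \<odot> (sites_expr \<odot> (Const 2 \<odot> sites_expr)) \<oplus> Const 1) = int (Suc N)"
      using base by (simp add: costs_in_def N_def)
    then show ?thesis by (simp only: \<sigma>'_def aug_prog_def sem.simps(5) body_def nat_int)
  qed
  ultimately have fin: "aug_inv (xm \<sigma>') (ym \<sigma>')" "?stop \<sigma>' \<or> aug_potential (xm \<sigma>') + int (Suc N) \<le> int N" by simp_all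
  show sol: "int_solution (xm \<sigma>') (ym \<sigma>')" using fin(1) by (simp add: aug_inv_def)
  have "0 \<le> aug_potential (xm \<sigma>')" using sol dem by (rule aug_potential_bounds)
  then obtain D where "farthest (xm \<sigma>') D" "\<And>i. i < m \<Longrightarrow> gain D i \<le> f i" using fin(2) by auto
  then show "real_of_int (int_open (ym \<sigma>')) + real_of_int (int_conn (xm \<sigma>')) \<le> 2.96 * (open_part ys + conn_part xs)"
    using fin(1) by (intro aug_final)
qed

end

section \<open>The complete program\<close>

definition out_prog :: sprog where
  "out_prog = seq [
     map_prog 6 10 sites_expr (scalar 10) (Read 50 (scalar 10) \<oplus> Read 55 (scalar 10)),
     map_prog 7 10 (sites_expr \<odot> clients_expr) (scalar 10) (Read 51 (scalar 10) \<oplus> Read 56 (scalar 10))]"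

definition main_prog :: sprog where
  "main_prog = seq [prep_prog, mw_prog, bulk_prog, round_prog, aug_prog, out_prog]"

text \<open>Level 0 holds inputs, indices, flags and counters; level 1 what involves products of
  these, such as common denominators and coverage. The weights are multiplied by numbers of level 1
  in every step and are thus on level 2, as are the accumulators 35 to 38, which take part in sums
  and searches over them, and the arrays 53 and 62, which are assigned from accumulators.\<close>

definition array_level :: "nat \<Rightarrow> nat" where
  "array_level a =
     (if a \<in> {30, 35, 36, best_num, best_den, 53, 62} then 2
      else if a \<in> {6, 7, 20, 21, 22, 23, 24, 31, 32, 33, 50, 51, 57, 59, 63} then 1 else 0)"

lemma bounded_loops_main_prog: "bounded_loops main_prog"
  by (simp add: main_prog_def prep_prog_def mw_prog_def mw_search_def mw_candidate_def mw_update_def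
      bulk_prog_def round_prog_def round_search_def round_choose_def round_new_def round_fill_def
      round_join_prog_def aug_prog_def far_step_def aug_search_def aug_update_def out_prog_def
      sum_prog_def map_prog_def argmin_prog_def prod_prog_def)

lemma levelled_main_prog: "levelled array_level main_prog"
  by (simp add: main_prog_def prep_prog_def mw_prog_def mw_search_def mw_candidate_def mw_update_def
      bulk_prog_def round_prog_def round_search_def round_choose_def round_new_def round_fill_def
      round_join_prog_def aug_prog_def far_step_def aug_search_def aug_update_def out_prog_def
      sum_prog_def map_prog_def argmin_prog_def prod_prog_def array_level_def)

lemma writes_mw_prog: "writes mw_prog = {10, 11, 12, best_idx, 30, 31, 32, 33, 34, 35, 36, best_num, best_den, 41, 42}"
  by (auto simp: mw_prog_def mw_search_def mw_candidate_def mw_update_def)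

lemma writes_round_prog: "writes round_prog =
    {10, 11, 12, best_idx, 36, best_num, best_den, 42, 53, 54, 55, 56, 57, 58, 59, 60, 61}"
  by (auto simp: round_prog_def writes_round_search writes_round_choose writes_round_join_prog)

lemma writes_aug_prog: "writes aug_prog =
    {10, 11, 12, best_idx, 34, 36, best_num, best_den, 42, 55, 56, 62, 63}"
  by (auto simp: aug_prog_def writes_far_step writes_aug_search writes_aug_update)

text \<open>A token is a pair of a site \<open>t div cap\<close> and a slot
  \<open>t mod cap\<close>, so the sum splits into blocks of length \<open>cap\<close>, and exactly
  \<open>z i\<close> slots of block \<open>i\<close> count, as
  \<open>z i \<le> int cap\<close>.\<close>

lemma sum_over_tokens:
  fixes g :: "nat \<Rightarrow> int"
  assumes "\<And>i. i < m \<Longrightarrow> 0 \<le> z i \<and> z i \<le> int cap"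
  shows "(\<Sum>t\<in>{t. t < m * cap \<and> int (t mod cap) < z (t div cap)}. g (t div cap)) = (\<Sum>i<m. z i * g i)"
proof -
  let ?h = "\<lambda>t. if int (t mod cap) < z (t div cap) then g (t div cap) else 0"
  have "(\<Sum>t\<in>{t. t < m * cap \<and> int (t mod cap) < z (t div cap)}. g (t div cap)) = (\<Sum>t<m * cap. ?h t)"
    by (rule sum.mono_neutral_cong_left) auto
  also have "\<dots> = (\<Sum>i<m. \<Sum>t\<in>{i * cap..<i * cap + cap}. ?h t)"
    by (rule sum.nat_group[symmetric])
  also have "\<dots> = (\<Sum>i<m. z i * g i)"
  proof (rule sum.cong)
    fix i
    assume "i \<in> {..<m}"
    then have z: "0 \<le> z i" "z i \<le> int cap" using assms by auto
    have "(\<Sum>t\<in>{i * cap..<i * cap + cap}. ?h t) = (\<Sum>k<cap. ?h (i * cap + k))"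
      by (simp add: sum.atLeastLessThan_shift_0[of _ "i * cap"] atLeast0LessThan)
    also have "\<dots> = (\<Sum>k<cap. if int k < z i then g i else 0)"
      by (intro sum.cong) auto
    also have "\<dots> = (\<Sum>k\<in>{..<nat (z i)}. g i)"
      using z by (intro sum.mono_neutral_cong_right) auto
    also have "\<dots> = z i * g i" using z by simp
    finally show "(\<Sum>t\<in>{i * cap..<i * cap + cap}. ?h t) = z i * g i" .
  qed simp
  finally show ?thesis .
qed

lemma sum_over_fibers:
  fixes g :: "nat \<Rightarrow> int"
  assumes "finite A" "\<And>c. c \<in> A \<Longrightarrow> s c < m"
  shows "(\<Sum>i<m. g i * int (card {c \<in> A. s c = i})) = (\<Sum>c\<in>A. g (s c))"
proof -
  have "(\<Sum>i<m. g i * int (card {c \<in> A. s c = i})) = (\<Sum>i<m. \<Sum>c\<in>{c \<in> A. s c = i}. g (s c))"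
    by (intro sum.cong) (auto simp: mult.commute)
  also have "\<dots> = (\<Sum>c\<in>A. g (s c))"
    using assms by (intro sum.group) auto
  finally show ?thesis .
qed

lemma sem_out_prog:
  assumes "\<sigma> 0 0 = int m" "\<sigma> 0 1 = int n"
  shows "i < m \<Longrightarrow> sem out_prog \<sigma> 6 (int i) = \<sigma> 50 (int i) + \<sigma> 55 (int i)"
    and "k < m * n \<Longrightarrow> sem out_prog \<sigma> 7 (int k) = \<sigma> 51 (int k) + \<sigma> 56 (int k)"
proof -
  define p1 where "p1 = map_prog 6 10 sites_expr (scalar 10) (Read 50 (scalar 10) \<oplus> Read 55 (scalar 10))"
  define p2 where "p2 = map_prog 7 10 (sites_expr \<odot> clients_expr) (scalar 10) (Read 51 (scalar 10) \<oplus> Read 56 (scalar 10))"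
  define \<sigma>1 where "\<sigma>1 = sem p1 \<sigma>"
  have out: "sem out_prog \<sigma> = sem p2 \<sigma>1" by (simp add: out_prog_def p1_def p2_def \<sigma>1_def)
  have f1: "\<sigma>1 b = \<sigma> b" if "b \<notin> {6, 10}" for b
    using that sem_frame[of b] by (simp add: \<sigma>1_def p1_def)
  have f2: "sem p2 \<sigma>1 b = \<sigma>1 b" if "b \<notin> {7, 10}" for b
    using that sem_frame[of b] by (simp add: p2_def)
  have "\<sigma>1 6 (int i) = \<sigma> 50 (int i) + \<sigma> 55 (int i)" if "i < m" for i
    unfolding \<sigma>1_def p1_def
    by (rule sem_map_prog(1)[where N = m and \<iota> = int and \<phi> = "\<lambda>i. \<sigma> 50 (int i) + \<sigma> 55 (int i)"])
      (use assms that in auto)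
  then show "i < m \<Longrightarrow> sem out_prog \<sigma> 6 (int i) = \<sigma> 50 (int i) + \<sigma> 55 (int i)" unfolding out using f2 by simp
  show "sem out_prog \<sigma> 7 (int k) = \<sigma> 51 (int k) + \<sigma> 56 (int k)" if "k < m * n"
    unfolding out p2_def
    by (rule sem_map_prog(1)[where N = "m * n" and \<iota> = int and \<phi> = "\<lambda>i. \<sigma> 51 (int i) + \<sigma> 56 (int i)"])
      (use assms that f1 in \<open>auto simp: nat_mult_distrib\<close>)
qed

definition rest_prog :: sprog where
  "rest_prog = seq [mw_prog, bulk_prog, round_prog, aug_prog, out_prog]"

context ftfp_costs
begin

text \<open>\<open>x\<close> and \<open>y\<close> are an arbitrary fractional solution, which the
  program does not know; so the cost bound holds against all of them at once and passes to the
  infimum.\<close>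

theorem sem_rest_prog:
  assumes base: "costs_in \<sigma>" and r: "\<And>j. j < n \<Longrightarrow> \<sigma> 5 (int j) = r j" "\<And>j. j < n \<Longrightarrow> 1 \<le> r j"
    and R: "\<sigma> 21 0 = R" "\<And>j. j < n \<Longrightarrow> \<sigma> 24 (int j) * r j = R" "0 < R"
    and init: "\<And>j. j < n \<Longrightarrow> \<sigma> 30 (int j) = \<sigma> 24 (int j)"
    and zero: "\<And>b. b \<in> {31, 32, 33, 55, 56, 57} \<Longrightarrow> \<sigma> b = (\<lambda>_. 0)"
    and lp: "frac_feasible (\<lambda>j. real_of_int (r j)) x y"
  defines "Yo \<equiv> \<lambda>i. sem rest_prog \<sigma> 6 (int i)" and "Xo \<equiv> \<lambda>i j. sem rest_prog \<sigma> 7 (int (i * n + j))"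
  shows "i < m \<Longrightarrow> 0 \<le> Yo i" "i < m \<Longrightarrow> j < n \<Longrightarrow> 0 \<le> Xo i j \<and> Xo i j \<le> Yo i"
    "j < n \<Longrightarrow> r j \<le> (\<Sum>i<m. Xo i j)"
    "open_part (\<lambda>i. real_of_int (Yo i)) + conn_part (\<lambda>i j. real_of_int (Xo i j))
       \<le> 3 * (open_part y + conn_part x)"
proof -
  define K :: int where "K = 200000 * (int n + 1)"
  define cap :: nat where "cap = 400000 * (n + 1)"
  define h :: nat where "h = 100000 * (n + 1)"
  have Kh: "K = 2 * int h" and Kcap: "2 * K = int cap" and K_pos: "0 < K" and h_pos: "0 < h"
    by (simp_all add: K_def h_def cap_def)
  define LP where "LP = open_part y + conn_part x"
  have LP: "0 \<le> LP" using open_part_nonneg[OF lp] conn_part_nonneg[OF lp] by (simp add: LP_def)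
  interpret mw: mult_weights m n f d r K x y
    by unfold_locales (use r(2) K_pos lp in auto)
  define \<sigma>1 where "\<sigma>1 = sem mw_prog \<sigma>"
  define X where "X i j = \<sigma>1 31 (int (i * n + j))" for i j
  define Y where "Y i = \<sigma>1 32 (int i)" for i
  define cov where "cov j = \<sigma>1 33 (int j)" for j
  have f1: "\<sigma>1 b = \<sigma> b" if "b \<notin> writes mw_prog" for b
    unfolding \<sigma>1_def using that by (rule sem_frame)
  note mw = mw.sem_mw_prog[OF base K_def r(1) R init, folded \<sigma>1_def]
  have zero': "\<sigma> 31 k = 0" "\<sigma> 32 k = 0" "\<sigma> 33 k = 0" for k using zero by simp_all
  have minv: "mw.mw_inv (\<lambda>j. \<sigma>1 30 (int j)) X Y cov" and mact: "mw.active cov = {}"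
    unfolding X_def Y_def cov_def using mw zero' by simp_all
  have Y_nn: "0 \<le> Y i" if "i < m" for i using minv that by (simp add: mw.mw_inv_def)
  have XY: "0 \<le> X i j" "X i j \<le> Y i" if "i < m" "j < n" for i j
    using minv that by (simp_all add: mw.mw_inv_def)
  have X_cov: "K * r j \<le> (\<Sum>i<m. X i j)" if "j < n" for j
  proof -
    have "cov j = (\<Sum>i<m. X i j)" using minv that by (simp add: mw.mw_inv_def)
    moreover have "\<not> cov j < K * r j" using mact that by (auto simp: mw.active_def)
    ultimately show ?thesis by simp
  qed
  have cost1: "open_part (\<lambda>i. real_of_int (Y i)) + conn_part (\<lambda>i j. real_of_int (X i j)) \<le> 1.0112 * real_of_int K * LP"
    unfolding LP_def using minv K_def by (rule mw.mw_final)
  have base1: "costs_in \<sigma>1" using base costs_in_cong[of \<sigma>1 \<sigma>] f1 by (simp add: writes_mw_prog)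
  define \<sigma>2 where "\<sigma>2 = sem bulk_prog \<sigma>1"
  note bulk = sem_bulk_prog[OF base1 K_def cap_def, folded \<sigma>2_def]
  define A where "A i = \<sigma>2 50 (int i)" for i
  define B where "B i j = \<sigma>2 51 (int (i * n + j))" for i j
  have A_eq: "A i = (if 0 < Y i div K then Y i div K - 1 else 0)" if "i < m" for i
    using bulk(1)[OF that] by (simp add: A_def Y_def)
  have B_eq: "B i j = min (X i j div K) (A i)" if "i < m" "j < n" for i j
    using bulk(2)[OF that] by (simp add: A_def B_def X_def)
  have ip: "0 \<le> B i j" "B i j \<le> A i" "0 \<le> X i j - K * B i j" "X i j - K * B i j \<le> Y i - K * A i" if "i < m" "j < n" for i j
    using integral_part[OF K_pos XY[OF that]] B_eq[OF that] A_eq[OF that(1)] by simp_all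
  have A_nn: "0 \<le> A i" and Y'_lt: "Y i - K * A i < 2 * K" and Y'_nn: "0 \<le> Y i - K * A i" if "i < m" for i
    using integral_part[OF K_pos order.refl Y_nn[OF that]] integral_part[OF K_pos Y_nn[OF that] order.refl]
      A_eq[OF that] by simp_all
  define X' where "X' i j = X i j - K * B i j" for i j
  define Y' where "Y' i = Y i - K * A i" for i
  define dem where "dem j = nat (\<sigma>2 53 (int j))" for j
  have dem: "\<sigma>2 53 (int j) = int (dem j)" "int (dem j) = max 0 (r j - (\<Sum>i<m. B i j))" if "j < n" for j
  proof -
    have "\<sigma>1 5 = \<sigma> 5" using f1 by (simp add: writes_mw_prog)
    then have "\<sigma>2 53 (int j) = max 0 (r j - (\<Sum>i<m. B i j))"
      using bulk(3)[OF that] r(1)[OF that] by (simp add: B_def)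
    then show "\<sigma>2 53 (int j) = int (dem j)" "int (dem j) = max 0 (r j - (\<Sum>i<m. B i j))"
      by (simp_all add: dem_def)
  qed
  \<comment> \<open>If the part kept exceeds the demand, then \<open>dem j = 0\<close> and it
    suffices that the residual is nonnegative.\<close>
  have X'_sum: "K * int (dem j) \<le> (\<Sum>i<m. X' i j)" if "j < n" for j
  proof -
    have "(\<Sum>i<m. X' i j) = (\<Sum>i<m. X i j) - K * (\<Sum>i<m. B i j)"
      by (simp add: X'_def sum_subtractf sum_distrib_left)
    then have "K * (r j - (\<Sum>i<m. B i j)) \<le> (\<Sum>i<m. X' i j)"
      using X_cov[OF that] by (simp add: right_diff_distrib)
    moreover have "0 \<le> (\<Sum>i<m. X' i j)" using ip(3) that by (intro sum_nonneg) (simp add: X'_def)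
    ultimately show ?thesis unfolding dem(2)[OF that] by (simp add: max_def)
  qed
  \<comment> \<open>A client uses less than two units of residual facilities per site. This keeps
    the number of rounds of the rounding polynomial.\<close>
  have dem_le: "dem j \<le> 2 * m" if "j < n" for j
  proof -
    have "(\<Sum>i<m. X' i j) \<le> (\<Sum>i<m. 2 * K)"
      using ip(4) Y'_lt that by (intro sum_mono) (force simp: X'_def)
    then have "K * int (dem j) \<le> K * (2 * int m)" using X'_sum[OF that] by (simp add: mult.commute mult.left_commute)
    then have "int (dem j) \<le> 2 * int m" using K_pos by (simp add: mult_le_cancel_left)
    then show ?thesis by simp
  qed
  \<comment> \<open>The tokens of the clients at a site are nested initial segments, so all tokens
    in use there are among the first \<open>Y'\<close> ones. The facility cost of the clusters can
    therefore be charged to \<open>Y'\<close>.\<close>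
  define own0 where "own0 j = {t. t < m * cap \<and> int (t mod cap) < X' (t div cap) j}" for j
  have own_sum: "(\<Sum>t\<in>own0 j. g (t div cap)) = (\<Sum>i<m. X' i j * g i)" if "j < n" for j and g :: "nat \<Rightarrow> int"
    unfolding own0_def using ip(3,4) Y'_lt that Kcap
    by (intro sum_over_tokens) (force simp: X'_def)
  interpret tp: token_program m n f d own0 dem h cap
  proof unfold_locales
    fix j
    assume j: "j < n"
    have "int (card (own0 j)) = (\<Sum>i<m. X' i j)" using own_sum[OF j, of "\<lambda>_. 1"] by simp
    then have "int (2 * h * dem j) \<le> int (card (own0 j))" using X'_sum[OF j] by (simp add: Kh)
    then show "2 * h * dem j \<le> card (own0 j)" by (simp only: of_nat_le_iff)
  qed (auto simp: h_def cap_def own0_def)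
  have f2: "\<sigma>2 b = \<sigma>1 b" if "b \<notin> {10, 11, 35, 50, 51, 53, 54}" for b using that by (rule bulk(5))
  have base2: "costs_in \<sigma>2" using base1 costs_in_cong[of \<sigma>2 \<sigma>1] f2 by simp
  have own2: "tp.owns \<sigma>2 own0"
    unfolding tp.owns_def
  proof (intro allI impI conjI)
    fix j t
    assume jt: "j < n" "t < m * cap"
    then show "\<sigma>2 54 (int (j * (m * cap) + t)) = of_bool (t \<in> own0 j)"
      using bulk(4)[OF jt] by (simp add: own0_def X'_def X_def B_def)
  qed (auto simp: own0_def)
  define \<sigma>3 where "\<sigma>3 = sem round_prog \<sigma>2"
  have z2: "\<sigma>2 b = (\<lambda>_. 0)" if "b \<in> {55, 56, 57}" for b
    using that zero f2 f1 by (auto simp: writes_mw_prog)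
  obtain own rem cl cs J Ra rad where rep: "tp.represents \<sigma>3 own rem cl cs J"
    and rinv: "tp.round_inv own rem cl cs J Ra rad" and rem0: "\<And>j. j < n \<Longrightarrow> rem j = 0"
    and used: "\<And>t. t < m * cap \<Longrightarrow> cl t \<noteq> 0 \<Longrightarrow> \<exists>j<n. t \<in> own0 j"
  proof -
    have "\<exists>own rem cl cs J R rad. tp.represents \<sigma>3 own rem cl cs J \<and> tp.round_inv own rem cl cs J R rad \<and>
      (\<forall>j<n. rem j = 0) \<and> (\<forall>t<m * cap. cl t \<noteq> 0 \<longrightarrow> (\<exists>j<n. t \<in> own0 j))"
      unfolding \<sigma>3_def using base2 own2 dem(1) z2 dem_le by (intro tp.sem_round_prog) auto
    then show thesis using that by blast
  qed
  have Jj: "J j \<subseteq> tp.clusters cl" "finite (J j)" "card (J j) = dem j" if "j < n" for j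
    using rinv that rem0[OF that] by (auto simp: tp.round_inv_def)
  have cs_m: "cs c < m" if "c \<in> tp.clusters cl" for c using rinv that by (rule tp.round_inv_site)
  define x3 where "x3 i j = \<sigma>3 56 (int (i * n + j))" for i j
  define y3 where "y3 i = \<sigma>3 55 (int i)" for i
  have x3: "x3 i j = int (card {c \<in> J j. cs c = i})" if "i < m" "j < n" for i j
    using rep that by (simp add: tp.represents_def x3_def)
  have y3: "y3 i = int (card {c \<in> tp.clusters cl. cs c = i})" if "i < m" for i
    using rep that by (simp add: tp.represents_def y3_def)
  define xs where "xs i j = real_of_int (X' i j) / real_of_int K" for i j
  define ys where "ys i = real_of_int (Y' i) / real_of_int K" for i
  have lp': "frac_feasible (\<lambda>j. real_of_int (int (dem j))) xs ys"
    unfolding frac_feasible_def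
  proof (intro conjI allI impI)
    fix i
    assume i: "i < m"
    have "0 \<le> Y' i" using Y'_nn[OF i] by (simp add: Y'_def)
    then show "0 \<le> ys i" using K_pos by (simp add: ys_def)
    fix j
    assume j: "j < n"
    have "0 \<le> X' i j" using ip(3)[OF i j] by (simp add: X'_def)
    then show "0 \<le> xs i j" using K_pos by (simp add: xs_def)
    have "X' i j \<le> Y' i" using ip(4)[OF i j] by (simp add: X'_def Y'_def)
    then show "xs i j \<le> ys i" unfolding xs_def ys_def
      using K_pos by (intro divide_right_mono) simp_all
  next
    fix j
    assume j: "j < n"
    have "real_of_int (K * int (dem j)) \<le> real_of_int (\<Sum>i<m. X' i j)"
      using X'_sum[OF j] by (simp only: of_int_le_iff)
    then show "real_of_int (int (dem j)) \<le> (\<Sum>i<m. xs i j)"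
      using K_pos by (simp add: xs_def sum_divide_distrib[symmetric] le_divide_eq mult.commute)
  qed
  interpret au: augmentation m n f d "\<lambda>j. int (dem j)" xs ys
    by unfold_locales (rule lp')
  have sol3: "au.int_solution x3 y3"
    unfolding au.int_solution_def
  proof (intro conjI allI impI)
    fix i
    assume i: "i < m"
    show "0 \<le> y3 i" using y3[OF i] by simp
    fix j
    assume j: "j < n"
    show "0 \<le> x3 i j" using x3[OF i j] by simp
    have "card {c \<in> J j. cs c = i} \<le> card {c \<in> tp.clusters cl. cs c = i}"
      using Jj(1)[OF j] tp.finite_clusters by (intro card_mono) auto
    then show "x3 i j \<le> y3 i" using x3[OF i j] y3[OF i] by simp
  next
    fix j
    assume j: "j < n"
    have "(\<Sum>i<m. x3 i j) = (\<Sum>i<m. 1 * int (card {c \<in> J j. cs c = i}))" using x3 j by simp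
    also have "\<dots> = (\<Sum>c\<in>J j. 1)"
      using Jj[OF j] cs_m by (intro sum_over_fibers) auto
    finally show "(\<Sum>i<m. x3 i j) = int (dem j)" using Jj(3)[OF j] by simp
  qed
  have open3: "int h * au.int_open y3 \<le> (\<Sum>i<m. f i * Y' i)"
  proof -
    have "au.int_open y3 = (\<Sum>i<m. f i * int (card {c \<in> tp.clusters cl. cs c = i}))"
      using y3 by (simp add: au.int_open_def)
    also have "\<dots> = (\<Sum>c\<in>tp.clusters cl. f (cs c))"
      using tp.finite_clusters cs_m by (intro sum_over_fibers) auto
    finally have "int h * au.int_open y3 \<le> (\<Sum>t\<in>{t \<in> {..<m * cap}. cl t \<noteq> 0}. f (t div cap))"
      using tp.round_final(1)[OF rinv rem0] by simp
    also have "\<dots> \<le> (\<Sum>t\<in>{t. t < m * cap \<and> int (t mod cap) < Y' (t div cap)}. f (t div cap))"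
    proof (rule sum_mono2)
      show "{t \<in> {..<m * cap}. cl t \<noteq> 0} \<subseteq> {t. t < m * cap \<and> int (t mod cap) < Y' (t div cap)}"
      proof
        fix t
        assume t: "t \<in> {t \<in> {..<m * cap}. cl t \<noteq> 0}"
        then obtain j where j: "j < n" "t \<in> own0 j" using used[of t] by auto
        have "t div cap < m" using t by (simp add: less_mult_imp_div_less)
        then have "X' (t div cap) j \<le> Y' (t div cap)" using ip(4) j by (simp add: X'_def Y'_def)
        then show "t \<in> {t. t < m * cap \<and> int (t mod cap) < Y' (t div cap)}"
          using j t by (auto simp: own0_def)
      qed
      show "0 \<le> f (t div cap)"
        if "t \<in> {t. t < m * cap \<and> int (t mod cap) < Y' (t div cap)} - {t \<in> {..<m * cap}. cl t \<noteq> 0}" for t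
        using that by (intro f_nonneg) (auto simp: less_mult_imp_div_less)
    qed simp
    also have "\<dots> = (\<Sum>i<m. Y' i * f i)"
      using Y'_nn Y'_lt Kcap by (intro sum_over_tokens) (force simp: Y'_def)
    finally show ?thesis by (simp add: mult.commute)
  qed
  have conn3: "int h * au.int_conn x3 \<le> 3 * (\<Sum>j<n. \<Sum>i<m. d i j * X' i j)"
  proof -
    have "au.int_conn x3 = (\<Sum>j<n. \<Sum>c\<in>J j. d (cs c) j)"
      unfolding au.int_conn_def
    proof (rule sum.cong)
      fix j
      assume "j \<in> {..<n}"
      then have j: "j < n" by simp
      have "(\<Sum>i<m. d i j * x3 i j) = (\<Sum>i<m. d i j * int (card {c \<in> J j. cs c = i}))" using x3 j by simp
      also have "\<dots> = (\<Sum>c\<in>J j. d (cs c) j)"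
        using Jj[OF j] cs_m by (intro sum_over_fibers) auto
      finally show "(\<Sum>i<m. d i j * x3 i j) = (\<Sum>c\<in>J j. d (cs c) j)" .
    qed simp
    then have "int h * au.int_conn x3 = (\<Sum>j<n. int h * (\<Sum>c\<in>J j. d (cs c) j))" by (simp add: sum_distrib_left)
    also have "\<dots> \<le> (\<Sum>j<n. 3 * (\<Sum>t\<in>own0 j. d (t div cap) j))"
      using tp.round_final(2)[OF rinv rem0] by (intro sum_mono) simp
    also have "\<dots> = (\<Sum>j<n. 3 * (\<Sum>i<m. d i j * X' i j))"
    proof (rule sum.cong)
      fix j
      assume "j \<in> {..<n}"
      then show "3 * (\<Sum>t\<in>own0 j. d (t div cap) j) = 3 * (\<Sum>i<m. d i j * X' i j)"
        using own_sum[of j "\<lambda>i. d i j"] by (simp add: mult.commute)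
    qed simp
    also have "\<dots> = 3 * (\<Sum>j<n. \<Sum>i<m. d i j * X' i j)" by (simp only: sum_distrib_left)
    finally show ?thesis .
  qed
  define FY where "FY = (\<Sum>i<m. real_of_int (f i) * real_of_int (Y' i))"
  define DX where "DX = (\<Sum>i<m. \<Sum>j<n. real_of_int (d i j) * real_of_int (X' i j))"
  have op_ys: "open_part ys = FY / real_of_int K"
    by (simp add: open_part_def ys_def FY_def sum_divide_distrib)
  have cp_xs: "conn_part xs = DX / real_of_int K"
    by (simp add: conn_part_def xs_def DX_def sum_divide_distrib)
  \<comment> \<open>\<open>K = 2 * h\<close> turns the charges per \<open>h\<close> tokens into the
    factors 2 and 6.\<close>
  have hK: "real_of_int K = 2 * real h" and h_real: "0 < real h" using Kh h_pos by simp_all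
  have "real_of_int (int h * au.int_open y3) \<le> real_of_int (\<Sum>i<m. f i * Y' i)"
    using open3 by (simp only: of_int_le_iff)
  then have "real h * real_of_int (au.int_open y3) \<le> FY" by (simp add: FY_def)
  then have o3: "real_of_int (au.int_open y3) \<le> 2 * open_part ys"
    unfolding op_ys hK using h_real by (simp add: field_simps)
  have "real_of_int (int h * au.int_conn x3) \<le> real_of_int (3 * (\<Sum>j<n. \<Sum>i<m. d i j * X' i j))"
    using conn3 by (simp only: of_int_le_iff)
  moreover have "real_of_int (\<Sum>j<n. \<Sum>i<m. d i j * X' i j) = DX"
    unfolding DX_def by (subst sum.swap) simp
  ultimately have "real h * real_of_int (au.int_conn x3) \<le> 3 * DX" by simp
  then have c3: "real_of_int (au.int_conn x3) \<le> 6 * conn_part xs"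
    unfolding cp_xs hK using h_real by (simp add: field_simps)
  have f3: "\<sigma>3 b = \<sigma>2 b" if "b \<notin> writes round_prog" for b
    unfolding \<sigma>3_def using that by (rule sem_frame)
  have base3: "costs_in \<sigma>3" using base2 costs_in_cong[of \<sigma>3 \<sigma>2] f3 by (simp add: writes_round_prog)
  define \<sigma>4 where "\<sigma>4 = sem aug_prog \<sigma>3"
  define x4 where "x4 i j = \<sigma>4 56 (int (i * n + j))" for i j
  define y4 where "y4 i = \<sigma>4 55 (int i)" for i
  have ainv: "au.aug_inv (\<lambda>i j. \<sigma>3 56 (int (i * n + j))) (\<lambda>i. \<sigma>3 55 (int i))"
    using au.aug_init[OF sol3 o3 c3] unfolding x3_def y3_def .
  have dem_le': "int (dem j) \<le> 2 * int m" if "j < n" for j using dem_le[OF that] by simp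
  have sol4: "au.int_solution x4 y4"
    and cost4: "real_of_int (au.int_open y4) + real_of_int (au.int_conn x4) \<le> 2.96 * (open_part ys + conn_part xs)"
    using au.sem_aug_prog[OF base3 ainv dem_le'] unfolding \<sigma>4_def x4_def y4_def by blast+
  have f4: "\<sigma>4 b = \<sigma>3 b" if "b \<notin> writes aug_prog" for b
    unfolding \<sigma>4_def using that by (rule sem_frame)
  have AB4: "\<sigma>4 50 = \<sigma>2 50" "\<sigma>4 51 = \<sigma>2 51" using f4 f3 by (simp_all add: writes_aug_prog writes_round_prog)
  have base4: "costs_in \<sigma>4" using base3 costs_in_cong[of \<sigma>4 \<sigma>3] f4 by (simp add: writes_aug_prog)
  have out: "sem rest_prog \<sigma> = sem out_prog \<sigma>4"
    by (simp add: rest_prog_def \<sigma>1_def \<sigma>2_def \<sigma>3_def \<sigma>4_def)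
  have \<sigma>40: "\<sigma>4 0 0 = int m" "\<sigma>4 0 1 = int n" using base4 by (simp_all add: costs_in_def)
  have Yo: "Yo i = A i + y4 i" if "i < m" for i
    using sem_out_prog(1)[of \<sigma>4 m n, OF \<sigma>40 that] by (simp add: Yo_def out A_def y4_def AB4)
  have Xo: "Xo i j = B i j + x4 i j" if "i < m" "j < n" for i j
    using sem_out_prog(2)[of \<sigma>4 m n, OF \<sigma>40 index_less[OF that]] unfolding Xo_def out B_def x4_def AB4 .
  have s4: "0 \<le> y4 i" "0 \<le> x4 i j" "x4 i j \<le> y4 i" if "i < m" "j < n" for i j
    using sol4 that by (simp_all add: au.int_solution_def)
  show "0 \<le> Yo i" if "i < m" for i
    using Yo[OF that] A_nn[OF that] sol4 that by (simp add: au.int_solution_def)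
  show "0 \<le> Xo i j \<and> Xo i j \<le> Yo i" if "i < m" "j < n" for i j
    using Yo[OF that(1)] Xo[OF that] ip(1,2)[OF that] s4[OF that] by simp
  show "r j \<le> (\<Sum>i<m. Xo i j)" if "j < n" for j
  proof -
    have "(\<Sum>i<m. Xo i j) = (\<Sum>i<m. B i j) + (\<Sum>i<m. x4 i j)"
      using Xo that by (simp add: sum.distrib)
    also have "(\<Sum>i<m. x4 i j) = int (dem j)" using sol4 that by (simp add: au.int_solution_def)
    finally show ?thesis using dem(2)[OF that] by simp
  qed
  define FA where "FA = (\<Sum>i<m. real_of_int (f i) * real_of_int (A i))"
  define DB where "DB = (\<Sum>i<m. \<Sum>j<n. real_of_int (d i j) * real_of_int (B i j))"
  have nn: "0 \<le> FA" "0 \<le> DB"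
    unfolding FA_def DB_def using A_nn ip(1) f_nonneg d_nonneg by (auto intro!: sum_nonneg mult_nonneg_nonneg)
  have io: "real_of_int (au.int_open y4) = open_part (\<lambda>i. real_of_int (y4 i))"
    by (simp add: au.int_open_def open_part_def)
  have ic: "real_of_int (au.int_conn x4) = conn_part (\<lambda>i j. real_of_int (x4 i j))"
    unfolding au.int_conn_def conn_part_def by (subst sum.swap) simp
  have oY: "open_part (\<lambda>i. real_of_int (Yo i)) = FA + open_part (\<lambda>i. real_of_int (y4 i))"
    unfolding open_part_def FA_def sum.distrib[symmetric] by (intro sum.cong) (simp_all add: Yo algebra_simps)
  have cX: "conn_part (\<lambda>i j. real_of_int (Xo i j)) = DB + conn_part (\<lambda>i j. real_of_int (x4 i j))"
    unfolding conn_part_def DB_def sum.distrib[symmetric] by (intro sum.cong) (simp_all add: Xo algebra_simps)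
  have oY1: "open_part (\<lambda>i. real_of_int (Y i)) = FY + real_of_int K * FA"
    unfolding open_part_def FY_def FA_def sum_distrib_left sum.distrib[symmetric]
    by (intro sum.cong) (simp_all add: Y'_def algebra_simps)
  have cX1: "conn_part (\<lambda>i j. real_of_int (X i j)) = DX + real_of_int K * DB"
    unfolding conn_part_def DX_def DB_def sum_distrib_left sum.distrib[symmetric]
    by (intro sum.cong) (simp_all add: X'_def algebra_simps)
  have KR: "0 < real_of_int K" using K_pos by simp
  have "FY + real_of_int K * FA + (DX + real_of_int K * DB) \<le> 1.0112 * real_of_int K * LP"
    using cost1 unfolding oY1 cX1 .
  then have "(FY + real_of_int K * FA + (DX + real_of_int K * DB)) / real_of_int K \<le> 1.0112 * LP"
    using KR by (simp add: divide_le_eq mult.commute mult.left_commute)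
  then have total: "FY / real_of_int K + DX / real_of_int K + FA + DB \<le> 1.0112 * LP"
    using KR by (simp add: add_divide_distrib)
  have "open_part (\<lambda>i. real_of_int (Yo i)) + conn_part (\<lambda>i j. real_of_int (Xo i j))
      \<le> FA + DB + 2.96 * (FY / real_of_int K + DX / real_of_int K)"
    using cost4 unfolding oY cX io ic op_ys cp_xs by linarith
  also have "\<dots> \<le> 3 * LP"
  proof -
    \<comment> \<open>The integral part \<open>FA + DB\<close> is paid once and only the residual
      \<open>G\<close> with the factor 2.96, so the total is at most
      \<open>2.96 * 1.0112 * LP\<close>, which is below \<open>2.994 * LP\<close> unless
      \<open>LP\<close> is 0.\<close>
    define G where "G = FY / real_of_int K + DX / real_of_int K"
    have "10000 * (G + FA + DB) \<le> 10112 * LP" using total by (simp add: G_def)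
    then have "100 * (FA + DB) + 296 * G \<le> 300 * LP" using nn LP by simp
    then show ?thesis unfolding G_def[symmetric] by simp
  qed
  finally show "open_part (\<lambda>i. real_of_int (Yo i)) + conn_part (\<lambda>i j. real_of_int (Xo i j))
       \<le> 3 * (open_part y + conn_part x)" unfolding LP_def .
qed

end

section \<open>Input tables, scaling and the final bound\<close>

lemma length_concat_rows: "length (concat (map (\<lambda>i. map (g i) [0..<n]) [0..<m])) = m * n"
  by (simp add: length_concat comp_def sum_list_triv)

lemma nth_concat_rows:
  "i < m \<Longrightarrow> j < n \<Longrightarrow> concat (map (\<lambda>i. map (g i) [0..<n]) [0..<m]) ! (i * n + j) = g i j"
proof (induction m)
  case (Suc m)
  have app: "concat (map (\<lambda>i. map (g i) [0..<n]) [0..<Suc m]) =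
      concat (map (\<lambda>i. map (g i) [0..<n]) [0..<m]) @ map (g m) [0..<n]" by simp
  show ?case
  proof (cases "i = m")
    case True
    then show ?thesis unfolding app nth_append length_concat_rows using Suc.prems by simp
  next
    case False
    then have "i * n + j < m * n" using Suc.prems by (intro index_less) auto
    then show ?thesis unfolding app nth_append length_concat_rows using Suc False by simp
  qed
qed simp

lemma input_memory_values:
  fixes I :: ftfp
  defines "m \<equiv> nsites I" and "n \<equiv> nclients I"
  shows "input_memory I 0 0 = int m" "input_memory I 0 1 = int n"
    "i < m \<Longrightarrow> input_memory I 1 (int i) = fst (quotient_of (open_cost I i))"
    "i < m \<Longrightarrow> input_memory I 2 (int i) = snd (quotient_of (open_cost I i))"
    "i < m \<Longrightarrow> j < n \<Longrightarrow> input_memory I 3 (int (i * n + j)) = fst (quotient_of (conn_cost I i j))"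
    "i < m \<Longrightarrow> j < n \<Longrightarrow> input_memory I 4 (int (i * n + j)) = snd (quotient_of (conn_cost I i j))"
    "j < n \<Longrightarrow> input_memory I 5 (int j) = int (demand I j)"
    "6 \<le> b \<Longrightarrow> input_memory I b = (\<lambda>_. 0)"
proof -
  have len: "length (input_tables I) = 6" by (simp add: input_tables_def Let_def)
  have tabs: "input_tables I ! 0 = [int m, int n]"
    "input_tables I ! 1 = map (\<lambda>i. fst (quotient_of (open_cost I i))) [0..<m]"
    "input_tables I ! 2 = map (\<lambda>i. snd (quotient_of (open_cost I i))) [0..<m]"
    "input_tables I ! 3 = map (\<lambda>d. fst (quotient_of d)) (concat (map (\<lambda>i. map (conn_cost I i) [0..<n]) [0..<m]))"
    "input_tables I ! 4 = map (\<lambda>d. snd (quotient_of d)) (concat (map (\<lambda>i. map (conn_cost I i) [0..<n]) [0..<m]))"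
    "input_tables I ! 5 = map (\<lambda>j. int (demand I j)) [0..<n]"
    by (simp_all add: input_tables_def Let_def m_def n_def numeral_eq_Suc)
  have mem: "input_memory I a (int k) = input_tables I ! a ! k"
    if "a < 6" "k < length (input_tables I ! a)" for a k
    using that by (simp add: input_memory_def len)
  show "input_memory I 0 0 = int m" using mem[of 0 0] by (simp add: tabs)
  show "input_memory I 0 1 = int n" using mem[of 0 1] by (simp add: tabs)
  show "i < m \<Longrightarrow> input_memory I 1 (int i) = fst (quotient_of (open_cost I i))" by (subst mem) (simp_all add: tabs del: One_nat_def)
  show "i < m \<Longrightarrow> input_memory I 2 (int i) = snd (quotient_of (open_cost I i))" by (subst mem) (simp_all add: tabs)
  show "input_memory I 3 (int (i * n + j)) = fst (quotient_of (conn_cost I i j))" if "i < m" "j < n"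
    using index_less[OF that] nth_concat_rows[OF that, of "conn_cost I"] that
    by (subst mem) (simp_all add: tabs length_concat_rows)
  show "input_memory I 4 (int (i * n + j)) = snd (quotient_of (conn_cost I i j))" if "i < m" "j < n"
    using index_less[OF that] nth_concat_rows[OF that, of "conn_cost I"] that
    by (subst mem) (simp_all add: tabs length_concat_rows)
  show "j < n \<Longrightarrow> input_memory I 5 (int j) = int (demand I j)" by (subst mem) (simp_all add: tabs)
  show "6 \<le> b \<Longrightarrow> input_memory I b = (\<lambda>_. 0)" by (simp add: input_memory_def len fun_eq_iff)
qed

lemma of_rat_scaled:
  assumes "snd (quotient_of q) dvd L"
  shows "real_of_int (fst (quotient_of q) * (L div snd (quotient_of q))) = real_of_int L * of_rat q"
proof -
  obtain a b where ab: "quotient_of q = (a, b)" by (cases "quotient_of q")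
  have b: "0 < b" using quotient_of_denom_pos[OF ab] .
  have q: "(of_rat q :: real) = of_int a / of_int b"
    using quotient_of_div[OF ab] by (simp add: of_rat_divide)
  obtain c where "L = b * c" using assms by (auto simp: ab elim: dvdE)
  then show ?thesis using b by (simp add: ab q)
qed

text \<open>Scaling all costs by the common denominator \<open>L\<close> multiplies the cost of the
  output and that of every fractional solution alike, so the factor 3 carries over.\<close>

theorem main_prog_correct:
  assumes I: "ftfp_instance I"
  defines "\<sigma> \<equiv> sem main_prog (input_memory I)"
  shows "int_feasible I (output_x I \<sigma>) (output_y I \<sigma>)"
    and "lp_feasible I x y \<Longrightarrow> cost I (output_x I \<sigma>) (output_y I \<sigma>) \<le> 3 * cost I x y"
proof -
  define m n where "m = nsites I" and "n = nclients I"
  define \<sigma>0 where "\<sigma>0 = input_memory I"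
  define \<sigma>1 where "\<sigma>1 = sem prep_prog \<sigma>0"
  note inp = input_memory_values[where I = I, folded m_def n_def \<sigma>0_def]
  define L where "L = (\<Prod>i<m. \<sigma>0 2 (int i)) * (\<Prod>k<m * n. \<sigma>0 4 (int k))"
  define R where "R = (\<Prod>j<n. \<sigma>0 5 (int j))"
  note prep = sem_prep_prog[of \<sigma>0 m n, OF inp(1,2), folded \<sigma>1_def L_def R_def]
  define r where "r j = int (demand I j)" for j
  have r: "1 \<le> r j" if "j < n" for j using I that by (simp add: ftfp_instance_def r_def n_def)
  have snd_pos: "0 < snd (quotient_of q)" for q
    using quotient_of_denom_pos[of q] by (cases "quotient_of q") auto
  have den2: "0 < \<sigma>0 2 (int i)" if "i < m" for i using inp(4)[OF that] snd_pos by simp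
  have den4: "0 < \<sigma>0 4 (int k)" if k: "k < m * n" for k
  proof -
    obtain i j where "i < m" "j < n" "k = i * n + j" using k by (rule index_split)
    then show ?thesis using inp(6) snd_pos by simp
  qed
  have L_pos: "0 < L" unfolding L_def using den2 den4 by (intro mult_pos_pos prod_pos) auto
  have dvd2: "\<sigma>0 2 (int i) dvd L" if "i < m" for i
    unfolding L_def using that by (intro dvd_mult2 dvd_prodI) auto
  have dvd4: "\<sigma>0 4 (int k) dvd L" if "k < m * n" for k
    unfolding L_def using that by (intro dvd_mult dvd_prodI) auto
  define f where "f i = \<sigma>1 22 (int i)" for i
  define d where "d i j = \<sigma>1 23 (int (i * n + j))" for i j
  have f_real: "real_of_int (f i) = real_of_int L * of_rat (open_cost I i)" if "i < m" for i
    using of_rat_scaled[of "open_cost I i" L] dvd2[OF that] prep(1)[OF that] inp(3,4)[OF that] by (simp add: f_def)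
  have d_real: "real_of_int (d i j) = real_of_int L * of_rat (conn_cost I i j)" if "i < m" "j < n" for i j
    using of_rat_scaled[of "conn_cost I i j" L] dvd4[OF index_less[OF that]] prep(2)[OF index_less[OF that]]
      inp(5,6)[OF that] by (simp only: d_def)
  have LR: "0 < real_of_int L" using L_pos by simp
  have "\<exists>D :: nat + nat \<Rightarrow> nat + nat \<Rightarrow> real.
      (\<forall>u\<in>{..<m} <+> {..<n}. \<forall>v\<in>{..<m} <+> {..<n}. 0 \<le> D u v \<and> D u v = D v u) \<and>
      (\<forall>u\<in>{..<m} <+> {..<n}. \<forall>v\<in>{..<m} <+> {..<n}. \<forall>w\<in>{..<m} <+> {..<n}. D u w \<le> D u v + D v w) \<and>
      (\<forall>i<m. \<forall>j<n. D (Inl i) (Inr j) = of_rat (conn_cost I i j))"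
  proof -
    have "metric_costs I" using I by (simp add: ftfp_instance_def)
    then show ?thesis
      unfolding metric_costs_def Let_def m_def[symmetric] n_def[symmetric] by (elim exE conjE) (intro exI conjI)
  qed
  then obtain D :: "nat + nat \<Rightarrow> nat + nat \<Rightarrow> real" where
    Dnn: "\<forall>u\<in>{..<m} <+> {..<n}. \<forall>v\<in>{..<m} <+> {..<n}. 0 \<le> D u v \<and> D u v = D v u" and
    Dtri: "\<forall>u\<in>{..<m} <+> {..<n}. \<forall>v\<in>{..<m} <+> {..<n}. \<forall>w\<in>{..<m} <+> {..<n}. D u w \<le> D u v + D v w" and
    Deq: "\<forall>i<m. \<forall>j<n. D (Inl i) (Inr j) = of_rat (conn_cost I i j)"
    by (elim exE conjE)
  have mI: "Inl i \<in> {..<m} <+> {..<n}" if "i < m" for i using that by auto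
  have mR: "Inr j \<in> {..<m} <+> {..<n}" if "j < n" for j using that by auto
  interpret ftfp_costs m n f d
  proof
    fix i
    assume i: "i < m"
    have "0 \<le> (of_rat (open_cost I i) :: real)" using I i by (simp add: ftfp_instance_def m_def)
    then have "0 \<le> real_of_int (f i)" using f_real[OF i] LR by simp
    then show "0 \<le> f i" by simp
  next
    fix i j
    assume ij: "i < m" "j < n"
    have "0 \<le> (of_rat (conn_cost I i j) :: real)" using I ij by (simp add: ftfp_instance_def m_def n_def)
    then have "0 \<le> real_of_int (d i j)" using d_real[OF ij] LR by simp
    then show "0 \<le> d i j" by simp
  next
    fix i i' j k
    assume a: "i < m" "i' < m" "j < n" "k < n"
    \<comment> \<open>Two triangles: the first passes through the client \<open>k\<close>, the
      second through the site \<open>i'\<close>.\<close>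
    have "D (Inl i) (Inr j) \<le> D (Inl i) (Inr k) + (D (Inr k) (Inl i') + D (Inl i') (Inr j))"
      using Dtri[rule_format, OF mI[OF a(1)] mR[OF a(4)] mR[OF a(3)]]
        Dtri[rule_format, OF mR[OF a(4)] mI[OF a(2)] mR[OF a(3)]] by linarith
    moreover have "D (Inr k) (Inl i') = D (Inl i') (Inr k)"
      using Dnn[rule_format, OF mR[OF a(4)] mI[OF a(2)]] by simp
    ultimately have "(of_rat (conn_cost I i j) :: real)
        \<le> of_rat (conn_cost I i' j) + of_rat (conn_cost I i' k) + of_rat (conn_cost I i k)"
      using Deq a by simp
    then have "real_of_int L * of_rat (conn_cost I i j)
        \<le> real_of_int L * (of_rat (conn_cost I i' j) + of_rat (conn_cost I i' k) + of_rat (conn_cost I i k))"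
      using LR by (intro mult_left_mono) auto
    then have "real_of_int (d i j) \<le> real_of_int (d i' j + d i' k + d i k)"
      using d_real a by (simp add: distrib_left)
    then show "d i j \<le> d i' j + d i' k + d i k" by (simp only: of_int_le_iff)
  qed
  have f1: "\<sigma>1 b = \<sigma>0 b" if "b \<notin> {10, 20, 21, 22, 23, 24, 30}" for b using that by (rule prep(6))
  have base: "costs_in \<sigma>1" using f1 inp(1,2) by (simp add: costs_in_def f_def d_def)
  have r5: "\<sigma>1 5 (int j) = r j" if "j < n" for j using f1 inp(7)[OF that] by (simp add: r_def)
  have R_pos: "0 < R" unfolding R_def
  proof (rule prod_pos)
    fix j
    assume "j \<in> {..<n}"
    then show "0 < \<sigma>0 5 (int j)" using inp(7)[of j] r[of j] by (simp add: r_def)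
  qed
  have q: "\<sigma>1 24 (int j) * r j = R" if "j < n" for j
  proof -
    have "r j dvd R" unfolding R_def using inp(7)[OF that] that
      by (metis r_def dvd_prodI finite_lessThan lessThan_iff)
    then show ?thesis using prep(4)[OF that] inp(7)[OF that] by (simp add: r_def)
  qed
  have zero: "\<sigma>1 b = (\<lambda>_. 0)" if "b \<in> {31, 32, 33, 55, 56, 57}" for b
    using that f1[of b] inp(8)[of b] by auto
  have pq: "\<sigma>1 30 (int j) = \<sigma>1 24 (int j)" if "j < n" for j using prep(4,5)[OF that] by simp
  have \<sigma>: "\<sigma> = sem rest_prog \<sigma>1"
    by (simp add: \<sigma>_def main_prog_def rest_prog_def \<sigma>1_def \<sigma>0_def)
  have ff: "frac_feasible (\<lambda>j. real_of_int (r j)) x y \<longleftrightarrow> lp_feasible I x y" for x y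
    unfolding frac_feasible_def lp_feasible_def m_def[symmetric] n_def[symmetric] by (simp add: r_def)
  have cost: "open_part y + conn_part x = real_of_int L * cost I x y" for x y
  proof -
    have "open_part y = real_of_int L * (\<Sum>i<m. of_rat (open_cost I i) * y i)"
      unfolding open_part_def sum_distrib_left by (intro sum.cong) (simp_all add: f_real)
    moreover have "conn_part x = real_of_int L * (\<Sum>i<m. \<Sum>j<n. of_rat (conn_cost I i j) * x i j)"
      unfolding conn_part_def sum_distrib_left by (intro sum.cong refl) (simp add: d_real)
    ultimately show ?thesis by (simp add: cost_def m_def n_def distrib_left)
  qed
  note rest = sem_rest_prog[OF base r5 r prep(3) q R_pos pq zero, folded \<sigma>]
  \<comment> \<open>Feasibility of the output is proved relative to a fractional solution, so one
    has to be exhibited: every site offers the sum of all demands to every client. If there is a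
    client, there is also a site.\<close>
  have exists: "\<exists>x y. frac_feasible (\<lambda>j. real_of_int (r j)) x y"
  proof -
    define s where "s = (\<Sum>j<n. real_of_int (r j))"
    have rs: "real_of_int (r j) \<le> s" if "j < n" for j
      unfolding s_def using that r by (intro member_le_sum) (auto intro: order.trans[of 0 1])
    have s0: "0 \<le> s" unfolding s_def using r by (intro sum_nonneg) (auto intro: order.trans[of 0 1])
    have "real_of_int (r j) \<le> (\<Sum>i<m. s)" if "j < n" for j
    proof -
      have "0 < m" using I that by (auto simp: ftfp_instance_def m_def n_def)
      then have "1 * s \<le> real m * s" using s0 by (intro mult_right_mono) auto
      then show ?thesis using rs[OF that] by simp
    qed
    then have "frac_feasible (\<lambda>j. real_of_int (r j)) (\<lambda>_ _. s) (\<lambda>_. s)"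
      using s0 by (simp add: frac_feasible_def)
    then show ?thesis by blast
  qed
  have out: "output_x I \<sigma> = (\<lambda>i j. real_of_int (\<sigma> 7 (int (i * n + j))))"
    "output_y I \<sigma> = (\<lambda>i. real_of_int (\<sigma> 6 (int i)))"
    by (simp_all add: output_x_def output_y_def n_def fun_eq_iff)
  show "int_feasible I (output_x I \<sigma>) (output_y I \<sigma>)"
  proof -
    obtain x y where xy: "frac_feasible (\<lambda>j. real_of_int (r j)) x y" using exists by blast
    have Yn: "0 \<le> \<sigma> 6 (int i)" if "i < m" for i using rest(1)[OF _ _ _ _ _ xy] that by blast
    have Xn: "0 \<le> \<sigma> 7 (int (i * n + j)) \<and> \<sigma> 7 (int (i * n + j)) \<le> \<sigma> 6 (int i)" if "i < m" "j < n" for i j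
      using rest(2)[OF _ _ _ _ _ xy] that by blast
    have Dm: "r j \<le> (\<Sum>i<m. \<sigma> 7 (int (i * n + j)))" if "j < n" for j
      using rest(3)[OF _ _ _ _ _ xy] that by blast
    have nats: "real_of_int z \<in> \<nat>" if "0 \<le> z" for z using that by (metis of_int_of_nat_eq of_nat_in_Nats zero_le_imp_eq_int)
    have "real (demand I j) \<le> (\<Sum>i<m. real_of_int (\<sigma> 7 (int (i * n + j))))" if "j < n" for j
    proof -
      have "real_of_int (r j) \<le> real_of_int (\<Sum>i<m. \<sigma> 7 (int (i * n + j)))"
        using Dm[OF that] by (simp only: of_int_le_iff)
      then show ?thesis by (simp add: r_def)
    qed
    then show ?thesis
      unfolding int_feasible_def lp_feasible_def out m_def[symmetric] n_def[symmetric]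
      using Yn Xn nats by simp
  qed
  show "cost I (output_x I \<sigma>) (output_y I \<sigma>) \<le> 3 * cost I x y" if "lp_feasible I x y"
  proof -
    have xy: "frac_feasible (\<lambda>j. real_of_int (r j)) x y" using that by (simp add: ff)
    have "real_of_int L * cost I (output_x I \<sigma>) (output_y I \<sigma>) \<le> 3 * (real_of_int L * cost I x y)"
      unfolding cost[symmetric] out using rest(4)[OF _ _ _ _ _ xy] by blast
    then have "real_of_int L * cost I (output_x I \<sigma>) (output_y I \<sigma>) \<le> real_of_int L * (3 * cost I x y)"
      by (simp only: mult.left_commute)
    then show ?thesis using LR by (simp only: mult_le_cancel_left_pos)
  qed
qed

theorem theorem8:
  shows "\<exists>(P :: prog) (p :: nat poly). \<forall>I. ftfp_instance I \<longrightarrow>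
    (let T = poly p (input_size I); \<mu> = final_memory P (input_memory I) T in
       halts_within P (input_memory I) T \<and>
       (\<forall>\<sigma> \<in> set_pmf \<mu>. int_feasible I (output_x I \<sigma>) (output_y I \<sigma>)) \<and>
       measure_pmf.expectation \<mu> (\<lambda>\<sigma>. cost I (output_x I \<sigma>) (output_y I \<sigma>)) \<le> 3 * lp_opt I \<and>
       3 * lp_opt I \<le> 3 * int_opt I)"
proof -
  have lev: "array_level a \<le> 2" for a by (simp add: array_level_def)
  obtain q where halts: "\<And>I. halts_within (compile main_prog) (input_memory I) (poly q (input_size I))"
    and final: "\<And>I. final_memory (compile main_prog) (input_memory I) (poly q (input_size I))
       = return_pmf (sem main_prog (input_memory I))"
    using structured_polynomial_time[OF lev bounded_loops_main_prog levelled_main_prog] by blast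
  have "int_feasible I (output_x I \<sigma>) (output_y I \<sigma>) \<and>
      cost I (output_x I \<sigma>) (output_y I \<sigma>) \<le> 3 * lp_opt I \<and> lp_opt I \<le> int_opt I"
    if I: "ftfp_instance I" and \<sigma>: "\<sigma> = sem main_prog (input_memory I)" for I \<sigma>
  proof -
    have feas: "int_feasible I (output_x I \<sigma>) (output_y I \<sigma>)"
      unfolding \<sigma> using I by (rule main_prog_correct)
    \<comment> \<open>One third of the cost of the output is a lower bound for all fractional costs,
      hence for their infimum; no optimal fractional solution has to be exhibited.\<close>
    have "cost I (output_x I \<sigma>) (output_y I \<sigma>) / 3 \<le> lp_opt I"
      unfolding lp_opt_def
    proof (rule cInf_greatest)
      show "{cost I x y | x y. lp_feasible I x y} \<noteq> {}" using feas by (auto simp: int_feasible_def)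
      fix c
      assume "c \<in> {cost I x y | x y. lp_feasible I x y}"
      then obtain x y where "lp_feasible I x y" "c = cost I x y" by blast
      then show "cost I (output_x I \<sigma>) (output_y I \<sigma>) / 3 \<le> c"
        using main_prog_correct(2)[OF I, of x y] by (simp add: \<sigma>)
    qed
    moreover have "lp_opt I \<le> int_opt I"
      unfolding lp_opt_def int_opt_def
    proof (rule cInf_superset_mono)
      show "{cost I x y | x y. int_feasible I x y} \<noteq> {}" using feas by blast
      \<comment> \<open>The infimum over a larger set of reals is smaller only if that set is
        bounded below, which follows from nonnegative costs.\<close>
      show "bdd_below {cost I x y | x y. lp_feasible I x y}"
      proof (rule bdd_belowI)
        fix c
        assume "c \<in> {cost I x y | x y. lp_feasible I x y}"
        then obtain x y where xy: "lp_feasible I x y" "c = cost I x y" by blast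
        have "0 \<le> cost I x y"
          unfolding cost_def using I xy(1)
          by (intro add_nonneg_nonneg sum_nonneg mult_nonneg_nonneg)
            (auto simp: ftfp_instance_def lp_feasible_def)
        then show "0 \<le> c" using xy(2) by simp
      qed
    qed (auto simp: int_feasible_def)
    ultimately show ?thesis using feas by simp
  qed
  \<comment> \<open>No coin is flipped, so the final distribution is a point mass and the
    expectation is the cost of a single output.\<close>
  then show ?thesis
    using halts by (intro exI[of _ "compile main_prog"] exI[of _ q]) (simp add: Let_def final)
qed

end
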